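(* Let $K$ and $H$ be Hopf algebras over $\mathbb{K}$, with $H$ having invertible antipode, let $A$ be a $(K,H)$-bicomodule algebra, and let $\sigma:K\otimes K\to\mathbb{K}$ and $\gamma:H\otimes H\to\mathbb{K}$ be 2-cocycles. Then: (i) $B=A^{coH}\subset A$ is an $H$-Hopf-Galois extension if and only if ${}_\sigma B\subset{}_\sigma A_\gamma$ is an $H_\gamma$-Hopf-Galois extension. (ii) (for $\mathbb{K}$ a field) $A$ is a principal $H$-comodule algebra if and only if ${}_\sigma A_\gamma$ is a principal $H_\gamma$-comodule algebra.
   Context: $\mathbb{K}$ denotes $\mathbb{C}$ or $\mathbb{C}[[\hbar]]$; the notion of principal comodule algebra is defined over a field. Sweedler notation (sums understood): $\Delta(h)=h_{(1)}\otimes h_{(2)}$, right $H$-coactions $\delta^A(a)=a_{(0)}\otimes a_{(1)}\in A\otimes H$, left $K$-coactions $\rho^A(a)=a_{(-1)}\otimes a_{(0)}\in K\otimes A$; $S$ antipode, $\varepsilon$ counit. A $(K,H)$-bicomodule algebra is a unital associative algebra $A$ with a left $K$-coaction $\rho^A$ and a right $H$-coaction $\delta^A$, both unital algebra maps, such that $(\rho^A\otimes\mathrm{id})\circ\delta^A=(\mathrm{id}\otimes\delta^A)\circ\rho^A$. For a right $H$-comodule algebra $A$ put $B=A^{coH}=\{b\in A:\delta^A(b)=b\otimes1_H\}$; $B\subset A$ is an $H$-Hopf-Galois extension ($H$ with invertible antipode) if $\chi:A\otimes_B A\to A\otimes H$, $a\otimes_B a'\mapsto a\,a'_{(0)}\otimes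 a'_{(1)}$, is bijective. $A$ is a principal $H$-comodule algebra if $B\subset A$ is an $H$-Hopf-Galois extension and there is a left $B$-module and right $H$-comodule morphism $s:A\to B\otimes A$ with $m\circ s=\mathrm{id}_A$, where $m:B\otimes A\to A$ is the restricted product. A 2-cocycle on a Hopf algebra $H$ is a linear $\gamma:H\otimes H\to\mathbb{K}$ with $\gamma(g_{(1)}\otimes h_{(1)})\gamma(g_{(2)}h_{(2)}\otimes k)=\gamma(h_{(1)}\otimes k_{(1)})\gamma(g\otimes h_{(2)}k_{(2)})$ for all $g,h,k\in H$, convolution invertible with inverse $\bar\gamma$, and $\gamma(h\otimes1)=\varepsilon(h)=\gamma(1\otimes h)$. The twisted Hopf algebra $H_\gamma$ is $H$ with the same coalgebra structure and unit, product $h\cdot_\gamma k=\gamma(h_{(1)}\otimes k_{(1)})h_{(2)}k_{(2)}\bar\gamma(h_{(3)}\otimes k_{(3)})$ and antipode $S_\gamma(h)=u_\gamma(h_{(1)})S(h_{(2)})\bar u_\gamma(h_{(3)})$, with $u_\gamma(h)=\gamma(h_{(1)}\otimes S(h_{(2)}))$, $\bar u_\gamma(h)=\bar\gamma(S(h_{(1)})\otimes h_{(2)})$; similarly for $K_\sigma$. For a right $H$-comodule algebra $A$, $A_\gamma$ is the right $H_\gamma$-comodule algebra with the same space, coaction and unit and product $a\bullet_\gamma a'=a_{(0)}a'_{(0)}\,\bar\gamma(a_{(1)}\otimes a'_{(1)})$. For a left $K$-comodule algebra $A$, ${}_\sigma A$ is the left $K_\sigma$-comodule algebra with the same space, coaction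 and unit and product $a\,{}_\sigma\bullet\,a'=\sigma(a_{(-1)}\otimes a'_{(-1)})\,a_{(0)}a'_{(0)}$. For a $(K,H)$-bicomodule algebra $A$, ${}_\sigma A_\gamma:={}_\sigma(A_\gamma)=({}_\sigma A)_\gamma$, which is a $(K_\sigma,H_\gamma)$-bicomodule algebra. Its subalgebra of $H_\gamma$-coinvariants is ${}_\sigma B$, i.e. $B=A^{coH}$ with product $b\,{}_\sigma\bullet\,b'$. *)

theory Defs
  imports Complex_Main "HOL-Library.Poly_Mapping"
begin

text \<open>
  Conventions.  The ground ring is an arbitrary commutative ring \<open>'k\<close> with \<open>0 \<noteq> 1\<close>, which covers
  both the complex numbers and formal power series over them (\<open>complex fps\<close>).  A module is a
  type \<open>'a::ab_group_add\<close> with an explicit scalar multiplication satisfying the library predicate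
  \<open>module\<close>.  Tensor products are the usual ones: formal linear combinations of pairs (or triples)
  modulo the submodule generated by the multilinearity relations.  An element of a tensor product
  is an actual coset.
\<close>

section \<open>Formal linear combinations and cosets\<close>

definition fscale :: "'k::comm_ring_1 \<Rightarrow> ('x \<Rightarrow>\<^sub>0 'k) \<Rightarrow> ('x \<Rightarrow>\<^sub>0 'k)" where
  "fscale c x = Poly_Mapping.map ((*) c) x"

abbreviation gen :: "'x \<Rightarrow> ('x \<Rightarrow>\<^sub>0 'k::comm_ring_1)" where
  "gen p \<equiv> Poly_Mapping.single p 1"

definition lin_ext :: "('k::comm_ring_1 \<Rightarrow> 't \<Rightarrow> 't) \<Rightarrow> ('x \<Rightarrow> 't) \<Rightarrow> ('x \<Rightarrow>\<^sub>0 'k) \<Rightarrow> 't::ab_group_add" where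
  "lin_ext s f x = (\<Sum>p\<in>Poly_Mapping.keys x. s (Poly_Mapping.lookup x p) (f p))"

definition coset :: "('x \<Rightarrow>\<^sub>0 'k::comm_ring_1) set \<Rightarrow> ('x \<Rightarrow>\<^sub>0 'k) \<Rightarrow> ('x \<Rightarrow>\<^sub>0 'k) set" where
  "coset N x = {y. y - x \<in> N}"

definition rep :: "('x \<Rightarrow>\<^sub>0 'k::comm_ring_1) set \<Rightarrow> ('x \<Rightarrow>\<^sub>0 'k)" where
  "rep X = (SOME x. x \<in> X)"

lemma module_fscale: "module (fscale :: 'k::comm_ring_1 \<Rightarrow> ('x \<Rightarrow>\<^sub>0 'k) \<Rightarrow> _)"
proof -
  have l: "Poly_Mapping.lookup (fscale c x) p = c * Poly_Mapping.lookup x p"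
    for c :: 'k and x :: "'x \<Rightarrow>\<^sub>0 'k" and p
    by (simp add: fscale_def map.rep_eq when_def)
  show ?thesis
    by (unfold_locales) (auto intro!: poly_mapping_eqI simp: l lookup_add algebra_simps)
qed

section \<open>Tensor products\<close>

text \<open>
  \<open>M\<close> and \<open>N\<close> are submodules of the ambient modules (usually \<open>UNIV\<close>).  They are kept explicit so
  that the tensor product of a submodule, such as the coinvariants, with a module is the genuine
  tensor product and not its image in the ambient one.
\<close>

definition null2 :: "('k::comm_ring_1 \<Rightarrow> 'm \<Rightarrow> 'm) \<Rightarrow> ('k \<Rightarrow> 'n \<Rightarrow> 'n) \<Rightarrow> 'm::ab_group_add set \<Rightarrow> 'n::ab_group_add set
    \<Rightarrow> ('m \<times> 'n \<Rightarrow>\<^sub>0 'k) set" where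
  "null2 sM sN M N = module.span fscale
    ({gen (m + m', n) - gen (m, n) - gen (m', n) |m m' n. m \<in> M \<and> m' \<in> M \<and> n \<in> N} \<union>
     {gen (m, n + n') - gen (m, n) - gen (m, n') |m n n'. m \<in> M \<and> n \<in> N \<and> n' \<in> N} \<union>
     {gen (sM c m, n) - fscale c (gen (m, n)) |c m n. m \<in> M \<and> n \<in> N} \<union>
     {gen (m, sN c n) - fscale c (gen (m, n)) |c m n. m \<in> M \<and> n \<in> N})"

definition tensor2 :: "('k::comm_ring_1 \<Rightarrow> 'm \<Rightarrow> 'm) \<Rightarrow> ('k \<Rightarrow> 'n \<Rightarrow> 'n) \<Rightarrow> 'm::ab_group_add set \<Rightarrow> 'n::ab_group_add set
    \<Rightarrow> ('m \<times> 'n \<Rightarrow>\<^sub>0 'k) set set" where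
  "tensor2 sM sN M N = coset (null2 sM sN M N) ` {x. Poly_Mapping.keys x \<subseteq> M \<times> N}"

definition null3 :: "('k::comm_ring_1 \<Rightarrow> 'm \<Rightarrow> 'm) \<Rightarrow> ('k \<Rightarrow> 'n \<Rightarrow> 'n) \<Rightarrow> ('k \<Rightarrow> 'p \<Rightarrow> 'p)
    \<Rightarrow> 'm::ab_group_add set \<Rightarrow> 'n::ab_group_add set \<Rightarrow> 'p::ab_group_add set \<Rightarrow> ('m \<times> 'n \<times> 'p \<Rightarrow>\<^sub>0 'k) set" where
  "null3 sM sN sP M N P = module.span fscale
    ({gen (m + m', n, p) - gen (m, n, p) - gen (m', n, p) |m m' n p. m \<in> M \<and> m' \<in> M \<and> n \<in> N \<and> p \<in> P} \<union>
     {gen (m, n + n', p) - gen (m, n, p) - gen (m, n', p) |m n n' p. m \<in> M \<and> n \<in> N \<and> n' \<in> N \<and> p \<in> P} \<union>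
     {gen (m, n, p + p') - gen (m, n, p) - gen (m, n, p') |m n p p'. m \<in> M \<and> n \<in> N \<and> p \<in> P \<and> p' \<in> P} \<union>
     {gen (sM c m, n, p) - fscale c (gen (m, n, p)) |c m n p. m \<in> M \<and> n \<in> N \<and> p \<in> P} \<union>
     {gen (m, sN c n, p) - fscale c (gen (m, n, p)) |c m n p. m \<in> M \<and> n \<in> N \<and> p \<in> P} \<union>
     {gen (m, n, sP c p) - fscale c (gen (m, n, p)) |c m n p. m \<in> M \<and> n \<in> N \<and> p \<in> P})"

text \<open>
  A linear map from the module with scalar multiplication \<open>s\<close> to the quotient of the formal
  combinations by \<open>N\<close>; sum and multiples of cosets are computed on representatives.
\<close>

definition linear_mod :: "('k::comm_ring_1 \<Rightarrow> 'm \<Rightarrow> 'm) \<Rightarrow> ('x \<Rightarrow>\<^sub>0 'k) set \<Rightarrow> ('m::ab_group_add \<Rightarrow> ('x \<Rightarrow>\<^sub>0 'k) set) \<Rightarrow> bool" where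
  "linear_mod s N f \<longleftrightarrow>
    (\<forall>a b. f (a + b) = coset N (rep (f a) + rep (f b))) \<and>
    (\<forall>c a. f (s c a) = coset N (fscale c (rep (f a))))"

text \<open>
  Sweedler sums.  \<open>sweedler s X f\<close> is the sum of \<open>f x\<^sub>1 x\<^sub>2\<close> over a representative of
  \<open>X = x\<^sub>1 \<otimes> x\<^sub>2\<close> (sum understood), that is, the value at \<open>X\<close> of the linear map induced by the
  bilinear \<open>f\<close>.  It does not depend on the representative if \<open>f\<close> is bilinear
  (lemma \<open>sweedler_coset\<close> below).  To define
  an element of a tensor product, \<open>f\<close> takes values in formal combinations (\<open>s = fscale\<close>), is
  bilinear modulo the relevant relations, and the result is wrapped in \<open>coset\<close>.
\<close>

definition sweedler :: "('k::comm_ring_1 \<Rightarrow> 't \<Rightarrow> 't) \<Rightarrow> ('m \<times> 'n \<Rightarrow>\<^sub>0 'k) set \<Rightarrow> ('m \<Rightarrow> 'n \<Rightarrow> 't) \<Rightarrow> 't::ab_group_add" where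
  "sweedler s X f = lin_ext s (\<lambda>(x1, x2). f x1 x2) (rep X)"

definition bilin :: "('k::comm_ring_1 \<Rightarrow> 'm \<Rightarrow> 'm) \<Rightarrow> ('k \<Rightarrow> 'n \<Rightarrow> 'n) \<Rightarrow> ('k \<Rightarrow> 't \<Rightarrow> 't)
    \<Rightarrow> ('m::ab_group_add \<Rightarrow> 'n::ab_group_add \<Rightarrow> 't::ab_group_add) \<Rightarrow> bool" where
  "bilin s1 s2 s f \<longleftrightarrow> (\<forall>y. module_hom s1 s (\<lambda>x. f x y)) \<and> (\<forall>x. module_hom s2 s (f x))"

lemma lin_ext_add:
  assumes "module s"
  shows "lin_ext s f (x + y) = lin_ext s f x + lin_ext s f y"
proof -
  interpret module s by fact
  let ?K = "Poly_Mapping.keys x \<union> Poly_Mapping.keys y"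
  have e: "lin_ext s f z = (\<Sum>p\<in>?K. s (Poly_Mapping.lookup z p) (f p))" if "Poly_Mapping.keys z \<subseteq> ?K" for z
    unfolding lin_ext_def using that
    by (intro sum.mono_neutral_left) (auto simp: in_keys_iff)
  show ?thesis
    using Poly_Mapping.keys_add[of x y]
    by (simp add: e lookup_add scale_left_distrib sum.distrib)
qed

lemma lin_ext_fscale:
  assumes "module s"
  shows "lin_ext s f (fscale c x) = s c (lin_ext s f x)"
proof -
  interpret module s by fact
  have l: "Poly_Mapping.lookup (fscale c x) p = c * Poly_Mapping.lookup x p" for p
    by (simp add: fscale_def map.rep_eq when_def)
  have "lin_ext s f (fscale c x) = (\<Sum>p\<in>Poly_Mapping.keys x. s (Poly_Mapping.lookup (fscale c x) p) (f p))"
    unfolding lin_ext_def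
    by (intro sum.mono_neutral_left) (auto simp: in_keys_iff l)
  then show ?thesis
    by (simp add: l lin_ext_def scale_sum_right)
qed

lemma module_hom_lin_ext: "module s \<Longrightarrow> module_hom fscale s (lin_ext s f)"
  by (simp add: module_hom_def module_hom_axioms_def module_fscale lin_ext_add lin_ext_fscale)

lemma lin_ext_gen: "module s \<Longrightarrow> lin_ext s f (gen p) = f p"
  by (simp add: lin_ext_def module.scale_one)

lemma lin_ext_null2:
  assumes "bilin s1 s2 s f" and "x \<in> null2 s1 s2 M N"
  shows "lin_ext s (\<lambda>(a, b). f a b) x = 0"
proof -
  have h1: "module_hom s1 s (\<lambda>a. f a b)" and h2: "module_hom s2 s (f a)" for a b
    using assms(1) by (auto simp: bilin_def)
  have m: "module s" using h1 by (simp add: module_hom_def)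
  interpret L: module_hom fscale s "lin_ext s (\<lambda>(a, b). f a b)"
    by (rule module_hom_lin_ext[OF m])
  note [simp] = lin_ext_gen[OF m] module_hom.add[OF h1] module_hom.add[OF h2]
    module_hom.scale[OF h1] module_hom.scale[OF h2] L.diff L.scale
  show ?thesis
    using assms(2) unfolding null2_def
    by (rule L.eq_0_on_span[rotated]) auto
qed

lemma sweedler_coset:
  assumes "bilin s1 s2 s f"
  shows "sweedler s (coset (null2 s1 s2 M N) x) f = lin_ext s (\<lambda>(a, b). f a b) x"
proof -
  have m: "module s" using assms by (simp add: bilin_def module_hom_def)
  interpret L: module_hom fscale s "lin_ext s (\<lambda>(a, b). f a b)"
    by (rule module_hom_lin_ext[OF m])
  have "0 \<in> null2 s1 s2 M N"
    by (simp add: null2_def module.span_zero[OF module_fscale])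
  then have "x \<in> coset (null2 s1 s2 M N) x" by (simp add: coset_def)
  then have "rep (coset (null2 s1 s2 M N) x) - x \<in> null2 s1 s2 M N"
    unfolding rep_def by (rule someI2) (simp add: coset_def)
  from lin_ext_null2[OF assms this] show ?thesis
    by (simp add: sweedler_def L.diff)
qed

section \<open>Algebras and Hopf algebras\<close>

record ('k::comm_ring_1, 'a) alg =
  smul :: "'k \<Rightarrow> 'a \<Rightarrow> 'a"
  mul :: "'a \<Rightarrow> 'a \<Rightarrow> 'a"
  unit :: 'a

definition algebra :: "('k::comm_ring_1, 'a::ab_group_add, 'z) alg_scheme \<Rightarrow> bool" where
  "algebra A \<longleftrightarrow> module (smul A) \<and> bilin (smul A) (smul A) (smul A) (mul A) \<and>
    (\<forall>a b c. mul A (mul A a b) c = mul A a (mul A b c)) \<and>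
    (\<forall>a. mul A (unit A) a = a \<and> mul A a (unit A) = a)"

record (overloaded) ('k::comm_ring_1, 'h) hopf = "('k::comm_ring_1, 'h) alg" +
  comul :: "'h \<Rightarrow> ('h \<times> 'h \<Rightarrow>\<^sub>0 'k) set"
  counit :: "'h \<Rightarrow> 'k"
  antipode :: "'h \<Rightarrow> 'h"

text \<open>The relations of the tensor product over the ground ring, between whole modules.\<close>

abbreviation nul :: "('k::comm_ring_1, 'm::ab_group_add, 'y) alg_scheme \<Rightarrow> ('k, 'n::ab_group_add, 'z) alg_scheme
    \<Rightarrow> ('m \<times> 'n \<Rightarrow>\<^sub>0 'k) set" where
  "nul A C \<equiv> null2 (smul A) (smul C) UNIV UNIV"

abbreviation nul3 :: "('k::comm_ring_1, 'm::ab_group_add, 'x) alg_scheme \<Rightarrow> ('k, 'n::ab_group_add, 'y) alg_scheme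
    \<Rightarrow> ('k, 'p::ab_group_add, 'z) alg_scheme \<Rightarrow> ('m \<times> 'n \<times> 'p \<Rightarrow>\<^sub>0 'k) set" where
  "nul3 A C D \<equiv> null3 (smul A) (smul C) (smul D) UNIV UNIV UNIV"

abbreviation tens :: "('k::comm_ring_1, 'm::ab_group_add, 'y) alg_scheme \<Rightarrow> ('k, 'n::ab_group_add, 'z) alg_scheme
    \<Rightarrow> ('m \<times> 'n \<Rightarrow>\<^sub>0 'k) set set" where
  "tens A C \<equiv> tensor2 (smul A) (smul C) UNIV UNIV"

definition tens_mul :: "('k::comm_ring_1, 'm::ab_group_add, 'y) alg_scheme \<Rightarrow> ('k, 'n::ab_group_add, 'z) alg_scheme
    \<Rightarrow> ('m \<times> 'n \<Rightarrow>\<^sub>0 'k) set \<Rightarrow> ('m \<times> 'n \<Rightarrow>\<^sub>0 'k) set \<Rightarrow> ('m \<times> 'n \<Rightarrow>\<^sub>0 'k) set" where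
  "tens_mul A C X Y = coset (nul A C)
    (sweedler fscale X (\<lambda>x1 x2. sweedler fscale Y (\<lambda>y1 y2. gen (mul A x1 y1, mul C x2 y2))))"

definition coalgebra :: "('k::comm_ring_1, 'h::ab_group_add, 'z) hopf_scheme \<Rightarrow> bool" where
  "coalgebra H \<longleftrightarrow> module (smul H) \<and>
    (\<forall>h. comul H h \<in> tens H H) \<and> linear_mod (smul H) (nul H H) (comul H) \<and>
    module_hom (smul H) (*) (counit H) \<and>
    (\<forall>h. coset (nul3 H H H) (sweedler fscale (comul H h) (\<lambda>h1 h2.
              sweedler fscale (comul H h1) (\<lambda>h11 h12. gen (h11, h12, h2))))
       = coset (nul3 H H H) (sweedler fscale (comul H h) (\<lambda>h1 h2.
              sweedler fscale (comul H h2) (\<lambda>h21 h22. gen (h1, h21, h22))))) \<and>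
    (\<forall>h. sweedler (smul H) (comul H h) (\<lambda>h1 h2. smul H (counit H h1) h2) = h) \<and>
    (\<forall>h. sweedler (smul H) (comul H h) (\<lambda>h1 h2. smul H (counit H h2) h1) = h)"

definition bialgebra :: "('k::comm_ring_1, 'h::ab_group_add, 'z) hopf_scheme \<Rightarrow> bool" where
  "bialgebra H \<longleftrightarrow> algebra H \<and> coalgebra H \<and>
    comul H (unit H) = coset (nul H H) (gen (unit H, unit H)) \<and>
    (\<forall>h k. comul H (mul H h k) = tens_mul H H (comul H h) (comul H k)) \<and>
    counit H (unit H) = 1 \<and>
    (\<forall>h k. counit H (mul H h k) = counit H h * counit H k)"

definition hopf_algebra :: "('k::comm_ring_1, 'h::ab_group_add, 'z) hopf_scheme \<Rightarrow> bool" where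
  "hopf_algebra H \<longleftrightarrow> bialgebra H \<and> module_hom (smul H) (smul H) (antipode H) \<and>
    (\<forall>h. sweedler (smul H) (comul H h) (\<lambda>h1 h2. mul H (antipode H h1) h2) = smul H (counit H h) (unit H)) \<and>
    (\<forall>h. sweedler (smul H) (comul H h) (\<lambda>h1 h2. mul H h1 (antipode H h2)) = smul H (counit H h) (unit H))"

section \<open>Comodule algebras\<close>

record (overloaded) ('k::comm_ring_1, 'a, 'h) right_comod_alg = "('k::comm_ring_1, 'a) alg" +
  rcoact :: "'a \<Rightarrow> ('a \<times> 'h \<Rightarrow>\<^sub>0 'k) set"

record (overloaded) ('k::comm_ring_1, 'a, 'h, 'l) bicomod_alg = "('k::comm_ring_1, 'a, 'h) right_comod_alg" +
  lcoact :: "'a \<Rightarrow> ('l \<times> 'a \<Rightarrow>\<^sub>0 'k) set"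

definition right_comodule_algebra :: "('k::comm_ring_1, 'h::ab_group_add, 'y) hopf_scheme
    \<Rightarrow> ('k, 'a::ab_group_add, 'h, 'z) right_comod_alg_scheme \<Rightarrow> bool" where
  "right_comodule_algebra H A \<longleftrightarrow> algebra A \<and>
    (\<forall>a. rcoact A a \<in> tens A H) \<and> linear_mod (smul A) (nul A H) (rcoact A) \<and>
    (\<forall>a. coset (nul3 A H H) (sweedler fscale (rcoact A a) (\<lambda>a0 h.
              sweedler fscale (rcoact A a0) (\<lambda>a00 a01. gen (a00, a01, h))))
       = coset (nul3 A H H) (sweedler fscale (rcoact A a) (\<lambda>a0 h.
              sweedler fscale (comul H h) (\<lambda>h1 h2. gen (a0, h1, h2))))) \<and>
    (\<forall>a. sweedler (smul A) (rcoact A a) (\<lambda>a0 h. smul A (counit H h) a0) = a) \<and>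
    rcoact A (unit A) = coset (nul A H) (gen (unit A, unit H)) \<and>
    (\<forall>a b. rcoact A (mul A a b) = tens_mul A H (rcoact A a) (rcoact A b))"

definition left_comodule_algebra :: "('k::comm_ring_1, 'l::ab_group_add, 'y) hopf_scheme
    \<Rightarrow> ('k, 'a::ab_group_add, 'h, 'l, 'z) bicomod_alg_scheme \<Rightarrow> bool" where
  "left_comodule_algebra K A \<longleftrightarrow> algebra A \<and>
    (\<forall>a. lcoact A a \<in> tens K A) \<and> linear_mod (smul A) (nul K A) (lcoact A) \<and>
    (\<forall>a. coset (nul3 K K A) (sweedler fscale (lcoact A a) (\<lambda>k a0.
              sweedler fscale (lcoact A a0) (\<lambda>l a00. gen (k, l, a00))))
       = coset (nul3 K K A) (sweedler fscale (lcoact A a) (\<lambda>k a0.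
              sweedler fscale (comul K k) (\<lambda>k1 k2. gen (k1, k2, a0))))) \<and>
    (\<forall>a. sweedler (smul A) (lcoact A a) (\<lambda>k a0. smul A (counit K k) a0) = a) \<and>
    lcoact A (unit A) = coset (nul K A) (gen (unit K, unit A)) \<and>
    (\<forall>a b. lcoact A (mul A a b) = tens_mul K A (lcoact A a) (lcoact A b))"

definition bicomodule_algebra :: "('k::comm_ring_1, 'l::ab_group_add, 'x) hopf_scheme
    \<Rightarrow> ('k, 'h::ab_group_add, 'y) hopf_scheme
    \<Rightarrow> ('k, 'a::ab_group_add, 'h, 'l, 'z) bicomod_alg_scheme \<Rightarrow> bool" where
  "bicomodule_algebra K H A \<longleftrightarrow> left_comodule_algebra K A \<and> right_comodule_algebra H A \<and>
    (\<forall>a. coset (nul3 K A H) (sweedler fscale (rcoact A a) (\<lambda>a0 h.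
              sweedler fscale (lcoact A a0) (\<lambda>k a'. gen (k, a', h))))
       = coset (nul3 K A H) (sweedler fscale (lcoact A a) (\<lambda>k a0.
              sweedler fscale (rcoact A a0) (\<lambda>a' h. gen (k, a', h)))))"

section \<open>Hopf-Galois extensions and principal comodule algebras\<close>

definition coinvariants :: "('k::comm_ring_1, 'h::ab_group_add, 'y) hopf_scheme
    \<Rightarrow> ('k, 'a::ab_group_add, 'h, 'z) right_comod_alg_scheme \<Rightarrow> 'a set" where
  "coinvariants H A = {b. rcoact A b = coset (nul A H) (gen (b, unit H))}"

text \<open>The balanced tensor product of \<open>A\<close> with itself over a subalgebra \<open>B\<close>.\<close>

definition balanced_null :: "('k::comm_ring_1, 'a::ab_group_add, 'z) alg_scheme \<Rightarrow> 'a set \<Rightarrow> ('a \<times> 'a \<Rightarrow>\<^sub>0 'k) set" where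
  "balanced_null A B = module.span fscale
    (nul A A \<union> {gen (mul A a b, a') - gen (a, mul A b a') |a b a'. b \<in> B})"

definition balanced_tensor :: "('k::comm_ring_1, 'a::ab_group_add, 'z) alg_scheme \<Rightarrow> 'a set \<Rightarrow> ('a \<times> 'a \<Rightarrow>\<^sub>0 'k) set set" where
  "balanced_tensor A B = range (coset (balanced_null A B))"

definition canonical_map :: "('k::comm_ring_1, 'h::ab_group_add, 'y) hopf_scheme
    \<Rightarrow> ('k, 'a::ab_group_add, 'h, 'z) right_comod_alg_scheme
    \<Rightarrow> ('a \<times> 'a \<Rightarrow>\<^sub>0 'k) set \<Rightarrow> ('a \<times> 'h \<Rightarrow>\<^sub>0 'k) set" where
  "canonical_map H A X = coset (nul A H) (sweedler fscale X (\<lambda>a a'.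
     sweedler fscale (rcoact A a') (\<lambda>a0 h. gen (mul A a a0, h))))"

text \<open>
  The predicate includes the standing assumptions on \<open>H\<close> and \<open>A\<close>; so, for a twist, it also asserts
  that the twisted data form a comodule algebra over a Hopf algebra with invertible antipode.
\<close>

definition hopf_galois :: "('k::comm_ring_1, 'h::ab_group_add, 'y) hopf_scheme
    \<Rightarrow> ('k, 'a::ab_group_add, 'h, 'z) right_comod_alg_scheme \<Rightarrow> bool" where
  "hopf_galois H A \<longleftrightarrow> hopf_algebra H \<and> bij (antipode H) \<and> right_comodule_algebra H A \<and>
     bij_betw (canonical_map H A) (balanced_tensor A (coinvariants H A)) (tens A H)"

definition principal_comodule_algebra :: "('k::comm_ring_1, 'h::ab_group_add, 'y) hopf_scheme
    \<Rightarrow> ('k, 'a::ab_group_add, 'h, 'z) right_comod_alg_scheme \<Rightarrow> bool" where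
  "principal_comodule_algebra H A \<longleftrightarrow> hopf_galois H A \<and>
    (let B = coinvariants H A;
         N = null2 (smul A) (smul A) B UNIV;
         N3 = null3 (smul A) (smul A) (smul H) B UNIV UNIV
     in \<exists>s. (\<forall>a. s a \<in> tensor2 (smul A) (smul A) B UNIV) \<and> linear_mod (smul A) N s \<and>
          (\<forall>b\<in>B. \<forall>a. s (mul A b a) = coset N (sweedler fscale (s a) (\<lambda>b' a'. gen (mul A b b', a')))) \<and>
          (\<forall>a. coset N3 (sweedler fscale (s a) (\<lambda>b a'. sweedler fscale (rcoact A a') (\<lambda>a0 h. gen (b, a0, h))))
             = coset N3 (sweedler fscale (rcoact A a) (\<lambda>a0 h. sweedler fscale (s a0) (\<lambda>b a'. gen (b, a', h))))) \<and>
          (\<forall>a. sweedler (smul A) (s a) (mul A) = a))"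

section \<open>2-cocycles and twists\<close>

text \<open>Linear forms on \<open>H \<otimes> H\<close> are given as bilinear forms in two arguments.\<close>

definition conv2 :: "('k::comm_ring_1, 'h, 'z) hopf_scheme \<Rightarrow> ('h \<Rightarrow> 'h \<Rightarrow> 'k) \<Rightarrow> ('h \<Rightarrow> 'h \<Rightarrow> 'k) \<Rightarrow> 'h \<Rightarrow> 'h \<Rightarrow> 'k" where
  "conv2 H f g h k = sweedler (*) (comul H h) (\<lambda>h1 h2. sweedler (*) (comul H k) (\<lambda>k1 k2. f h1 k1 * g h2 k2))"

definition is_conv_inverse :: "('k::comm_ring_1, 'h::ab_group_add, 'z) hopf_scheme \<Rightarrow> ('h \<Rightarrow> 'h \<Rightarrow> 'k) \<Rightarrow> ('h \<Rightarrow> 'h \<Rightarrow> 'k) \<Rightarrow> bool" where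
  "is_conv_inverse H \<gamma> \<gamma>' \<longleftrightarrow> bilin (smul H) (smul H) (*) \<gamma>' \<and>
     conv2 H \<gamma> \<gamma>' = (\<lambda>h k. counit H h * counit H k) \<and>
     conv2 H \<gamma>' \<gamma> = (\<lambda>h k. counit H h * counit H k)"

definition two_cocycle :: "('k::comm_ring_1, 'h::ab_group_add, 'z) hopf_scheme \<Rightarrow> ('h \<Rightarrow> 'h \<Rightarrow> 'k) \<Rightarrow> bool" where
  "two_cocycle H \<gamma> \<longleftrightarrow> bilin (smul H) (smul H) (*) \<gamma> \<and>
     (\<forall>g h k. sweedler (*) (comul H g) (\<lambda>g1 g2. sweedler (*) (comul H h) (\<lambda>h1 h2. \<gamma> g1 h1 * \<gamma> (mul H g2 h2) k))
            = sweedler (*) (comul H h) (\<lambda>h1 h2. sweedler (*) (comul H k) (\<lambda>k1 k2. \<gamma> h1 k1 * \<gamma> g (mul H h2 k2)))) \<and>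
     (\<exists>\<gamma>'. is_conv_inverse H \<gamma> \<gamma>') \<and>
     (\<forall>h. \<gamma> h (unit H) = counit H h \<and> \<gamma> (unit H) h = counit H h)"

definition cinv :: "('k::comm_ring_1, 'h::ab_group_add, 'z) hopf_scheme \<Rightarrow> ('h \<Rightarrow> 'h \<Rightarrow> 'k) \<Rightarrow> 'h \<Rightarrow> 'h \<Rightarrow> 'k" where
  "cinv H \<gamma> = (THE \<gamma>'. is_conv_inverse H \<gamma> \<gamma>')"

definition sweedler3 :: "('k::comm_ring_1, 'h, 'z) hopf_scheme \<Rightarrow> ('k \<Rightarrow> 't \<Rightarrow> 't) \<Rightarrow> 'h \<Rightarrow> ('h \<Rightarrow> 'h \<Rightarrow> 'h \<Rightarrow> 't) \<Rightarrow> 't::ab_group_add" where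
  "sweedler3 H s h f = sweedler s (comul H h) (\<lambda>h1 h'. sweedler s (comul H h') (\<lambda>h2 h3. f h1 h2 h3))"

definition twisted_hopf :: "('k::comm_ring_1, 'h::ab_group_add, 'z) hopf_scheme \<Rightarrow> ('h \<Rightarrow> 'h \<Rightarrow> 'k) \<Rightarrow> ('k, 'h, 'z) hopf_scheme" where
  "twisted_hopf H \<gamma> =
    (let \<gamma>i = cinv H \<gamma>;
         u = (\<lambda>h. sweedler (*) (comul H h) (\<lambda>h1 h2. \<gamma> h1 (antipode H h2)));
         ui = (\<lambda>h. sweedler (*) (comul H h) (\<lambda>h1 h2. \<gamma>i (antipode H h1) h2))
     in H\<lparr>mul := (\<lambda>h k. sweedler3 H (smul H) h (\<lambda>h1 h2 h3. sweedler3 H (smul H) k (\<lambda>k1 k2 k3.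
                     smul H (\<gamma> h1 k1 * \<gamma>i h3 k3) (mul H h2 k2)))),
          antipode := (\<lambda>h. sweedler3 H (smul H) h (\<lambda>h1 h2 h3. smul H (u h1 * ui h3) (antipode H h2)))\<rparr>)"

definition right_twist :: "('k::comm_ring_1, 'h::ab_group_add, 'y) hopf_scheme \<Rightarrow> ('h \<Rightarrow> 'h \<Rightarrow> 'k)
    \<Rightarrow> ('k, 'a::ab_group_add, 'h, 'z) right_comod_alg_scheme \<Rightarrow> ('k, 'a, 'h, 'z) right_comod_alg_scheme" where
  "right_twist H \<gamma> A = A\<lparr>mul := (\<lambda>a a'.
     sweedler (smul A) (rcoact A a) (\<lambda>a0 a1. sweedler (smul A) (rcoact A a') (\<lambda>a0' a1'.
       smul A (cinv H \<gamma> a1 a1') (mul A a0 a0'))))\<rparr>"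

definition left_twist :: "('l \<Rightarrow> 'l \<Rightarrow> 'k::comm_ring_1)
    \<Rightarrow> ('k, 'a::ab_group_add, 'h, 'l, 'z) bicomod_alg_scheme \<Rightarrow> ('k, 'a, 'h, 'l, 'z) bicomod_alg_scheme" where
  "left_twist \<sigma> A = A\<lparr>mul := (\<lambda>a a'.
     sweedler (smul A) (lcoact A a) (\<lambda>k a0. sweedler (smul A) (lcoact A a') (\<lambda>k' a0'.
       smul A (\<sigma> k k') (mul A a0 a0'))))\<rparr>"

text \<open>
  The coactions and the unit are kept, so the twisted algebra has the same set \<open>B\<close> of
  coinvariants.  Its product restricted to \<open>B\<close> is the left twist of the product of \<open>B\<close>, since
  \<open>\<gamma>\<close> is normalised.
\<close>

definition two_sided_twist :: "('l \<Rightarrow> 'l \<Rightarrow> 'k::comm_ring_1) \<Rightarrow> ('k, 'h::ab_group_add, 'y) hopf_scheme \<Rightarrow> ('h \<Rightarrow> 'h \<Rightarrow> 'k)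
    \<Rightarrow> ('k, 'a::ab_group_add, 'h, 'l, 'z) bicomod_alg_scheme \<Rightarrow> ('k, 'a, 'h, 'l, 'z) bicomod_alg_scheme" where
  "two_sided_twist \<sigma> H \<gamma> A = left_twist \<sigma> (right_twist H \<gamma> A)"

end

theory Submission
  imports Defs
begin

text \<open>The right twist changes neither the coinvariants \<open>B\<close> nor the balanced tensor product, and it
  changes the canonical map by an explicit bijection of \<open>A \<otimes> H\<close>.  For the left twist,
  \<open>a \<otimes> a' \<mapsto> \<sigma>(a\<^sub>-\<^sub>1 \<otimes> a'\<^sub>-\<^sub>1) a\<^sub>0 \<otimes> a'\<^sub>0\<close> induces an isomorphism of the balanced tensor products that
  intertwines the canonical maps; it is well defined since functionals on \<open>K\<close> act on \<open>B\<close>.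
  A section of a principal comodule algebra is also one for the right twist.  For the left twist it
  need not be \<open>K\<close>-colinear, so it has to be deformed by a trilinear form on \<open>K\<close> built from \<open>\<sigma>\<close>, its
  inverse and the antipode.

  Identities between Sweedler sums with values in a tensor product are verified after applying
  arbitrary multilinear maps into the module \<open>Hom\<^sub>\<int>('k, \<real>/\<int>)\<close>, which separates the points of every
  quotient module.\<close>

section \<open>A cogenerator for modules\<close>

text \<open>The ground ring is arbitrary, so nothing is flat: B \<otimes> A need not embed in A
  \<otimes> A, and the left coaction need not restrict to a map from B to K \<otimes> B. Part (i)
  therefore uses B only through the functionals on K that act on it; part (ii) obtains the missing
  splitting from the invertibility of scalars. A second obstacle is that \<open>sweedler\<close>
  evaluates on a chosen representative. It may be rewritten by the coassociativity laws only when
  its argument is multilinear on the nose; multilinearity modulo relations is not enough. Hence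
  values are moved into an honest module, and since functionals with values in the ground ring do
  not separate points in general, that module is a cogenerator. The equivalences are not reduced to
  one implication by twisting back: the comparison maps of (i) have explicit inverses, and (ii) has
  an explicit construction in each direction. This spares the proof that an inverse cocycle is a
  cocycle for the twisted Hopf algebra.\<close>

definition lin_graph :: "('r::comm_ring_1 \<Rightarrow> 'm::ab_group_add \<Rightarrow> 'm) \<Rightarrow> ('r \<Rightarrow> 'n::ab_group_add \<Rightarrow> 'n) \<Rightarrow> 'n set \<Rightarrow> ('m \<times> 'n) set \<Rightarrow> bool" where
  "lin_graph s t X G \<longleftrightarrow> (0, 0) \<in> G \<and> (\<forall>a b a' b'. (a, b) \<in> G \<longrightarrow> (a', b') \<in> G \<longrightarrow> (a + a', b + b') \<in> G) \<and>
    (\<forall>c a b. (a, b) \<in> G \<longrightarrow> (s c a, t c b) \<in> G) \<and> (\<forall>a b. (a, b) \<in> G \<longrightarrow> b \<in> X) \<and> (\<forall>b. (0, b) \<in> G \<longrightarrow> b = 0)"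

text \<open>Baer's criterion: the last assumption says that homomorphisms defined on an ideal of the
  ground ring extend.\<close>

lemma lin_graph_extend:
  assumes s: "module s" and t: "module t" and X: "module.subspace t X"
    and G0: "lin_graph s t X G0"
    and step: "\<And>G y. lin_graph s t X G \<Longrightarrow> \<exists>d\<in>X. \<forall>c x. (s c y, x) \<in> G \<longrightarrow> x = t c d"
  shows "\<exists>f. module_hom s t f \<and> (\<forall>a b. (a, b) \<in> G0 \<longrightarrow> f a = b) \<and> (\<forall>a. f a \<in> X)"
proof -
  interpret s: module s by fact
  interpret t: module t by fact
  let ?A = "{G. lin_graph s t X G \<and> G0 \<subseteq> G}"
  have "\<exists>M\<in>?A. \<forall>Y\<in>?A. M \<subseteq> Y \<longrightarrow> Y = M"
  proof (rule subset_Zorn_nonempty)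
    show "?A \<noteq> {}" using G0 by blast
    fix C assume ne: "C \<noteq> {}" and ch: "subset.chain ?A C"
    have in_C: "lin_graph s t X G" "G0 \<subseteq> G" if "G \<in> C" for G
      using that ch by (auto simp: subset.chain_def)
    have two: "\<exists>G\<in>C. p \<in> G \<and> q \<in> G" if "p \<in> \<Union>C" "q \<in> \<Union>C" for p q
    proof -
      from that obtain G G' where "G \<in> C" "p \<in> G" "G' \<in> C" "q \<in> G'" by blast
      moreover then have "G \<subseteq> G' \<or> G' \<subseteq> G" using ch unfolding subset_chain_def by blast
      ultimately show ?thesis by blast
    qed
    obtain G1 where G1: "G1 \<in> C" using ne by blast
    have "lin_graph s t X (\<Union>C)"
      unfolding lin_graph_def
    proof (intro conjI allI impI)
      show "(0, 0) \<in> \<Union>C" using in_C(1)[OF G1] G1 by (auto simp: lin_graph_def)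
    next
      fix a b a' b' assume "(a, b) \<in> \<Union>C" "(a', b') \<in> \<Union>C"
      from two[OF this] obtain G where G: "G \<in> C" "(a, b) \<in> G" "(a', b') \<in> G" by blast
      then have "(a + a', b + b') \<in> G" using in_C(1)[OF G(1)] unfolding lin_graph_def by blast
      then show "(a + a', b + b') \<in> \<Union>C" using G(1) by blast
    next
      fix c a b assume "(a, b) \<in> \<Union>C"
      then obtain G where G: "G \<in> C" "(a, b) \<in> G" by blast
      then have "(s c a, t c b) \<in> G" using in_C(1)[OF G(1)] unfolding lin_graph_def by blast
      then show "(s c a, t c b) \<in> \<Union>C" using G(1) by blast
    next
      fix a b assume "(a, b) \<in> \<Union>C"
      then obtain G where G: "G \<in> C" "(a, b) \<in> G" by blast
      then show "b \<in> X" using in_C(1)[OF G(1)] unfolding lin_graph_def by blast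
    next
      fix b assume "(0, b) \<in> \<Union>C"
      then obtain G where G: "G \<in> C" "(0, b) \<in> G" by blast
      then show "b = 0" using in_C(1)[OF G(1)] unfolding lin_graph_def by blast
    qed
    then show "\<Union>C \<in> ?A" using in_C(2)[OF G1] G1 by blast
  qed
  then obtain M where M: "lin_graph s t X M" "G0 \<subseteq> M"
    and max: "\<And>Y. lin_graph s t X Y \<Longrightarrow> M \<subseteq> Y \<Longrightarrow> Y = M"
    by (smt (verit, best) mem_Collect_eq order_trans)
  have M0: "(0, 0) \<in> M" and Madd: "\<And>a b a' b'. (a, b) \<in> M \<Longrightarrow> (a', b') \<in> M \<Longrightarrow> (a + a', b + b') \<in> M"
    and Mscale: "\<And>c a b. (a, b) \<in> M \<Longrightarrow> (s c a, t c b) \<in> M" and MX: "\<And>a b. (a, b) \<in> M \<Longrightarrow> b \<in> X"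
    and Mfun: "\<And>b. (0, b) \<in> M \<Longrightarrow> b = 0"
    using M(1) unfolding lin_graph_def by blast+
  have total: "\<exists>b. (y, b) \<in> M" for y
  proof -
    obtain d where d: "d \<in> X" "\<And>c x. (s c y, x) \<in> M \<Longrightarrow> x = t c d" using step[OF M(1)] by blast
    \<comment> \<open>Adjoin y with value d. By the choice of d, a multiple of y that is already in
      the domain has the value prescribed by d; this keeps the enlarged graph single-valued.\<close>
    let ?Y = "{(a + s c y, b + t c d) |a b c. (a, b) \<in> M}"
    have "lin_graph s t X ?Y"
      unfolding lin_graph_def
    proof (intro conjI allI impI)
      show "(0, 0) \<in> ?Y" using M0 by (auto intro!: exI[of _ 0])
    next
      fix a b a' b' assume "(a, b) \<in> ?Y" "(a', b') \<in> ?Y"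
      then obtain x z c x' z' c' where "(x, z) \<in> M" "(x', z') \<in> M"
        and "a = x + s c y" "b = z + t c d" "a' = x' + s c' y" "b' = z' + t c' d" by blast
      with Madd[of x z x' z'] show "(a + a', b + b') \<in> ?Y"
        by (auto intro!: exI[of _ "x + x'"] exI[of _ "z + z'"] exI[of _ "c + c'"] simp: algebra_simps)
    next
      fix r a b assume "(a, b) \<in> ?Y"
      then obtain x z c where "(x, z) \<in> M" "a = x + s c y" "b = z + t c d" by blast
      with Mscale[of x z r] show "(s r a, t r b) \<in> ?Y"
        by (auto intro!: exI[of _ "s r x"] exI[of _ "t r z"] exI[of _ "r * c"] simp: algebra_simps)
    next
      fix a b assume "(a, b) \<in> ?Y"
      then show "b \<in> X" using MX d(1) X t.subspace_add t.subspace_scale by blast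
    next
      fix b assume "(0, b) \<in> ?Y"
      then obtain x z c where z: "(x, z) \<in> M" "0 = x + s c y" "b = z + t c d" by blast
      from Mscale[OF z(1), of "-1"] have "(- x, - z) \<in> M" by simp
      moreover have "- x = s c y" using z(2) by (simp add: eq_neg_iff_add_eq_0 add.commute neg_eq_iff_add_eq_0)
      ultimately have "- z = t c d" using d(2) by simp
      then show "b = 0" using z(3) by (simp add: neg_eq_iff_add_eq_0)
    qed
    moreover have "M \<subseteq> ?Y"
    proof safe
      fix a b assume "(a, b) \<in> M"
      then show "\<exists>a' b' c. (a, b) = (a' + s c y, b' + t c d) \<and> (a', b') \<in> M"
        by (intro exI[of _ a] exI[of _ b] exI[of _ 0]) simp
    qed
    ultimately have "?Y = M" by (rule max)
    moreover have "(y, d) \<in> ?Y" using M0 by (auto intro!: exI[of _ 0] exI[of _ 1])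
    ultimately show ?thesis by blast
  qed
  have uniq: "b = b'" if "(a, b) \<in> M" "(a, b') \<in> M" for a b b'
  proof -
    have "(- a, - b') \<in> M" using Mscale[OF that(2), of "-1"] by simp
    from Madd[OF that(1) this] have "(0, b - b') \<in> M" by simp
    then show ?thesis using Mfun by fastforce
  qed
  define f where "f a = (SOME b. (a, b) \<in> M)" for a
  have f: "(a, f a) \<in> M" for a unfolding f_def using total by (rule someI_ex)
  have "module_hom s t f"
    by unfold_locales (auto intro: uniq[OF f] Madd Mscale f)
  moreover have "\<forall>a b. (a, b) \<in> G0 \<longrightarrow> f a = b" using M(2) uniq f by blast
  ultimately show ?thesis using f MX by blast
qed

\<comment> \<open>The group R/Z as a module over the integers\<close>
quotient_type circle = real / "\<lambda>x y. \<exists>n::int. x - y = of_int n"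
proof (rule equivpI)
  show "reflp (\<lambda>x y :: real. \<exists>n::int. x - y = of_int n)"
    by (rule reflpI) (auto intro: exI[of _ 0])
  show "symp (\<lambda>x y :: real. \<exists>n::int. x - y = of_int n)"
    by (rule sympI) (metis minus_diff_eq of_int_minus)
  show "transp (\<lambda>x y :: real. \<exists>n::int. x - y = of_int n)"
  proof (rule transpI)
    fix x y z :: real assume "\<exists>n::int. x - y = of_int n" "\<exists>n::int. y - z = of_int n"
    then obtain m n :: int where "x - y = of_int m" "y - z = of_int n" by blast
    then show "\<exists>n::int. x - z = of_int n" by (intro exI[of _ "m + n"]) simp
  qed
qed

instantiation circle :: ab_group_add
begin

lift_definition zero_circle :: circle is 0 .

lift_definition plus_circle :: "circle \<Rightarrow> circle \<Rightarrow> circle" is "(+)"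
proof -
  fix a b c d :: real assume "\<exists>n::int. a - b = of_int n" "\<exists>n::int. c - d = of_int n"
  then obtain m n :: int where "a - b = of_int m" "c - d = of_int n" by blast
  then show "\<exists>n::int. a + c - (b + d) = of_int n" by (intro exI[of _ "m + n"]) simp
qed

lift_definition uminus_circle :: "circle \<Rightarrow> circle" is "uminus"
  by (metis minus_diff_minus of_int_minus)

definition minus_circle :: "circle \<Rightarrow> circle \<Rightarrow> circle" where
  "minus_circle x y = x + - y"

instance
  by standard (transfer; auto intro!: exI[of _ 0] simp: minus_circle_def)+

end

lift_definition circle_scale :: "int \<Rightarrow> circle \<Rightarrow> circle" is "\<lambda>n x. of_int n * x"
  by (metis of_int_mult right_diff_distrib')

lemma module_circle_scale: "module circle_scale"
  by unfold_locales (transfer; auto intro!: exI[of _ 0] simp: algebra_simps)+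

lemma circle_divisible: "m \<noteq> 0 \<Longrightarrow> \<exists>d. circle_scale m d = c"
proof transfer
  fix m :: int and c :: real assume "m \<noteq> 0"
  then show "\<exists>d n. of_int m * d - c = of_int n"
    by (intro exI[of _ "c / of_int m"] exI[of _ 0]) simp
qed

text \<open>In \<open>cog_separates\<close> the number m is the order of a point modulo a subgroup,
  with 0 for infinite order, and d is the value to be assigned to that point. The witnesses are the
  classes of 1/m and, for m = 0, of 1/2.\<close>

lemma circle_torsion:
  assumes "m \<noteq> 1" "m \<ge> 0"
  shows "\<exists>d. d \<noteq> 0 \<and> circle_scale m d = 0"
proof -
  have frac: "of_int k \<noteq> 1 / (of_int n :: real)" if "n \<ge> 2" for k n :: int
  proof
    assume "of_int k = 1 / (of_int n :: real)"
    then have "of_int (k * n) = (1 :: real)" using that by (simp add: field_simps)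
    then have "k * n = 1" by (simp only: of_int_eq_1_iff)
    then show False using that by (simp add: zmult_eq_1_iff)
  qed
  show ?thesis
  proof (cases "m = 0")
    case True
    have "\<exists>d::real. \<not> (\<exists>n::int. d - 0 = of_int n)"
      using frac[of 2] by (intro exI[of _ "1/2"]) (metis diff_zero of_int_numeral order_refl)
    then have "\<exists>d::circle. d \<noteq> 0" by transfer
    then show ?thesis using module.scale_zero_left[OF module_circle_scale] True by blast
  next
    case False
    with assms have m: "m \<ge> 2" by simp
    have "\<exists>d::real. \<not> (\<exists>n::int. d - 0 = of_int n) \<and> (\<exists>n::int. of_int m * d - 0 = of_int n)"
    proof (intro exI[of _ "1 / of_int m"] conjI)
      show "\<not> (\<exists>n::int. 1 / of_int m - 0 = (of_int n :: real))" using frac[OF m] by (metis diff_zero)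
      show "\<exists>n::int. of_int m * (1 / of_int m) - 0 = (of_int n :: real)" using m by (intro exI[of _ 1]) simp
    qed
    then show ?thesis by transfer
  qed
qed

text \<open>Serves twice in \<open>cog_separates\<close>: for the integers that move a point into a
  subgroup, and for those that move it into the domain of a partial homomorphism. The case m = 0
  occurs when no nonzero integer does so.\<close>

lemma int_ideal_principal:
  fixes I :: "int set"
  assumes 0: "0 \<in> I" and diff: "\<And>a b. a \<in> I \<Longrightarrow> b \<in> I \<Longrightarrow> a - b \<in> I" and mult: "\<And>a b. a \<in> I \<Longrightarrow> b * a \<in> I"
  obtains m where "m \<ge> 0" "m \<in> I" "\<And>i. i \<in> I \<Longrightarrow> m dvd i"
proof (cases "\<exists>n. n > 0 \<and> int n \<in> I")
  case False
  have "i = 0" if "i \<in> I" for i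
  proof (rule ccontr)
    assume "i \<noteq> 0"
    moreover have "int (nat \<bar>i\<bar>) \<in> I" using that mult[of i "-1"] by (cases "i \<ge> 0") auto
    ultimately show False using False by (metis zero_less_abs_iff zero_less_nat_eq)
  qed
  then show ?thesis using that[of 0] 0 by auto
next
  case True
  define n where "n = (LEAST n. n > 0 \<and> int n \<in> I)"
  have n: "n > 0" "int n \<in> I" using LeastI_ex[OF True] by (auto simp: n_def)
  have "int n dvd i" if "i \<in> I" for i
  proof (rule ccontr)
    assume "\<not> int n dvd i"
    then have pos: "i mod int n > 0" using n(1)
      by (metis dvd_eq_mod_eq_0 of_nat_0_less_iff order_le_imp_less_or_eq pos_mod_sign)
    have "i - (i div int n) * int n \<in> I" by (intro diff mult that n)
    then have "i mod int n \<in> I" by (simp add: minus_div_mult_eq_mod)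
    then have "n \<le> nat (i mod int n)" unfolding n_def by (intro Least_le) (simp add: pos[unfolded n_def] less_imp_le[OF pos[unfolded n_def]])
    moreover have "i mod int n < int n" using n(1) by simp
    ultimately show False using pos by linarith
  qed
  then show ?thesis using that[of "int n"] n by auto
qed

text \<open>The module coinduced from R/Z: linear maps from M to it correspond to additive maps from
  M to R/Z, by evaluation at 1. The type depends on the ground ring alone, so a hypothesis about all
  maps into it can be stated at one fixed type, whereas HOL cannot quantify over all target modules
  inside a hypothesis.\<close>

typedef (overloaded) ('k::comm_ring_1) cog = "{f :: 'k \<Rightarrow> circle. \<forall>a b. f (a + b) = f a + f b}"
  by (rule exI[of _ "\<lambda>_. 0"]) simp

setup_lifting type_definition_cog

instantiation cog :: (comm_ring_1) ab_group_add
begin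

lift_definition zero_cog :: "'a cog" is "\<lambda>_. 0" by simp

lift_definition plus_cog :: "'a cog \<Rightarrow> 'a cog \<Rightarrow> 'a cog" is "\<lambda>f g x. f x + g x" by (simp add: algebra_simps)

lift_definition uminus_cog :: "'a cog \<Rightarrow> 'a cog" is "\<lambda>f x. - f x" by simp

lift_definition minus_cog :: "'a cog \<Rightarrow> 'a cog \<Rightarrow> 'a cog" is "\<lambda>f g x. f x - g x" by (simp add: algebra_simps)

instance
  by standard (transfer; simp add: algebra_simps)+

end

lift_definition cog_scale :: "'k::comm_ring_1 \<Rightarrow> 'k cog \<Rightarrow> 'k cog" is "\<lambda>c f x. f (x * c)"
  by (simp add: algebra_simps)

lemma module_cog_scale: "module cog_scale"
  by unfold_locales (transfer; simp add: algebra_simps)+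

text \<open>Coinduction reduces the claim to an additive map into R/Z that vanishes on N but not at
  x. Such a map is first defined on the subgroup generated by N and x and then extended by
  divisibility.\<close>

lemma cog_separates:
  fixes s :: "'k::comm_ring_1 \<Rightarrow> 't::ab_group_add \<Rightarrow> 't"
  assumes s: "module s" and N: "module.subspace s N" and x: "x \<notin> N"
  shows "\<exists>g. module_hom s cog_scale g \<and> (\<forall>n\<in>N. g n = 0) \<and> g x \<noteq> 0"
proof -
  interpret s: module s by fact
  interpret c: module circle_scale by (rule module_circle_scale)
  \<comment> \<open>The scalar multiplication is restricted to the integers, so that
    \<open>lin_graph_extend\<close> yields additive maps.\<close>
  let ?z = "\<lambda>n::int. s (of_int n)"
  interpret z: module ?z by unfold_locales (auto simp: algebra_simps)
  note N0 = s.subspace_0[OF N] and Nadd = s.subspace_add[OF N] and Ns = s.subspace_scale[OF N]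
    and Nd = s.subspace_diff[OF N]
  obtain m where m: "m \<ge> 0" "?z m x \<in> N" "\<And>i. ?z i x \<in> N \<Longrightarrow> m dvd i"
  proof (rule int_ideal_principal[of "{m. ?z m x \<in> N}"])
    show "b * a \<in> {m. ?z m x \<in> N}" if "a \<in> {m. ?z m x \<in> N}" for a b
      using that Ns[of "?z a x" "of_int b"] by simp
    show "a - b \<in> {m. ?z m x \<in> N}" if "a \<in> {m. ?z m x \<in> N}" "b \<in> {m. ?z m x \<in> N}" for a b
      using that Nd by (simp add: s.scale_left_diff_distrib)
  qed (use N0 in auto)
  have "m \<noteq> 1" using m(2) x by auto
  then obtain c where c: "c \<noteq> 0" "circle_scale m c = 0" using circle_torsion m(1) by blast
  \<comment> \<open>Well defined because m, which kills c, generates the ideal of all i with i x in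
    N.\<close>
  let ?G = "{(n + ?z i x, circle_scale i c) |n i. n \<in> N}"
  have G: "lin_graph ?z circle_scale UNIV ?G"
    unfolding lin_graph_def
  proof (intro conjI allI impI)
    show "(0, 0) \<in> ?G" using N0 by (auto intro!: exI[of _ 0])
  next
    fix a b a' b' assume "(a, b) \<in> ?G" "(a', b') \<in> ?G"
    then obtain n i n' i' where "n \<in> N" "n' \<in> N" "a = n + ?z i x" "b = circle_scale i c"
      "a' = n' + ?z i' x" "b' = circle_scale i' c" by blast
    then show "(a + a', b + b') \<in> ?G"
      by (auto intro!: exI[of _ "n + n'"] exI[of _ "i + i'"] Nadd simp: algebra_simps)
  next
    fix r a b assume "(a, b) \<in> ?G"
    then obtain n i where "n \<in> N" "a = n + ?z i x" "b = circle_scale i c" by blast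
    then show "(?z r a, circle_scale r b) \<in> ?G"
      by (auto intro!: exI[of _ "?z r n"] exI[of _ "r * i"] Ns simp: algebra_simps)
  next
    fix b assume "(0, b) \<in> ?G"
    then obtain n i where n: "n \<in> N" "0 = n + ?z i x" "b = circle_scale i c" by blast
    then have "?z i x = - n" by (metis add.commute eq_neg_iff_add_eq_0)
    then have "?z i x \<in> N" using Ns[OF n(1), of "-1"] by simp
    then obtain k where "i = k * m" using m(3) by (metis dvd_def mult.commute)
    then have "b = circle_scale k (circle_scale m c)" using n(3) by simp
    then show "b = 0" by (simp add: c)
  qed simp
  have "\<exists>f. module_hom ?z circle_scale f \<and> (\<forall>a b. (a, b) \<in> ?G \<longrightarrow> f a = b) \<and> (\<forall>a. f a \<in> UNIV)"
  proof (rule lin_graph_extend[OF z.module_axioms c.module_axioms c.subspace_UNIV G])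
    fix G y assume G: "lin_graph ?z circle_scale UNIV G"
    have Gadd: "\<And>a b a' b'. (a, b) \<in> G \<Longrightarrow> (a', b') \<in> G \<Longrightarrow> (a + a', b + b') \<in> G"
      and Gscale: "\<And>c a b. (a, b) \<in> G \<Longrightarrow> (?z c a, circle_scale c b) \<in> G"
      and Gfun: "\<And>b. (0, b) \<in> G \<Longrightarrow> b = 0" and G0: "(0, 0) \<in> G"
      using G unfolding lin_graph_def by blast+
    have Gdiff: "(a - a', b - b') \<in> G" if "(a, b) \<in> G" "(a', b') \<in> G" for a b a' b'
      using Gadd[OF that(1) Gscale[OF that(2), of "-1"]] by simp
    \<comment> \<open>The multiples of y in the domain of G are those of m y. Hence an m-th part d
      of the value e at m y accounts for all of them; for m = 0 the value 0 is taken.\<close>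
    obtain m where m: "m \<ge> 0" "\<exists>x. (?z m y, x) \<in> G" "\<And>i x. (?z i y, x) \<in> G \<Longrightarrow> m dvd i"
    proof (rule int_ideal_principal[of "{m. \<exists>x. (?z m y, x) \<in> G}"])
      show "b * a \<in> {m. \<exists>x. (?z m y, x) \<in> G}" if "a \<in> {m. \<exists>x. (?z m y, x) \<in> G}" for a b
        using that Gscale[of "?z a y" _ b] by auto
      show "a - b \<in> {m. \<exists>x. (?z m y, x) \<in> G}"
        if "a \<in> {m. \<exists>x. (?z m y, x) \<in> G}" "b \<in> {m. \<exists>x. (?z m y, x) \<in> G}" for a b
        using that Gdiff[of "?z a y" _ "?z b y"] by (auto simp: s.scale_left_diff_distrib)
    qed (use G0 in auto)
    obtain e where e: "(?z m y, e) \<in> G" using m(2) by blast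
    obtain d where d: "circle_scale m d = e"
    proof (cases "m = 0")
      case True
      then have "e = 0" using e Gfun by simp
      then show ?thesis using that[of 0] by simp
    qed (use circle_divisible that in blast)
    have "x = circle_scale i d" if ix: "(?z i y, x) \<in> G" for i x
    proof -
      obtain k where k: "i = k * m" using m(3)[OF ix] by (metis dvd_def mult.commute)
      have "(?z i y - ?z k (?z m y), x - circle_scale k e) \<in> G" by (rule Gdiff[OF ix Gscale[OF e]])
      then have "x = circle_scale k e" using Gfun[of "x - circle_scale k e"] by (simp add: k)
      then show ?thesis by (simp add: k d[symmetric])
    qed
    then show "\<exists>d\<in>UNIV. \<forall>c x. (?z c y, x) \<in> G \<longrightarrow> x = circle_scale c d" by blast
  qed
  then obtain f where f: "module_hom ?z circle_scale f" and fG: "\<And>a b. (a, b) \<in> ?G \<Longrightarrow> f a = b" by blast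
  interpret f: module_hom ?z circle_scale f by fact
  have fN: "f n = 0" if "n \<in> N" for n
    by (rule fG) (use that in \<open>auto intro!: exI[of _ n] exI[of _ "0::int"]\<close>)
  have fx: "f x = c"
    by (rule fG) (use N0 in \<open>auto intro!: exI[of _ "0::'t"] exI[of _ "1::int"]\<close>)
  \<comment> \<open>The adjunction: the additive map f becomes the linear map that sends a to r
    \<mapsto> f(r a). It vanishes on N because N is closed under all scalars, and evaluation at 1
    recovers f.\<close>
  define g where "g a = Abs_cog (\<lambda>r. f (s r a))" for a
  have g: "Rep_cog (g a) = (\<lambda>r. f (s r a))" for a
    unfolding g_def by (rule Abs_cog_inverse) (simp add: s.scale_left_distrib f.add)
  have "module_hom s cog_scale g"
  proof (unfold_locales, goal_cases)
    case 1 show ?case by (rule module.scale_right_distrib[OF module_cog_scale])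
  next
    case 2 show ?case by (rule module.scale_left_distrib[OF module_cog_scale])
  next
    case 3 show ?case by (rule module.scale_scale[OF module_cog_scale])
  next
    case 4 show ?case by (rule module.scale_one[OF module_cog_scale])
  next
    case 5 show ?case
      by (simp add: Rep_cog_inject[symmetric] g plus_cog.rep_eq s.scale_right_distrib f.add)
  next
    case 6 show ?case
      by (simp add: Rep_cog_inject[symmetric] g cog_scale.rep_eq)
  qed
  moreover have "\<forall>n\<in>N. g n = 0"
    by (simp add: Rep_cog_inject[symmetric] g zero_cog.rep_eq fun_eq_iff fN Ns)
  moreover have "g x \<noteq> 0"
  proof
    assume "g x = 0"
    then have "Rep_cog (g x) 1 = 0" by (simp add: zero_cog.rep_eq)
    then show False by (simp add: g fx c)
  qed
  ultimately show ?thesis by blast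
qed

section \<open>Sweedler calculus\<close>

lemma module_mult: "module ((*) :: 'k::comm_ring_1 \<Rightarrow> 'k \<Rightarrow> 'k)"
  by unfold_locales (auto simp: algebra_simps)

text \<open>Introduction rules for linearity in one variable; they discharge the side conditions of
  the calculations with Sweedler sums. Many of them carry an inner linear map in the varying
  argument, so that they match nested expressions directly.\<close>

named_theorems hom_intros

lemma hom_id: "module s \<Longrightarrow> module_hom s s (\<lambda>x. x)"
  by (simp add: module_hom_def module_hom_axioms_def)

lemma hom_comp: "module_hom s t g \<Longrightarrow> module_hom r s f \<Longrightarrow> module_hom r t (\<lambda>x. g (f x))"
  by (simp add: module_hom_def module_hom_axioms_def)

lemma hom_scale_r: "module_hom r s f \<Longrightarrow> module_hom r s (\<lambda>x. s c (f x))"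
  by (simp add: module_hom_def module_hom_axioms_def module.scale_right_distrib module.scale_left_commute)

lemma hom_scale_l: "module s \<Longrightarrow> module_hom r (*) f \<Longrightarrow> module_hom r s (\<lambda>x. s (f x) m)"
  by (simp add: module_hom_def module_hom_axioms_def module.scale_left_distrib module.scale_scale)

lemma hom_diff: "module_hom r s f \<Longrightarrow> module_hom r s g \<Longrightarrow> module_hom r s (\<lambda>x. f x - g x)"
  by (simp add: module_hom_def module_hom_axioms_def module.scale_right_diff_distrib)

lemma hom_sweedler:
  assumes "module r" "module s" "\<And>a b. module_hom r s (\<lambda>x. F a b x)"
  shows "module_hom r s (\<lambda>x. sweedler s X (\<lambda>a b. F a b x))"
proof -
  interpret s: module s by fact
  have "F a b (x + y) = F a b x + F a b y" "F a b (r c x) = s c (F a b x)" for a b c x y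
    using assms(3)[of a b] by (simp_all add: module_hom_def module_hom_axioms_def)
  then show ?thesis
    using assms(1,2)
    by (auto simp: module_hom_def module_hom_axioms_def sweedler_def lin_ext_def case_prod_beta
        s.scale_right_distrib sum.distrib s.scale_sum_right mult.commute intro!: sum.cong)
qed

lemma sweedler_hom:
  assumes "module_hom s t g"
  shows "g (sweedler s X f) = sweedler t X (\<lambda>a b. g (f a b))"
proof -
  interpret module_hom s t g by fact
  show ?thesis by (simp add: sweedler_def lin_ext_def sum scale case_prod_beta)
qed

text \<open>Needs no bilinearity: both sums run over fixed representatives, so this is the exchange
  of two finite sums. It applies as long as neither tensor depends on the components of the
  other.\<close>

lemma sweedler_swap:
  assumes "module s"
  shows "sweedler s X (\<lambda>a b. sweedler s Y (\<lambda>c d. F a b c d)) = sweedler s Y (\<lambda>c d. sweedler s X (\<lambda>a b. F a b c d))"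
proof -
  interpret s: module s by fact
  show ?thesis
    unfolding sweedler_def lin_ext_def case_prod_beta s.scale_sum_right
    by (subst sum.swap) (simp add: mult.commute)
qed

lemma sweedler_cong_keys:
  assumes "\<And>a b. (a, b) \<in> Poly_Mapping.keys (rep X) \<Longrightarrow> f a b = g a b"
  shows "sweedler s X f = sweedler s X g"
  unfolding sweedler_def lin_ext_def by (intro sum.cong) (auto simp: assms)

lemma sweedler_cong: "(\<And>a b. f a b = g a b) \<Longrightarrow> sweedler s X f = sweedler s X g"
  by (rule arg_cong[of f g]) (simp add: fun_eq_iff)

lemma sweedler_scale:
  assumes "module s"
  shows "sweedler s X (\<lambda>a b. s c (f a b)) = s c (sweedler s X f)"
  by (rule sweedler_hom[symmetric], rule hom_scale_r, rule hom_id, rule assms)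

lemma sweedler_scale_left:
  assumes "module s"
  shows "sweedler s X (\<lambda>a b. s (f a b) m) = s (sweedler (*) X f) m"
  by (rule sweedler_hom[symmetric], rule hom_scale_l, rule assms, rule hom_id, rule module_mult)

lemma bilinI:
  assumes "\<And>y. module_hom s1 s (\<lambda>x. f x y)" "\<And>x. module_hom s2 s (\<lambda>y. f x y)"
  shows "bilin s1 s2 s f"
  using assms by (simp add: bilin_def)

lemma bilin_hom1: "bilin s1 s2 s f \<Longrightarrow> module_hom r s1 g \<Longrightarrow> module_hom r s (\<lambda>x. f (g x) y)"
  unfolding bilin_def by (blast intro: hom_comp[of s1 s "\<lambda>x. f x y" for y])

lemma bilin_hom2: "bilin s1 s2 s f \<Longrightarrow> module_hom r s2 g \<Longrightarrow> module_hom r s (\<lambda>x. f y (g x))"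
  unfolding bilin_def by (blast intro: hom_comp)

lemma bilin_modules: "bilin s1 s2 s f \<Longrightarrow> module s1" "bilin s1 s2 s f \<Longrightarrow> module s2" "bilin s1 s2 s f \<Longrightarrow> module s"
  by (auto simp: bilin_def module_hom_def)

definition trilin :: "('k::comm_ring_1 \<Rightarrow> 'm \<Rightarrow> 'm) \<Rightarrow> ('k \<Rightarrow> 'n \<Rightarrow> 'n) \<Rightarrow> ('k \<Rightarrow> 'p \<Rightarrow> 'p) \<Rightarrow> ('k \<Rightarrow> 't \<Rightarrow> 't)
    \<Rightarrow> ('m::ab_group_add \<Rightarrow> 'n::ab_group_add \<Rightarrow> 'p::ab_group_add \<Rightarrow> 't::ab_group_add) \<Rightarrow> bool" where
  "trilin s1 s2 s3 s f \<longleftrightarrow> (\<forall>y z. module_hom s1 s (\<lambda>x. f x y z)) \<and> (\<forall>x z. module_hom s2 s (\<lambda>y. f x y z)) \<and>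
    (\<forall>x y. module_hom s3 s (f x y))"

lemma trilinI:
  assumes "\<And>y z. module_hom s1 s (\<lambda>x. f x y z)" "\<And>x z. module_hom s2 s (\<lambda>y. f x y z)"
    "\<And>x y. module_hom s3 s (\<lambda>z. f x y z)"
  shows "trilin s1 s2 s3 s f"
  using assms by (simp add: trilin_def)

lemma trilin_hom1: "trilin s1 s2 s3 s f \<Longrightarrow> module_hom r s1 g \<Longrightarrow> module_hom r s (\<lambda>x. f (g x) y z)"
  unfolding trilin_def by (blast intro: hom_comp[of s1 s "\<lambda>x. f x y z" for y z])

lemma trilin_hom2: "trilin s1 s2 s3 s f \<Longrightarrow> module_hom r s2 g \<Longrightarrow> module_hom r s (\<lambda>y. f x (g y) z)"
  unfolding trilin_def by (blast intro: hom_comp[of s2 s "\<lambda>y. f x y z" for x z])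

lemma trilin_hom3: "trilin s1 s2 s3 s f \<Longrightarrow> module_hom r s3 g \<Longrightarrow> module_hom r s (\<lambda>z. f x y (g z))"
  unfolding trilin_def by (blast intro: hom_comp)

lemma trilin_modules: "trilin s1 s2 s3 s f \<Longrightarrow> module s"
  by (auto simp: trilin_def module_hom_def)

lemmas [hom_intros] = hom_id hom_scale_r hom_scale_l hom_sweedler bilinI trilinI module_mult module_cog_scale

section \<open>Cosets, their representatives, and tests by linear maps\<close>

lemma subspace_null2: "module.subspace fscale (null2 s1 s2 M N)"
  unfolding null2_def by (rule module.subspace_span[OF module_fscale])

lemma subspace_null3: "module.subspace fscale (null3 s1 s2 s3 M N P)"
  unfolding null3_def by (rule module.subspace_span[OF module_fscale])

lemma coset_eq_iff:
  assumes "module.subspace fscale N"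
  shows "coset N x = coset N y \<longleftrightarrow> x - y \<in> N"
proof -
  interpret module fscale by (rule module_fscale)
  note sub = subspace_0[OF assms] subspace_diff[OF assms] subspace_add[OF assms]
  show ?thesis
  proof
    assume "coset N x = coset N y"
    moreover have "x \<in> coset N x" by (simp add: coset_def sub)
    ultimately show "x - y \<in> N" by (simp add: coset_def)
  next
    assume d: "x - y \<in> N"
    have "z - x \<in> N \<longleftrightarrow> z - y \<in> N" for z
      using sub(3)[OF _ d, of "z - x"] sub(2)[OF _ d, of "z - y"] by auto
    then show "coset N x = coset N y" by (auto simp: coset_def)
  qed
qed

lemma rep_coset:
  assumes "module.subspace fscale N"
  shows "rep (coset N x) - x \<in> N"
proof -
  have "x \<in> coset N x" by (simp add: coset_def module.subspace_0[OF module_fscale assms])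
  then show ?thesis unfolding rep_def by (rule someI2) (simp add: coset_def)
qed

lemma coset_rep:
  assumes "module.subspace fscale N"
  shows "coset N (rep (coset N x)) = coset N x"
  using rep_coset[OF assms] by (simp add: coset_eq_iff[OF assms])

text \<open>Equalities in a quotient can be tested on homomorphisms into the single module \<open>'k cog\<close>, so
  that no calculation has to be done modulo a submodule.\<close>

lemma coset_eqI_cog:
  fixes x y :: "'x \<Rightarrow>\<^sub>0 'k::comm_ring_1"
  assumes "module.subspace fscale N"
    and "\<And>g :: _ \<Rightarrow> 'k cog. module_hom fscale cog_scale g \<Longrightarrow> (\<And>n. n \<in> N \<Longrightarrow> g n = 0) \<Longrightarrow> g x = g y"
  shows "coset N x = coset N y"
proof (rule ccontr)
  assume "coset N x \<noteq> coset N y"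
  then have "x - y \<notin> N" by (simp add: coset_eq_iff[OF assms(1)])
  from cog_separates[OF module_fscale assms(1) this] obtain g :: "_ \<Rightarrow> 'k cog"
    where g: "module_hom fscale cog_scale g" "\<forall>n\<in>N. g n = 0" "g (x - y) \<noteq> 0" by blast
  then show False using assms(2)[OF g(1)] module_hom.diff[OF g(1)] by simp
qed

lemma gen_decomposition:
  fixes x :: "'x \<Rightarrow>\<^sub>0 'k::comm_ring_1"
  shows "x = (\<Sum>p\<in>Poly_Mapping.keys x. fscale (Poly_Mapping.lookup x p) (gen p))"
proof (rule poly_mapping_eqI)
  fix q
  have "Poly_Mapping.lookup (fscale c (gen p)) q = (if p = q then c else 0)" for c :: 'k and p :: 'x
    by (simp add: fscale_def map.rep_eq when_def lookup_single)
  then show "Poly_Mapping.lookup x q = Poly_Mapping.lookup (\<Sum>p\<in>Poly_Mapping.keys x. fscale (Poly_Mapping.lookup x p) (gen p)) q"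
    by (simp add: lookup_sum in_keys_iff)
qed

lemma hom_eq_lin_ext:
  assumes "module_hom fscale t g"
  shows "g x = lin_ext t (\<lambda>p. g (gen p)) x"
proof -
  interpret module_hom fscale t g by fact
  show ?thesis by (subst gen_decomposition[of x]) (simp add: sum scale lin_ext_def)
qed

lemma lin_ext_sweedler:
  "module t \<Longrightarrow> lin_ext t f (sweedler fscale X g) = sweedler t X (\<lambda>a b. lin_ext t f (g a b))"
  by (rule sweedler_hom[OF module_hom_lin_ext])

text \<open>A linear map that kills the relations of M \<otimes> N is bilinear on M \<times> N only,
  whereas \<open>bilin\<close> speaks of whole types. Precomposition with linear maps into M and N
  makes it total; later p is a projection onto the coinvariants.\<close>

lemma null2_bilin_on:
  assumes g: "module_hom fscale t g" and 0: "\<And>n. n \<in> null2 s1 s2 M N \<Longrightarrow> g n = 0"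
    and p: "module_hom r1 s1 p" "\<And>a. p a \<in> M" and q: "module_hom r2 s2 q" "\<And>a. q a \<in> N"
  shows "bilin r1 r2 t (\<lambda>a b. g (gen (p a, q b)))"
proof -
  interpret module_hom fscale t g by fact
  have base: "x \<in> null2 s1 s2 M N" if "x \<in> {gen (m + m', n) - gen (m, n) - gen (m', n) |m m' n. m \<in> M \<and> m' \<in> M \<and> n \<in> N} \<union>
     {gen (m, n + n') - gen (m, n) - gen (m, n') |m n n'. m \<in> M \<and> n \<in> N \<and> n' \<in> N} \<union>
     {gen (s1 c m, n) - fscale c (gen (m, n)) |c m n. m \<in> M \<and> n \<in> N} \<union>
     {gen (m, s2 c n) - fscale c (gen (m, n)) |c m n. m \<in> M \<and> n \<in> N}" for x
    unfolding null2_def using m1.span_base[OF that] .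
  have "g (gen (m + m', n) - gen (m, n) - gen (m', n)) = 0" if "m \<in> M" "m' \<in> M" "n \<in> N" for m m' n
    using that by (intro 0 base) blast
  moreover have "g (gen (m, n + n') - gen (m, n) - gen (m, n')) = 0" if "m \<in> M" "n \<in> N" "n' \<in> N" for m n n'
    using that by (intro 0 base) blast
  moreover have "g (gen (s1 c m, n) - fscale c (gen (m, n))) = 0" if "m \<in> M" "n \<in> N" for c m n
    using that by (intro 0 base) blast
  moreover have "g (gen (m, s2 c n) - fscale c (gen (m, n))) = 0" if "m \<in> M" "n \<in> N" for c m n
    using that by (intro 0 base) blast
  ultimately show ?thesis
    using p q m2.module_axioms
    by (simp add: bilin_def module_hom_def module_hom_axioms_def diff add scale algebra_simps)
qed

lemma null2_bilin:
  assumes "module_hom fscale t g" "\<And>n. n \<in> null2 s1 s2 UNIV UNIV \<Longrightarrow> g n = 0" "module s1" "module s2"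
  shows "bilin s1 s2 t (\<lambda>a b. g (gen (a, b)))"
  using null2_bilin_on[OF assms(1,2) hom_id[OF assms(3)] _ hom_id[OF assms(4)]] by simp

lemma null3_trilin_on:
  assumes g: "module_hom fscale t g" and 0: "\<And>n. n \<in> null3 s1 s2 s3 M UNIV UNIV \<Longrightarrow> g n = 0"
    and p: "module_hom r1 s1 p" "\<And>a. p a \<in> M" and s: "module s2" "module s3"
  shows "trilin r1 s2 s3 t (\<lambda>a b c. g (gen (p a, b, c)))"
proof -
  interpret module_hom fscale t g by fact
  have base: "x \<in> null3 s1 s2 s3 M UNIV UNIV" if "x \<in>
    {gen (m + m', n, p) - gen (m, n, p) - gen (m', n, p) |m m' n p. m \<in> M \<and> m' \<in> M \<and> n \<in> UNIV \<and> p \<in> UNIV} \<union>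
     {gen (m, n + n', p) - gen (m, n, p) - gen (m, n', p) |m n n' p. m \<in> M \<and> n \<in> UNIV \<and> n' \<in> UNIV \<and> p \<in> UNIV} \<union>
     {gen (m, n, p + p') - gen (m, n, p) - gen (m, n, p') |m n p p'. m \<in> M \<and> n \<in> UNIV \<and> p \<in> UNIV \<and> p' \<in> UNIV} \<union>
     {gen (s1 c m, n, p) - fscale c (gen (m, n, p)) |c m n p. m \<in> M \<and> n \<in> UNIV \<and> p \<in> UNIV} \<union>
     {gen (m, s2 c n, p) - fscale c (gen (m, n, p)) |c m n p. m \<in> M \<and> n \<in> UNIV \<and> p \<in> UNIV} \<union>
     {gen (m, n, s3 c p) - fscale c (gen (m, n, p)) |c m n p. m \<in> M \<and> n \<in> UNIV \<and> p \<in> UNIV}" for x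
    unfolding null3_def using m1.span_base[OF that] .
  have "g (gen (m + m', n, c) - gen (m, n, c) - gen (m', n, c)) = 0" if "m \<in> M" "m' \<in> M" for m m' n c
    by (intro 0, intro base, rule UnI1, rule UnI1, rule UnI1, rule UnI1, rule UnI1, use that in blast)
  moreover have "g (gen (m, n + n', c) - gen (m, n, c) - gen (m, n', c)) = 0" if "m \<in> M" for m n n' c
    by (intro 0, intro base, rule UnI1, rule UnI1, rule UnI1, rule UnI1, rule UnI2, use that in blast)
  moreover have "g (gen (m, n, c + c') - gen (m, n, c) - gen (m, n, c')) = 0" if "m \<in> M" for m n c c'
    by (intro 0, intro base, rule UnI1, rule UnI1, rule UnI1, rule UnI2, use that in blast)
  moreover have "g (gen (s1 d m, n, c) - fscale d (gen (m, n, c))) = 0" if "m \<in> M" for d m n c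
    by (intro 0, intro base, rule UnI1, rule UnI1, rule UnI2, use that in blast)
  moreover have "g (gen (m, s2 d n, c) - fscale d (gen (m, n, c))) = 0" if "m \<in> M" for d m n c
    by (intro 0, intro base, rule UnI1, rule UnI2, use that in blast)
  moreover have "g (gen (m, n, s3 d c) - fscale d (gen (m, n, c))) = 0" if "m \<in> M" for d m n c
    by (intro 0, intro base, rule UnI2, use that in blast)
  ultimately show ?thesis
    using p s m2.module_axioms
    by (simp add: trilin_def module_hom_def module_hom_axioms_def diff add scale algebra_simps)
qed

lemma subspace_keys: "module.subspace fscale {x :: 'x \<Rightarrow>\<^sub>0 'k::comm_ring_1. Poly_Mapping.keys x \<subseteq> S}"
proof (rule module.subspaceI[OF module_fscale])
  fix x y :: "'x \<Rightarrow>\<^sub>0 'k" and c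
  assume "x \<in> {x. Poly_Mapping.keys x \<subseteq> S}"
  then show "fscale c x \<in> {x. Poly_Mapping.keys x \<subseteq> S}"
    by (auto simp: fscale_def in_keys_iff map.rep_eq when_def split: if_splits)
qed (use Poly_Mapping.keys_add in \<open>fastforce\<close>)+

lemma keys_sweedler:
  assumes "\<And>a b. (a, b) \<in> Poly_Mapping.keys (rep X) \<Longrightarrow> Poly_Mapping.keys (f a b) \<subseteq> S"
  shows "Poly_Mapping.keys (sweedler fscale X f) \<subseteq> S"
proof -
  have "sweedler fscale X f \<in> {x. Poly_Mapping.keys x \<subseteq> S}"
    unfolding sweedler_def lin_ext_def
    by (intro module.subspace_sum[OF module_fscale subspace_keys] module.subspace_scale[OF module_fscale subspace_keys])
      (use assms in auto)
  then show ?thesis by simp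
qed

lemma keys_null2:
  assumes "module s1" "module.subspace s1 M" "x \<in> null2 s1 s2 M UNIV"
  shows "Poly_Mapping.keys x \<subseteq> M \<times> UNIV"
proof -
  interpret module fscale by (rule module_fscale)
  note sub = module.subspace_add[OF assms(1,2)] module.subspace_scale[OF assms(1,2)]
  have g: "gen (m, n) \<in> {x. Poly_Mapping.keys x \<subseteq> M \<times> UNIV}" if "m \<in> M" for m n
    using that by simp
  note cl = subspace_diff[OF subspace_keys] subspace_scale[OF subspace_keys] g sub
  have "null2 s1 s2 M UNIV \<subseteq> {x. Poly_Mapping.keys x \<subseteq> M \<times> UNIV}"
    unfolding null2_def
  proof (rule span_minimal[OF _ subspace_keys], intro Un_least subsetI)
  qed (elim CollectE exE conjE, hypsubst, intro cl, assumption+)+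
  then show ?thesis using assms(3) by blast
qed

text \<open>The representative \<open>rep X\<close> is an arbitrary choice, but two representatives
  differ by relations, and the relations themselves only involve pairs with first entry in M. So
  identities that hold on M only may be used under the sum.\<close>

lemma tensor2_keys:
  assumes "module s1" "module.subspace s1 M" "X \<in> tensor2 s1 s2 M UNIV" "(a, b) \<in> Poly_Mapping.keys (rep X)"
  shows "a \<in> M"
proof -
  from assms(3) obtain x where x: "X = coset (null2 s1 s2 M UNIV) x" "Poly_Mapping.keys x \<subseteq> M \<times> UNIV"
    by (auto simp: tensor2_def)
  have "rep X - x \<in> {x. Poly_Mapping.keys x \<subseteq> M \<times> UNIV}"
    using keys_null2[OF assms(1,2) rep_coset[OF subspace_null2]] by (simp add: x(1))
  from module.subspace_add[OF module_fscale subspace_keys this, of x] x(2)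
  have "Poly_Mapping.keys (rep X) \<subseteq> M \<times> UNIV" by simp
  then show ?thesis using assms(4) by blast
qed

lemma tensor2_UNIV: "X \<in> tensor2 s1 s2 UNIV UNIV \<Longrightarrow> X = coset (null2 s1 s2 UNIV UNIV) (rep X)"
  using coset_rep[OF subspace_null2] by (fastforce simp: tensor2_def)

lemma coset_in_tensor2: "coset (null2 s1 s2 UNIV UNIV) x \<in> tensor2 s1 s2 UNIV UNIV"
  by (simp add: tensor2_def)

lemma tens_eqI:
  fixes X :: "('m::ab_group_add \<times> 'n::ab_group_add \<Rightarrow>\<^sub>0 'k::comm_ring_1) set"
  assumes "module s1" "module s2" and X: "X \<in> tensor2 s1 s2 UNIV UNIV" and Y: "Y \<in> tensor2 s1 s2 UNIV UNIV"
    and eq: "\<And>F :: _ \<Rightarrow> _ \<Rightarrow> 'k cog. bilin s1 s2 cog_scale F \<Longrightarrow> sweedler cog_scale X F = sweedler cog_scale Y F"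
  shows "X = Y"
proof -
  have "coset (null2 s1 s2 UNIV UNIV) (rep X) = coset (null2 s1 s2 UNIV UNIV) (rep Y)"
  proof (rule coset_eqI_cog[OF subspace_null2])
    fix g :: "_ \<Rightarrow> 'k cog"
    assume g: "module_hom fscale cog_scale g" "\<And>n. n \<in> null2 s1 s2 UNIV UNIV \<Longrightarrow> g n = 0"
    have [simp]: "(\<lambda>(a, b). g (gen (a, b))) = (\<lambda>p. g (gen p))" by (simp add: fun_eq_iff)
    have "bilin s1 s2 cog_scale (\<lambda>a b. g (gen (a, b)))" by (rule null2_bilin[OF g assms(1,2)])
    from eq[OF this] show "g (rep X) = g (rep Y)"
      by (simp add: hom_eq_lin_ext[OF g(1), of "rep X"] hom_eq_lin_ext[OF g(1), of "rep Y"] sweedler_def)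
  qed
  with tensor2_UNIV[OF X] tensor2_UNIV[OF Y] show ?thesis by simp
qed

definition tmap :: "('k::comm_ring_1 \<Rightarrow> 'a \<Rightarrow> 'a) \<Rightarrow> ('k \<Rightarrow> 'm \<Rightarrow> 'm) \<Rightarrow> ('k \<Rightarrow> 'n \<Rightarrow> 'n)
    \<Rightarrow> ('a::ab_group_add \<Rightarrow> ('m::ab_group_add \<times> 'n::ab_group_add \<Rightarrow>\<^sub>0 'k) set) \<Rightarrow> bool" where
  "tmap s s1 s2 X \<longleftrightarrow> module s \<and> module s1 \<and> module s2 \<and> (\<forall>a. X a \<in> tensor2 s1 s2 UNIV UNIV) \<and>
    linear_mod s (null2 s1 s2 UNIV UNIV) X"

lemma linear_mod_hom:
  assumes "linear_mod s (null2 s1 s2 M N) X" "bilin s1 s2 t F" "module s"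
  shows "module_hom s t (\<lambda>a. sweedler t (X a) F)"
proof -
  note m = bilin_modules(3)[OF assms(2)]
  have "sweedler t (X (a + b)) F = sweedler t (X a) F + sweedler t (X b) F" for a b
  proof -
    have "X (a + b) = coset (null2 s1 s2 M N) (rep (X a) + rep (X b))"
      using assms(1) by (simp add: linear_mod_def)
    then show ?thesis
      by (simp add: sweedler_coset[OF assms(2)] lin_ext_add[OF m]) (simp add: sweedler_def)
  qed
  moreover have "sweedler t (X (s c a)) F = t c (sweedler t (X a) F)" for a c
  proof -
    have "X (s c a) = coset (null2 s1 s2 M N) (fscale c (rep (X a)))"
      using assms(1) by (simp add: linear_mod_def)
    then show ?thesis
      by (simp add: sweedler_coset[OF assms(2)] lin_ext_fscale[OF m]) (simp add: sweedler_def)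
  qed
  ultimately show ?thesis
    using assms(3) m by (simp add: module_hom_def module_hom_axioms_def)
qed

lemma tmap_hom:
  assumes "tmap s s1 s2 X" "bilin s1 s2 t F" "module_hom r s f"
  shows "module_hom r t (\<lambda>a. sweedler t (X (f a)) F)"
proof (rule hom_comp[OF _ assms(3), of t "\<lambda>a. sweedler t (X a) F"])
  show "module_hom s t (\<lambda>a. sweedler t (X a) F)"
    using assms(1) by (intro linear_mod_hom[OF _ assms(2)]) (auto simp: tmap_def)
qed

text \<open>Coassociativity and its variants (for coactions, or for two commuting coactions), tested on
  trilinear maps.\<close>

definition nest_law :: "('k::comm_ring_1 \<Rightarrow> 'm \<Rightarrow> 'm) \<Rightarrow> ('k \<Rightarrow> 'n \<Rightarrow> 'n) \<Rightarrow> ('k \<Rightarrow> 'p \<Rightarrow> 'p) \<Rightarrow> ('k \<Rightarrow> 't \<Rightarrow> 't)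
    \<Rightarrow> ('a \<times> 'p \<Rightarrow>\<^sub>0 'k) set \<Rightarrow> ('a \<Rightarrow> ('m::ab_group_add \<times> 'n::ab_group_add \<Rightarrow>\<^sub>0 'k) set)
    \<Rightarrow> ('m \<times> 'b \<Rightarrow>\<^sub>0 'k) set \<Rightarrow> ('b \<Rightarrow> ('n \<times> 'p::ab_group_add \<Rightarrow>\<^sub>0 'k) set) \<Rightarrow> ('t::ab_group_add) itself \<Rightarrow> bool" where
  "nest_law s1 s2 s3 s X Y X' Y' T \<longleftrightarrow> (\<forall>F. trilin s1 s2 s3 s F \<longrightarrow>
     sweedler s X (\<lambda>a b. sweedler s (Y a) (\<lambda>c d. F c d b)) = sweedler s X' (\<lambda>a b. sweedler s (Y' b) (\<lambda>c d. F a c d)))"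

lemma lin_ext_null3:
  assumes "trilin s1 s2 s3 s f" and "x \<in> null3 s1 s2 s3 M N P"
  shows "lin_ext s (\<lambda>(a, b, c). f a b c) x = 0"
proof -
  have h1: "module_hom s1 s (\<lambda>a. f a b c)" and h2: "module_hom s2 s (\<lambda>b. f a b c)"
    and h3: "module_hom s3 s (f a b)" for a b c
    using assms(1) by (auto simp: trilin_def)
  have m: "module s" by (rule trilin_modules[OF assms(1)])
  interpret L: module_hom fscale s "lin_ext s (\<lambda>(a, b, c). f a b c)"
    by (rule module_hom_lin_ext[OF m])
  note [simp] = lin_ext_gen[OF m] module_hom.add[OF h1] module_hom.add[OF h2] module_hom.add[OF h3]
    module_hom.scale[OF h1] module_hom.scale[OF h2] module_hom.scale[OF h3] L.diff L.scale
  show ?thesis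
    using assms(2) unfolding null3_def
    by (rule L.eq_0_on_span[rotated]) auto
qed

lemma nest_lawI:
  assumes "coset (null3 s1 s2 s3 M N P) (sweedler fscale X (\<lambda>a b. sweedler fscale (Y a) (\<lambda>c d. gen (c, d, b))))
    = coset (null3 s1 s2 s3 M N P) (sweedler fscale X' (\<lambda>a b. sweedler fscale (Y' b) (\<lambda>c d. gen (a, c, d))))"
  shows "nest_law s1 s2 s3 s X Y X' Y' T"
  unfolding nest_law_def
proof (intro allI impI)
  fix F assume F: "trilin s1 s2 s3 s F"
  note m = trilin_modules[OF F]
  have "lin_ext s (\<lambda>(a, b, c). F a b c) (sweedler fscale X (\<lambda>a b. sweedler fscale (Y a) (\<lambda>c d. gen (c, d, b)))
     - sweedler fscale X' (\<lambda>a b. sweedler fscale (Y' b) (\<lambda>c d. gen (a, c, d)))) = 0"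
    using assms unfolding coset_eq_iff[OF subspace_null3] by (rule lin_ext_null3[OF F])
  then show "sweedler s X (\<lambda>a b. sweedler s (Y a) (\<lambda>c d. F c d b)) = sweedler s X' (\<lambda>a b. sweedler s (Y' b) (\<lambda>c d. F a c d))"
    by (simp add: module_hom.diff[OF module_hom_lin_ext[OF m]] lin_ext_sweedler[OF m] lin_ext_gen[OF m])
qed

lemma nest_lawD:
  assumes "nest_law s1 s2 s3 s X Y X' Y' T" "trilin s1 s2 s3 s F"
  shows "sweedler s X (\<lambda>a b. sweedler s (Y a) (\<lambda>c d. F c d b)) = sweedler s X' (\<lambda>a b. sweedler s (Y' b) (\<lambda>c d. F a c d))"
  using assms by (simp add: nest_law_def)

text \<open>Two laws applied side by side with their components interleaved. This is the shape in
  which the coactions of both factors of a product occur.\<close>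

lemma nest_law2:
  fixes s :: "'k::comm_ring_1 \<Rightarrow> 't::ab_group_add \<Rightarrow> 't"
  assumes m: "module s"
    and l1: "nest_law s1 s2 s3 s X Y X' Y' TYPE('t)" and l2: "nest_law r1 r2 r3 s U V U' V' TYPE('t)"
    and t1: "\<And>a b c. trilin s1 s2 s3 s (\<lambda>x y z. F x a y b z c)"
    and t2: "\<And>x y z. trilin r1 r2 r3 s (\<lambda>a b c. F x a y b z c)"
  shows "sweedler s X (\<lambda>a b. sweedler s U (\<lambda>a' b'. sweedler s (Y a) (\<lambda>c d. sweedler s (V a') (\<lambda>c' d'. F c c' d d' b b'))))
    = sweedler s X' (\<lambda>a b. sweedler s U' (\<lambda>a' b'. sweedler s (Y' b) (\<lambda>c d. sweedler s (V' b') (\<lambda>c' d'. F a a' c c' d d'))))"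
proof -
  note hs = t1[unfolded trilin_def]
  have t1': "module s1" "module s2" "module s3"
    using t1 by (auto simp: trilin_def module_hom_def)
  have "sweedler s X (\<lambda>a b. sweedler s U (\<lambda>a' b'. sweedler s (Y a) (\<lambda>c d. sweedler s (V a') (\<lambda>c' d'. F c c' d d' b b'))))
    = sweedler s X (\<lambda>a b. sweedler s (Y a) (\<lambda>c d. sweedler s U (\<lambda>a' b'. sweedler s (V a') (\<lambda>c' d'. F c c' d d' b b'))))"
    by (subst sweedler_swap[OF m]) (rule refl)
  also have "\<dots> = sweedler s X (\<lambda>a b. sweedler s (Y a) (\<lambda>c d. sweedler s U' (\<lambda>a' b'. sweedler s (V' b') (\<lambda>c' d'. F c a' d c' b d'))))"
    by (subst nest_lawD[OF l2 t2]) (rule refl)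
  also have "\<dots> = sweedler s X' (\<lambda>a b. sweedler s (Y' b) (\<lambda>c d. sweedler s U' (\<lambda>a' b'. sweedler s (V' b') (\<lambda>c' d'. F a a' c c' d d'))))"
    by (rule nest_lawD[OF l1]) (intro hom_intros t1' m; use hs in blast)
  also have "\<dots> = sweedler s X' (\<lambda>a b. sweedler s U' (\<lambda>a' b'. sweedler s (Y' b) (\<lambda>c d. sweedler s (V' b') (\<lambda>c' d'. F a a' c c' d d'))))"
    by (subst sweedler_swap[OF m]) (rule refl)
  finally show ?thesis .
qed

section \<open>Bialgebras and convolution\<close>

lemma tens_mul_bilin:
  assumes "bilin (smul A) (smul C) s F"
  shows "sweedler s (tens_mul A C X Y) F = sweedler s X (\<lambda>x1 x2. sweedler s Y (\<lambda>y1 y2. F (mul A x1 y1) (mul C x2 y2)))"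
  using bilin_modules(3)[OF assms]
  by (simp add: tens_mul_def sweedler_coset[OF assms] lin_ext_sweedler lin_ext_gen)

locale bialg =
  fixes H :: "('k::comm_ring_1, 'h::ab_group_add, 'z) hopf_scheme"
  assumes bialgebra: "bialgebra H"
begin

abbreviation mult_H (infixl "\<cdot>" 70) where "x \<cdot> y \<equiv> mul H x y"
abbreviation one_H ("\<one>") where "\<one> \<equiv> unit H"
abbreviation counit_H ("\<epsilon>") where "\<epsilon> \<equiv> counit H"
abbreviation comul_sum ("\<Delta>") where "\<Delta> s h f \<equiv> sweedler s (comul H h) f"

lemma algebra_H: "algebra H" and coalgebra_H: "coalgebra H"
  using bialgebra by (auto simp: bialgebra_def)

lemma module_H [hom_intros]: "module (smul H)"
  and bilin_mul: "bilin (smul H) (smul H) (smul H) (mul H)"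
  and mult_assoc: "(x \<cdot> y) \<cdot> z = x \<cdot> (y \<cdot> z)"
  and mult_one_left [simp]: "\<one> \<cdot> x = x" and mult_one_right [simp]: "x \<cdot> \<one> = x"
  using algebra_H by (auto simp: algebra_def)

lemma tmap_comul: "tmap (smul H) (smul H) (smul H) (comul H)"
  using coalgebra_H by (auto simp: tmap_def coalgebra_def)

lemma counit_hom: "module_hom (smul H) (*) \<epsilon>"
  using coalgebra_H by (simp add: coalgebra_def)

lemmas [hom_intros] = bilin_hom1[OF bilin_mul] bilin_hom2[OF bilin_mul] tmap_hom[OF tmap_comul] hom_comp[OF counit_hom]

lemma coassoc_law: "nest_law (smul H) (smul H) (smul H) s (comul H h) (comul H) (comul H h) (comul H) T"
  by (rule nest_lawI[where M=UNIV and N=UNIV and P=UNIV]) (use coalgebra_H in \<open>simp add: coalgebra_def\<close>)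

lemmas coassoc = nest_lawD[OF coassoc_law]

lemma counit_left:
  assumes "module_hom (smul H) s f"
  shows "\<Delta> s h (\<lambda>a b. s (\<epsilon> a) (f b)) = f h"
proof -
  have "f (\<Delta> (smul H) h (\<lambda>a b. smul H (\<epsilon> a) b)) = \<Delta> s h (\<lambda>a b. s (\<epsilon> a) (f b))"
    by (simp add: sweedler_hom[OF assms] module_hom.scale[OF assms])
  then show ?thesis using coalgebra_H by (simp add: coalgebra_def)
qed

lemma counit_right:
  assumes "module_hom (smul H) s f"
  shows "\<Delta> s h (\<lambda>a b. s (\<epsilon> b) (f a)) = f h"
proof -
  have "f (\<Delta> (smul H) h (\<lambda>a b. smul H (\<epsilon> b) a)) = \<Delta> s h (\<lambda>a b. s (\<epsilon> b) (f a))"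
    by (simp add: sweedler_hom[OF assms] module_hom.scale[OF assms])
  then show ?thesis using coalgebra_H by (simp add: coalgebra_def)
qed

lemma comul_mul:
  assumes "bilin (smul H) (smul H) s F"
  shows "\<Delta> s (h \<cdot> k) F = \<Delta> s h (\<lambda>h1 h2. \<Delta> s k (\<lambda>k1 k2. F (h1 \<cdot> k1) (h2 \<cdot> k2)))"
  using bialgebra tens_mul_bilin[OF assms] by (simp add: bialgebra_def)

lemma comul_one:
  assumes "bilin (smul H) (smul H) s F"
  shows "\<Delta> s \<one> F = F \<one> \<one>"
  using bialgebra bilin_modules(3)[OF assms] by (simp add: bialgebra_def sweedler_coset[OF assms] lin_ext_gen)

lemma counit_mult [simp]: "\<epsilon> (h \<cdot> k) = \<epsilon> h * \<epsilon> k" and counit_one [simp]: "\<epsilon> \<one> = 1"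
  using bialgebra by (auto simp: bialgebra_def)

text \<open>The left action of the convolution algebra of bilinear forms on bilinear maps with
  values in any module; \<open>rconv\<close> is the right action. For scalar values both are the
  convolution product, and the twisted product of H will be \<gamma> acting from the left and its
  inverse from the right on the multiplication.\<close>

definition lconv :: "('k \<Rightarrow> 't \<Rightarrow> 't) \<Rightarrow> ('h \<Rightarrow> 'h \<Rightarrow> 'k) \<Rightarrow> ('h \<Rightarrow> 'h \<Rightarrow> 't) \<Rightarrow> 'h \<Rightarrow> 'h \<Rightarrow> 't::ab_group_add" where
  "lconv s f G x y = \<Delta> s x (\<lambda>x1 x2. \<Delta> s y (\<lambda>y1 y2. s (f x1 y1) (G x2 y2)))"

definition rconv :: "('k \<Rightarrow> 't \<Rightarrow> 't) \<Rightarrow> ('h \<Rightarrow> 'h \<Rightarrow> 't) \<Rightarrow> ('h \<Rightarrow> 'h \<Rightarrow> 'k) \<Rightarrow> 'h \<Rightarrow> 'h \<Rightarrow> 't::ab_group_add" where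
  "rconv s G f x y = \<Delta> s x (\<lambda>x1 x2. \<Delta> s y (\<lambda>y1 y2. s (f x2 y2) (G x1 y1)))"

definition e2 :: "'h \<Rightarrow> 'h \<Rightarrow> 'k" where
  "e2 x y = \<epsilon> x * \<epsilon> y"

abbreviation form2 :: "('h \<Rightarrow> 'h \<Rightarrow> 'k) \<Rightarrow> bool" where
  "form2 f \<equiv> bilin (smul H) (smul H) (*) f"

lemma conv2_lconv: "conv2 H f g = lconv (*) f g"
  by (simp add: conv2_def lconv_def fun_eq_iff)

lemma form2_e2: "form2 e2"
  unfolding e2_def by (intro hom_intros)

lemma bilin_lconv:
  assumes f: "form2 f" and G: "bilin (smul H) (smul H) s G"
  shows "bilin (smul H) (smul H) s (lconv s f G)"
  unfolding lconv_def
  by (intro hom_intros bilin_modules(3)[OF G] bilin_hom1[OF f] bilin_hom2[OF f] bilin_hom1[OF G] bilin_hom2[OF G])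

lemma bilin_rconv:
  assumes f: "form2 f" and G: "bilin (smul H) (smul H) s G"
  shows "bilin (smul H) (smul H) s (rconv s G f)"
  unfolding rconv_def
  by (intro hom_intros bilin_modules(3)[OF G] bilin_hom1[OF f] bilin_hom2[OF f] bilin_hom1[OF G] bilin_hom2[OF G])

lemma coassoc2:
  fixes s :: "'k \<Rightarrow> 't::ab_group_add \<Rightarrow> 't"
  assumes "module s" "\<And>a b c. trilin (smul H) (smul H) (smul H) s (\<lambda>x y z. F x a y b z c)"
    "\<And>x y z. trilin (smul H) (smul H) (smul H) s (\<lambda>a b c. F x a y b z c)"
  shows "\<Delta> s x (\<lambda>a b. \<Delta> s y (\<lambda>a' b'. \<Delta> s a (\<lambda>c d. \<Delta> s a' (\<lambda>c' d'. F c c' d d' b b'))))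
    = \<Delta> s x (\<lambda>a b. \<Delta> s y (\<lambda>a' b'. \<Delta> s b (\<lambda>c d. \<Delta> s b' (\<lambda>c' d'. F a a' c c' d d'))))"
  by (rule nest_law2[OF assms(1) coassoc_law coassoc_law]) (use assms(2,3) in simp_all)

lemma
  assumes f: "form2 f" and g: "form2 g" and G: "bilin (smul H) (smul H) s G"
  shows lconv_lconv: "lconv s f (lconv s g G) = lconv s (lconv (*) f g) G"
    and lconv_rconv: "lconv s f (rconv s G g) = rconv s (lconv s f G) g"
proof -
  note m = bilin_modules(3)[OF G]
  note pull = sweedler_scale[OF m, symmetric] sweedler_scale_left[OF m, symmetric] module.scale_scale[OF m]
  note h = bilin_hom1[OF f] bilin_hom2[OF f] bilin_hom1[OF G] bilin_hom2[OF G] bilin_hom1[OF g] bilin_hom2[OF g] m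
  show "lconv s f (lconv s g G) = lconv s (lconv (*) f g) G"
    unfolding lconv_def fun_eq_iff pull
    by (subst coassoc2) (intro allI hom_intros h refl)+
  show "lconv s f (rconv s G g) = rconv s (lconv s f G) g"
    unfolding lconv_def rconv_def fun_eq_iff pull
    by (subst coassoc2) (intro allI hom_intros h refl | simp add: mult.commute)+
qed

lemma lconv_e2:
  assumes G: "bilin (smul H) (smul H) s G"
  shows "lconv s e2 G = G"
proof -
  note m = bilin_modules(3)[OF G]
  note h = bilin_hom1[OF G] bilin_hom2[OF G] m
  show ?thesis
    unfolding lconv_def e2_def module.scale_scale[OF m, symmetric] sweedler_scale[OF m]
    by (subst counit_left, (intro hom_intros h)[1])+ (rule refl)
qed

lemma rconv_e2:
  assumes G: "bilin (smul H) (smul H) s G"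
  shows "rconv s G e2 = G"
proof -
  note m = bilin_modules(3)[OF G]
  note h = bilin_hom1[OF G] bilin_hom2[OF G] m
  show ?thesis
    unfolding rconv_def e2_def module.scale_scale[OF m, symmetric] sweedler_scale[OF m]
    by (subst counit_right, (intro hom_intros h)[1])+ (rule refl)
qed

lemma lconv_rconv_mult: "lconv (*) f g = rconv (*) f g"
  by (simp add: lconv_def rconv_def mult.commute fun_eq_iff)

abbreviation form3 :: "('h \<Rightarrow> 'h \<Rightarrow> 'h \<Rightarrow> 'k) \<Rightarrow> bool" where
  "form3 f \<equiv> trilin (smul H) (smul H) (smul H) (*) f"

text \<open>Convolution of forms in three arguments, written as a convolution in the first argument
  with values in forms in the other two. In this way associativity and units reduce to
  \<open>lconv_lconv\<close>, \<open>lconv_e2\<close> and \<open>rconv_e2\<close>.\<close>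

definition conv3 :: "('h \<Rightarrow> 'h \<Rightarrow> 'h \<Rightarrow> 'k) \<Rightarrow> ('h \<Rightarrow> 'h \<Rightarrow> 'h \<Rightarrow> 'k) \<Rightarrow> 'h \<Rightarrow> 'h \<Rightarrow> 'h \<Rightarrow> 'k" where
  "conv3 f g x y z = \<Delta> (*) x (\<lambda>x1 x2. lconv (*) (f x1) (g x2) y z)"

definition e3 :: "'h \<Rightarrow> 'h \<Rightarrow> 'h \<Rightarrow> 'k" where
  "e3 x y z = \<epsilon> x * \<epsilon> y * \<epsilon> z"

lemma form2_form3: "form3 f \<Longrightarrow> form2 (f x)"
  by (simp add: trilin_def bilin_def)

lemma form3_conv3:
  assumes "form3 f" "form3 g"
  shows "form3 (conv3 f g)"
  unfolding conv3_def lconv_def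
  by (intro hom_intros assms[THEN trilin_hom1] assms[THEN trilin_hom2] assms[THEN trilin_hom3])

lemma lconv_sum_left: "lconv (*) (\<lambda>x y. \<Delta> (*) h (\<lambda>a b. p a b x y)) g y z = \<Delta> (*) h (\<lambda>a b. lconv (*) (p a b) g y z)"
  unfolding lconv_def
  by (simp add: sweedler_scale_left[OF module_mult, symmetric])
    (subst (2) sweedler_swap[OF module_mult], subst sweedler_swap[OF module_mult], rule refl)

lemma lconv_sum_right: "lconv (*) f (\<lambda>x y. \<Delta> (*) h (\<lambda>a b. p a b x y)) y z = \<Delta> (*) h (\<lambda>a b. lconv (*) f (p a b) y z)"
  unfolding lconv_def
  by (simp add: sweedler_scale[OF module_mult, symmetric])
    (subst (2) sweedler_swap[OF module_mult], subst sweedler_swap[OF module_mult], rule refl)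

lemma conv3_assoc:
  assumes f: "form3 f" and g: "form3 g" and h: "form3 h"
  shows "conv3 (conv3 f g) h = conv3 f (conv3 g h)"
proof (intro ext)
  fix x y z
  note hs = trilin_hom1[OF f] trilin_hom2[OF f] trilin_hom3[OF f] trilin_hom1[OF g] trilin_hom2[OF g] trilin_hom3[OF g]
    trilin_hom1[OF h] trilin_hom2[OF h] trilin_hom3[OF h]
  have "conv3 (conv3 f g) h x y z = \<Delta> (*) x (\<lambda>x1 x2. \<Delta> (*) x1 (\<lambda>a b. lconv (*) (lconv (*) (f a) (g b)) (h x2) y z))"
    unfolding conv3_def using lconv_sum_left by simp
  also have "\<dots> = \<Delta> (*) x (\<lambda>x1 x2. \<Delta> (*) x1 (\<lambda>a b. lconv (*) (f a) (lconv (*) (g b) (h x2)) y z))"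
    by (simp add: lconv_lconv form2_form3 f g h)
  also have "\<dots> = \<Delta> (*) x (\<lambda>x1 x2. \<Delta> (*) x2 (\<lambda>a b. lconv (*) (f x1) (lconv (*) (g a) (h b)) y z))"
    by (rule coassoc) (unfold lconv_def, intro hom_intros hs)
  also have "\<dots> = conv3 f (conv3 g h) x y z"
    unfolding conv3_def using lconv_sum_right by simp
  finally show "conv3 (conv3 f g) h x y z = conv3 f (conv3 g h) x y z" .
qed

lemma conv3_e3:
  assumes f: "form3 f"
  shows "conv3 e3 f = f" "conv3 f e3 = f"
proof -
  note hs = trilin_hom1[OF f] trilin_hom2[OF f] trilin_hom3[OF f]
  have l: "e3 x = (\<lambda>y z. \<epsilon> x * e2 y z)" for x
    by (simp add: e3_def e2_def fun_eq_iff mult.assoc)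
  have l': "lconv (*) (\<lambda>y z. c * e2 y z) (f x) = (\<lambda>y z. c * f x y z)" for x c
    using fun_cong[OF fun_cong[OF lconv_e2[OF form2_form3[OF f]]], of x]
    by (simp add: lconv_def fun_eq_iff mult.assoc sweedler_scale[OF module_mult])
  have "lconv (*) (f x) (\<lambda>y z. c * e2 y z) = (\<lambda>y z. c * rconv (*) (f x) e2 y z)" for x c
    unfolding lconv_def rconv_def sweedler_scale[OF module_mult, symmetric] by (simp add: mult_ac)
  then have r': "lconv (*) (f x) (\<lambda>y z. c * e2 y z) = (\<lambda>y z. c * f x y z)" for x c
    by (simp add: rconv_e2 form2_form3[OF f])
  show "conv3 e3 f = f"
    unfolding conv3_def l l' by (subst counit_left, (intro hom_intros hs)[1]) (rule refl)
  show "conv3 f e3 = f"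
    unfolding conv3_def l r' by (subst counit_right, (intro hom_intros hs)[1]) (rule refl)
qed

end

text \<open>Inverting both sides of p q = r t gives the first equation, and moving one factor across
  on each side gives the other two. For the cocycle condition these become the cocycle identity of
  the inverse and two mixed identities. The predicate V singles out the trilinear forms among all
  functions.\<close>

lemma monoid_exchange:
  assumes closed: "\<And>x y. V x \<Longrightarrow> V y \<Longrightarrow> V (m x y)"
    and assoc: "\<And>x y z. V x \<Longrightarrow> V y \<Longrightarrow> V z \<Longrightarrow> m (m x y) z = m x (m y z)"
    and unit: "\<And>x. V x \<Longrightarrow> m e x = x" "\<And>x. V x \<Longrightarrow> m x e = x"
    and V: "V p" "V q" "V r" "V t" "V p'" "V q'" "V r'" "V t'"
    and eq: "m p q = m r t"
    and inv: "m p p' = e" "m p' p = e" "m q q' = e" "m r r' = e" "m r' r = e" "m t t' = e" "m t' t = e" "m q' q = e"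
  shows "m q' p' = m t' r'" "m r' p = m t q'" "m p' r = m q t'"
proof -
  show "m r' p = m t q'"
    by (metis assoc closed V eq inv unit)
  show "m p' r = m q t'"
    by (metis assoc closed V eq inv unit)
  show "m q' p' = m t' r'"
    by (metis assoc closed V eq inv unit)
qed

section \<open>Antipodes and 2-cocycles\<close>

locale cocycle = bialg H for H :: "('k::comm_ring_1, 'h::ab_group_add, 'z) hopf_scheme" +
  fixes \<gamma> :: "'h \<Rightarrow> 'h \<Rightarrow> 'k"
  assumes two_cocycle: "two_cocycle H \<gamma>"
begin

abbreviation inv_cocycle ("\<gamma>''") where "\<gamma>' \<equiv> cinv H \<gamma>"

lemma form_cocycle: "form2 \<gamma>"
  using two_cocycle by (simp add: two_cocycle_def)

text \<open>As \<open>cinv\<close> is a definite description, the inverse has to be shown unique, by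
  the usual argument in a monoid.\<close>

lemma is_conv_inverse_cinv: "is_conv_inverse H \<gamma> \<gamma>'"
proof -
  obtain g where g: "is_conv_inverse H \<gamma> g" using two_cocycle by (auto simp: two_cocycle_def)
  have e: "(\<lambda>h k. \<epsilon> h * \<epsilon> k) = e2" by (simp add: e2_def fun_eq_iff)
  have "g' = g" if g': "is_conv_inverse H \<gamma> g'" for g'
  proof -
    have "g' = lconv (*) g' (lconv (*) \<gamma> g)"
      using g g' by (simp add: is_conv_inverse_def conv2_lconv e lconv_rconv_mult rconv_e2)
    also have "\<dots> = lconv (*) (lconv (*) g' \<gamma>) g"
      using g g' form_cocycle by (simp add: is_conv_inverse_def lconv_lconv)
    also have "\<dots> = g"
      using g g' by (simp add: is_conv_inverse_def conv2_lconv e lconv_e2)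
    finally show ?thesis .
  qed
  with g show ?thesis unfolding cinv_def by (rule theI)
qed

lemma form_cinv: "form2 \<gamma>'"
  using is_conv_inverse_cinv by (simp add: is_conv_inverse_def)

lemma conv_cinv: "lconv (*) \<gamma> \<gamma>' = e2" "lconv (*) \<gamma>' \<gamma> = e2"
  using is_conv_inverse_cinv by (simp_all add: is_conv_inverse_def conv2_lconv e2_def fun_eq_iff)

lemmas form_homs = bilin_hom1[OF form_cocycle] bilin_hom2[OF form_cocycle] bilin_hom1[OF form_cinv] bilin_hom2[OF form_cinv]
lemmas [hom_intros] = form_homs

lemma cocycle_one [simp]: "\<gamma> h \<one> = \<epsilon> h" "\<gamma> \<one> h = \<epsilon> h"
  using two_cocycle by (simp_all add: two_cocycle_def)

lemma cinv_one [simp]: "\<gamma>' h \<one> = \<epsilon> h" "\<gamma>' \<one> h = \<epsilon> h"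
proof -
  have "\<epsilon> h = \<Delta> (*) h (\<lambda>a b. \<Delta> (*) \<one> (\<lambda>c d. \<gamma> a c * \<gamma>' b d))"
    using fun_cong[OF fun_cong[OF conv_cinv(1), of h], of \<one>] by (simp add: lconv_def e2_def)
  also have "\<dots> = \<Delta> (*) h (\<lambda>a b. \<gamma> a \<one> * \<gamma>' b \<one>)"
    by (intro sweedler_cong comul_one hom_intros)
  also have "\<dots> = \<gamma>' h \<one>"
    unfolding cocycle_one by (rule counit_left) (intro hom_intros)
  finally show "\<gamma>' h \<one> = \<epsilon> h" ..
  have "\<epsilon> h = \<Delta> (*) \<one> (\<lambda>c d. \<Delta> (*) h (\<lambda>a b. \<gamma> c a * \<gamma>' d b))"
    using fun_cong[OF fun_cong[OF conv_cinv(1), of \<one>], of h] by (simp add: lconv_def e2_def)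
  also have "\<dots> = \<Delta> (*) h (\<lambda>a b. \<gamma> \<one> a * \<gamma>' \<one> b)"
    by (intro comul_one hom_intros)
  also have "\<dots> = \<gamma>' \<one> h"
    unfolding cocycle_one by (rule counit_left) (intro hom_intros)
  finally show "\<gamma>' \<one> h = \<epsilon> h" ..
qed

lemma cocycle: "\<Delta> (*) g (\<lambda>g1 g2. \<Delta> (*) h (\<lambda>h1 h2. \<gamma> g1 h1 * \<gamma> (g2 \<cdot> h2) k))
    = \<Delta> (*) h (\<lambda>h1 h2. \<Delta> (*) k (\<lambda>k1 k2. \<gamma> h1 k1 * \<gamma> g (h2 \<cdot> k2)))"
  using two_cocycle by (simp add: two_cocycle_def)

lemmas counit_sum = counit_left[where s="(*)"] counit_right[where s="(*)"]

text \<open>The four abbreviations pull a form on two arguments back to three: along x \<otimes> y,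
  along x y \<otimes> z, along y \<otimes> z and along x \<otimes> y z. Each is multiplicative for
  convolution and preserves the unit, so inverses go to inverses. The cocycle condition says that
  \<open>?P \<gamma>\<close> times \<open>?Q \<gamma>\<close> is \<open>?R \<gamma>\<close> times
  \<open>?T \<gamma>\<close>, and \<open>monoid_exchange\<close> rearranges it.\<close>

lemma
  shows cocycle_inverse: "\<Delta> (*) x (\<lambda>x1 x2. \<Delta> (*) y (\<lambda>y1 y2. \<gamma>' (x1 \<cdot> y1) z * \<gamma>' x2 y2))
      = \<Delta> (*) y (\<lambda>y1 y2. \<Delta> (*) z (\<lambda>z1 z2. \<gamma>' x (y1 \<cdot> z1) * \<gamma>' y2 z2))" (is ?A)
    and cocycle_mixed1: "\<Delta> (*) y (\<lambda>y1 y2. \<gamma>' y1 z * \<gamma> x y2)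
      = \<Delta> (*) x (\<lambda>x1 x2. \<Delta> (*) y (\<lambda>y1 y2. \<Delta> (*) z (\<lambda>z1 z2. \<gamma> x1 (y1 \<cdot> z1) * \<gamma>' (x2 \<cdot> y2) z2)))" (is ?B)
    and cocycle_mixed2: "\<Delta> (*) y (\<lambda>y1 y2. \<gamma>' x y1 * \<gamma> y2 z)
      = \<Delta> (*) x (\<lambda>x1 x2. \<Delta> (*) y (\<lambda>y1 y2. \<Delta> (*) z (\<lambda>z1 z2. \<gamma> (x1 \<cdot> y1) z1 * \<gamma>' x2 (y2 \<cdot> z2))))" (is ?C)
proof -
  let ?P = "\<lambda>f x y z. f x y * \<epsilon> z" and ?Q = "\<lambda>f x y z. f (x \<cdot> y) z"
  let ?R = "\<lambda>f x y z. \<epsilon> x * f y z" and ?T = "\<lambda>f x y z. f x (y \<cdot> z)"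
  note sc = sweedler_scale[OF module_mult]
  have form3: "form3 (?P f)" "form3 (?Q f)" "form3 (?R f)" "form3 (?T f)" if f: "form2 f" for f
    by (intro hom_intros bilin_hom1[OF f] bilin_hom2[OF f])+
  have split_zP: "\<Delta> (*) z (\<lambda>z1 z2. c * \<epsilon> z1 * f z2) = c * f z" "\<Delta> (*) z (\<lambda>z1 z2. f z1 * (c * \<epsilon> z2)) = f z * c"
    if "module_hom (smul H) (*) f" for c z f
  proof -
    note hf = hom_comp[OF that]
    show "\<Delta> (*) z (\<lambda>z1 z2. c * \<epsilon> z1 * f z2) = c * f z"
      unfolding mult.assoc sc by (subst counit_sum(1)[OF that]) (rule refl)
    have "\<Delta> (*) z (\<lambda>z1 z2. f z1 * (c * \<epsilon> z2)) = \<Delta> (*) z (\<lambda>z1 z2. \<epsilon> z2 * (f z1 * c))"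
      by (simp only: mult_ac)
    also have "\<dots> = f z * c"
      by (rule counit_sum(2)) (intro hom_intros hf)
    finally show "\<Delta> (*) z (\<lambda>z1 z2. f z1 * (c * \<epsilon> z2)) = f z * c" .
  qed
  have PP: "conv3 (?P f) (?P g) = ?P (lconv (*) f g)" if f: "form2 f" and g: "form2 g" for f g
  proof (intro ext)
    fix x y z
    have "conv3 (?P f) (?P g) x y z = \<Delta> (*) x (\<lambda>x1 x2. \<Delta> (*) y (\<lambda>y1 y2. f x1 y1 * (g x2 y2 * \<epsilon> z)))"
      unfolding conv3_def lconv_def by (intro sweedler_cong split_zP hom_intros)
    then show "conv3 (?P f) (?P g) x y z = ?P (lconv (*) f g) x y z"
      by (simp add: lconv_def mult.assoc[symmetric]) (simp add: sweedler_scale_left[OF module_mult])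
  qed
  have RR: "conv3 (?R f) (?R g) = ?R (lconv (*) f g)" if f: "form2 f" and g: "form2 g" for f g
  proof (intro ext)
    fix x y z
    have "conv3 (?R f) (?R g) x y z = \<Delta> (*) x (\<lambda>x1 x2. \<epsilon> x1 * (\<epsilon> x2 * lconv (*) f g y z))"
      unfolding conv3_def lconv_def by (simp add: sc[symmetric] mult_ac)
    also have "\<dots> = \<epsilon> x * lconv (*) f g y z"
      by (rule counit_sum) (intro hom_intros)
    finally show "conv3 (?R f) (?R g) x y z = ?R (lconv (*) f g) x y z" .
  qed
  have QQ: "conv3 (?Q f) (?Q g) = ?Q (lconv (*) f g)" if f: "form2 f" and g: "form2 g" for f g
    unfolding conv3_def lconv_def fun_eq_iff
    by (intro allI comul_mul[symmetric] hom_intros bilin_hom1[OF f] bilin_hom2[OF f] bilin_hom1[OF g] bilin_hom2[OF g])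
  have TT: "conv3 (?T f) (?T g) = ?T (lconv (*) f g)" if f: "form2 f" and g: "form2 g" for f g
    unfolding conv3_def lconv_def fun_eq_iff
    by (intro allI sweedler_cong comul_mul[symmetric] hom_intros bilin_hom1[OF f] bilin_hom2[OF f] bilin_hom1[OF g] bilin_hom2[OF g])
  have e: "?P e2 = e3" "?Q e2 = e3" "?R e2 = e3" "?T e2 = e3"
    by (simp_all add: e2_def e3_def fun_eq_iff mult_ac)
  have PQ: "conv3 (?P f) (?Q g) x y z = \<Delta> (*) x (\<lambda>x1 x2. \<Delta> (*) y (\<lambda>y1 y2. f x1 y1 * g (x2 \<cdot> y2) z))"
    if f: "form2 f" and g: "form2 g" for f g x y z
    unfolding conv3_def lconv_def by (intro sweedler_cong split_zP hom_intros bilin_hom2[OF g])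
  have QP: "conv3 (?Q f) (?P g) x y z = \<Delta> (*) x (\<lambda>x1 x2. \<Delta> (*) y (\<lambda>y1 y2. f (x1 \<cdot> y1) z * g x2 y2))"
    if f: "form2 f" and g: "form2 g" for f g x y z
    unfolding conv3_def lconv_def by (intro sweedler_cong split_zP hom_intros bilin_hom2[OF f])
  have RT: "conv3 (?R f) (?T g) x y z = \<Delta> (*) y (\<lambda>y1 y2. \<Delta> (*) z (\<lambda>z1 z2. f y1 z1 * g x (y2 \<cdot> z2)))"
    if f: "form2 f" and g: "form2 g" for f g x y z
    unfolding conv3_def lconv_def mult.assoc sc
    by (rule counit_sum) (intro hom_intros bilin_hom1[OF g])
  have TR: "conv3 (?T f) (?R g) x y z = \<Delta> (*) y (\<lambda>y1 y2. \<Delta> (*) z (\<lambda>z1 z2. f x (y1 \<cdot> z1) * g y2 z2))"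
    if f: "form2 f" and g: "form2 g" for f g x y z
    unfolding conv3_def lconv_def mult.left_commute[of _ "\<epsilon> _"] sc
    by (rule counit_sum) (intro hom_intros bilin_hom1[OF f])
  have RP: "conv3 (?R f) (?P g) x y z = \<Delta> (*) y (\<lambda>y1 y2. f y1 z * g x y2)"
    if f: "form2 f" and g: "form2 g" for f g x y z
  proof -
    have "conv3 (?R f) (?P g) x y z = \<Delta> (*) x (\<lambda>x1 x2. \<epsilon> x1 * \<Delta> (*) y (\<lambda>y1 y2. \<Delta> (*) z (\<lambda>z1 z2. f y1 z1 * (g x2 y2 * \<epsilon> z2))))"
      unfolding conv3_def lconv_def mult.assoc sc ..
    also have "\<dots> = \<Delta> (*) y (\<lambda>y1 y2. \<Delta> (*) z (\<lambda>z1 z2. f y1 z1 * (g x y2 * \<epsilon> z2)))"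
      by (rule counit_sum) (intro hom_intros bilin_hom1[OF g])
    also have "\<dots> = \<Delta> (*) y (\<lambda>y1 y2. f y1 z * g x y2)"
      by (intro sweedler_cong split_zP hom_intros bilin_hom2[OF f])
    finally show ?thesis .
  qed
  have PR: "conv3 (?P f) (?R g) x y z = \<Delta> (*) y (\<lambda>y1 y2. f x y1 * g y2 z)"
    if f: "form2 f" and g: "form2 g" for f g x y z
  proof -
    have "conv3 (?P f) (?R g) x y z = \<Delta> (*) x (\<lambda>x1 x2. \<epsilon> x2 * \<Delta> (*) y (\<lambda>y1 y2. \<Delta> (*) z (\<lambda>z1 z2. f x1 y1 * \<epsilon> z1 * g y2 z2)))"
      unfolding conv3_def lconv_def mult.left_commute[of _ "\<epsilon> _"] sc ..
    also have "\<dots> = \<Delta> (*) y (\<lambda>y1 y2. \<Delta> (*) z (\<lambda>z1 z2. f x y1 * \<epsilon> z1 * g y2 z2))"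
      by (rule counit_sum) (intro hom_intros bilin_hom1[OF f])
    also have "\<dots> = \<Delta> (*) y (\<lambda>y1 y2. f x y1 * g y2 z)"
      by (intro sweedler_cong split_zP hom_intros bilin_hom2[OF g])
    finally show ?thesis .
  qed
  note c = form_cocycle and i = form_cinv
  have "conv3 (?P \<gamma>) (?Q \<gamma>) = conv3 (?R \<gamma>) (?T \<gamma>)"
    by (intro ext) (simp only: PQ[OF c c] RT[OF c c] cocycle)
  note ex = monoid_exchange[of form3 conv3 e3, OF form3_conv3 conv3_assoc conv3_e3 form3[OF c] form3[OF i] this
      PP[OF c i, unfolded conv_cinv e] PP[OF i c, unfolded conv_cinv e] QQ[OF c i, unfolded conv_cinv e]
      RR[OF c i, unfolded conv_cinv e] RR[OF i c, unfolded conv_cinv e]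
      TT[OF c i, unfolded conv_cinv e] TT[OF i c, unfolded conv_cinv e] QQ[OF i c, unfolded conv_cinv e]]
  from ex(1) show ?A
    unfolding fun_eq_iff QP[OF i i] TR[OF i i] by blast
  from ex(2) show ?B
    unfolding fun_eq_iff RP[OF i c] by (simp add: conv3_def lconv_def)
  from ex(3) show ?C
    unfolding fun_eq_iff PR[OF i c] by (simp add: conv3_def lconv_def)
qed

end

section \<open>Identities for the antipode\<close>

locale hopf_alg =
  fixes H :: "('k::comm_ring_1, 'h::ab_group_add, 'z) hopf_scheme"
  assumes hopf: "hopf_algebra H"
begin

sublocale bialg H
  using hopf by unfold_locales (simp add: hopf_algebra_def)

abbreviation antipode_H ("\<S>") where "\<S> \<equiv> antipode H"

lemma antipode_hom: "module_hom (smul H) (smul H) \<S>"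
  using hopf by (simp add: hopf_algebra_def)

lemmas [hom_intros] = hom_comp[OF antipode_hom]

lemma
  assumes f: "module_hom (smul H) s f"
  shows antipode_left: "\<Delta> s h (\<lambda>a b. f (\<S> a \<cdot> b)) = s (\<epsilon> h) (f \<one>)"
    and antipode_right: "\<Delta> s h (\<lambda>a b. f (a \<cdot> \<S> b)) = s (\<epsilon> h) (f \<one>)"
proof -
  have "f (\<Delta> (smul H) h (\<lambda>a b. \<S> a \<cdot> b)) = s (\<epsilon> h) (f \<one>)"
    using hopf by (simp add: hopf_algebra_def module_hom.scale[OF f])
  then show "\<Delta> s h (\<lambda>a b. f (\<S> a \<cdot> b)) = s (\<epsilon> h) (f \<one>)" by (simp add: sweedler_hom[OF f])
  have "f (\<Delta> (smul H) h (\<lambda>a b. a \<cdot> \<S> b)) = s (\<epsilon> h) (f \<one>)"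
    using hopf by (simp add: hopf_algebra_def module_hom.scale[OF f])
  then show "\<Delta> s h (\<lambda>a b. f (a \<cdot> \<S> b)) = s (\<epsilon> h) (f \<one>)" by (simp add: sweedler_hom[OF f])
qed

lemma
  assumes G: "bilin (smul H) (smul H) s G"
  shows antipode_left_head: "\<Delta> s h (\<lambda>a t. \<Delta> s t (\<lambda>b c. G (\<S> a \<cdot> b) c)) = G \<one> h"
    and antipode_right_head: "\<Delta> s h (\<lambda>a t. \<Delta> s t (\<lambda>b c. G (a \<cdot> \<S> b) c)) = G \<one> h"
    and antipode_left_tail: "\<Delta> s h (\<lambda>a t. \<Delta> s t (\<lambda>b c. G a (\<S> b \<cdot> c))) = G h \<one>"
    and antipode_right_tail: "\<Delta> s h (\<lambda>a t. \<Delta> s t (\<lambda>b c. G a (b \<cdot> \<S> c))) = G h \<one>"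
proof -
  note hs = hom_intros bilin_hom1[OF G] bilin_hom2[OF G] bilin_modules(3)[OF G]
  have "\<Delta> s h (\<lambda>a t. \<Delta> s t (\<lambda>b c. G (\<S> a \<cdot> b) c)) = \<Delta> s h (\<lambda>x c. \<Delta> s x (\<lambda>a b. G (\<S> a \<cdot> b) c))"
    by (rule coassoc[symmetric]) (intro hs)
  also have "\<dots> = \<Delta> s h (\<lambda>x c. s (\<epsilon> x) (G \<one> c))"
    by (intro sweedler_cong antipode_left hs)
  also have "\<dots> = G \<one> h" by (rule counit_left) (intro hs)
  finally show "\<Delta> s h (\<lambda>a t. \<Delta> s t (\<lambda>b c. G (\<S> a \<cdot> b) c)) = G \<one> h" .
  have "\<Delta> s h (\<lambda>a t. \<Delta> s t (\<lambda>b c. G (a \<cdot> \<S> b) c)) = \<Delta> s h (\<lambda>x c. \<Delta> s x (\<lambda>a b. G (a \<cdot> \<S> b) c))"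
    by (rule coassoc[symmetric]) (intro hs)
  also have "\<dots> = \<Delta> s h (\<lambda>x c. s (\<epsilon> x) (G \<one> c))"
    by (intro sweedler_cong antipode_right hs)
  also have "\<dots> = G \<one> h" by (rule counit_left) (intro hs)
  finally show "\<Delta> s h (\<lambda>a t. \<Delta> s t (\<lambda>b c. G (a \<cdot> \<S> b) c)) = G \<one> h" .
  have "\<Delta> s h (\<lambda>a t. \<Delta> s t (\<lambda>b c. G a (\<S> b \<cdot> c))) = \<Delta> s h (\<lambda>a t. s (\<epsilon> t) (G a \<one>))"
    by (intro sweedler_cong antipode_left hs)
  also have "\<dots> = G h \<one>" by (rule counit_right) (intro hs)
  finally show "\<Delta> s h (\<lambda>a t. \<Delta> s t (\<lambda>b c. G a (\<S> b \<cdot> c))) = G h \<one>" .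
  have "\<Delta> s h (\<lambda>a t. \<Delta> s t (\<lambda>b c. G a (b \<cdot> \<S> c))) = \<Delta> s h (\<lambda>a t. s (\<epsilon> t) (G a \<one>))"
    by (intro sweedler_cong antipode_right hs)
  also have "\<dots> = G h \<one>" by (rule counit_right) (intro hs)
  finally show "\<Delta> s h (\<lambda>a t. \<Delta> s t (\<lambda>b c. G a (b \<cdot> \<S> c))) = G h \<one>" .
qed

lemma counit_antipode [simp]: "\<epsilon> (\<S> h) = \<epsilon> h"
proof -
  have "\<epsilon> (\<S> h) = \<Delta> (*) h (\<lambda>a b. \<epsilon> b * \<epsilon> (\<S> a))"
    by (rule counit_right[symmetric]) (intro hom_intros)
  also have "\<dots> = \<Delta> (*) h (\<lambda>a b. \<epsilon> (\<S> a \<cdot> b))"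
    by (simp add: mult.commute)
  also have "\<dots> = \<epsilon> h * \<epsilon> \<one>"
    by (rule antipode_left) (intro hom_intros)
  finally show ?thesis by simp
qed

text \<open>Both sides are convolution inverses of the coproduct: the sum
  \<open>S(h\<^sub>1)\<^sub>1 h\<^sub>2 S(h\<^sub>5) \<otimes> S(h\<^sub>1)\<^sub>2 h\<^sub>3 S(h\<^sub>4)\<close> collapses to either of them.\<close>

lemma comul_antipode:
  assumes F: "bilin (smul H) (smul H) s F"
  shows "\<Delta> s (\<S> h) F = \<Delta> s h (\<lambda>a b. F (\<S> b) (\<S> a))"
proof -
  note hs = hom_intros bilin_hom1[OF F] bilin_hom2[OF F] bilin_modules(3)[OF F]
  note sw = sweedler_swap[OF bilin_modules(3)[OF F]]
  define K where "K x a b t = \<Delta> s (\<S> x) (\<lambda>p q. \<Delta> s t (\<lambda>c d. F (p \<cdot> a \<cdot> \<S> d) (q \<cdot> b \<cdot> \<S> c)))" for x a b t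
  have "\<Delta> s (\<S> h) F = \<Delta> s (\<S> h) (\<lambda>p q. F (p \<cdot> \<one>) q)" by simp
  also have "\<dots> = \<Delta> s h (\<lambda>x t. \<Delta> s t (\<lambda>a d. \<Delta> s (\<S> x) (\<lambda>p q. F (p \<cdot> (a \<cdot> \<S> d)) q)))"
    by (rule antipode_right_tail[symmetric, of s "\<lambda>x y. \<Delta> s (\<S> x) (\<lambda>p q. F (p \<cdot> y) q)"]) (intro hs)
  also have "\<dots> = \<Delta> s h (\<lambda>x t. \<Delta> s (\<S> x) (\<lambda>p q. \<Delta> s t (\<lambda>a d. F (p \<cdot> (a \<cdot> \<S> d)) (q \<cdot> \<one>))))"
    by (subst sw) simp
  also have "\<dots> = \<Delta> s h (\<lambda>x t. \<Delta> s (\<S> x) (\<lambda>p q. \<Delta> s t (\<lambda>a t. \<Delta> s t (\<lambda>b u. \<Delta> s u (\<lambda>c d. F (p \<cdot> (a \<cdot> \<S> d)) (q \<cdot> (b \<cdot> \<S> c)))))))"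
    by (intro sweedler_cong antipode_right_head[symmetric] hs)
  also have "\<dots> = \<Delta> s h (\<lambda>x t. \<Delta> s t (\<lambda>a t. \<Delta> s t (\<lambda>b u. K x a b u)))"
    unfolding K_def mult_assoc
    by (rule sweedler_cong, rule trans[OF sw], rule sweedler_cong, rule sw)
  also have "\<dots> = \<Delta> s h (\<lambda>x t. \<Delta> s t (\<lambda>y u. \<Delta> s y (\<lambda>a b. K x a b u)))"
    unfolding K_def by (intro sweedler_cong coassoc[symmetric] hs)
  also have "\<dots> = \<Delta> s h (\<lambda>x t. \<Delta> s t (\<lambda>y u. \<Delta> s (\<S> x \<cdot> y) (\<lambda>p q. \<Delta> s u (\<lambda>c d. F (p \<cdot> \<S> d) (q \<cdot> \<S> c)))))"
    unfolding K_def
    by (subst sw) (intro sweedler_cong comul_mul[symmetric] hs)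
  also have "\<dots> = \<Delta> s \<one> (\<lambda>p q. \<Delta> s h (\<lambda>c d. F (p \<cdot> \<S> d) (q \<cdot> \<S> c)))"
    by (rule antipode_left_head) (intro hs)
  also have "\<dots> = \<Delta> s h (\<lambda>c d. F (\<one> \<cdot> \<S> d) (\<one> \<cdot> \<S> c))"
    by (rule comul_one) (intro hs)
  finally show ?thesis by simp
qed

text \<open>The sum S(x1 y1) x2 y2 S(y3) S(x3) is evaluated in two ways: cancelling on the left
  gives S(y) S(x), cancelling on the right gives S(x y).\<close>

lemma antipode_mult: "\<S> (x \<cdot> y) = \<S> y \<cdot> \<S> x"
proof -
  let ?s = "smul H"
  note hs = hom_intros
  note sw = sweedler_swap[OF module_H]
  have "\<S> y \<cdot> \<S> x = \<Delta> ?s x (\<lambda>a b. ?s (\<epsilon> a) (\<S> y \<cdot> \<S> b))"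
    by (rule counit_left[symmetric]) (intro hs)
  also have "\<dots> = \<Delta> ?s x (\<lambda>a b. \<Delta> ?s y (\<lambda>c d. ?s (\<epsilon> c) (?s (\<epsilon> a) (\<S> d \<cdot> \<S> b))))"
    by (intro sweedler_cong counit_left[symmetric] hs)
  also have "\<dots> = \<Delta> ?s x (\<lambda>a b. \<Delta> ?s y (\<lambda>c d. ?s (\<epsilon> (a \<cdot> c)) (\<one> \<cdot> \<S> d \<cdot> \<S> b)))"
    by (simp add: module.scale_scale[OF module_H] mult.commute)
  also have "\<dots> = \<Delta> ?s x (\<lambda>a b. \<Delta> ?s y (\<lambda>c d. \<Delta> ?s (a \<cdot> c) (\<lambda>p q. \<S> p \<cdot> q \<cdot> \<S> d \<cdot> \<S> b)))"
    by (intro sweedler_cong antipode_left[symmetric] hs)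
  also have "\<dots> = \<Delta> ?s x (\<lambda>a b. \<Delta> ?s y (\<lambda>c d. \<Delta> ?s a (\<lambda>a1 a2. \<Delta> ?s c (\<lambda>c1 c2. \<S> (a1 \<cdot> c1) \<cdot> (a2 \<cdot> c2) \<cdot> \<S> d \<cdot> \<S> b))))"
    by (intro sweedler_cong comul_mul hs)
  also have "\<dots> = \<Delta> ?s x (\<lambda>a b. \<Delta> ?s y (\<lambda>c d. \<Delta> ?s b (\<lambda>a1 a2. \<Delta> ?s d (\<lambda>c1 c2. \<S> (a \<cdot> c) \<cdot> (a1 \<cdot> c1) \<cdot> \<S> c2 \<cdot> \<S> a2))))"
    by (rule coassoc2) (intro hs)+
  also have "\<dots> = \<Delta> ?s x (\<lambda>a b. \<Delta> ?s b (\<lambda>a1 a2. \<Delta> ?s y (\<lambda>c d. \<Delta> ?s d (\<lambda>c1 c2. (\<S> (a \<cdot> c) \<cdot> a1 \<cdot> (c1 \<cdot> \<S> c2)) \<cdot> \<S> a2))))"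
    by (subst sw) (simp add: mult_assoc)
  also have "\<dots> = \<Delta> ?s x (\<lambda>a b. \<Delta> ?s b (\<lambda>a1 a2. (\<S> (a \<cdot> y) \<cdot> a1 \<cdot> \<one>) \<cdot> \<S> a2))"
    by (intro sweedler_cong antipode_right_tail hs)
  also have "\<dots> = \<Delta> ?s x (\<lambda>a b. \<Delta> ?s b (\<lambda>a1 a2. \<S> (a \<cdot> y) \<cdot> (a1 \<cdot> \<S> a2)))"
    by (simp add: mult_assoc)
  also have "\<dots> = \<S> (x \<cdot> y) \<cdot> \<one>"
    by (rule antipode_right_tail) (intro hs)
  finally show ?thesis by simp
qed

end

context bialg
begin

text \<open>Rebracketings of the fourfold coproduct. The second one groups the two middle legs,
  which prepares a cancellation between neighbours.\<close>

lemma
  assumes m: "module s"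
    and 1: "\<And>b c d. module_hom (smul H) s (\<lambda>a. K a b c d)" and 2: "\<And>a c d. module_hom (smul H) s (\<lambda>b. K a b c d)"
    and 3: "\<And>a b d. module_hom (smul H) s (\<lambda>c. K a b c d)" and 4: "\<And>a b c. module_hom (smul H) s (\<lambda>d. K a b c d)"
  shows coassoc_right: "\<Delta> s h (\<lambda>x y. \<Delta> s x (\<lambda>a b. \<Delta> s y (\<lambda>c d. K a b c d)))
      = \<Delta> s h (\<lambda>a t. \<Delta> s t (\<lambda>b t. \<Delta> s t (\<lambda>c d. K a b c d)))"
    and coassoc_mid: "\<Delta> s h (\<lambda>x y. \<Delta> s x (\<lambda>a b. \<Delta> s y (\<lambda>c d. K a b c d)))
      = \<Delta> s h (\<lambda>a t. \<Delta> s t (\<lambda>x d. \<Delta> s x (\<lambda>b c. K a b c d)))"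
proof -
  have h: "module_hom (smul H) s (\<lambda>x. K (f x) b c d)" "module_hom (smul H) s (\<lambda>x. K a (f x) c d)"
    "module_hom (smul H) s (\<lambda>x. K a b (f x) d)" "module_hom (smul H) s (\<lambda>x. K a b c (f x))"
    if "module_hom (smul H) (smul H) f" for a b c d f
    using hom_comp[OF 1 that] hom_comp[OF 2 that] hom_comp[OF 3 that] hom_comp[OF 4 that] .
  show r: "\<Delta> s h (\<lambda>x y. \<Delta> s x (\<lambda>a b. \<Delta> s y (\<lambda>c d. K a b c d)))
      = \<Delta> s h (\<lambda>a t. \<Delta> s t (\<lambda>b t. \<Delta> s t (\<lambda>c d. K a b c d)))"
    by (rule coassoc) (intro hom_intros m h)
  also have "\<dots> = \<Delta> s h (\<lambda>a t. \<Delta> s t (\<lambda>x d. \<Delta> s x (\<lambda>b c. K a b c d)))"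
    by (intro sweedler_cong coassoc[symmetric] hom_intros m h)
  finally show "\<Delta> s h (\<lambda>x y. \<Delta> s x (\<lambda>a b. \<Delta> s y (\<lambda>c d. K a b c d)))
      = \<Delta> s h (\<lambda>a t. \<Delta> s t (\<lambda>x d. \<Delta> s x (\<lambda>b c. K a b c d)))" .
qed

end

lemmas scalar_pull = sweedler_scale[OF module_mult, symmetric] sweedler_scale_left[OF module_mult, symmetric]
lemmas scalar_swap = sweedler_swap[OF module_mult]

section \<open>The functionals u and u' of a 2-cocycle, and the forms built from them\<close>

locale hopf_cocycle = hopf_alg H + cocycle H \<gamma>
  for H :: "('k::comm_ring_1, 'h::ab_group_add, 'z) hopf_scheme" and \<gamma> :: "'h \<Rightarrow> 'h \<Rightarrow> 'k"
begin

definition u :: "'h \<Rightarrow> 'k" where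
  "u h = \<Delta> (*) h (\<lambda>a b. \<gamma> a (\<S> b))"

definition u' :: "'h \<Rightarrow> 'k" where
  "u' h = \<Delta> (*) h (\<lambda>a b. \<gamma>' (\<S> a) b)"

lemma u_hom: "module_hom (smul H) (*) u" "module_hom (smul H) (*) u'"
  using u_def[abs_def] u'_def[abs_def] by (simp_all, (intro hom_intros)+)

lemmas [hom_intros] = hom_comp[OF u_hom(1)] hom_comp[OF u_hom(2)]

text \<open>Because the antipode reverses the coproduct, a convolution whose legs are crossed under
  the antipode is an ordinary convolution product at \<open>\<S> x\<close>.\<close>

lemma lconv_antipode_left:
  assumes "form2 \<alpha>" "form2 \<beta>"
  shows "\<Delta> (*) x (\<lambda>a b. \<Delta> (*) t (\<lambda>c d. \<alpha> (\<S> b) c * \<beta> (\<S> a) d)) = lconv (*) \<alpha> \<beta> (\<S> x) t"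
  unfolding lconv_def
  by (rule comul_antipode[symmetric]) (intro hom_intros assms[THEN bilin_hom1] assms[THEN bilin_hom2])

lemma lconv_antipode_right:
  assumes "form2 \<alpha>" "form2 \<beta>"
  shows "\<Delta> (*) x (\<lambda>a b. \<Delta> (*) t (\<lambda>c d. \<alpha> a (\<S> d) * \<beta> b (\<S> c))) = lconv (*) \<alpha> \<beta> x (\<S> t)"
  unfolding lconv_def
  by (intro sweedler_cong comul_antipode[symmetric] hom_intros assms[THEN bilin_hom1] assms[THEN bilin_hom2])

text \<open>\<open>cocycle_mixed1\<close> rewrites the sum as \<gamma>(h1, S(h4) h5)
  \<open>\<gamma>'\<close>(h2 S(h3), h6), in which both antipodes stand next to their neighbours and
  cancel.\<close>

lemma u_u': "\<Delta> (*) h (\<lambda>a b. u a * u' b) = \<epsilon> h"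
proof -
  note hs = hom_intros
  have "\<Delta> (*) h (\<lambda>a b. u a * u' b)
      = \<Delta> (*) h (\<lambda>x y. \<Delta> (*) x (\<lambda>a b. \<Delta> (*) y (\<lambda>c d. \<gamma> a (\<S> b) * \<gamma>' (\<S> c) d)))"
    unfolding u_def u'_def scalar_pull by (rule sweedler_cong, rule scalar_swap)
  also have "\<dots> = \<Delta> (*) h (\<lambda>a t. \<Delta> (*) t (\<lambda>x d. \<Delta> (*) x (\<lambda>b c. \<gamma> a (\<S> b) * \<gamma>' (\<S> c) d)))"
    by (rule coassoc_mid) (intro hs)+
  also have "\<dots> = \<Delta> (*) h (\<lambda>a t. \<Delta> (*) t (\<lambda>x d. \<Delta> (*) (\<S> x) (\<lambda>p q. \<gamma>' p d * \<gamma> a q)))"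
    by (subst comul_antipode) (intro hs | simp add: mult.commute)+
  also have "\<dots> = \<Delta> (*) h (\<lambda>a t. \<Delta> (*) t (\<lambda>x d. \<Delta> (*) a (\<lambda>a1 a2. \<Delta> (*) (\<S> x) (\<lambda>p q. \<Delta> (*) d (\<lambda>d1 d2.
      \<gamma> a1 (p \<cdot> d1) * \<gamma>' (a2 \<cdot> q) d2)))))"
    by (simp only: cocycle_mixed1)
  also have "\<dots> = \<Delta> (*) h (\<lambda>a t. \<Delta> (*) t (\<lambda>x d. \<Delta> (*) a (\<lambda>a1 a2. \<Delta> (*) x (\<lambda>q p. \<Delta> (*) d (\<lambda>d1 d2.
      \<gamma> a1 (\<S> p \<cdot> d1) * \<gamma>' (a2 \<cdot> \<S> q) d2)))))"
    by (intro sweedler_cong comul_antipode hs)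
  also have "\<dots> = \<Delta> (*) h (\<lambda>a t. \<Delta> (*) a (\<lambda>a1 a2. \<Delta> (*) t (\<lambda>x d. \<Delta> (*) x (\<lambda>q p. \<Delta> (*) d (\<lambda>d1 d2.
      \<gamma> a1 (\<S> p \<cdot> d1) * \<gamma>' (a2 \<cdot> \<S> q) d2)))))"
    by (rule sweedler_cong, rule scalar_swap)
  also have "\<dots> = \<Delta> (*) h (\<lambda>a t. \<Delta> (*) a (\<lambda>a1 a2. \<Delta> (*) t (\<lambda>q t. \<Delta> (*) t (\<lambda>p t. \<Delta> (*) t (\<lambda>d1 d2.
      \<gamma> a1 (\<S> p \<cdot> d1) * \<gamma>' (a2 \<cdot> \<S> q) d2)))))"
    by (rule sweedler_cong, rule sweedler_cong, rule coassoc_right) (intro hs)+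
  also have "\<dots> = \<Delta> (*) h (\<lambda>a t. \<Delta> (*) a (\<lambda>a1 a2. \<Delta> (*) t (\<lambda>q t. \<gamma> a1 \<one> * \<gamma>' (a2 \<cdot> \<S> q) t)))"
    by (intro sweedler_cong antipode_left_head hs)
  also have "\<dots> = \<Delta> (*) h (\<lambda>a t. \<Delta> (*) a (\<lambda>a1 a2. \<epsilon> a1 * \<Delta> (*) t (\<lambda>q t. \<gamma>' (a2 \<cdot> \<S> q) t)))"
    by (simp add: scalar_pull)
  also have "\<dots> = \<Delta> (*) h (\<lambda>a t. \<Delta> (*) t (\<lambda>q t. \<gamma>' (a \<cdot> \<S> q) t))"
    by (intro sweedler_cong counit_left hs)
  also have "\<dots> = \<gamma>' \<one> h"
    by (rule antipode_right_head) (intro hs)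
  finally show ?thesis by simp
qed

text \<open>Here \<open>cocycle_mixed2\<close> leads to \<gamma>(S(h2) h3, S(h6))
  \<open>\<gamma>'\<close>(S(h1), h4 S(h5)), and again both antipodes meet their neighbours.\<close>

lemma u'_u: "\<Delta> (*) h (\<lambda>a b. u' a * u b) = \<epsilon> h"
proof -
  note hs = hom_intros
  have "\<Delta> (*) h (\<lambda>a b. u' a * u b)
      = \<Delta> (*) h (\<lambda>x y. \<Delta> (*) x (\<lambda>a b. \<Delta> (*) y (\<lambda>c d. \<gamma>' (\<S> a) b * \<gamma> c (\<S> d))))"
    unfolding u_def u'_def scalar_pull by (rule sweedler_cong, rule scalar_swap)
  also have "\<dots> = \<Delta> (*) h (\<lambda>a t. \<Delta> (*) t (\<lambda>x d. \<Delta> (*) x (\<lambda>b c. \<gamma>' (\<S> a) b * \<gamma> c (\<S> d))))"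
    by (rule coassoc_mid) (intro hs)+
  also have "\<dots> = \<Delta> (*) h (\<lambda>a t. \<Delta> (*) t (\<lambda>x d. \<Delta> (*) (\<S> a) (\<lambda>p q. \<Delta> (*) x (\<lambda>b c. \<Delta> (*) (\<S> d) (\<lambda>v w.
      \<gamma> (p \<cdot> b) v * \<gamma>' q (c \<cdot> w))))))"
    by (simp only: cocycle_mixed2)
  also have "\<dots> = \<Delta> (*) h (\<lambda>a t. \<Delta> (*) t (\<lambda>x d. \<Delta> (*) a (\<lambda>q p. \<Delta> (*) x (\<lambda>b c. \<Delta> (*) (\<S> d) (\<lambda>v w.
      \<gamma> (\<S> p \<cdot> b) v * \<gamma>' (\<S> q) (c \<cdot> w))))))"
    by (intro sweedler_cong comul_antipode hs)
  also have "\<dots> = \<Delta> (*) h (\<lambda>a t. \<Delta> (*) t (\<lambda>x d. \<Delta> (*) a (\<lambda>q p. \<Delta> (*) x (\<lambda>b c. \<Delta> (*) d (\<lambda>w v.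
      \<gamma> (\<S> p \<cdot> b) (\<S> v) * \<gamma>' (\<S> q) (c \<cdot> \<S> w))))))"
    by (intro sweedler_cong comul_antipode hs)
  also have "\<dots> = \<Delta> (*) h (\<lambda>a t. \<Delta> (*) a (\<lambda>q p. \<Delta> (*) t (\<lambda>x d. \<Delta> (*) x (\<lambda>b c. \<Delta> (*) d (\<lambda>w v.
      \<gamma> (\<S> p \<cdot> b) (\<S> v) * \<gamma>' (\<S> q) (c \<cdot> \<S> w))))))"
    by (rule sweedler_cong, rule scalar_swap)
  also have "\<dots> = \<Delta> (*) h (\<lambda>a t. \<Delta> (*) a (\<lambda>q p. \<Delta> (*) t (\<lambda>b t. \<Delta> (*) t (\<lambda>c t. \<Delta> (*) t (\<lambda>w v.
      \<gamma> (\<S> p \<cdot> b) (\<S> v) * \<gamma>' (\<S> q) (c \<cdot> \<S> w))))))"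
    by (rule sweedler_cong, rule sweedler_cong, rule coassoc_right) (intro hs)+
  also have "\<dots> = \<Delta> (*) h (\<lambda>a t. \<Delta> (*) a (\<lambda>q p. \<Delta> (*) t (\<lambda>b t. \<gamma> (\<S> p \<cdot> b) (\<S> t) * \<gamma>' (\<S> q) \<one>)))"
    by (intro sweedler_cong antipode_right_head hs)
  also have "\<dots> = \<Delta> (*) h (\<lambda>a t. \<Delta> (*) a (\<lambda>q p. \<epsilon> q * \<Delta> (*) t (\<lambda>b t. \<gamma> (\<S> p \<cdot> b) (\<S> t))))"
    by (simp add: scalar_pull mult.commute)
  also have "\<dots> = \<Delta> (*) h (\<lambda>a t. \<Delta> (*) t (\<lambda>b t. \<gamma> (\<S> a \<cdot> b) (\<S> t)))"
    by (intro sweedler_cong counit_left hs)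
  also have "\<dots> = \<gamma> \<one> (\<S> h)"
    by (rule antipode_left_head) (intro hs)
  finally show ?thesis by simp
qed

lemma counit_counit: "\<Delta> (*) h (\<lambda>a b. \<epsilon> a * \<epsilon> b) = \<epsilon> h"
  by (rule counit_left) (intro hom_intros)

text \<open>Written out, this is \<open>\<gamma>'\<close>(S(h2), h3) \<gamma>(S(h1), h4), the
  convolution product of \<open>\<gamma>'\<close> and \<gamma> at S(h1) and h2. The next lemma is
  its mirror image.\<close>

lemma antipode_cocycle_u': "\<Delta> (*) h (\<lambda>a t. \<Delta> (*) t (\<lambda>b c. \<gamma> (\<S> a) c * u' b)) = \<epsilon> h"
proof -
  note hs = hom_intros
  have "\<Delta> (*) h (\<lambda>a t. \<Delta> (*) t (\<lambda>b c. \<gamma> (\<S> a) c * u' b))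
      = \<Delta> (*) h (\<lambda>a t. \<Delta> (*) t (\<lambda>x d. \<Delta> (*) x (\<lambda>b c. \<gamma>' (\<S> b) c * \<gamma> (\<S> a) d)))"
    unfolding u'_def scalar_pull by (simp add: mult.commute)
  also have "\<dots> = \<Delta> (*) h (\<lambda>x t. \<Delta> (*) x (\<lambda>a b. \<Delta> (*) t (\<lambda>c d. \<gamma>' (\<S> b) c * \<gamma> (\<S> a) d)))"
    by (rule coassoc_mid[symmetric]) (intro hs)+
  also have "\<dots> = \<epsilon> h"
    by (simp add: lconv_antipode_left[OF form_cinv form_cocycle] conv_cinv e2_def counit_counit)
  finally show ?thesis .
qed

lemma cinv_antipode_u: "\<Delta> (*) h (\<lambda>a t. \<Delta> (*) t (\<lambda>b c. \<gamma>' a (\<S> c) * u b)) = \<epsilon> h"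
proof -
  note hs = hom_intros
  have "\<Delta> (*) h (\<lambda>a t. \<Delta> (*) t (\<lambda>b c. \<gamma>' a (\<S> c) * u b))
      = \<Delta> (*) h (\<lambda>a t. \<Delta> (*) t (\<lambda>x d. \<Delta> (*) x (\<lambda>b c. \<gamma>' a (\<S> d) * \<gamma> b (\<S> c))))"
    unfolding u_def scalar_pull ..
  also have "\<dots> = \<Delta> (*) h (\<lambda>x t. \<Delta> (*) x (\<lambda>a b. \<Delta> (*) t (\<lambda>c d. \<gamma>' a (\<S> d) * \<gamma> b (\<S> c))))"
    by (rule coassoc_mid[symmetric]) (intro hs)+
  also have "\<dots> = \<epsilon> h"
    by (simp add: lconv_antipode_right[OF form_cinv form_cocycle] conv_cinv e2_def counit_counit)
  finally show ?thesis .
qed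

text \<open>The canonical maps of a comodule algebra \<open>A\<close> and of its right twist differ by the map
  \<open>a \<otimes> h \<mapsto> rf(a\<^sub>1, h\<^sub>1) a\<^sub>0 \<otimes> h\<^sub>2\<close> of \<open>A \<otimes> H\<close>, whose inverse is given by \<open>rg\<close>; \<open>lf\<close> and \<open>lg\<close>
  are the mirror images.  Both are inverse to each other for the convolution product with one
  coproduct reversed.\<close>

definition rf :: "'h \<Rightarrow> 'h \<Rightarrow> 'k" where "rf x h = \<Delta> (*) h (\<lambda>a b. u a * \<gamma>' x (\<S> b))"
definition rg :: "'h \<Rightarrow> 'h \<Rightarrow> 'k" where "rg x h = \<Delta> (*) h (\<lambda>a b. \<gamma> x (\<S> a) * u' b)"
definition lf :: "'h \<Rightarrow> 'h \<Rightarrow> 'k" where "lf x y = \<Delta> (*) x (\<lambda>a b. u a * \<gamma>' (\<S> b) y)"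
definition lg :: "'h \<Rightarrow> 'h \<Rightarrow> 'k" where "lg x y = \<Delta> (*) x (\<lambda>a b. \<gamma> (\<S> a) y * u' b)"

lemma form_rf: "form2 rf" and form_rg: "form2 rg" and form_lf: "form2 lf" and form_lg: "form2 lg"
  unfolding rf_def[abs_def] rg_def[abs_def] lf_def[abs_def] lg_def[abs_def] by (intro hom_intros)+

lemmas [hom_intros] = bilin_hom1[OF form_rf] bilin_hom2[OF form_rf] bilin_hom1[OF form_rg] bilin_hom2[OF form_rg]
  bilin_hom1[OF form_lf] bilin_hom2[OF form_lf] bilin_hom1[OF form_lg] bilin_hom2[OF form_lg]

text \<open>The factors u' and u meet in the middle of the coproduct of h and cancel; what remains
  is the convolution of \<open>\<gamma>'\<close> and \<gamma> at x and S(h). In \<open>rg_rf\<close>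
  the cocycles meet in the middle and cancel first, and u and u' afterwards.\<close>

lemma rf_rg: "\<Delta> (*) x (\<lambda>x1 x2. \<Delta> (*) h (\<lambda>h1 h2. rf x1 h2 * rg x2 h1)) = \<epsilon> x * \<epsilon> h"
proof -
  note hs = hom_intros
  have "\<Delta> (*) x (\<lambda>x1 x2. \<Delta> (*) h (\<lambda>h1 h2. rf x1 h2 * rg x2 h1))
      = \<Delta> (*) x (\<lambda>x1 x2. \<Delta> (*) h (\<lambda>h1 h2. \<Delta> (*) h1 (\<lambda>a b. \<Delta> (*) h2 (\<lambda>c d. \<gamma>' x1 (\<S> d) * \<gamma> x2 (\<S> a) * (u' b * u c)))))"
    unfolding rf_def rg_def scalar_pull by (rule sweedler_cong)+ (simp only: mult_ac)
  also have "\<dots> = \<Delta> (*) x (\<lambda>x1 x2. \<Delta> (*) h (\<lambda>a t. \<Delta> (*) t (\<lambda>y d. \<Delta> (*) y (\<lambda>b c. \<gamma>' x1 (\<S> d) * \<gamma> x2 (\<S> a) * (u' b * u c)))))"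
    by (rule sweedler_cong, rule coassoc_mid) (intro hs)+
  also have "\<dots> = \<Delta> (*) x (\<lambda>x1 x2. \<Delta> (*) h (\<lambda>a t. \<Delta> (*) t (\<lambda>y d. \<epsilon> y * (\<gamma>' x1 (\<S> d) * \<gamma> x2 (\<S> a)))))"
    by (simp only: sweedler_scale[OF module_mult] u'_u) (simp only: mult.commute)
  also have "\<dots> = \<Delta> (*) x (\<lambda>x1 x2. \<Delta> (*) h (\<lambda>a d. \<gamma>' x1 (\<S> d) * \<gamma> x2 (\<S> a)))"
    by (intro sweedler_cong counit_left hs)
  also have "\<dots> = \<epsilon> x * \<epsilon> h"
    by (simp add: lconv_antipode_right[OF form_cinv form_cocycle] conv_cinv e2_def)
  finally show ?thesis .
qed

lemma rg_rf: "\<Delta> (*) x (\<lambda>x1 x2. \<Delta> (*) h (\<lambda>h1 h2. rg x1 h2 * rf x2 h1)) = \<epsilon> x * \<epsilon> h"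
proof -
  note hs = hom_intros
  have "\<Delta> (*) x (\<lambda>x1 x2. \<Delta> (*) h (\<lambda>h1 h2. rg x1 h2 * rf x2 h1))
      = \<Delta> (*) x (\<lambda>x1 x2. \<Delta> (*) h (\<lambda>h1 h2. \<Delta> (*) h1 (\<lambda>a b. \<Delta> (*) h2 (\<lambda>c d. u a * u' d * (\<gamma> x1 (\<S> c) * \<gamma>' x2 (\<S> b))))))"
    unfolding rf_def rg_def scalar_pull by (rule sweedler_cong)+ (simp only: mult_ac)
  also have "\<dots> = \<Delta> (*) x (\<lambda>x1 x2. \<Delta> (*) h (\<lambda>a t. \<Delta> (*) t (\<lambda>y d. \<Delta> (*) y (\<lambda>b c. u a * u' d * (\<gamma> x1 (\<S> c) * \<gamma>' x2 (\<S> b))))))"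
    by (rule sweedler_cong, rule coassoc_mid) (intro hs)+
  also have "\<dots> = \<Delta> (*) h (\<lambda>a t. \<Delta> (*) t (\<lambda>y d. u a * u' d * \<Delta> (*) x (\<lambda>x1 x2. \<Delta> (*) y (\<lambda>b c. \<gamma> x1 (\<S> c) * \<gamma>' x2 (\<S> b)))))"
    unfolding scalar_pull
    by (rule trans[OF scalar_swap], rule sweedler_cong, rule scalar_swap)
  also have "\<dots> = \<Delta> (*) h (\<lambda>a t. \<Delta> (*) t (\<lambda>y d. \<epsilon> y * (u a * u' d * \<epsilon> x)))"
    by (simp only: lconv_antipode_right[OF form_cocycle form_cinv] conv_cinv e2_def counit_antipode) (simp only: mult_ac)
  also have "\<dots> = \<Delta> (*) h (\<lambda>a d. u a * u' d * \<epsilon> x)"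
    by (intro sweedler_cong counit_left hs)
  also have "\<dots> = \<epsilon> x * \<epsilon> h"
    unfolding sweedler_scale_left[OF module_mult] u_u' by (rule mult.commute)
  finally show ?thesis .
qed

lemma lf_lg: "\<Delta> (*) x (\<lambda>x1 x2. \<Delta> (*) y (\<lambda>y1 y2. lf x1 y2 * lg x2 y1)) = \<epsilon> x * \<epsilon> y"
proof -
  note hs = hom_intros
  have "\<Delta> (*) x (\<lambda>x1 x2. \<Delta> (*) y (\<lambda>y1 y2. lf x1 y2 * lg x2 y1))
      = \<Delta> (*) y (\<lambda>y1 y2. \<Delta> (*) x (\<lambda>x1 x2. lf x1 y2 * lg x2 y1))"
    by (rule scalar_swap)
  also have "\<dots> = \<Delta> (*) y (\<lambda>y1 y2. \<Delta> (*) x (\<lambda>x1 x2. \<Delta> (*) x1 (\<lambda>a b. \<Delta> (*) x2 (\<lambda>c d. u a * u' d * (\<gamma> (\<S> c) y1 * \<gamma>' (\<S> b) y2)))))"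
    unfolding lf_def lg_def scalar_pull
    by (rule sweedler_cong)+ (rule trans[OF scalar_swap], (rule sweedler_cong)+, simp only: mult_ac)
  also have "\<dots> = \<Delta> (*) y (\<lambda>y1 y2. \<Delta> (*) x (\<lambda>a t. \<Delta> (*) t (\<lambda>z d. \<Delta> (*) z (\<lambda>b c. u a * u' d * (\<gamma> (\<S> c) y1 * \<gamma>' (\<S> b) y2)))))"
    by (rule sweedler_cong, rule coassoc_mid) (intro hs)+
  also have "\<dots> = \<Delta> (*) x (\<lambda>a t. \<Delta> (*) t (\<lambda>z d. u a * u' d * \<Delta> (*) z (\<lambda>b c. \<Delta> (*) y (\<lambda>y1 y2. \<gamma> (\<S> c) y1 * \<gamma>' (\<S> b) y2))))"
    unfolding scalar_pull
    by (rule trans[OF scalar_swap], rule sweedler_cong, rule trans[OF scalar_swap], rule sweedler_cong, rule scalar_swap)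
  also have "\<dots> = \<Delta> (*) x (\<lambda>a t. \<Delta> (*) t (\<lambda>z d. \<epsilon> z * (u a * u' d * \<epsilon> y)))"
    by (simp only: lconv_antipode_left[OF form_cocycle form_cinv] conv_cinv e2_def counit_antipode) (simp only: mult_ac)
  also have "\<dots> = \<Delta> (*) x (\<lambda>a d. u a * u' d * \<epsilon> y)"
    by (intro sweedler_cong counit_left hs)
  also have "\<dots> = \<epsilon> x * \<epsilon> y"
    by (simp add: sweedler_scale_left[OF module_mult] u_u')
  finally show ?thesis .
qed

lemma lg_lf: "\<Delta> (*) x (\<lambda>x1 x2. \<Delta> (*) y (\<lambda>y1 y2. lg x1 y2 * lf x2 y1)) = \<epsilon> x * \<epsilon> y"
proof -
  note hs = hom_intros
  have "\<Delta> (*) x (\<lambda>x1 x2. \<Delta> (*) y (\<lambda>y1 y2. lg x1 y2 * lf x2 y1))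
      = \<Delta> (*) y (\<lambda>y1 y2. \<Delta> (*) x (\<lambda>x1 x2. lg x1 y2 * lf x2 y1))"
    by (rule scalar_swap)
  also have "\<dots> = \<Delta> (*) y (\<lambda>y1 y2. \<Delta> (*) x (\<lambda>x1 x2. \<Delta> (*) x1 (\<lambda>a b. \<Delta> (*) x2 (\<lambda>c d. \<gamma>' (\<S> d) y1 * \<gamma> (\<S> a) y2 * (u' b * u c)))))"
    unfolding lf_def lg_def scalar_pull
    by (rule sweedler_cong)+ (rule trans[OF scalar_swap], (rule sweedler_cong)+, simp only: mult_ac)
  also have "\<dots> = \<Delta> (*) y (\<lambda>y1 y2. \<Delta> (*) x (\<lambda>a t. \<Delta> (*) t (\<lambda>z d. \<Delta> (*) z (\<lambda>b c. \<gamma>' (\<S> d) y1 * \<gamma> (\<S> a) y2 * (u' b * u c)))))"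
    by (rule sweedler_cong, rule coassoc_mid) (intro hs)+
  also have "\<dots> = \<Delta> (*) y (\<lambda>y1 y2. \<Delta> (*) x (\<lambda>a t. \<Delta> (*) t (\<lambda>z d. \<epsilon> z * (\<gamma>' (\<S> d) y1 * \<gamma> (\<S> a) y2))))"
    by (simp only: sweedler_scale[OF module_mult] u'_u) (simp only: mult.commute)
  also have "\<dots> = \<Delta> (*) y (\<lambda>y1 y2. \<Delta> (*) x (\<lambda>a d. \<gamma>' (\<S> d) y1 * \<gamma> (\<S> a) y2))"
    by (intro sweedler_cong counit_left hs)
  also have "\<dots> = \<Delta> (*) x (\<lambda>a d. \<Delta> (*) y (\<lambda>y1 y2. \<gamma>' (\<S> d) y1 * \<gamma> (\<S> a) y2))"
    by (rule scalar_swap)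
  also have "\<dots> = \<epsilon> x * \<epsilon> y"
    by (simp add: lconv_antipode_left[OF form_cinv form_cocycle] conv_cinv e2_def)
  finally show ?thesis .
qed

text \<open>The scalar content of \<open>canonical_map_right_twist\<close>: rf absorbs the factor
  \<open>\<gamma>'\<close> of the twisted product. After \<open>cocycle_inverse\<close> the sum is
  \<open>\<gamma>'\<close>(x, y1 S(y5)) \<open>\<gamma>'\<close>(y2, S(y4)) u(y3), which first
  \<open>cinv_antipode_u\<close> and then the antipode collapse.\<close>

lemma cinv_rf: "\<Delta> (*) x (\<lambda>x1 x2. \<Delta> (*) y (\<lambda>y1 t. \<Delta> (*) t (\<lambda>y2 y3. \<gamma>' x2 y2 * rf (x1 \<cdot> y1) y3))) = \<epsilon> x * \<epsilon> y"
proof -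
  note hs = hom_intros
  have "\<Delta> (*) x (\<lambda>x1 x2. \<Delta> (*) y (\<lambda>y1 t. \<Delta> (*) t (\<lambda>y2 y3. \<gamma>' x2 y2 * rf (x1 \<cdot> y1) y3)))
      = \<Delta> (*) x (\<lambda>x1 x2. \<Delta> (*) y (\<lambda>z w. \<Delta> (*) z (\<lambda>y1 y2. \<gamma>' x2 y2 * rf (x1 \<cdot> y1) w)))"
    by (intro sweedler_cong coassoc[symmetric] hs)
  also have "\<dots> = \<Delta> (*) y (\<lambda>z w. \<Delta> (*) w (\<lambda>c d. u c * \<Delta> (*) x (\<lambda>x1 x2. \<Delta> (*) z (\<lambda>y1 y2. \<gamma>' (x1 \<cdot> y1) (\<S> d) * \<gamma>' x2 y2))))"
  proof -
    have "\<Delta> (*) x (\<lambda>x1 x2. \<Delta> (*) y (\<lambda>z w. \<Delta> (*) z (\<lambda>y1 y2. \<gamma>' x2 y2 * rf (x1 \<cdot> y1) w)))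
      = \<Delta> (*) y (\<lambda>z w. \<Delta> (*) x (\<lambda>x1 x2. \<Delta> (*) z (\<lambda>y1 y2. \<Delta> (*) w (\<lambda>c d. u c * (\<gamma>' (x1 \<cdot> y1) (\<S> d) * \<gamma>' x2 y2)))))"
      unfolding rf_def scalar_pull
      by (rule trans[OF scalar_swap], (rule sweedler_cong)+, simp only: mult_ac)
    also have "\<dots> = \<Delta> (*) y (\<lambda>z w. \<Delta> (*) x (\<lambda>x1 x2. \<Delta> (*) w (\<lambda>c d. \<Delta> (*) z (\<lambda>y1 y2. u c * (\<gamma>' (x1 \<cdot> y1) (\<S> d) * \<gamma>' x2 y2)))))"
      by ((rule sweedler_cong)+, rule scalar_swap)
    also have "\<dots> = \<Delta> (*) y (\<lambda>z w. \<Delta> (*) w (\<lambda>c d. \<Delta> (*) x (\<lambda>x1 x2. \<Delta> (*) z (\<lambda>y1 y2. u c * (\<gamma>' (x1 \<cdot> y1) (\<S> d) * \<gamma>' x2 y2)))))"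
      by (rule sweedler_cong, rule scalar_swap)
    finally show ?thesis unfolding scalar_pull .
  qed
  also have "\<dots> = \<Delta> (*) y (\<lambda>z w. \<Delta> (*) w (\<lambda>c d. u c * \<Delta> (*) z (\<lambda>y1 y2. \<Delta> (*) (\<S> d) (\<lambda>p q. \<gamma>' x (y1 \<cdot> p) * \<gamma>' y2 q))))"
    by (simp only: cocycle_inverse)
  also have "\<dots> = \<Delta> (*) y (\<lambda>z w. \<Delta> (*) w (\<lambda>c d. u c * \<Delta> (*) z (\<lambda>y1 y2. \<Delta> (*) d (\<lambda>q p. \<gamma>' x (y1 \<cdot> \<S> p) * \<gamma>' y2 (\<S> q)))))"
    by (subst comul_antipode) (intro hs refl)+
  also have "\<dots> = \<Delta> (*) y (\<lambda>z w. \<Delta> (*) z (\<lambda>y1 y2. \<Delta> (*) w (\<lambda>c d. \<Delta> (*) d (\<lambda>q p. \<gamma>' x (y1 \<cdot> \<S> p) * (\<gamma>' y2 (\<S> q) * u c)))))"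
    unfolding scalar_pull
    by (rule sweedler_cong, rule trans[OF scalar_swap], (rule sweedler_cong)+, simp only: mult_ac)
  also have "\<dots> = \<Delta> (*) y (\<lambda>y1 t. \<Delta> (*) t (\<lambda>y2 w. \<Delta> (*) w (\<lambda>c d. \<Delta> (*) d (\<lambda>q p. \<gamma>' x (y1 \<cdot> \<S> p) * (\<gamma>' y2 (\<S> q) * u c)))))"
    by (rule coassoc) (intro hs)
  also have "\<dots> = \<Delta> (*) y (\<lambda>y1 t. \<Delta> (*) t (\<lambda>y2 w. \<Delta> (*) w (\<lambda>z p. \<Delta> (*) z (\<lambda>c q. \<gamma>' x (y1 \<cdot> \<S> p) * (\<gamma>' y2 (\<S> q) * u c)))))"
    by (intro sweedler_cong coassoc[symmetric] hs)
  also have "\<dots> = \<Delta> (*) y (\<lambda>y1 t. \<Delta> (*) t (\<lambda>v p. \<Delta> (*) v (\<lambda>y2 z. \<Delta> (*) z (\<lambda>c q. \<gamma>' x (y1 \<cdot> \<S> p) * (\<gamma>' y2 (\<S> q) * u c)))))"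
    by (rule sweedler_cong, rule coassoc[symmetric]) (intro hs)
  also have "\<dots> = \<Delta> (*) y (\<lambda>y1 t. \<Delta> (*) t (\<lambda>v p. \<epsilon> v * \<gamma>' x (y1 \<cdot> \<S> p)))"
    by (simp only: sweedler_scale[OF module_mult] cinv_antipode_u) (simp only: mult.commute)
  also have "\<dots> = \<Delta> (*) y (\<lambda>y1 p. \<gamma>' x (y1 \<cdot> \<S> p))"
    by (intro sweedler_cong counit_left hs)
  also have "\<dots> = \<epsilon> y * \<gamma>' x \<one>"
    by (rule antipode_right) (intro hs)
  finally show ?thesis by simp
qed

text \<open>\<open>cocycle_mixed1\<close> gives \<gamma>(x1, S(x4) y1) \<open>\<gamma>'\<close>(x2
  S(x3), y2), whose second factor collapses to counits. In this closed form products in the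
  arguments of lf can be expanded, as \<open>cocycle_lf\<close> does.\<close>

lemma lf_alt: "lf x y = \<Delta> (*) x (\<lambda>a b. \<gamma> a (\<S> b \<cdot> y))"
proof -
  note hs = hom_intros
  have "lf x y = \<Delta> (*) x (\<lambda>z d. \<Delta> (*) z (\<lambda>a c. \<gamma> a (\<S> c) * \<gamma>' (\<S> d) y))"
    unfolding lf_def u_def scalar_pull ..
  also have "\<dots> = \<Delta> (*) x (\<lambda>a t. \<Delta> (*) t (\<lambda>c d. \<gamma> a (\<S> c) * \<gamma>' (\<S> d) y))"
    by (rule coassoc) (intro hs)
  also have "\<dots> = \<Delta> (*) x (\<lambda>a t. \<Delta> (*) (\<S> t) (\<lambda>p q. \<gamma>' p y * \<gamma> a q))"
    by (subst comul_antipode) (intro hs | simp add: mult.commute)+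
  also have "\<dots> = \<Delta> (*) x (\<lambda>a t. \<Delta> (*) a (\<lambda>a1 a2. \<Delta> (*) (\<S> t) (\<lambda>p q. \<Delta> (*) y (\<lambda>y1 y2. \<gamma> a1 (p \<cdot> y1) * \<gamma>' (a2 \<cdot> q) y2))))"
    by (simp only: cocycle_mixed1)
  also have "\<dots> = \<Delta> (*) x (\<lambda>a t. \<Delta> (*) a (\<lambda>a1 a2. \<Delta> (*) t (\<lambda>q p. \<Delta> (*) y (\<lambda>y1 y2. \<gamma> a1 (\<S> p \<cdot> y1) * \<gamma>' (a2 \<cdot> \<S> q) y2))))"
    by (intro sweedler_cong comul_antipode hs)
  also have "\<dots> = \<Delta> (*) x (\<lambda>a1 t. \<Delta> (*) t (\<lambda>z p. \<Delta> (*) z (\<lambda>a2 q. \<Delta> (*) y (\<lambda>y1 y2. \<gamma> a1 (\<S> p \<cdot> y1) * \<gamma>' (a2 \<cdot> \<S> q) y2))))"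
    by (rule coassoc_mid) (intro hs)+
  also have "\<dots> = \<Delta> (*) x (\<lambda>a1 t. \<Delta> (*) t (\<lambda>z p. \<epsilon> z * \<Delta> (*) y (\<lambda>y1 y2. \<gamma> a1 (\<S> p \<cdot> y1) * \<gamma>' \<one> y2)))"
    by (intro sweedler_cong antipode_right hs)
  also have "\<dots> = \<Delta> (*) x (\<lambda>a1 p. \<Delta> (*) y (\<lambda>y1 y2. \<gamma> a1 (\<S> p \<cdot> y1) * \<gamma>' \<one> y2))"
    by (intro sweedler_cong counit_left hs)
  also have "\<dots> = \<Delta> (*) x (\<lambda>a1 p. \<Delta> (*) y (\<lambda>y1 y2. \<epsilon> y2 * \<gamma> a1 (\<S> p \<cdot> y1)))"
    by (simp add: mult.commute)
  also have "\<dots> = \<Delta> (*) x (\<lambda>a1 p. \<gamma> a1 (\<S> p \<cdot> y))"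
    by (intro sweedler_cong counit_right hs)
  finally show ?thesis .
qed

text \<open>Expanding lf by \<open>lf_alt\<close> produces S(x3) x4, which cancels; the rest is the
  cocycle condition for x, y1 and S(y2) n. This identity is what makes the deformed section linear
  over B.\<close>

lemma cocycle_lf:
  "\<Delta> (*) x (\<lambda>x1 t. \<Delta> (*) t (\<lambda>x2 x3. \<Delta> (*) y (\<lambda>y1 y2. \<gamma> x1 y1 * lf (x2 \<cdot> y2) (x3 \<cdot> n))))
    = \<Delta> (*) n (\<lambda>n1 n2. lf y n1 * \<gamma> x n2)"
proof -
  note hs = hom_intros
  have "\<Delta> (*) x (\<lambda>x1 t. \<Delta> (*) t (\<lambda>x2 x3. \<Delta> (*) y (\<lambda>y1 y2. \<gamma> x1 y1 * lf (x2 \<cdot> y2) (x3 \<cdot> n))))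
    = \<Delta> (*) x (\<lambda>x1 t. \<Delta> (*) t (\<lambda>x2 x3. \<Delta> (*) y (\<lambda>y1 y2. \<gamma> x1 y1 *
        \<Delta> (*) x2 (\<lambda>a b. \<Delta> (*) y2 (\<lambda>c d. \<gamma> (a \<cdot> c) (\<S> d \<cdot> (\<S> b \<cdot> x3 \<cdot> n)))))))"
    unfolding lf_alt by (subst comul_mul) (intro hs | simp only: antipode_mult mult_assoc)+
  also have "\<dots> = \<Delta> (*) x (\<lambda>x1 t. \<Delta> (*) t (\<lambda>x2 x3. \<Delta> (*) x2 (\<lambda>a b. \<Delta> (*) y (\<lambda>y1 y2. \<Delta> (*) y2 (\<lambda>c d.
        \<gamma> x1 y1 * \<gamma> (a \<cdot> c) (\<S> d \<cdot> (\<S> b \<cdot> x3 \<cdot> n)))))))"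
    unfolding scalar_pull by ((rule sweedler_cong)+, rule scalar_swap)
  also have "\<dots> = \<Delta> (*) x (\<lambda>x1 t. \<Delta> (*) t (\<lambda>a t. \<Delta> (*) t (\<lambda>b x3. \<Delta> (*) y (\<lambda>y1 y2. \<Delta> (*) y2 (\<lambda>c d.
        \<gamma> x1 y1 * \<gamma> (a \<cdot> c) (\<S> d \<cdot> (\<S> b \<cdot> x3 \<cdot> n)))))))"
    by (rule sweedler_cong, rule coassoc) (intro hs)
  also have "\<dots> = \<Delta> (*) x (\<lambda>x1 t. \<Delta> (*) y (\<lambda>y1 y2. \<Delta> (*) y2 (\<lambda>c d. \<gamma> x1 y1 * \<gamma> (t \<cdot> c) (\<S> d \<cdot> (\<one> \<cdot> n)))))"
    by (rule sweedler_cong, rule antipode_left_tail) (intro hs)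
  also have "\<dots> = \<Delta> (*) x (\<lambda>x1 x2. \<Delta> (*) y (\<lambda>z d. \<Delta> (*) z (\<lambda>y1 c. \<gamma> x1 y1 * \<gamma> (x2 \<cdot> c) (\<S> d \<cdot> (\<one> \<cdot> n)))))"
    by (intro sweedler_cong coassoc[symmetric] hs)
  also have "\<dots> = \<Delta> (*) y (\<lambda>z d. \<Delta> (*) x (\<lambda>x1 x2. \<Delta> (*) z (\<lambda>y1 c. \<gamma> x1 y1 * \<gamma> (x2 \<cdot> c) (\<S> d \<cdot> n))))"
    unfolding mult_one_left by (rule scalar_swap)
  also have "\<dots> = \<Delta> (*) y (\<lambda>z d. \<Delta> (*) z (\<lambda>y1 y2. \<Delta> (*) (\<S> d \<cdot> n) (\<lambda>k1 k2. \<gamma> y1 k1 * \<gamma> x (y2 \<cdot> k2))))"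
    by (simp only: cocycle)
  also have "\<dots> = \<Delta> (*) y (\<lambda>z d. \<Delta> (*) z (\<lambda>y1 y2. \<Delta> (*) (\<S> d) (\<lambda>p q. \<Delta> (*) n (\<lambda>n1 n2. \<gamma> y1 (p \<cdot> n1) * \<gamma> x (y2 \<cdot> (q \<cdot> n2))))))"
    by (intro sweedler_cong comul_mul hs)
  also have "\<dots> = \<Delta> (*) y (\<lambda>z d. \<Delta> (*) z (\<lambda>y1 y2. \<Delta> (*) d (\<lambda>q p. \<Delta> (*) n (\<lambda>n1 n2. \<gamma> y1 (\<S> p \<cdot> n1) * \<gamma> x (y2 \<cdot> (\<S> q \<cdot> n2))))))"
    by (intro sweedler_cong comul_antipode hs)
  also have "\<dots> = \<Delta> (*) y (\<lambda>y1 t. \<Delta> (*) t (\<lambda>z p. \<Delta> (*) z (\<lambda>y2 q. \<Delta> (*) n (\<lambda>n1 n2. \<gamma> y1 (\<S> p \<cdot> n1) * \<gamma> x (y2 \<cdot> (\<S> q \<cdot> n2))))))"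
    by (rule coassoc_mid) (intro hs)+
  also have "\<dots> = \<Delta> (*) y (\<lambda>y1 t. \<Delta> (*) t (\<lambda>z p. \<epsilon> z * \<Delta> (*) n (\<lambda>n1 n2. \<gamma> y1 (\<S> p \<cdot> n1) * \<gamma> x (\<one> \<cdot> n2))))"
    unfolding mult_assoc[symmetric] by (intro sweedler_cong antipode_right hs)
  also have "\<dots> = \<Delta> (*) y (\<lambda>y1 p. \<Delta> (*) n (\<lambda>n1 n2. \<gamma> y1 (\<S> p \<cdot> n1) * \<gamma> x (\<one> \<cdot> n2)))"
    by (intro sweedler_cong counit_left hs)
  also have "\<dots> = \<Delta> (*) n (\<lambda>n1 n2. lf y n1 * \<gamma> x n2)"
    unfolding lf_alt scalar_pull mult_one_left by (rule scalar_swap)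
  finally show ?thesis .
qed

end

section \<open>Comodule algebras and their twists\<close>

locale alg =
  fixes A :: "('k::comm_ring_1, 'a::ab_group_add, 'z) alg_scheme"
  assumes algebra_A: "algebra A"
begin

abbreviation mult_A (infixl "\<odot>" 70) where "x \<odot> y \<equiv> mul A x y"

lemma module_A [hom_intros]: "module (smul A)"
  and bilin_mul_A: "bilin (smul A) (smul A) (smul A) (mul A)"
  and mult_A_assoc: "(x \<odot> y) \<odot> z = x \<odot> (y \<odot> z)"
  and mult_A_one [simp]: "unit A \<odot> x = x" "x \<odot> unit A = x"
  using algebra_A by (auto simp: algebra_def)

lemmas [hom_intros] = bilin_hom1[OF bilin_mul_A] bilin_hom2[OF bilin_mul_A]

end

section \<open>Right comodule algebras and the right twist\<close>

locale rcomod = bialg H for H :: "('k::comm_ring_1, 'h::ab_group_add, 'y) hopf_scheme" +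
  fixes A :: "('k, 'a::ab_group_add, 'h, 'z) right_comod_alg_scheme"
  assumes rcomod: "right_comodule_algebra H A"
begin

sublocale alg A
  using rcomod by unfold_locales (simp add: right_comodule_algebra_def)

abbreviation rcoact_sum ("\<delta>") where "\<delta> s a f \<equiv> sweedler s (rcoact A a) f"

lemma tmap_rcoact: "tmap (smul A) (smul A) (smul H) (rcoact A)"
  using rcomod module_A module_H by (auto simp: tmap_def right_comodule_algebra_def)

lemmas [hom_intros] = tmap_hom[OF tmap_rcoact]

lemma rcoact_law: "nest_law (smul A) (smul H) (smul H) s (rcoact A a) (rcoact A) (rcoact A a) (comul H) T"
  by (rule nest_lawI[where M=UNIV and N=UNIV and P=UNIV]) (use rcomod in \<open>simp add: right_comodule_algebra_def\<close>)

lemma rcoact_counit: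
  assumes "module_hom (smul A) s f"
  shows "\<delta> s a (\<lambda>a0 h. s (\<epsilon> h) (f a0)) = f a"
proof -
  have "f (\<delta> (smul A) a (\<lambda>a0 h. smul A (\<epsilon> h) a0)) = \<delta> s a (\<lambda>a0 h. s (\<epsilon> h) (f a0))"
    by (simp add: sweedler_hom[OF assms] module_hom.scale[OF assms])
  then show ?thesis using rcomod by (simp add: right_comodule_algebra_def)
qed

lemma rcoact_one:
  assumes "bilin (smul A) (smul H) s F"
  shows "\<delta> s (unit A) F = F (unit A) \<one>"
  using rcomod bilin_modules(3)[OF assms]
  by (simp add: right_comodule_algebra_def sweedler_coset[OF assms] lin_ext_gen)

lemma rcoact_mul:
  assumes "bilin (smul A) (smul H) s F"
  shows "\<delta> s (a \<odot> b) F = \<delta> s a (\<lambda>a0 h. \<delta> s b (\<lambda>b0 k. F (a0 \<odot> b0) (h \<cdot> k)))"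
  using rcomod tens_mul_bilin[OF assms] by (simp add: right_comodule_algebra_def)

lemma rcoact2:
  fixes s :: "'k \<Rightarrow> 't::ab_group_add \<Rightarrow> 't"
  assumes "module s" "\<And>a b c. trilin (smul A) (smul H) (smul H) s (\<lambda>x y z. F x a y b z c)"
    "\<And>x y z. trilin (smul A) (smul H) (smul H) s (\<lambda>a b c. F x a y b z c)"
  shows "\<delta> s x (\<lambda>a b. \<delta> s y (\<lambda>a' b'. \<delta> s a (\<lambda>c d. \<delta> s a' (\<lambda>c' d'. F c c' d d' b b'))))
    = \<delta> s x (\<lambda>a b. \<delta> s y (\<lambda>a' b'. \<Delta> s b (\<lambda>c d. \<Delta> s b' (\<lambda>c' d'. F a a' c c' d d'))))"
  by (rule nest_law2[OF assms(1) rcoact_law rcoact_law]) (use assms(2,3) in simp_all)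

end

locale rcomod_cocycle = rcomod H A + cocycle H \<gamma>
  for H :: "('k::comm_ring_1, 'h::ab_group_add, 'y) hopf_scheme"
    and A :: "('k, 'a::ab_group_add, 'h, 'z) right_comod_alg_scheme" and \<gamma>
begin

abbreviation rmul (infixl "\<bullet>" 70) where "x \<bullet> y \<equiv> mul (right_twist H \<gamma> A) x y"

lemma rmul_eq: "a \<bullet> b = \<delta> (smul A) a (\<lambda>a0 h. \<delta> (smul A) b (\<lambda>b0 k. smul A (\<gamma>' h k) (a0 \<odot> b0)))"
  by (simp add: right_twist_def)

lemma bilin_rmul: "bilin (smul A) (smul A) (smul A) (mul (right_twist H \<gamma> A))"
  using rmul_eq[abs_def] by (simp, intro hom_intros)

lemma hom_rmul:
  assumes "module_hom (smul A) s f"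
  shows "f (a \<bullet> b) = \<delta> s a (\<lambda>a0 h. \<delta> s b (\<lambda>b0 k. s (\<gamma>' h k) (f (a0 \<odot> b0))))"
  by (simp add: rmul_eq sweedler_hom[OF assms] module_hom.scale[OF assms])

lemma rcoact_rmul:
  assumes F: "bilin (smul A) (smul H) s F"
  shows "\<delta> s (a \<bullet> b) F = \<delta> s a (\<lambda>a0 h. \<delta> s b (\<lambda>b0 k. \<Delta> s h (\<lambda>h1 h2. \<Delta> s k (\<lambda>k1 k2.
    s (\<gamma>' h2 k2) (F (a0 \<odot> b0) (h1 \<cdot> k1))))))"
proof -
  note m = bilin_modules(3)[OF F]
  note hs = hom_intros m bilin_hom1[OF F] bilin_hom2[OF F]
  have "\<delta> s (a \<bullet> b) F = \<delta> s a (\<lambda>a0 h. \<delta> s b (\<lambda>b0 k. s (\<gamma>' h k) (\<delta> s (a0 \<odot> b0) F)))"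
    by (rule hom_rmul[of s "\<lambda>x. \<delta> s x F"]) (intro hs F)
  also have "\<dots> = \<delta> s a (\<lambda>a0 h. \<delta> s b (\<lambda>b0 k. \<delta> s a0 (\<lambda>a00 h'. \<delta> s b0 (\<lambda>b00 k'.
      s (\<gamma>' h k) (F (a00 \<odot> b00) (h' \<cdot> k'))))))"
    unfolding rcoact_mul[OF F] sweedler_scale[OF m, symmetric] ..
  also have "\<dots> = \<delta> s a (\<lambda>a0 h. \<delta> s b (\<lambda>b0 k. \<Delta> s h (\<lambda>h1 h2. \<Delta> s k (\<lambda>k1 k2.
    s (\<gamma>' h2 k2) (F (a0 \<odot> b0) (h1 \<cdot> k1))))))"
    by (rule rcoact2) (intro hs)+
  finally show ?thesis .
qed

text \<open>On the H-legs of the three factors, associativity is \<open>cocycle_inverse\<close>, the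
  cocycle identity for \<open>\<gamma>'\<close>.\<close>

lemma rmul_assoc: "(a \<bullet> b) \<bullet> c = a \<bullet> (b \<bullet> c)"
proof -
  let ?s = "smul A"
  note m = module_A
  note hs = hom_intros
  note sw = sweedler_swap[OF m] and sc = sweedler_scale_left[OF m]
  have "(a \<bullet> b) \<bullet> c = \<delta> ?s c (\<lambda>c0 l. \<delta> ?s (a \<bullet> b) (\<lambda>x0 h. ?s (\<gamma>' h l) (x0 \<odot> c0)))"
    unfolding rmul_eq[of "a \<bullet> b"] by (rule sw)
  also have "\<dots> = \<delta> ?s c (\<lambda>c0 l. \<delta> ?s a (\<lambda>a0 h. \<delta> ?s b (\<lambda>b0 k. \<Delta> ?s h (\<lambda>h1 h2. \<Delta> ?s k (\<lambda>k1 k2.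
      ?s (\<gamma>' h2 k2) (?s (\<gamma>' (h1 \<cdot> k1) l) ((a0 \<odot> b0) \<odot> c0)))))))"
    by (intro sweedler_cong rcoact_rmul hs)
  also have "\<dots> = \<delta> ?s c (\<lambda>c0 l. \<delta> ?s a (\<lambda>a0 h. \<delta> ?s b (\<lambda>b0 k.
      ?s (\<Delta> (*) h (\<lambda>h1 h2. \<Delta> (*) k (\<lambda>k1 k2. \<gamma>' (h1 \<cdot> k1) l * \<gamma>' h2 k2))) (a0 \<odot> (b0 \<odot> c0)))))"
    by (simp only: module.scale_scale[OF m] sc mult_A_assoc mult.commute)
  also have "\<dots> = \<delta> ?s a (\<lambda>a0 h. \<delta> ?s b (\<lambda>b0 k. \<delta> ?s c (\<lambda>c0 l.
      ?s (\<Delta> (*) k (\<lambda>k1 k2. \<Delta> (*) l (\<lambda>l1 l2. \<gamma>' h (k1 \<cdot> l1) * \<gamma>' k2 l2))) (a0 \<odot> (b0 \<odot> c0)))))"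
    unfolding cocycle_inverse by (rule trans[OF sw], rule sweedler_cong, rule sw)
  also have "\<dots> = \<delta> ?s a (\<lambda>a0 h. \<delta> ?s b (\<lambda>b0 k. \<delta> ?s c (\<lambda>c0 l. \<Delta> ?s k (\<lambda>k1 k2. \<Delta> ?s l (\<lambda>l1 l2.
      ?s (\<gamma>' k2 l2) (?s (\<gamma>' h (k1 \<cdot> l1)) (a0 \<odot> (b0 \<odot> c0))))))))"
    by (simp only: module.scale_scale[OF m] sc mult.commute)
  also have "\<dots> = \<delta> ?s a (\<lambda>a0 h. \<delta> ?s (b \<bullet> c) (\<lambda>x0 l. ?s (\<gamma>' h l) (a0 \<odot> x0)))"
    by (rule sweedler_cong, rule rcoact_rmul[symmetric]) (intro hs)
  also have "\<dots> = a \<bullet> (b \<bullet> c)"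
    unfolding rmul_eq[of a] ..
  finally show ?thesis .
qed

lemma algebra_right_twist: "algebra (right_twist H \<gamma> A)"
proof -
  have "unit A \<bullet> a = \<delta> (smul A) a (\<lambda>b0 k. smul A (\<gamma>' \<one> k) (unit A \<odot> b0))" for a
    unfolding rmul_eq by (rule rcoact_one) (intro hom_intros)
  then have 1: "unit A \<bullet> a = a" for a
    using rcoact_counit[OF hom_id[OF module_A]] by simp
  have "a \<bullet> unit A = \<delta> (smul A) a (\<lambda>b0 k. smul A (\<gamma>' k \<one>) (b0 \<odot> unit A))" for a
    unfolding rmul_eq by (rule sweedler_cong, rule rcoact_one) (intro hom_intros)
  then have 2: "a \<bullet> unit A = a" for a
    using rcoact_counit[OF hom_id[OF module_A]] by simp
  have [simp]: "smul (right_twist H \<gamma> A) = smul A" "unit (right_twist H \<gamma> A) = unit A"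
    by (simp_all add: right_twist_def)
  show ?thesis
    unfolding algebra_def by (simp add: module_A bilin_rmul rmul_assoc 1 2)
qed

end

section \<open>Left comodule algebras and the left twist\<close>

locale lcomod = bialg H for H :: "('k::comm_ring_1, 'l::ab_group_add, 'y) hopf_scheme" +
  fixes A :: "('k, 'a::ab_group_add, 'h, 'l, 'z) bicomod_alg_scheme"
  assumes lcomod: "left_comodule_algebra H A"
begin

sublocale alg A
  using lcomod by unfold_locales (simp add: left_comodule_algebra_def)

abbreviation lcoact_sum ("\<rho>") where "\<rho> s a f \<equiv> sweedler s (lcoact A a) f"

lemma tmap_lcoact: "tmap (smul A) (smul H) (smul A) (lcoact A)"
  using lcomod module_A module_H by (auto simp: tmap_def left_comodule_algebra_def)

lemmas [hom_intros] = tmap_hom[OF tmap_lcoact]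

lemma lcoact_law: "nest_law (smul H) (smul H) (smul A) s (lcoact A a) (comul H) (lcoact A a) (lcoact A) T"
  by (rule nest_lawI[where M=UNIV and N=UNIV and P=UNIV]) (use lcomod in \<open>simp add: left_comodule_algebra_def\<close>)

lemmas lcoact_assoc = nest_lawD[OF lcoact_law]

lemma lcoact_counit:
  assumes "module_hom (smul A) s f"
  shows "\<rho> s a (\<lambda>k a0. s (\<epsilon> k) (f a0)) = f a"
proof -
  have "f (\<rho> (smul A) a (\<lambda>k a0. smul A (\<epsilon> k) a0)) = \<rho> s a (\<lambda>k a0. s (\<epsilon> k) (f a0))"
    by (simp add: sweedler_hom[OF assms] module_hom.scale[OF assms])
  then show ?thesis using lcomod by (simp add: left_comodule_algebra_def)
qed

lemma lcoact_one:
  assumes "bilin (smul H) (smul A) s F"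
  shows "\<rho> s (unit A) F = F \<one> (unit A)"
  using lcomod bilin_modules(3)[OF assms]
  by (simp add: left_comodule_algebra_def sweedler_coset[OF assms] lin_ext_gen)

lemma lcoact_mul:
  assumes "bilin (smul H) (smul A) s F"
  shows "\<rho> s (a \<odot> b) F = \<rho> s a (\<lambda>h a0. \<rho> s b (\<lambda>k b0. F (h \<cdot> k) (a0 \<odot> b0)))"
  using lcomod tens_mul_bilin[OF assms] by (simp add: left_comodule_algebra_def)

lemma lcoact2:
  fixes s :: "'k \<Rightarrow> 't::ab_group_add \<Rightarrow> 't"
  assumes "module s" "\<And>a b c. trilin (smul H) (smul H) (smul A) s (\<lambda>x y z. F x a y b z c)"
    "\<And>x y z. trilin (smul H) (smul H) (smul A) s (\<lambda>a b c. F x a y b z c)"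
  shows "\<rho> s x (\<lambda>a b. \<rho> s y (\<lambda>a' b'. \<rho> s b (\<lambda>c d. \<rho> s b' (\<lambda>c' d'. F a a' c c' d d'))))
    = \<rho> s x (\<lambda>a b. \<rho> s y (\<lambda>a' b'. \<Delta> s a (\<lambda>c d. \<Delta> s a' (\<lambda>c' d'. F c c' d d' b b'))))"
  by (rule nest_law2[OF assms(1) lcoact_law lcoact_law, symmetric]) (use assms(2,3) in simp_all)

end

locale lcomod_cocycle = lcomod H A + cocycle H \<sigma>
  for H :: "('k::comm_ring_1, 'l::ab_group_add, 'y) hopf_scheme"
    and A :: "('k, 'a::ab_group_add, 'h, 'l, 'z) bicomod_alg_scheme" and \<sigma>
begin

abbreviation lmul (infixl "\<circ>\<^sub>\<sigma>" 70) where "x \<circ>\<^sub>\<sigma> y \<equiv> mul (left_twist \<sigma> A) x y"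

lemma lmul_eq: "a \<circ>\<^sub>\<sigma> b = \<rho> (smul A) a (\<lambda>h a0. \<rho> (smul A) b (\<lambda>k b0. smul A (\<sigma> h k) (a0 \<odot> b0)))"
  by (simp add: left_twist_def)

lemma bilin_lmul: "bilin (smul A) (smul A) (smul A) (mul (left_twist \<sigma> A))"
  using lmul_eq[abs_def] by (simp, intro hom_intros)

lemma hom_lmul:
  assumes "module_hom (smul A) s f"
  shows "f (a \<circ>\<^sub>\<sigma> b) = \<rho> s a (\<lambda>h a0. \<rho> s b (\<lambda>k b0. s (\<sigma> h k) (f (a0 \<odot> b0))))"
  by (simp add: lmul_eq sweedler_hom[OF assms] module_hom.scale[OF assms])

lemma lcoact_lmul:
  assumes F: "bilin (smul H) (smul A) s F"
  shows "\<rho> s (a \<circ>\<^sub>\<sigma> b) F = \<rho> s a (\<lambda>h a0. \<rho> s b (\<lambda>k b0. \<Delta> s h (\<lambda>h1 h2. \<Delta> s k (\<lambda>k1 k2.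
    s (\<sigma> h1 k1) (F (h2 \<cdot> k2) (a0 \<odot> b0))))))"
proof -
  note m = bilin_modules(3)[OF F]
  note hs = hom_intros m bilin_hom1[OF F] bilin_hom2[OF F]
  have "\<rho> s (a \<circ>\<^sub>\<sigma> b) F = \<rho> s a (\<lambda>h a0. \<rho> s b (\<lambda>k b0. s (\<sigma> h k) (\<rho> s (a0 \<odot> b0) F)))"
    by (rule hom_lmul[of s "\<lambda>x. \<rho> s x F"]) (intro hs F)
  also have "\<dots> = \<rho> s a (\<lambda>h a0. \<rho> s b (\<lambda>k b0. \<rho> s a0 (\<lambda>h' a00. \<rho> s b0 (\<lambda>k' b00.
      s (\<sigma> h k) (F (h' \<cdot> k') (a00 \<odot> b00))))))"
    unfolding lcoact_mul[OF F] sweedler_scale[OF m, symmetric] ..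
  also have "\<dots> = \<rho> s a (\<lambda>h a0. \<rho> s b (\<lambda>k b0. \<Delta> s h (\<lambda>h1 h2. \<Delta> s k (\<lambda>k1 k2.
    s (\<sigma> h1 k1) (F (h2 \<cdot> k2) (a0 \<odot> b0))))))"
    by (rule lcoact2) (intro hs)+
  finally show ?thesis .
qed

text \<open>The left twist uses \<sigma> itself on the K-legs, so the cocycle condition applies
  directly and not its inverse form.\<close>

lemma lmul_assoc: "(a \<circ>\<^sub>\<sigma> b) \<circ>\<^sub>\<sigma> c = a \<circ>\<^sub>\<sigma> (b \<circ>\<^sub>\<sigma> c)"
proof -
  let ?s = "smul A"
  note m = module_A
  note hs = hom_intros
  note sw = sweedler_swap[OF m] and sc = sweedler_scale_left[OF m]
  have "(a \<circ>\<^sub>\<sigma> b) \<circ>\<^sub>\<sigma> c = \<rho> ?s c (\<lambda>l c0. \<rho> ?s (a \<circ>\<^sub>\<sigma> b) (\<lambda>h x0. ?s (\<sigma> h l) (x0 \<odot> c0)))"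
    unfolding lmul_eq[of "a \<circ>\<^sub>\<sigma> b"] by (rule sw)
  also have "\<dots> = \<rho> ?s c (\<lambda>l c0. \<rho> ?s a (\<lambda>h a0. \<rho> ?s b (\<lambda>k b0. \<Delta> ?s h (\<lambda>h1 h2. \<Delta> ?s k (\<lambda>k1 k2.
      ?s (\<sigma> h1 k1) (?s (\<sigma> (h2 \<cdot> k2) l) ((a0 \<odot> b0) \<odot> c0)))))))"
    by (intro sweedler_cong lcoact_lmul hs)
  also have "\<dots> = \<rho> ?s c (\<lambda>l c0. \<rho> ?s a (\<lambda>h a0. \<rho> ?s b (\<lambda>k b0.
      ?s (\<Delta> (*) h (\<lambda>h1 h2. \<Delta> (*) k (\<lambda>k1 k2. \<sigma> h1 k1 * \<sigma> (h2 \<cdot> k2) l))) (a0 \<odot> (b0 \<odot> c0)))))"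
    by (simp only: module.scale_scale[OF m] sc mult_A_assoc)
  also have "\<dots> = \<rho> ?s a (\<lambda>h a0. \<rho> ?s b (\<lambda>k b0. \<rho> ?s c (\<lambda>l c0.
      ?s (\<Delta> (*) k (\<lambda>k1 k2. \<Delta> (*) l (\<lambda>l1 l2. \<sigma> k1 l1 * \<sigma> h (k2 \<cdot> l2)))) (a0 \<odot> (b0 \<odot> c0)))))"
    unfolding cocycle by (rule trans[OF sw], rule sweedler_cong, rule sw)
  also have "\<dots> = \<rho> ?s a (\<lambda>h a0. \<rho> ?s b (\<lambda>k b0. \<rho> ?s c (\<lambda>l c0. \<Delta> ?s k (\<lambda>k1 k2. \<Delta> ?s l (\<lambda>l1 l2.
      ?s (\<sigma> k1 l1) (?s (\<sigma> h (k2 \<cdot> l2)) (a0 \<odot> (b0 \<odot> c0))))))))"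
    by (simp only: module.scale_scale[OF m] sc)
  also have "\<dots> = \<rho> ?s a (\<lambda>h a0. \<rho> ?s (b \<circ>\<^sub>\<sigma> c) (\<lambda>l x0. ?s (\<sigma> h l) (a0 \<odot> x0)))"
    by (rule sweedler_cong, rule lcoact_lmul[symmetric]) (intro hs)
  also have "\<dots> = a \<circ>\<^sub>\<sigma> (b \<circ>\<^sub>\<sigma> c)"
    unfolding lmul_eq[of a] ..
  finally show ?thesis .
qed

lemma algebra_left_twist: "algebra (left_twist \<sigma> A)"
proof -
  have "unit A \<circ>\<^sub>\<sigma> a = \<rho> (smul A) a (\<lambda>k b0. smul A (\<sigma> \<one> k) (unit A \<odot> b0))" for a
    unfolding lmul_eq by (rule lcoact_one) (intro hom_intros)
  then have 1: "unit A \<circ>\<^sub>\<sigma> a = a" for a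
    using lcoact_counit[OF hom_id[OF module_A]] by simp
  have "a \<circ>\<^sub>\<sigma> unit A = \<rho> (smul A) a (\<lambda>k b0. smul A (\<sigma> k \<one>) (b0 \<odot> unit A))" for a
    unfolding lmul_eq by (rule sweedler_cong, rule lcoact_one) (intro hom_intros)
  then have 2: "a \<circ>\<^sub>\<sigma> unit A = a" for a
    using lcoact_counit[OF hom_id[OF module_A]] by simp
  have [simp]: "smul (left_twist \<sigma> A) = smul A" "unit (left_twist \<sigma> A) = unit A"
    by (simp_all add: left_twist_def)
  show ?thesis
    unfolding algebra_def by (simp add: module_A bilin_lmul lmul_assoc 1 2)
qed

end

lemma tens_mul_in_tens: "tens_mul A C X Y \<in> tens A C"
  by (simp add: tens_mul_def coset_in_tensor2)

lemma tens_mul_eqI: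
  fixes X :: "('m::ab_group_add \<times> 'n::ab_group_add \<Rightarrow>\<^sub>0 'k::comm_ring_1) set"
  assumes "module (smul A)" "module (smul C)" "Z \<in> tens A C"
    and "\<And>F :: _ \<Rightarrow> _ \<Rightarrow> 'k cog. bilin (smul A) (smul C) cog_scale F \<Longrightarrow> sweedler cog_scale Z F
      = sweedler cog_scale X (\<lambda>x1 x2. sweedler cog_scale Y (\<lambda>y1 y2. F (mul A x1 y1) (mul C x2 y2)))"
  shows "Z = tens_mul A C X Y"
  by (rule tens_eqI[OF assms(1-3) tens_mul_in_tens]) (simp add: assms(4) tens_mul_bilin)

section \<open>Bicomodule algebras: each twist respects the other coaction\<close>

locale bicomod = rcomod H A + l: lcomod K A
  for K :: "('k::comm_ring_1, 'l::ab_group_add, 'x) hopf_scheme"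
    and H :: "('k, 'h::ab_group_add, 'y) hopf_scheme"
    and A :: "('k, 'a::ab_group_add, 'h, 'l, 'z) bicomod_alg_scheme" +
  assumes bicomod: "bicomodule_algebra K H A"
begin

lemma compat_law: "nest_law (smul K) (smul A) (smul H) s (rcoact A a) (lcoact A) (lcoact A a) (rcoact A) T"
  by (rule nest_lawI[where M=UNIV and N=UNIV and P=UNIV]) (use bicomod in \<open>simp add: bicomodule_algebra_def\<close>)

lemmas compat = nest_lawD[OF compat_law]

lemma compat2:
  fixes s :: "'k \<Rightarrow> 't::ab_group_add \<Rightarrow> 't"
  assumes "module s" "\<And>a b c. trilin (smul K) (smul A) (smul H) s (\<lambda>x y z. F x a y b z c)"
    "\<And>x y z. trilin (smul K) (smul A) (smul H) s (\<lambda>a b c. F x a y b z c)"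
  shows "\<delta> s x (\<lambda>a b. \<delta> s y (\<lambda>a' b'. l.lcoact_sum s a (\<lambda>c d. l.lcoact_sum s a' (\<lambda>c' d'. F c c' d d' b b'))))
    = l.lcoact_sum s x (\<lambda>a b. l.lcoact_sum s y (\<lambda>a' b'. \<delta> s b (\<lambda>c d. \<delta> s b' (\<lambda>c' d'. F a a' c c' d d'))))"
  by (rule nest_law2[OF assms(1) compat_law compat_law]) (use assms(2,3) in simp_all)

end

lemma bicomodI:
  assumes "bialgebra K" "bialgebra H" "bicomodule_algebra K H A"
  shows "bicomod K H A"
  using assms by unfold_locales (auto simp: bicomodule_algebra_def)

locale bicomod_rcocycle = bicomod K H A + rcomod_cocycle H A \<gamma>
  for K :: "('k::comm_ring_1, 'l::ab_group_add, 'x) hopf_scheme"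
    and H :: "('k, 'h::ab_group_add, 'y) hopf_scheme"
    and A :: "('k, 'a::ab_group_add, 'h, 'l, 'z) bicomod_alg_scheme" and \<gamma>
begin

text \<open>The scalar \<open>\<gamma>'\<close> reads the H-legs and the left coaction the K-legs.
  As the coactions commute (\<open>compat2\<close>), they can be read off in either order, and the
  left coaction stays multiplicative.\<close>

lemma left_comodule_right_twist: "left_comodule_algebra K (right_twist H \<gamma> A)"
proof -
  have [simp]: "smul (right_twist H \<gamma> A) = smul A" "unit (right_twist H \<gamma> A) = unit A"
    "lcoact (right_twist H \<gamma> A) = lcoact A"
    by (simp_all add: right_twist_def)
  have "lcoact A (a \<bullet> b) = tens_mul K (right_twist H \<gamma> A) (lcoact A a) (lcoact A b)" for a b
  proof (rule tens_mul_eqI)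
    fix F :: "_ \<Rightarrow> _ \<Rightarrow> 'k cog"
    let ?s = "cog_scale :: 'k \<Rightarrow> 'k cog \<Rightarrow> 'k cog"
    assume "bilin (smul K) (smul (right_twist H \<gamma> A)) ?s F"
    then have F: "bilin (smul K) (smul A) ?s F" by simp
    note m = bilin_modules(3)[OF F]
    note hs = hom_intros m bilin_hom1[OF F] bilin_hom2[OF F]
    have hF: "module_hom (smul A) ?s (F k)" for k using F by (simp add: bilin_def)
    have "sweedler ?s (lcoact A (a \<bullet> b)) F
        = \<delta> ?s a (\<lambda>a0 h. \<delta> ?s b (\<lambda>b0 j. ?s (\<gamma>' h j) (sweedler ?s (lcoact A (mul A a0 b0)) F)))"
      by (rule hom_rmul[of ?s "\<lambda>x. sweedler ?s (lcoact A x) F"]) (intro hs F)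
    also have "\<dots> = \<delta> ?s a (\<lambda>a0 h. \<delta> ?s b (\<lambda>b0 j. sweedler ?s (lcoact A a0) (\<lambda>k a'. sweedler ?s (lcoact A b0) (\<lambda>l b'.
        ?s (\<gamma>' h j) (F (mul K k l) (mul A a' b'))))))"
      unfolding l.lcoact_mul[OF F] sweedler_scale[OF m, symmetric] ..
    also have "\<dots> = sweedler ?s (lcoact A a) (\<lambda>k a0. sweedler ?s (lcoact A b) (\<lambda>l b0. \<delta> ?s a0 (\<lambda>a' h. \<delta> ?s b0 (\<lambda>b' j.
        ?s (\<gamma>' h j) (F (mul K k l) (mul A a' b'))))))"
      by (rule compat2) (intro hs)+
    finally show "sweedler ?s (lcoact A (a \<bullet> b)) F
      = sweedler ?s (lcoact A a) (\<lambda>x1 x2. sweedler ?s (lcoact A b) (\<lambda>y1 y2. F (mul K x1 y1) (x2 \<bullet> y2)))"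
      by (simp add: hom_rmul[OF hF])
  qed (use l.tmap_lcoact in \<open>auto simp: tmap_def\<close>)
  then show ?thesis
    using l.lcomod algebra_right_twist unfolding left_comodule_algebra_def by simp
qed

end

locale bicomod_lcocycle = bicomod K H A + l: lcomod_cocycle K A \<sigma>
  for K :: "('k::comm_ring_1, 'l::ab_group_add, 'x) hopf_scheme"
    and H :: "('k, 'h::ab_group_add, 'y) hopf_scheme"
    and A :: "('k, 'a::ab_group_add, 'h, 'l, 'z) bicomod_alg_scheme" and \<sigma>
begin

lemma right_comodule_left_twist: "right_comodule_algebra H (left_twist \<sigma> A)"
proof -
  have [simp]: "smul (left_twist \<sigma> A) = smul A" "unit (left_twist \<sigma> A) = unit A"
    "rcoact (left_twist \<sigma> A) = rcoact A"
    by (simp_all add: left_twist_def)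
  have "rcoact A (mul (left_twist \<sigma> A) a b) = tens_mul (left_twist \<sigma> A) H (rcoact A a) (rcoact A b)" for a b
  proof (rule tens_mul_eqI)
    fix F :: "_ \<Rightarrow> _ \<Rightarrow> 'k cog"
    let ?s = "cog_scale :: 'k \<Rightarrow> 'k cog \<Rightarrow> 'k cog"
    assume "bilin (smul (left_twist \<sigma> A)) (smul H) ?s F"
    then have F: "bilin (smul A) (smul H) ?s F" by simp
    note m = bilin_modules(3)[OF F]
    note hs = hom_intros m bilin_hom1[OF F] bilin_hom2[OF F]
    have hF: "module_hom (smul A) ?s (\<lambda>x. F x h)" for h using F by (simp add: bilin_def)
    have "\<delta> ?s (mul (left_twist \<sigma> A) a b) F
        = sweedler ?s (lcoact A a) (\<lambda>k a0. sweedler ?s (lcoact A b) (\<lambda>l b0. ?s (\<sigma> k l) (\<delta> ?s (mul A a0 b0) F)))"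
      by (rule l.hom_lmul[of ?s "\<lambda>x. \<delta> ?s x F"]) (intro hs F)
    also have "\<dots> = sweedler ?s (lcoact A a) (\<lambda>k a0. sweedler ?s (lcoact A b) (\<lambda>l b0. \<delta> ?s a0 (\<lambda>a' h. \<delta> ?s b0 (\<lambda>b' j.
        ?s (\<sigma> k l) (F (mul A a' b') (mul H h j))))))"
      unfolding rcoact_mul[OF F] sweedler_scale[OF m, symmetric] ..
    also have "\<dots> = \<delta> ?s a (\<lambda>a0 h. \<delta> ?s b (\<lambda>b0 j. sweedler ?s (lcoact A a0) (\<lambda>k a'. sweedler ?s (lcoact A b0) (\<lambda>l b'.
        ?s (\<sigma> k l) (F (mul A a' b') (mul H h j))))))"
      by (rule compat2[symmetric]) (intro hs)+
    finally show "\<delta> ?s (mul (left_twist \<sigma> A) a b) F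
      = \<delta> ?s a (\<lambda>x1 x2. \<delta> ?s b (\<lambda>y1 y2. F (mul (left_twist \<sigma> A) x1 y1) (mul H x2 y2)))"
      by (simp add: l.hom_lmul[OF hF])
  qed (use tmap_rcoact in \<open>auto simp: tmap_def\<close>)
  then show ?thesis
    using rcomod l.algebra_left_twist unfolding right_comodule_algebra_def by simp
qed

end

section \<open>The twisted Hopf algebra\<close>

text \<open>A bialgebra is a bicomodule algebra over itself, and its twist by a 2-cocycle is, as an
  algebra, the two-sided twist of this bicomodule algebra.\<close>

definition regular :: "('k::comm_ring_1, 'h::ab_group_add, 'z) hopf_scheme \<Rightarrow> ('k, 'h, 'h, 'h) bicomod_alg" where
  "regular H = \<lparr>smul = smul H, mul = mul H, unit = unit H, rcoact = comul H, lcoact = comul H\<rparr>"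

lemma regular_simps [simp]:
  "smul (regular H) = smul H" "mul (regular H) = mul H" "unit (regular H) = unit H"
  "rcoact (regular H) = comul H" "lcoact (regular H) = comul H"
  by (simp_all add: regular_def)

lemma bicomodule_algebra_regular:
  assumes "bialgebra H"
  shows "bicomodule_algebra H H (regular H)"
proof -
  have t: "tens_mul H (regular H) = tens_mul H H" "tens_mul (regular H) H = tens_mul H H"
    by (simp_all add: tens_mul_def fun_eq_iff)
  have a: "algebra (regular H)"
    using assms by (simp add: bialgebra_def algebra_def)
  show ?thesis
    using assms a unfolding bicomodule_algebra_def left_comodule_algebra_def right_comodule_algebra_def t
    by (simp add: bialgebra_def coalgebra_def)
qed

lemma right_twist_simps [simp]:
  "smul (right_twist H \<gamma> A) = smul A" "unit (right_twist H \<gamma> A) = unit A" "rcoact (right_twist H \<gamma> A) = rcoact A"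
  "lcoact (right_twist H \<gamma> A') = lcoact A'"
  by (simp_all add: right_twist_def)

lemma left_twist_simps [simp]:
  "smul (left_twist \<sigma> A) = smul A" "unit (left_twist \<sigma> A) = unit A" "rcoact (left_twist \<sigma> A) = rcoact A"
  "lcoact (left_twist \<sigma> A) = lcoact A"
  by (simp_all add: left_twist_def)

lemma twisted_hopf_simps [simp]:
  "smul (twisted_hopf H \<gamma>) = smul H" "unit (twisted_hopf H \<gamma>) = unit H" "comul (twisted_hopf H \<gamma>) = comul H"
  "counit (twisted_hopf H \<gamma>) = counit H"
  by (simp_all add: twisted_hopf_def Let_def)

context cocycle
begin

abbreviation tmul (infixl "\<star>" 70) where "x \<star> y \<equiv> mul (twisted_hopf H \<gamma>) x y"

lemma tmul_lconv: "mul (twisted_hopf H \<gamma>) = lconv (smul H) \<gamma> (rconv (smul H) (mul H) \<gamma>')"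
proof (intro ext)
  fix x y
  have "x \<star> y = \<Delta> (smul H) x (\<lambda>x1 x'. \<Delta> (smul H) x' (\<lambda>x2 x3. \<Delta> (smul H) y (\<lambda>y1 y'. \<Delta> (smul H) y' (\<lambda>y2 y3.
      smul H (\<gamma> x1 y1 * \<gamma>' x3 y3) (x2 \<cdot> y2)))))"
    by (simp add: twisted_hopf_def Let_def sweedler3_def)
  also have "\<dots> = \<Delta> (smul H) x (\<lambda>x1 x'. \<Delta> (smul H) y (\<lambda>y1 y'. \<Delta> (smul H) x' (\<lambda>x2 x3. \<Delta> (smul H) y' (\<lambda>y2 y3.
      smul H (\<gamma> x1 y1) (smul H (\<gamma>' x3 y3) (x2 \<cdot> y2))))))"
    unfolding module.scale_scale[OF module_H] by (rule sweedler_cong, rule sweedler_swap[OF module_H])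
  also have "\<dots> = lconv (smul H) \<gamma> (rconv (smul H) (mul H) \<gamma>') x y"
    unfolding lconv_def rconv_def sweedler_scale[OF module_H, symmetric] ..
  finally show "x \<star> y = lconv (smul H) \<gamma> (rconv (smul H) (mul H) \<gamma>') x y" .
qed

lemma tmul_rconv: "mul (twisted_hopf H \<gamma>) = rconv (smul H) (lconv (smul H) \<gamma> (mul H)) \<gamma>'"
  unfolding tmul_lconv by (rule lconv_rconv[OF form_cocycle form_cinv bilin_mul])

lemma bilin_tmul: "bilin (smul H) (smul H) (smul H) (mul (twisted_hopf H \<gamma>))"
  unfolding tmul_lconv by (intro bilin_lconv bilin_rconv form_cocycle form_cinv bilin_mul)

lemmas [hom_intros] = bilin_hom1[OF bilin_tmul] bilin_hom2[OF bilin_tmul]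

text \<open>Cancels the leading \<gamma> of the twisted product. Coproducts and coactions are
  multiplicative for twisted products because the \<open>\<gamma>'\<close> that ends one leg meets
  the \<gamma> that begins the next.\<close>

lemma lconv_cinv_tmul: "lconv (smul H) \<gamma>' (mul (twisted_hopf H \<gamma>)) = rconv (smul H) (mul H) \<gamma>'"
  unfolding tmul_lconv
  by (simp add: lconv_lconv[OF form_cinv form_cocycle bilin_rconv[OF form_cinv bilin_mul]] conv_cinv
      lconv_e2[OF bilin_rconv[OF form_cinv bilin_mul]])

lemma hom_lconv:
  assumes "module_hom t s f"
  shows "f (lconv t \<alpha> G x y) = lconv s \<alpha> (\<lambda>x y. f (G x y)) x y"
  unfolding lconv_def sweedler_hom[OF assms] module_hom.scale[OF assms] ..

lemma hom_rconv:
  assumes "module_hom t s f"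
  shows "f (rconv t G \<alpha> x y) = rconv s (\<lambda>x y. f (G x y)) \<alpha> x y"
  unfolding rconv_def sweedler_hom[OF assms] module_hom.scale[OF assms] ..

lemma hom_tmul:
  assumes "module_hom (smul H) s f"
  shows "f (x \<star> y) = rconv s (lconv s \<gamma> (\<lambda>x y. f (x \<cdot> y))) \<gamma>' x y"
  unfolding tmul_rconv hom_rconv[OF assms] hom_lconv[OF assms] ..

lemma comul_tmul:
  assumes F: "bilin (smul H) (smul H) s F"
  shows "\<Delta> s (x \<star> y) F = \<Delta> s x (\<lambda>x1 x2. \<Delta> s y (\<lambda>y1 y2. F (x1 \<star> y1) (x2 \<star> y2)))"
proof -
  note m = bilin_modules(3)[OF F]
  note hs = hom_intros m bilin_hom1[OF F] bilin_hom2[OF F]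
  define N where "N a b z = lconv s \<gamma> (\<lambda>p q. F (p \<cdot> q) z) a b" for a b z
  have N: "bilin (smul H) (smul H) s (\<lambda>a b. N a b z)" for z
    unfolding N_def by (intro bilin_lconv form_cocycle hs)
  have Nz: "module_hom (smul H) s (N a b)" for a b
    unfolding N_def lconv_def by (intro hs)
  note hN = bilin_hom1[OF N] bilin_hom2[OF N] hom_comp[OF Nz]
  have "\<Delta> s x (\<lambda>x1 x2. \<Delta> s y (\<lambda>y1 y2. F (x1 \<star> y1) (x2 \<star> y2)))
      = \<Delta> s x (\<lambda>x1 x2. \<Delta> s y (\<lambda>y1 y2. \<Delta> s x1 (\<lambda>a b. \<Delta> s y1 (\<lambda>c d. s (\<gamma>' b d) (N a c (x2 \<star> y2))))))"
  proof (intro sweedler_cong)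
    fix x1 x2 y1 y2
    have "module_hom (smul H) s (\<lambda>w. F w (x2 \<star> y2))" by (intro hs)
    from hom_tmul[OF this, of x1 y1]
    show "F (x1 \<star> y1) (x2 \<star> y2) = \<Delta> s x1 (\<lambda>a b. \<Delta> s y1 (\<lambda>c d. s (\<gamma>' b d) (N a c (x2 \<star> y2))))"
      unfolding N_def rconv_def .
  qed
  \<comment> \<open>The \<open>\<gamma>'\<close> that ends the first product is moved by
    coassociativity in front of the second product, whose leading \<gamma> it cancels by
    \<open>lconv_cinv_tmul\<close>.\<close>
  also have "\<dots> = \<Delta> s x (\<lambda>x1 x2. \<Delta> s y (\<lambda>y1 y2. \<Delta> s x2 (\<lambda>a b. \<Delta> s y2 (\<lambda>c d. s (\<gamma>' a c) (N x1 y1 (b \<star> d))))))"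
    by (rule coassoc2) (intro hs hN)+
  also have "\<dots> = \<Delta> s x (\<lambda>x1 x2. \<Delta> s y (\<lambda>y1 y2. N x1 y1 (lconv (smul H) \<gamma>' (mul (twisted_hopf H \<gamma>)) x2 y2)))"
    unfolding hom_lconv[OF Nz] by (simp only: lconv_def)
  also have "\<dots> = \<Delta> s x (\<lambda>x1 x2. \<Delta> s y (\<lambda>y1 y2. \<Delta> s x2 (\<lambda>a b. \<Delta> s y2 (\<lambda>c d. s (\<gamma>' b d) (N x1 y1 (a \<cdot> c))))))"
    unfolding lconv_cinv_tmul hom_rconv[OF Nz] by (simp only: rconv_def)
  also have "\<dots> = \<Delta> s x (\<lambda>x1 x2. \<Delta> s y (\<lambda>y1 y2. \<Delta> s x1 (\<lambda>a b. \<Delta> s y1 (\<lambda>c d. s (\<gamma>' x2 y2) (N a c (b \<cdot> d))))))"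
    by (rule coassoc2[symmetric]) (intro hs hN)+
  also have "\<dots> = rconv s (\<lambda>x y. \<Delta> s x (\<lambda>x1 x2. \<Delta> s y (\<lambda>y1 y2. N x1 y1 (x2 \<cdot> y2)))) \<gamma>' x y"
    unfolding rconv_def sweedler_scale[OF m] ..
  also have "(\<lambda>x y. \<Delta> s x (\<lambda>x1 x2. \<Delta> s y (\<lambda>y1 y2. N x1 y1 (x2 \<cdot> y2)))) = lconv s \<gamma> (\<lambda>x y. \<Delta> s (x \<cdot> y) F)"
  proof (intro ext)
    fix x y
    have "\<Delta> s x (\<lambda>x1 x2. \<Delta> s y (\<lambda>y1 y2. N x1 y1 (x2 \<cdot> y2)))
        = \<Delta> s x (\<lambda>x1 x2. \<Delta> s y (\<lambda>y1 y2. \<Delta> s x2 (\<lambda>a b. \<Delta> s y2 (\<lambda>c d. s (\<gamma> x1 y1) (F (a \<cdot> c) (b \<cdot> d))))))"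
      unfolding N_def lconv_def by (rule coassoc2) (intro hs)+
    also have "\<dots> = lconv s \<gamma> (\<lambda>x y. \<Delta> s (x \<cdot> y) F) x y"
      unfolding lconv_def comul_mul[OF F] sweedler_scale[OF m] ..
    finally show "\<Delta> s x (\<lambda>x1 x2. \<Delta> s y (\<lambda>y1 y2. N x1 y1 (x2 \<cdot> y2))) = lconv s \<gamma> (\<lambda>x y. \<Delta> s (x \<cdot> y) F) x y" .
  qed
  also have "rconv s (lconv s \<gamma> (\<lambda>x y. \<Delta> s (x \<cdot> y) F)) \<gamma>' x y = \<Delta> s (x \<star> y) F"
    by (rule hom_tmul[symmetric]) (intro hs F)
  finally show ?thesis ..
qed

lemma counit_tmul: "\<epsilon> (x \<star> y) = \<epsilon> x * \<epsilon> y"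
proof -
  have "\<epsilon> (x \<star> y) = lconv (*) \<gamma> (rconv (*) e2 \<gamma>') x y"
    unfolding tmul_lconv hom_lconv[OF counit_hom] hom_rconv[OF counit_hom] by (simp add: e2_def[abs_def])
  also have "\<dots> = e2 x y"
    by (simp add: lconv_rconv_mult[symmetric] lconv_e2[OF form_cinv] conv_cinv)
  finally show ?thesis by (simp add: e2_def)
qed

lemma tmul_two_sided: "mul (twisted_hopf H \<gamma>) = mul (left_twist \<gamma> (right_twist H \<gamma> (regular H)))"
proof (intro ext)
  fix x y
  show "x \<star> y = mul (left_twist \<gamma> (right_twist H \<gamma> (regular H))) x y"
    unfolding tmul_lconv by (simp add: left_twist_def right_twist_def lconv_def rconv_def)
qed

lemma bialgebra_twisted: "bialgebra (twisted_hopf H \<gamma>)"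
proof -
  interpret R: bicomod H H "regular H"
    by (intro bicomodI bialgebra bicomodule_algebra_regular)
  interpret R: bicomod_rcocycle H H "regular H" \<gamma>
    by unfold_locales
  interpret L: lcomod_cocycle H "right_twist H \<gamma> (regular H)" \<gamma>
    by unfold_locales (rule R.left_comodule_right_twist)
  have "algebra (twisted_hopf H \<gamma>)"
    using L.algebra_left_twist unfolding algebra_def by (simp add: tmul_two_sided[symmetric])
  moreover have "coalgebra (twisted_hopf H \<gamma>)"
    using coalgebra_H by (simp add: coalgebra_def)
  moreover have "comul H (x \<star> y) = tens_mul (twisted_hopf H \<gamma>) (twisted_hopf H \<gamma>) (comul H x) (comul H y)" for x y
    by (rule tens_mul_eqI) (use tmap_comul comul_tmul in \<open>auto simp: tmap_def\<close>)
  ultimately show ?thesis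
    using bialgebra counit_tmul by (simp add: bialgebra_def)
qed

end

text \<open>The \<open>\<gamma>'\<close> in the product of the A-legs meets the leading \<gamma> in
  the twisted product of the H-legs, so that only the final \<open>\<gamma>'\<close> of
  \<open>rcoact_rmul\<close> remains.\<close>

lemma (in rcomod_cocycle) right_comodule_right_twist:
  "right_comodule_algebra (twisted_hopf H \<gamma>) (right_twist H \<gamma> A)"
proof -
  have "rcoact A (a \<bullet> b) = tens_mul (right_twist H \<gamma> A) (twisted_hopf H \<gamma>) (rcoact A a) (rcoact A b)" for a b
  proof (rule tens_mul_eqI)
    fix F :: "_ \<Rightarrow> _ \<Rightarrow> 'k cog"
    let ?s = "cog_scale :: 'k \<Rightarrow> 'k cog \<Rightarrow> 'k cog"
    assume "bilin (smul (right_twist H \<gamma> A)) (smul (twisted_hopf H \<gamma>)) ?s F"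
    then have F: "bilin (smul A) (smul H) ?s F" by simp
    note m = bilin_modules(3)[OF F]
    note hs = hom_intros m bilin_hom1[OF F] bilin_hom2[OF F]
    have hF: "module_hom (smul A) ?s (\<lambda>x. F x h)" "module_hom (smul H) ?s (F x)" for x h using F by (simp_all add: bilin_def)
    have "\<delta> ?s a (\<lambda>a0 h. \<delta> ?s b (\<lambda>b0 k. F (a0 \<bullet> b0) (h \<star> k)))
        = \<delta> ?s a (\<lambda>a0 h. \<delta> ?s b (\<lambda>b0 k. \<delta> ?s a0 (\<lambda>a00 h'. \<delta> ?s b0 (\<lambda>b00 k'. ?s (\<gamma>' h' k') (F (a00 \<odot> b00) (h \<star> k))))))"
      unfolding hom_rmul[OF hF(1)] ..
    also have "\<dots> = \<delta> ?s a (\<lambda>a0 h. \<delta> ?s b (\<lambda>b0 k. \<Delta> ?s h (\<lambda>h1 h2. \<Delta> ?s k (\<lambda>k1 k2. ?s (\<gamma>' h1 k1) (F (a0 \<odot> b0) (h2 \<star> k2))))))"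
      by (rule rcoact2) (intro hs)+
    also have "\<dots> = \<delta> ?s a (\<lambda>a0 h. \<delta> ?s b (\<lambda>b0 k. F (a0 \<odot> b0) (lconv (smul H) \<gamma>' (mul (twisted_hopf H \<gamma>)) h k)))"
      unfolding hom_lconv[OF hF(2)] by (simp only: lconv_def)
    also have "\<dots> = \<delta> ?s (a \<bullet> b) F"
      unfolding lconv_cinv_tmul hom_rconv[OF hF(2)] rcoact_rmul[OF F] by (simp only: rconv_def)
    finally show "\<delta> ?s (a \<bullet> b) F = \<delta> ?s a (\<lambda>x1 x2. \<delta> ?s b (\<lambda>y1 y2. F (x1 \<bullet> y1) (x2 \<star> y2)))" ..
  qed (use tmap_rcoact in \<open>auto simp: tmap_def\<close>)
  then show ?thesis
    using rcomod algebra_right_twist unfolding right_comodule_algebra_def by simp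
qed

lemma (in bicomod_rcocycle) bicomodule_right_twist:
  "bicomodule_algebra K (twisted_hopf H \<gamma>) (right_twist H \<gamma> A)"
  using left_comodule_right_twist right_comodule_right_twist bicomod
  unfolding bicomodule_algebra_def by simp

context hopf_cocycle
begin

text \<open>With p = u and q = u' this is the factor by which the twisted antipode differs from
  \<open>\<S>\<close>. It is kept apart from \<open>\<S>\<close> since exchanging u and u' inverts
  it, which yields bijectivity of the twisted antipode.\<close>

definition two_sided_conv :: "('h \<Rightarrow> 'k) \<Rightarrow> ('h \<Rightarrow> 'k) \<Rightarrow> 'h \<Rightarrow> 'h" where
  "two_sided_conv p q h = \<Delta> (smul H) h (\<lambda>a t. \<Delta> (smul H) t (\<lambda>b c. smul H (p a * q c) b))"

lemma hom_two_sided_conv: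
  assumes "module_hom (smul H) (*) p" "module_hom (smul H) (*) q"
  shows "module_hom (smul H) (smul H) (two_sided_conv p q)"
  using two_sided_conv_def[of p q, abs_def]
  by (simp, intro hom_intros hom_comp[OF assms(1)] hom_comp[OF assms(2)])

lemma two_sided_conv_inverse:
  assumes p: "module_hom (smul H) (*) p" and q: "module_hom (smul H) (*) q"
    and r: "module_hom (smul H) (*) r" and s: "module_hom (smul H) (*) s"
    and rp: "\<And>h. \<Delta> (*) h (\<lambda>a b. r a * p b) = \<epsilon> h" and qs: "\<And>h. \<Delta> (*) h (\<lambda>a b. q a * s b) = \<epsilon> h"
  shows "two_sided_conv p q (two_sided_conv r s h) = h"
proof -
  let ?m = "smul H"
  note hs = hom_intros hom_comp[OF p] hom_comp[OF q] hom_comp[OF r] hom_comp[OF s]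
  note ss = module.scale_scale[OF module_H]
  note hc = hom_two_sided_conv[OF p q]
  have "two_sided_conv p q (two_sided_conv r s h) = \<Delta> ?m h (\<lambda>a t. \<Delta> ?m t (\<lambda>b c. ?m (r a * s c) (two_sided_conv p q b)))"
    unfolding two_sided_conv_def[of r s] sweedler_hom[OF hc] module_hom.scale[OF hc] ..
  also have "\<dots> = \<Delta> ?m h (\<lambda>a t. \<Delta> ?m t (\<lambda>b c. \<Delta> ?m b (\<lambda>d e. \<Delta> ?m e (\<lambda>f g. ?m (r a * s c) (?m (p d * q g) f)))))"
    unfolding two_sided_conv_def[of p q] sweedler_scale[OF module_H] ..
  also have "\<dots> = \<Delta> ?m h (\<lambda>a t. \<Delta> ?m t (\<lambda>d w. \<Delta> ?m w (\<lambda>e c. \<Delta> ?m e (\<lambda>f g. ?m (r a * s c) (?m (p d * q g) f)))))"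
    by (rule sweedler_cong, rule coassoc) (intro hs)
  also have "\<dots> = \<Delta> ?m h (\<lambda>a t. \<Delta> ?m t (\<lambda>d w. \<Delta> ?m w (\<lambda>f v. \<Delta> ?m v (\<lambda>g c. ?m (r a * s c) (?m (p d * q g) f)))))"
    by (intro sweedler_cong coassoc hs)
  also have "\<dots> = \<Delta> ?m h (\<lambda>a t. \<Delta> ?m t (\<lambda>d w. \<Delta> ?m w (\<lambda>f v. \<Delta> ?m v (\<lambda>g c. ?m (q g * s c) (?m (r a * p d) f)))))"
    unfolding ss by (simp only: mult_ac)
  also have "\<dots> = \<Delta> ?m h (\<lambda>a t. \<Delta> ?m t (\<lambda>d w. \<Delta> ?m w (\<lambda>f v. ?m (\<epsilon> v) (?m (r a * p d) f))))"
    unfolding sweedler_scale_left[OF module_H] qs ..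
  also have "\<dots> = \<Delta> ?m h (\<lambda>a t. \<Delta> ?m t (\<lambda>d f. ?m (r a * p d) f))"
    by (intro sweedler_cong counit_right hs)
  also have "\<dots> = \<Delta> ?m h (\<lambda>x f. \<Delta> ?m x (\<lambda>a d. ?m (r a * p d) f))"
    by (rule coassoc[symmetric]) (intro hs)
  also have "\<dots> = h"
    unfolding sweedler_scale_left[OF module_H] rp by (rule counit_left) (intro hs)
  finally show ?thesis .
qed

lemma twisted_antipode: "antipode (twisted_hopf H \<gamma>) h = \<S> (two_sided_conv u u' h)"
proof -
  have "antipode (twisted_hopf H \<gamma>) h = \<Delta> (smul H) h (\<lambda>a t. \<Delta> (smul H) t (\<lambda>b c. smul H (u a * u' c) (\<S> b)))"
    by (simp add: twisted_hopf_def Let_def sweedler3_def u_def u'_def)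
  then show ?thesis
    unfolding two_sided_conv_def sweedler_hom[OF antipode_hom] module_hom.scale[OF antipode_hom] .
qed

lemma bij_twisted_antipode:
  assumes "bij \<S>"
  shows "bij (antipode (twisted_hopf H \<gamma>))"
proof -
  have "bij (two_sided_conv u u')"
    by (rule o_bij[of "two_sided_conv u' u"])
      (simp_all add: fun_eq_iff two_sided_conv_inverse u_hom u_u' u'_u)
  moreover have "antipode (twisted_hopf H \<gamma>) = \<S> \<circ> two_sided_conv u u'"
    by (simp add: fun_eq_iff twisted_antipode)
  ultimately show ?thesis using assms by (simp add: bij_comp)
qed

text \<open>The half-twisted product of S(h1) and h2 consists of S(h2) h3, which cancels, and the
  scalar \<open>\<gamma>'\<close>(S(h1), h4), which is u'. \<open>lconv_antipode\<close> is the
  mirror image.\<close>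

lemma rconv_antipode: "\<Delta> (smul H) h (\<lambda>a b. rconv (smul H) (mul H) \<gamma>' (\<S> a) b) = smul H (u' h) \<one>"
proof -
  let ?m = "smul H"
  note hs = hom_intros
  have "\<Delta> ?m h (\<lambda>a b. rconv ?m (mul H) \<gamma>' (\<S> a) b)
      = \<Delta> ?m h (\<lambda>a b. \<Delta> ?m a (\<lambda>a1 a2. \<Delta> ?m b (\<lambda>b1 b2. ?m (\<gamma>' (\<S> a1) b2) (\<S> a2 \<cdot> b1))))"
    unfolding rconv_def by (intro sweedler_cong comul_antipode hs)
  also have "\<dots> = \<Delta> ?m h (\<lambda>a1 t. \<Delta> ?m t (\<lambda>x b2. \<Delta> ?m x (\<lambda>a2 b1. ?m (\<gamma>' (\<S> a1) b2) (\<S> a2 \<cdot> b1))))"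
    by (rule coassoc_mid) (intro hs)+
  also have "\<dots> = \<Delta> ?m h (\<lambda>a1 t. \<Delta> ?m t (\<lambda>x b2. ?m (\<epsilon> x) (?m (\<gamma>' (\<S> a1) b2) \<one>)))"
    by (intro sweedler_cong antipode_left hs)
  also have "\<dots> = \<Delta> ?m h (\<lambda>a1 b2. ?m (\<gamma>' (\<S> a1) b2) \<one>)"
    by (intro sweedler_cong counit_left hs)
  also have "\<dots> = ?m (u' h) \<one>"
    unfolding u'_def sweedler_scale_left[OF module_H] ..
  finally show ?thesis .
qed

lemma lconv_antipode: "\<Delta> (smul H) h (\<lambda>a b. lconv (smul H) \<gamma> (mul H) a (\<S> b)) = smul H (u h) \<one>"
proof -
  let ?m = "smul H"
  note hs = hom_intros
  have "\<Delta> ?m h (\<lambda>a b. lconv ?m \<gamma> (mul H) a (\<S> b))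
      = \<Delta> ?m h (\<lambda>a b. \<Delta> ?m a (\<lambda>a1 a2. \<Delta> ?m b (\<lambda>b1 b2. ?m (\<gamma> a1 (\<S> b2)) (a2 \<cdot> \<S> b1))))"
    unfolding lconv_def by (intro sweedler_cong comul_antipode hs)
  also have "\<dots> = \<Delta> ?m h (\<lambda>a1 t. \<Delta> ?m t (\<lambda>x b2. \<Delta> ?m x (\<lambda>a2 b1. ?m (\<gamma> a1 (\<S> b2)) (a2 \<cdot> \<S> b1))))"
    by (rule coassoc_mid) (intro hs)+
  also have "\<dots> = \<Delta> ?m h (\<lambda>a1 t. \<Delta> ?m t (\<lambda>x b2. ?m (\<epsilon> x) (?m (\<gamma> a1 (\<S> b2)) \<one>)))"
    by (intro sweedler_cong antipode_right hs)
  also have "\<dots> = \<Delta> ?m h (\<lambda>a1 b2. ?m (\<gamma> a1 (\<S> b2)) \<one>)"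
    by (intro sweedler_cong counit_left hs)
  also have "\<dots> = ?m (u h) \<one>"
    unfolding u_def sweedler_scale_left[OF module_H] ..
  finally show ?thesis .
qed

text \<open>The leading \<gamma> of the product and the u' of the twisted antipode form
  \<gamma>(S(h3), h5) u'(h4), which \<open>antipode_cocycle_u'\<close> removes. The half-twisted
  product of S(h2) and h6 then gives another u' by \<open>rconv_antipode\<close>, and this one
  cancels u(h1).\<close>

lemma twisted_antipode_left:
  "\<Delta> (smul H) h (\<lambda>x b. antipode (twisted_hopf H \<gamma>) x \<star> b) = smul H (\<epsilon> h) \<one>"
proof -
  let ?m = "smul H"
  let ?T = "rconv ?m (mul H) \<gamma>'"
  note bT = bilin_rconv[OF form_cinv bilin_mul]
  note hs = hom_intros bilin_hom1[OF bT] bilin_hom2[OF bT]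
  note ss = module.scale_scale[OF module_H] and sc = sweedler_scale[OF module_H]
  have tm: "\<S> c \<star> b = \<Delta> ?m c (\<lambda>c1 c2. \<Delta> ?m b (\<lambda>b1 b2. ?m (\<gamma> (\<S> c2) b1) (?T (\<S> c1) b2)))" for b c
    unfolding tmul_lconv lconv_def by (rule comul_antipode) (intro hs)
  have hb: "module_hom ?m ?m (\<lambda>x. \<S> x \<star> b)" for b by (intro hs)
  have "\<Delta> ?m h (\<lambda>x b. antipode (twisted_hopf H \<gamma>) x \<star> b)
      = \<Delta> ?m h (\<lambda>x b. \<Delta> ?m x (\<lambda>a y. \<Delta> ?m y (\<lambda>c d. ?m (u a * u' d) (\<S> c \<star> b))))"
    unfolding twisted_antipode two_sided_conv_def sweedler_hom[OF hb] module_hom.scale[OF hb] ..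
  also have "\<dots> = \<Delta> ?m h (\<lambda>x b. \<Delta> ?m x (\<lambda>a y. \<Delta> ?m y (\<lambda>c d. \<Delta> ?m c (\<lambda>c1 c2. \<Delta> ?m b (\<lambda>b1 b2.
      ?m (\<gamma> (\<S> c2) b1 * u' d) (?m (u a) (?T (\<S> c1) b2)))))))"
    unfolding tm sc[symmetric] ss by (simp only: mult_ac)
  also have "\<dots> = \<Delta> ?m h (\<lambda>x b. \<Delta> ?m x (\<lambda>a y. \<Delta> ?m y (\<lambda>c1 w. \<Delta> ?m w (\<lambda>c2 d. \<Delta> ?m b (\<lambda>b1 b2.
      ?m (\<gamma> (\<S> c2) b1 * u' d) (?m (u a) (?T (\<S> c1) b2)))))))"
    by (intro sweedler_cong coassoc hs)
  also have "\<dots> = \<Delta> ?m h (\<lambda>a t. \<Delta> ?m t (\<lambda>y b. \<Delta> ?m y (\<lambda>c1 w. \<Delta> ?m w (\<lambda>c2 d. \<Delta> ?m b (\<lambda>b1 b2.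
      ?m (\<gamma> (\<S> c2) b1 * u' d) (?m (u a) (?T (\<S> c1) b2)))))))"
    by (rule coassoc) (intro hs)
  also have "\<dots> = \<Delta> ?m h (\<lambda>a t. \<Delta> ?m t (\<lambda>c1 t. \<Delta> ?m t (\<lambda>w b. \<Delta> ?m w (\<lambda>c2 d. \<Delta> ?m b (\<lambda>b1 b2.
      ?m (\<gamma> (\<S> c2) b1 * u' d) (?m (u a) (?T (\<S> c1) b2)))))))"
    by (rule sweedler_cong, rule coassoc) (intro hs)
  also have "\<dots> = \<Delta> ?m h (\<lambda>a t. \<Delta> ?m t (\<lambda>c1 t. \<Delta> ?m t (\<lambda>c2 s. \<Delta> ?m s (\<lambda>z b2. \<Delta> ?m z (\<lambda>d b1.
      ?m (\<gamma> (\<S> c2) b1 * u' d) (?m (u a) (?T (\<S> c1) b2)))))))"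
    by (rule sweedler_cong, rule sweedler_cong, rule coassoc_mid) (intro hs)+
  also have "\<dots> = \<Delta> ?m h (\<lambda>a t. \<Delta> ?m t (\<lambda>c1 t. \<Delta> ?m t (\<lambda>v b2. \<Delta> ?m v (\<lambda>c2 z. \<Delta> ?m z (\<lambda>d b1.
      ?m (\<gamma> (\<S> c2) b1 * u' d) (?m (u a) (?T (\<S> c1) b2)))))))"
    by (rule sweedler_cong, rule sweedler_cong, rule coassoc[symmetric]) (intro hs)
  also have "\<dots> = \<Delta> ?m h (\<lambda>a t. \<Delta> ?m t (\<lambda>c1 t. \<Delta> ?m t (\<lambda>v b2. ?m (\<epsilon> v) (?m (u a) (?T (\<S> c1) b2)))))"
    by (simp only: sweedler_scale_left[OF module_H] antipode_cocycle_u')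
  also have "\<dots> = \<Delta> ?m h (\<lambda>a t. \<Delta> ?m t (\<lambda>c1 b2. ?m (u a) (?T (\<S> c1) b2)))"
    by (intro sweedler_cong counit_left hs)
  also have "\<dots> = \<Delta> ?m h (\<lambda>a t. ?m (u a * u' t) \<one>)"
    unfolding sc rconv_antipode ss ..
  also have "\<dots> = ?m (\<epsilon> h) \<one>"
    unfolding sweedler_scale_left[OF module_H] u_u' ..
  finally show ?thesis .
qed

text \<open>Now the final \<open>\<gamma>'\<close> of the product is split off:
  \<open>\<gamma>'\<close>(h2, S(h4)) u(h3) disappears by \<open>cinv_antipode_u\<close>, the rest
  gives u by \<open>lconv_antipode\<close>, and this u cancels the u' of the twisted
  antipode.\<close>

lemma twisted_antipode_right:
  "\<Delta> (smul H) h (\<lambda>a x. a \<star> antipode (twisted_hopf H \<gamma>) x) = smul H (\<epsilon> h) \<one>"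
proof -
  let ?m = "smul H"
  let ?L = "lconv ?m \<gamma> (mul H)"
  note bL = bilin_lconv[OF form_cocycle bilin_mul]
  note hs = hom_intros bilin_hom1[OF bL] bilin_hom2[OF bL]
  note ss = module.scale_scale[OF module_H] and sc = sweedler_scale[OF module_H]
  have tm: "a \<star> \<S> d = \<Delta> ?m a (\<lambda>a1 a2. \<Delta> ?m d (\<lambda>d1 d2. ?m (\<gamma>' a2 (\<S> d1)) (?L a1 (\<S> d2))))" for a d
    unfolding tmul_rconv rconv_def by (intro sweedler_cong comul_antipode hs)
  have hb: "module_hom ?m ?m (\<lambda>x. a \<star> \<S> x)" for a by (intro hs)
  have "\<Delta> ?m h (\<lambda>a x. a \<star> antipode (twisted_hopf H \<gamma>) x)
      = \<Delta> ?m h (\<lambda>a x. \<Delta> ?m x (\<lambda>c y. \<Delta> ?m y (\<lambda>d e. ?m (u c * u' e) (a \<star> \<S> d))))"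
    unfolding twisted_antipode two_sided_conv_def sweedler_hom[OF hb] module_hom.scale[OF hb] ..
  also have "\<dots> = \<Delta> ?m h (\<lambda>a x. \<Delta> ?m a (\<lambda>a1 a2. \<Delta> ?m x (\<lambda>c y. \<Delta> ?m y (\<lambda>d e. \<Delta> ?m d (\<lambda>d1 d2.
      ?m (\<gamma>' a2 (\<S> d1) * u c) (?m (u' e) (?L a1 (\<S> d2))))))))"
    unfolding tm sc[symmetric] ss
    by (rule sweedler_cong, rule trans[OF _ sweedler_swap[OF module_H]], rule sweedler_cong,
      rule trans[OF _ sweedler_swap[OF module_H]], rule sweedler_cong) (simp only: mult_ac)
  also have "\<dots> = \<Delta> ?m h (\<lambda>a1 t. \<Delta> ?m t (\<lambda>a2 s. \<Delta> ?m s (\<lambda>c y. \<Delta> ?m y (\<lambda>d e. \<Delta> ?m d (\<lambda>d1 d2.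
      ?m (\<gamma>' a2 (\<S> d1) * u c) (?m (u' e) (?L a1 (\<S> d2))))))))"
    by (rule coassoc_right) (intro hs)+
  also have "\<dots> = \<Delta> ?m h (\<lambda>a1 t. \<Delta> ?m t (\<lambda>a2 s. \<Delta> ?m s (\<lambda>c y. \<Delta> ?m y (\<lambda>d1 w. \<Delta> ?m w (\<lambda>d2 e.
      ?m (\<gamma>' a2 (\<S> d1) * u c) (?m (u' e) (?L a1 (\<S> d2))))))))"
    by (intro sweedler_cong coassoc hs)
  also have "\<dots> = \<Delta> ?m h (\<lambda>a1 t. \<Delta> ?m t (\<lambda>a2 s. \<Delta> ?m s (\<lambda>z w. \<Delta> ?m z (\<lambda>c d1. \<Delta> ?m w (\<lambda>d2 e.
      ?m (\<gamma>' a2 (\<S> d1) * u c) (?m (u' e) (?L a1 (\<S> d2))))))))"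
    by (rule sweedler_cong, rule sweedler_cong, rule coassoc[symmetric]) (intro hs)
  also have "\<dots> = \<Delta> ?m h (\<lambda>a1 t. \<Delta> ?m t (\<lambda>v w. \<Delta> ?m v (\<lambda>a2 z. \<Delta> ?m z (\<lambda>c d1. \<Delta> ?m w (\<lambda>d2 e.
      ?m (\<gamma>' a2 (\<S> d1) * u c) (?m (u' e) (?L a1 (\<S> d2))))))))"
    by (rule sweedler_cong, rule coassoc[symmetric]) (intro hs)
  also have "\<dots> = \<Delta> ?m h (\<lambda>a1 t. \<Delta> ?m t (\<lambda>v w. ?m (\<epsilon> v) (\<Delta> ?m w (\<lambda>d2 e. ?m (u' e) (?L a1 (\<S> d2))))))"
    unfolding cinv_antipode_u[symmetric] sweedler_scale_left[OF module_H, symmetric] sc ..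
  also have "\<dots> = \<Delta> ?m h (\<lambda>a1 w. \<Delta> ?m w (\<lambda>d2 e. ?m (u' e) (?L a1 (\<S> d2))))"
    by (intro sweedler_cong counit_left hs)
  also have "\<dots> = \<Delta> ?m h (\<lambda>x e. \<Delta> ?m x (\<lambda>a1 d2. ?m (u' e) (?L a1 (\<S> d2))))"
    by (rule coassoc[symmetric]) (intro hs)
  also have "\<dots> = \<Delta> ?m h (\<lambda>x e. ?m (u x * u' e) \<one>)"
    unfolding sc lconv_antipode ss mult.commute[of "u' _"] ..
  also have "\<dots> = ?m (\<epsilon> h) \<one>"
    unfolding sweedler_scale_left[OF module_H] u_u' ..
  finally show ?thesis .
qed

lemma hopf_twisted: "hopf_algebra (twisted_hopf H \<gamma>)"
proof -
  have "module_hom (smul H) (smul H) (antipode (twisted_hopf H \<gamma>))"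
    unfolding twisted_antipode[abs_def]
    by (intro hom_comp[OF antipode_hom] hom_two_sided_conv u_hom)
  then show ?thesis
    using bialgebra_twisted twisted_antipode_left twisted_antipode_right
    by (simp add: hopf_algebra_def)
qed

end

section \<open>Hopf-Galois extensions\<close>

definition balanced :: "('k::comm_ring_1, 'a::ab_group_add, 'z) alg_scheme \<Rightarrow> 'a set \<Rightarrow> ('k \<Rightarrow> 't \<Rightarrow> 't) \<Rightarrow> ('a \<Rightarrow> 'a \<Rightarrow> 't::ab_group_add) \<Rightarrow> bool" where
  "balanced A B s f \<longleftrightarrow> bilin (smul A) (smul A) s f \<and> (\<forall>a b a'. b \<in> B \<longrightarrow> f (mul A a b) a' = f a (mul A b a'))"

lemma subspace_balanced_null: "module.subspace fscale (balanced_null A B)"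
  unfolding balanced_null_def by (rule module.subspace_span[OF module_fscale])

lemma sweedler_balanced:
  assumes f: "balanced A B s f"
  shows "sweedler s (coset (balanced_null A B) x) f = lin_ext s (\<lambda>(a, b). f a b) x"
proof -
  have bf: "bilin (smul A) (smul A) s f" using f by (simp add: balanced_def)
  note m = bilin_modules(3)[OF bf]
  interpret L: module_hom fscale s "lin_ext s (\<lambda>(a, b). f a b)"
    by (rule module_hom_lin_ext[OF m])
  have "lin_ext s (\<lambda>(a, b). f a b) z = 0" if "z \<in> balanced_null A B" for z
    using that unfolding balanced_null_def
    by (rule L.eq_0_on_span[rotated])
      (use f in \<open>auto simp: lin_ext_null2[OF bf] L.diff lin_ext_gen[OF m] balanced_def\<close>)
  from this[OF rep_coset[OF subspace_balanced_null]] show ?thesis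
    by (simp add: sweedler_def L.diff)
qed

lemma balanced_eqI:
  fixes A :: "('k::comm_ring_1, 'a::ab_group_add, 'z) alg_scheme"
  assumes m: "module (smul A)" and X: "X \<in> balanced_tensor A B" and Y: "Y \<in> balanced_tensor A B"
    and eq: "\<And>f :: _ \<Rightarrow> _ \<Rightarrow> 'k cog. balanced A B cog_scale f \<Longrightarrow> sweedler cog_scale X f = sweedler cog_scale Y f"
  shows "X = Y"
proof -
  let ?N = "balanced_null A B"
  have r: "Z = coset ?N (rep Z)" if "Z \<in> balanced_tensor A B" for Z
    using that coset_rep[OF subspace_balanced_null] by (fastforce simp: balanced_tensor_def)
  have "coset ?N (rep X) = coset ?N (rep Y)"
  proof (rule coset_eqI_cog[OF subspace_balanced_null])
    fix g :: "_ \<Rightarrow> 'k cog"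
    assume g: "module_hom fscale cog_scale g" "\<And>n. n \<in> ?N \<Longrightarrow> g n = 0"
    interpret g: module_hom fscale cog_scale g by fact
    have [simp]: "(\<lambda>(a, b). g (gen (a, b))) = (\<lambda>p. g (gen p))" by (simp add: fun_eq_iff)
    have N: "n \<in> nul A A \<Longrightarrow> n \<in> ?N" "b \<in> B \<Longrightarrow> gen (mul A a b, a') - gen (a, mul A b a') \<in> ?N" for n a b a'
      unfolding balanced_null_def by (rule g.m1.span_base, blast)+
    have "bilin (smul A) (smul A) cog_scale (\<lambda>a b. g (gen (a, b)))"
      by (rule null2_bilin[OF g(1) _ m m]) (intro g(2) N)
    moreover have "g (gen (mul A a b, a')) = g (gen (a, mul A b a'))" if "b \<in> B" for a b a'
      using g(2)[OF N(2)[OF that]] by (simp add: g.diff)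
    ultimately have "balanced A B cog_scale (\<lambda>a b. g (gen (a, b)))" by (simp add: balanced_def)
    from eq[OF this] show "g (rep X) = g (rep Y)"
      by (simp add: hom_eq_lin_ext[OF g(1), of "rep X"] hom_eq_lin_ext[OF g(1), of "rep Y"] sweedler_def)
  qed
  with r[OF X] r[OF Y] show ?thesis by simp
qed

lemma canonical_map_bilin:
  assumes "bilin (smul A) (smul H) s F"
  shows "sweedler s (canonical_map H A X) F
    = sweedler s X (\<lambda>a a'. sweedler s (rcoact A a') (\<lambda>a0 h. F (mul A a a0) h))"
  using bilin_modules(3)[OF assms]
  by (simp add: canonical_map_def sweedler_coset[OF assms] lin_ext_sweedler lin_ext_gen)

lemma canonical_map_in_tens: "canonical_map H A X \<in> tens A H"
  by (simp add: canonical_map_def coset_in_tensor2)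

context rcomod
begin

abbreviation coinv ("\<B>") where "\<B> \<equiv> coinvariants H A"

lemma rcoact_coinv:
  assumes "b \<in> \<B>" "bilin (smul A) (smul H) s F"
  shows "\<delta> s b F = F b \<one>"
  using assms(1) bilin_modules(3)[OF assms(2)]
  by (simp add: coinvariants_def sweedler_coset[OF assms(2)] lin_ext_gen)

lemma coinvI:
  assumes "\<And>F :: _ \<Rightarrow> _ \<Rightarrow> 'k cog. bilin (smul A) (smul H) cog_scale F \<Longrightarrow> \<delta> cog_scale b F = F b \<one>"
  shows "b \<in> \<B>"
proof -
  have "rcoact A b = coset (nul A H) (gen (b, \<one>))"
  proof (rule tens_eqI[OF module_A module_H _ coset_in_tensor2])
    show "rcoact A b \<in> tens A H" using tmap_rcoact by (simp add: tmap_def)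
    fix F :: "_ \<Rightarrow> _ \<Rightarrow> 'k cog"
    assume F: "bilin (smul A) (smul H) cog_scale F"
    then show "\<delta> cog_scale b F = sweedler cog_scale (coset (nul A H) (gen (b, \<one>))) F"
      by (simp add: assms sweedler_coset[OF F] lin_ext_gen module_cog_scale)
  qed
  then show ?thesis by (simp add: coinvariants_def)
qed

text \<open>The well-definedness of the canonical map over B, and at the same time the form in which
  it is evaluated under test maps.\<close>

lemma balanced_canonical:
  assumes F: "bilin (smul A) (smul H) s F"
  shows "balanced A \<B> s (\<lambda>a a'. \<delta> s a' (\<lambda>a0 h. F (a \<odot> a0) h))"
proof -
  note hs = hom_intros bilin_modules(3)[OF F] bilin_hom1[OF F] bilin_hom2[OF F]
  have "\<delta> s a' (\<lambda>a0 h. F (a \<odot> b \<odot> a0) h) = \<delta> s (b \<odot> a') (\<lambda>a0 h. F (a \<odot> a0) h)" if b: "b \<in> \<B>" for a b a'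
  proof -
    have "\<delta> s (b \<odot> a') (\<lambda>a0 h. F (a \<odot> a0) h) = \<delta> s b (\<lambda>b0 h. \<delta> s a' (\<lambda>a0 k. F (a \<odot> (b0 \<odot> a0)) (h \<cdot> k)))"
      by (rule rcoact_mul) (intro hs)
    also have "\<dots> = \<delta> s a' (\<lambda>a0 k. F (a \<odot> (b \<odot> a0)) (\<one> \<cdot> k))"
      by (rule rcoact_coinv[OF b]) (intro hs)
    finally show ?thesis by (simp add: mult_A_assoc)
  qed
  moreover have "bilin (smul A) (smul A) s (\<lambda>a a'. \<delta> s a' (\<lambda>a0 h. F (a \<odot> a0) h))"
    by (intro hs)
  ultimately show ?thesis by (simp add: balanced_def)
qed

definition shift :: "('h \<Rightarrow> 'h \<Rightarrow> 'k) \<Rightarrow> ('a \<times> 'h \<Rightarrow>\<^sub>0 'k) set \<Rightarrow> ('a \<times> 'h \<Rightarrow>\<^sub>0 'k) set" where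
  "shift p Y = coset (nul A H) (sweedler fscale Y (\<lambda>a h. \<delta> fscale a (\<lambda>a0 a1. \<Delta> fscale h (\<lambda>h1 h2.
     fscale (p a1 h1) (gen (a0, h2))))))"

lemma shift_bilin:
  assumes "bilin (smul A) (smul H) s F"
  shows "sweedler s (shift p Y) F
    = sweedler s Y (\<lambda>a h. \<delta> s a (\<lambda>a0 a1. \<Delta> s h (\<lambda>h1 h2. s (p a1 h1) (F a0 h2))))"
  using bilin_modules(3)[OF assms]
  by (simp add: shift_def sweedler_coset[OF assms] lin_ext_sweedler lin_ext_gen lin_ext_fscale)

lemma shift_in_tens: "shift p Y \<in> tens A H"
  by (simp add: shift_def coset_in_tensor2)

text \<open>The first shift takes the last leg of the coproduct arising from a, but the first leg of
  that of h, and the second shift takes the neighbouring ones. This explains the crossed legs in the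
  hypothesis \<open>pq\<close>.\<close>

lemma shift_shift:
  assumes p: "form2 p" and q: "form2 q"
    and pq: "\<And>x y. \<Delta> (*) x (\<lambda>x1 x2. \<Delta> (*) y (\<lambda>y1 y2. p x1 y2 * q x2 y1)) = \<epsilon> x * \<epsilon> y"
    and Y: "Y \<in> tens A H"
  shows "shift p (shift q Y) = Y"
proof (rule tens_eqI[OF module_A module_H shift_in_tens Y])
  let ?s = "cog_scale :: 'k \<Rightarrow> 'k cog \<Rightarrow> 'k cog"
  fix F :: "_ \<Rightarrow> _ \<Rightarrow> 'k cog"
  assume F: "bilin (smul A) (smul H) ?s F"
  note m = module_cog_scale
  note hs = hom_intros bilin_hom1[OF F] bilin_hom2[OF F] bilin_hom1[OF p] bilin_hom2[OF p] bilin_hom1[OF q] bilin_hom2[OF q]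
  have eq: "\<delta> ?s a (\<lambda>a0 a1. \<Delta> ?s h (\<lambda>h1 h2. ?s (q a1 h1)
      (\<delta> ?s a0 (\<lambda>a0 a1. \<Delta> ?s h2 (\<lambda>h1 h2. ?s (p a1 h1) (F a0 h2)))))) = F a h" for a h
  proof -
    have "\<delta> ?s a (\<lambda>a0 a1. \<Delta> ?s h (\<lambda>h1 h2. ?s (q a1 h1)
        (\<delta> ?s a0 (\<lambda>a0 a1. \<Delta> ?s h2 (\<lambda>h1 h2. ?s (p a1 h1) (F a0 h2))))))
      = \<delta> ?s a (\<lambda>a0 x2. \<delta> ?s a0 (\<lambda>a0 x1. \<Delta> ?s h (\<lambda>h1 t. \<Delta> ?s t (\<lambda>h2 h3. ?s (p x1 h2 * q x2 h1) (F a0 h3)))))"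
      unfolding sweedler_scale[OF m, symmetric] module.scale_scale[OF m]
      by (rule sweedler_cong, rule trans[OF sweedler_swap[OF m]]) (simp only: mult.commute)
    also have "\<dots> = \<delta> ?s a (\<lambda>a0 x. \<Delta> ?s x (\<lambda>x1 x2. \<Delta> ?s h (\<lambda>h1 t. \<Delta> ?s t (\<lambda>h2 h3. ?s (p x1 h2 * q x2 h1) (F a0 h3)))))"
      by (rule nest_lawD[OF rcoact_law]) (intro hs)
    also have "\<dots> = \<delta> ?s a (\<lambda>a0 x. \<Delta> ?s x (\<lambda>x1 x2. \<Delta> ?s h (\<lambda>y h3. \<Delta> ?s y (\<lambda>h1 h2. ?s (p x1 h2 * q x2 h1) (F a0 h3)))))"
      by (intro sweedler_cong coassoc[symmetric] hs)
    also have "\<dots> = \<delta> ?s a (\<lambda>a0 x. \<Delta> ?s h (\<lambda>y h3. \<Delta> ?s x (\<lambda>x1 x2. \<Delta> ?s y (\<lambda>h1 h2. ?s (p x1 h2 * q x2 h1) (F a0 h3)))))"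
      by (rule sweedler_cong, rule sweedler_swap[OF m])
    also have "\<dots> = \<delta> ?s a (\<lambda>a0 x. \<Delta> ?s h (\<lambda>y h3. ?s (\<epsilon> x * \<epsilon> y) (F a0 h3)))"
      by (simp only: sweedler_scale_left[OF m] pq)
    also have "\<dots> = \<delta> ?s a (\<lambda>a0 x. ?s (\<epsilon> x) (\<Delta> ?s h (\<lambda>y h3. ?s (\<epsilon> y) (F a0 h3))))"
      unfolding module.scale_scale[OF m, symmetric] sweedler_scale[OF m] ..
    also have "\<dots> = \<Delta> ?s h (\<lambda>y h3. ?s (\<epsilon> y) (F a h3))"
      by (rule rcoact_counit) (intro hs)
    also have "\<dots> = F a h"
      by (rule counit_left) (intro hs)
    finally show ?thesis .
  qed
  have b: "bilin (smul A) (smul H) ?s (\<lambda>a h. \<delta> ?s a (\<lambda>a0 a1. \<Delta> ?s h (\<lambda>h1 h2. ?s (p a1 h1) (F a0 h2))))"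
    by (intro hs)
  show "sweedler ?s (shift p (shift q Y)) F = sweedler ?s Y F"
    unfolding shift_bilin[OF F] shift_bilin[OF b] eq ..
qed

end

section \<open>The right twist and the canonical map\<close>

locale rcomod_hopf_cocycle = rcomod_cocycle H A \<gamma> + hopf_cocycle H \<gamma>
  for H :: "('k::comm_ring_1, 'h::ab_group_add, 'y) hopf_scheme"
    and A :: "('k, 'a::ab_group_add, 'h, 'z) right_comod_alg_scheme" and \<gamma>
begin

lemma coinvariants_right_twist [simp]: "coinvariants (twisted_hopf H \<gamma>) (right_twist H \<gamma> A) = \<B>"
  by (simp add: coinvariants_def)

lemma rmul_coinv_right:
  assumes "b \<in> \<B>"
  shows "a \<bullet> b = a \<odot> b"
proof -
  have "a \<bullet> b = \<delta> (smul A) a (\<lambda>a0 h. smul A (\<gamma>' h \<one>) (a0 \<odot> b))"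
    unfolding rmul_eq by (rule sweedler_cong, rule rcoact_coinv[OF assms]) (intro hom_intros)
  also have "\<dots> = a \<odot> b"
    unfolding cinv_one by (rule rcoact_counit) (intro hom_intros)
  finally show ?thesis .
qed

lemma rmul_coinv_left:
  assumes "b \<in> \<B>"
  shows "b \<bullet> a = b \<odot> a"
proof -
  have "b \<bullet> a = \<delta> (smul A) a (\<lambda>a0 h. smul A (\<gamma>' \<one> h) (b \<odot> a0))"
    unfolding rmul_eq by (rule rcoact_coinv[OF assms]) (intro hom_intros)
  also have "\<dots> = b \<odot> a"
    unfolding cinv_one by (rule rcoact_counit) (intro hom_intros)
  finally show ?thesis .
qed

lemma balanced_null_right_twist: "balanced_null (right_twist H \<gamma> A) \<B> = balanced_null A \<B>"
proof -
  have "{gen (a \<bullet> b, a') - gen (a, b \<bullet> a') :: 'a \<times> 'a \<Rightarrow>\<^sub>0 'k |a b a'. b \<in> \<B>} = {gen (a \<odot> b, a') - gen (a, b \<odot> a') |a b a'. b \<in> \<B>}"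
    by (intro Collect_cong ex_cong1) (auto simp: rmul_coinv_left rmul_coinv_right)
  then show ?thesis by (simp add: balanced_null_def)
qed

text \<open>Under a test map, the shift adds rf on the H-legs to the \<open>\<gamma>'\<close> of the
  twisted product. Once the legs of a' are regrouped into one coproduct, these two factors are the
  left side of \<open>cinv_rf\<close>.\<close>

lemma canonical_map_right_twist:
  assumes X: "X \<in> balanced_tensor A \<B>"
  shows "shift rf (canonical_map (twisted_hopf H \<gamma>) (right_twist H \<gamma> A) X) = canonical_map H A X"
proof (rule tens_eqI[OF module_A module_H shift_in_tens canonical_map_in_tens])
  let ?s = "cog_scale :: 'k \<Rightarrow> 'k cog \<Rightarrow> 'k cog"
  fix F :: "_ \<Rightarrow> _ \<Rightarrow> 'k cog"
  assume F: "bilin (smul A) (smul H) ?s F"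
  note m = module_cog_scale
  note hs = hom_intros bilin_hom1[OF F] bilin_hom2[OF F]
  note sw = sweedler_swap[OF m] and ss = module.scale_scale[OF m]
  have "\<delta> ?s a' (\<lambda>b h. \<delta> ?s (a \<bullet> b) (\<lambda>c x. \<Delta> ?s h (\<lambda>h1 h2. ?s (rf x h1) (F c h2))))
      = \<delta> ?s a' (\<lambda>b h. F (a \<odot> b) h)" for a a'
  proof -
    have "\<delta> ?s a' (\<lambda>b h. \<delta> ?s (a \<bullet> b) (\<lambda>c x. \<Delta> ?s h (\<lambda>h1 h2. ?s (rf x h1) (F c h2))))
      = \<delta> ?s a' (\<lambda>b h. \<delta> ?s a (\<lambda>a0 x. \<delta> ?s b (\<lambda>b0 y. \<Delta> ?s x (\<lambda>x1 x2. \<Delta> ?s y (\<lambda>y1 y2. ?s (\<gamma>' x2 y2)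
          (\<Delta> ?s h (\<lambda>h1 h2. ?s (rf (x1 \<cdot> y1) h1) (F (a0 \<odot> b0) h2))))))))"
      by (intro sweedler_cong rcoact_rmul hs)
    also have "\<dots> = \<delta> ?s a (\<lambda>a0 x. \<delta> ?s a' (\<lambda>b h. \<delta> ?s b (\<lambda>b0 y. \<Delta> ?s y (\<lambda>y1 y2. \<Delta> ?s h (\<lambda>h1 h2. \<Delta> ?s x (\<lambda>x1 x2.
          ?s (\<gamma>' x2 y2 * rf (x1 \<cdot> y1) h1) (F (a0 \<odot> b0) h2)))))))"
      unfolding sweedler_scale[OF m, symmetric] ss
      by (rule trans[OF sw], rule sweedler_cong, rule sweedler_cong, rule sweedler_cong,
        rule trans[OF sw], rule sweedler_cong, rule sw)
    also have "\<dots> = \<delta> ?s a (\<lambda>a0 x. \<delta> ?s a' (\<lambda>b0 t. \<Delta> ?s t (\<lambda>y h. \<Delta> ?s y (\<lambda>y1 y2. \<Delta> ?s h (\<lambda>h1 h2. \<Delta> ?s x (\<lambda>x1 x2.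
          ?s (\<gamma>' x2 y2 * rf (x1 \<cdot> y1) h1) (F (a0 \<odot> b0) h2)))))))"
      by (rule sweedler_cong, rule nest_lawD[OF rcoact_law]) (intro hs)
    also have "\<dots> = \<delta> ?s a (\<lambda>a0 x. \<delta> ?s a' (\<lambda>b0 t. \<Delta> ?s t (\<lambda>y1 t. \<Delta> ?s t (\<lambda>w h2. \<Delta> ?s w (\<lambda>y2 h1. \<Delta> ?s x (\<lambda>x1 x2.
          ?s (\<gamma>' x2 y2 * rf (x1 \<cdot> y1) h1) (F (a0 \<odot> b0) h2)))))))"
      by (rule sweedler_cong, rule sweedler_cong, rule coassoc_mid) (intro hs)+
    also have "\<dots> = \<delta> ?s a (\<lambda>a0 x. \<delta> ?s a' (\<lambda>b0 t. \<Delta> ?s t (\<lambda>y h2. \<Delta> ?s y (\<lambda>y1 w. \<Delta> ?s w (\<lambda>y2 h1. \<Delta> ?s x (\<lambda>x1 x2.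
          ?s (\<gamma>' x2 y2 * rf (x1 \<cdot> y1) h1) (F (a0 \<odot> b0) h2)))))))"
      by (rule sweedler_cong, rule sweedler_cong, rule coassoc[symmetric]) (intro hs)
    also have "\<dots> = \<delta> ?s a (\<lambda>a0 x. \<delta> ?s a' (\<lambda>b0 t. \<Delta> ?s t (\<lambda>y h2. \<Delta> ?s x (\<lambda>x1 x2. \<Delta> ?s y (\<lambda>y1 w. \<Delta> ?s w (\<lambda>y2 h1.
          ?s (\<gamma>' x2 y2 * rf (x1 \<cdot> y1) h1) (F (a0 \<odot> b0) h2)))))))"
      by (rule sweedler_cong, rule sweedler_cong, rule sweedler_cong, rule trans[OF _ sw], rule sweedler_cong, rule sw)
    also have "\<dots> = \<delta> ?s a (\<lambda>a0 x. \<delta> ?s a' (\<lambda>b0 t. \<Delta> ?s t (\<lambda>y h2. ?s (\<epsilon> y) (?s (\<epsilon> x) (F (a0 \<odot> b0) h2)))))"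
      unfolding sweedler_scale_left[OF m] cinv_rf ss by (simp only: mult.commute)
    also have "\<dots> = \<delta> ?s a (\<lambda>a0 x. \<delta> ?s a' (\<lambda>b0 h. ?s (\<epsilon> x) (F (a0 \<odot> b0) h)))"
      by (intro sweedler_cong counit_left hs)
    also have "\<dots> = \<delta> ?s a' (\<lambda>b h. F (a \<odot> b) h)"
      unfolding sweedler_scale[OF m] by (rule rcoact_counit) (intro hs)
    finally show ?thesis .
  qed
  moreover have b: "bilin (smul (right_twist H \<gamma> A)) (smul (twisted_hopf H \<gamma>)) ?s
      (\<lambda>a h. \<delta> ?s a (\<lambda>a0 a1. \<Delta> ?s h (\<lambda>h1 h2. ?s (rf a1 h1) (F a0 h2))))"
    by (simp, intro hs)
  ultimately show "sweedler ?s (shift rf (canonical_map (twisted_hopf H \<gamma>) (right_twist H \<gamma> A) X)) F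
      = sweedler ?s (canonical_map H A X) F"
    unfolding shift_bilin[OF F] canonical_map_bilin[OF F] canonical_map_bilin[OF b] by simp
qed

lemma hopf_galois_right_twist:
  assumes "bij \<S>"
  shows "hopf_galois (twisted_hopf H \<gamma>) (right_twist H \<gamma> A) \<longleftrightarrow> hopf_galois H A"
proof -
  let ?\<chi> = "canonical_map (twisted_hopf H \<gamma>) (right_twist H \<gamma> A)"
  have Q: "bij_betw (shift rf) (tens A H) (tens A H)"
    by (rule bij_betw_byWitness[where f' = "shift rg"])
      (auto simp: shift_shift form_rf form_rg rf_rg rg_rf shift_in_tens)
  have "bij_betw ?\<chi> (balanced_tensor A \<B>) (tens A H)
      \<longleftrightarrow> bij_betw (shift rf \<circ> ?\<chi>) (balanced_tensor A \<B>) (tens A H)"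
    by (rule bij_betw_comp_iff2[OF Q]) (use canonical_map_in_tens[of "twisted_hopf H \<gamma>" "right_twist H \<gamma> A"] in auto)
  also have "\<dots> \<longleftrightarrow> bij_betw (canonical_map H A) (balanced_tensor A \<B>) (tens A H)"
    by (rule bij_betw_cong) (simp add: canonical_map_right_twist)
  finally show ?thesis
    using hopf hopf_twisted assms bij_twisted_antipode rcomod right_comodule_right_twist
    by (simp add: hopf_galois_def balanced_tensor_def balanced_null_right_twist)
qed

end

section \<open>The left twist and the canonical map\<close>

context lcomod_cocycle
begin

text \<open>The analogue of \<open>lconv\<close> for a coaction: forms on K act on bilinear maps on
  A, compatibly with convolution. The twisted product is \<sigma> acting on the product of A, so
  twisting and untwisting become multiplications by \<sigma> and its inverse.\<close>

definition ltwist :: "('k \<Rightarrow> 't \<Rightarrow> 't) \<Rightarrow> ('l \<Rightarrow> 'l \<Rightarrow> 'k) \<Rightarrow> ('a \<Rightarrow> 'a \<Rightarrow> 't) \<Rightarrow> 'a \<Rightarrow> 'a \<Rightarrow> 't::ab_group_add" where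
  "ltwist s f G a b = \<rho> s a (\<lambda>k a0. \<rho> s b (\<lambda>l b0. s (f k l) (G a0 b0)))"

lemma bilin_ltwist:
  assumes f: "form2 f" and G: "bilin (smul A) (smul A) s G"
  shows "bilin (smul A) (smul A) s (ltwist s f G)"
  unfolding ltwist_def
  by (intro hom_intros bilin_modules(3)[OF G] bilin_hom1[OF f] bilin_hom2[OF f] bilin_hom1[OF G] bilin_hom2[OF G])

lemma ltwist_ltwist:
  assumes f: "form2 f" and g: "form2 g" and G: "bilin (smul A) (smul A) s G"
  shows "ltwist s f (ltwist s g G) = ltwist s (lconv (*) f g) G"
proof -
  note m = bilin_modules(3)[OF G]
  note pull = sweedler_scale[OF m, symmetric] sweedler_scale_left[OF m, symmetric] module.scale_scale[OF m]
  note h = bilin_hom1[OF f] bilin_hom2[OF f] bilin_hom1[OF G] bilin_hom2[OF G] bilin_hom1[OF g] bilin_hom2[OF g] m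
  show ?thesis
    unfolding lconv_def ltwist_def fun_eq_iff pull
    by (subst lcoact2) (intro allI hom_intros h refl)+
qed

lemma ltwist_e2:
  assumes G: "bilin (smul A) (smul A) s G"
  shows "ltwist s e2 G = G"
proof -
  note m = bilin_modules(3)[OF G]
  note h = bilin_hom1[OF G] bilin_hom2[OF G] m
  show ?thesis
    unfolding ltwist_def e2_def module.scale_scale[OF m, symmetric] sweedler_scale[OF m]
    by (subst lcoact_counit, (intro hom_intros h)[1])+ (rule refl)
qed

lemma ltwist_cocycle_cinv:
  assumes G: "bilin (smul A) (smul A) s G"
  shows "ltwist s \<sigma> (ltwist s (cinv H \<sigma>) G) = G" "ltwist s (cinv H \<sigma>) (ltwist s \<sigma> G) = G"
  by (simp_all add: ltwist_ltwist form_cocycle form_cinv G conv_cinv ltwist_e2)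

lemma lmul_ltwist:
  assumes "module_hom (smul A) s g"
  shows "g (a \<circ>\<^sub>\<sigma> b) = ltwist s \<sigma> (\<lambda>x y. g (x \<odot> y)) a b"
  unfolding ltwist_def by (rule hom_lmul[OF assms])

text \<open>The old product is the new one twisted by the inverse of \<sigma>. This permits the use
  of hypotheses about the twisted product in calculations that begin with the product of A.\<close>

lemma ltwist_mul:
  assumes c: "form2 c" and g: "module_hom (smul A) s g"
  shows "ltwist s c (\<lambda>x y. g (x \<odot> y)) = ltwist s (lconv (*) c (cinv H \<sigma>)) (\<lambda>x y. g (x \<circ>\<^sub>\<sigma> y))"
proof -
  note hg = hom_comp[OF g]
  have b: "bilin (smul A) (smul A) s (\<lambda>x y. g (x \<odot> y))"
    using g by (intro hom_intros hg)
  have "ltwist s (lconv (*) c (cinv H \<sigma>)) (\<lambda>x y. g (x \<circ>\<^sub>\<sigma> y))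
      = ltwist s (lconv (*) c (lconv (*) (cinv H \<sigma>) \<sigma>)) (\<lambda>x y. g (x \<odot> y))"
    by (simp add: lmul_ltwist[OF g] ltwist_ltwist b bilin_lconv c form_cinv form_cocycle lconv_lconv)
  then show ?thesis
    by (simp add: conv_cinv lconv_rconv_mult[of c e2] rconv_e2 c)
qed

text \<open>The target relations are a parameter because one formula, with \<sigma> or its inverse,
  serves for both directions between the two balanced tensor products.\<close>

definition twist_map :: "('a \<times> 'a \<Rightarrow>\<^sub>0 'k) set \<Rightarrow> ('l \<Rightarrow> 'l \<Rightarrow> 'k) \<Rightarrow> ('a \<times> 'a \<Rightarrow>\<^sub>0 'k) set \<Rightarrow> ('a \<times> 'a \<Rightarrow>\<^sub>0 'k) set" where
  "twist_map N f X = coset N (sweedler fscale X (ltwist fscale f (\<lambda>a b. gen (a, b))))"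

lemma lin_ext_twist_map:
  assumes "module s"
  shows "lin_ext s G (sweedler fscale X (ltwist fscale f (\<lambda>a b. gen (a, b))))
    = sweedler s X (ltwist s f (\<lambda>a b. G (a, b)))"
proof -
  have "lin_ext s G (ltwist fscale f (\<lambda>a b. gen (a, b)) a b) = ltwist s f (\<lambda>a b. G (a, b)) a b" for a b
    using assms by (simp add: ltwist_def lin_ext_sweedler lin_ext_fscale lin_ext_gen)
  then show ?thesis using assms by (simp add: lin_ext_sweedler)
qed

end

context bicomod
begin

definition act :: "('l \<Rightarrow> 'k) \<Rightarrow> 'a \<Rightarrow> 'a" where
  "act f a = \<rho> (smul A) a (\<lambda>k a0. smul A (f k) a0)"

lemma hom_act:
  assumes "module_hom (smul A) s g"
  shows "g (act f a) = \<rho> s a (\<lambda>k a0. s (f k) (g a0))"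
  by (simp add: act_def sweedler_hom[OF assms] module_hom.scale[OF assms])

text \<open>Since the two coactions commute, functionals on \<open>K\<close> act on the coinvariants.  This replaces
  the statement that the left coaction maps \<open>B\<close> to \<open>K \<otimes> B\<close>, which needs flatness.\<close>

lemma act_coinv:
  assumes f: "module_hom (smul K) (*) f" and b: "b \<in> \<B>"
  shows "act f b \<in> \<B>"
proof (rule coinvI)
  let ?s = "cog_scale :: 'k \<Rightarrow> 'k cog \<Rightarrow> 'k cog"
  fix F :: "_ \<Rightarrow> _ \<Rightarrow> 'k cog"
  assume F: "bilin (smul A) (smul H) ?s F"
  note m = module_cog_scale
  note hs = hom_intros bilin_hom1[OF F] bilin_hom2[OF F] hom_comp[OF f]
  have "\<delta> ?s (act f b) F = \<rho> ?s b (\<lambda>k a0. ?s (f k) (\<delta> ?s a0 F))"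
    by (rule hom_act) (intro hs F)
  also have "\<dots> = \<rho> ?s b (\<lambda>k a0. \<delta> ?s a0 (\<lambda>a h. ?s (f k) (F a h)))"
    unfolding sweedler_scale[OF m] ..
  also have "\<dots> = \<delta> ?s b (\<lambda>a0 h. \<rho> ?s a0 (\<lambda>k a. ?s (f k) (F a h)))"
    by (rule compat[symmetric]) (intro hs)
  also have "\<dots> = \<rho> ?s b (\<lambda>k a. ?s (f k) (F a \<one>))"
    by (rule rcoact_coinv[OF b]) (intro hs)
  also have "\<dots> = F (act f b) \<one>"
    by (rule hom_act[symmetric]) (intro hs)
  finally show "\<delta> ?s (act f b) F = F (act f b) \<one>" .
qed

text \<open>A sum over the left coaction of b is moved across the balanced tensor sign after its
  K-leg is evaluated: then one element of B stands there, by \<open>act_coinv\<close>. The product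
  is a parameter \<mu> since this is used for the original and for the twisted product.\<close>

lemma act_balanced:
  assumes f: "bilin (smul A) (smul A) s f" and \<mu>: "bilin (smul A) (smul A) (smul A) \<mu>"
    and bal: "\<And>a b a'. b \<in> \<B> \<Longrightarrow> f (\<mu> a b) a' = f a (\<mu> b a')"
    and p: "module_hom (smul K) (*) p" and b: "b \<in> \<B>"
  shows "\<rho> s b (\<lambda>k b0. s (p k) (f (\<mu> a b0) a')) = \<rho> s b (\<lambda>k b0. s (p k) (f a (\<mu> b0 a')))"
proof -
  note hs = hom_intros bilin_hom1[OF f] bilin_hom2[OF f] bilin_hom1[OF \<mu>] bilin_hom2[OF \<mu>]
  have "\<rho> s b (\<lambda>k b0. s (p k) (f (\<mu> a b0) a')) = f (\<mu> a (act p b)) a'"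
    by (rule hom_act[symmetric]) (intro hs)
  also have "\<dots> = f a (\<mu> (act p b) a')"
    by (rule bal[OF act_coinv[OF p b]])
  also have "\<dots> = \<rho> s b (\<lambda>k b0. s (p k) (f a (\<mu> b0 a')))"
    by (rule hom_act) (intro hs)
  finally show ?thesis .
qed

end

context bicomod_lcocycle
begin

abbreviation lmul' (infixl "\<diamondop>" 70) where "x \<diamondop> y \<equiv> mul (left_twist \<sigma> A) x y"
abbreviation inv_cocycle' ("\<sigma>''") where "\<sigma>' \<equiv> cinv K \<sigma>"

lemma coinvariants_left_twist [simp]: "coinvariants H (left_twist \<sigma> A) = \<B>"
  by (simp add: coinvariants_def)

text \<open>The cocycle condition turns the scalar of (a b) \<otimes> a' into that of a \<otimes> (b
  a'). For fixed K-legs of a and a' this scalar is a linear functional of the K-leg of b, which is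
  all that \<open>act_balanced\<close> asks for.\<close>

lemma balanced_ltwist:
  assumes f: "balanced A \<B> s f"
  shows "balanced (left_twist \<sigma> A) \<B> s (l.ltwist s \<sigma> f)"
proof -
  have bf: "bilin (smul A) (smul A) s f" using f by (simp add: balanced_def)
  note m = bilin_modules(3)[OF bf]
  note hs = hom_intros bilin_hom1[OF bf] bilin_hom2[OF bf] m
  note sw = sweedler_swap[OF m] and ss = module.scale_scale[OF m] and sc = sweedler_scale_left[OF m]
  have "l.ltwist s \<sigma> f (a \<diamondop> b) a' = l.ltwist s \<sigma> f a (b \<diamondop> a')" if b: "b \<in> \<B>" for a b a'
  proof -
    have "l.ltwist s \<sigma> f (a \<diamondop> b) a' = \<rho> s a' (\<lambda>n c. \<rho> s (a \<diamondop> b) (\<lambda>k x. s (\<sigma> k n) (f x c)))"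
      unfolding l.ltwist_def by (rule sw)
    also have "\<dots> = \<rho> s a' (\<lambda>n c. \<rho> s a (\<lambda>k a0. \<rho> s b (\<lambda>j b0. sweedler s (comul K k) (\<lambda>k1 k2. sweedler s (comul K j) (\<lambda>j1 j2.
        s (\<sigma> k1 j1) (s (\<sigma> (mul K k2 j2) n) (f (mul A a0 b0) c)))))))"
      by (intro sweedler_cong l.lcoact_lmul hs)
    also have "\<dots> = \<rho> s a (\<lambda>k a0. \<rho> s a' (\<lambda>n c. \<rho> s b (\<lambda>j b0.
        s (sweedler (*) (comul K j) (\<lambda>j1 j2. sweedler (*) (comul K n) (\<lambda>n1 n2. \<sigma> j1 n1 * \<sigma> k (mul K j2 n2))))
          (f (mul A a0 b0) c))))"
      unfolding ss sc l.cocycle by (rule sw)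
    also have "\<dots> = \<rho> s a (\<lambda>k a0. \<rho> s a' (\<lambda>n c. \<rho> s b (\<lambda>j b0.
        s (sweedler (*) (comul K j) (\<lambda>j1 j2. sweedler (*) (comul K n) (\<lambda>n1 n2. \<sigma> j1 n1 * \<sigma> k (mul K j2 n2))))
          (f a0 (mul A b0 c)))))"
      by (intro sweedler_cong act_balanced[OF bf bilin_mul_A _ _ b] hs) (use f in \<open>simp add: balanced_def\<close>)
    also have "\<dots> = \<rho> s a (\<lambda>k a0. \<rho> s b (\<lambda>j b0. \<rho> s a' (\<lambda>n c. sweedler s (comul K j) (\<lambda>j1 j2. sweedler s (comul K n) (\<lambda>n1 n2.
        s (\<sigma> j1 n1) (s (\<sigma> k (mul K j2 n2)) (f a0 (mul A b0 c))))))))"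
      unfolding ss sc by (rule sweedler_cong, rule sw)
    also have "\<dots> = \<rho> s a (\<lambda>k a0. \<rho> s (b \<diamondop> a') (\<lambda>n x. s (\<sigma> k n) (f a0 x)))"
      by (rule sweedler_cong, rule l.lcoact_lmul[symmetric]) (intro hs)
    finally show ?thesis unfolding l.ltwist_def .
  qed
  then show ?thesis
    using l.bilin_ltwist[OF l.form_cocycle bf] by (simp add: balanced_def)
qed

text \<open>The hypothesis on f concerns the twisted product, so products of A are first rewritten
  by \<open>ltwist_mul\<close>. On either side this produces a scalar of
  \<open>cocycle_inverse\<close>, here named \<open>?p\<close>, and \<open>act_balanced\<close>
  applies as before.\<close>

lemma balanced_ltwist_inverse:
  assumes f: "balanced (left_twist \<sigma> A) \<B> s f"
  shows "balanced A \<B> s (l.ltwist s \<sigma>' f)"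
proof -
  have bf: "bilin (smul A) (smul A) s f" using f by (simp add: balanced_def)
  note m = bilin_modules(3)[OF bf]
  note hs = hom_intros bilin_hom1[OF bf] bilin_hom2[OF bf] m
  note sw = sweedler_swap[OF m]
  let ?p = "\<lambda>k n j. sweedler (*) (comul K j) (\<lambda>j1 j2. sweedler (*) (comul K n) (\<lambda>n1 n2. \<sigma>' k (mul K j1 n1) * \<sigma>' j2 n2))"
  have "l.ltwist s \<sigma>' f (mul A a b) a' = l.ltwist s \<sigma>' f a (mul A b a')" if b: "b \<in> \<B>" for a b a'
  proof -
    have 1: "l.lconv (*) (\<lambda>k j. \<sigma>' (mul K k j) n) \<sigma>' k j = ?p k n j" for n k j
      unfolding l.lconv_def by (rule l.cocycle_inverse)
    have 2: "l.lconv (*) (\<lambda>j n. \<sigma>' k (mul K j n)) \<sigma>' j n = ?p k n j" for n k j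
      unfolding l.lconv_def ..
    have "l.ltwist s \<sigma>' f (mul A a b) a' = \<rho> s a' (\<lambda>n c. \<rho> s (mul A a b) (\<lambda>k x. s (\<sigma>' k n) (f x c)))"
      unfolding l.ltwist_def by (rule sw)
    also have "\<dots> = \<rho> s a' (\<lambda>n c. l.ltwist s (\<lambda>k j. \<sigma>' (mul K k j) n) (\<lambda>x y. f (mul A x y) c) a b)"
      unfolding l.ltwist_def by (intro sweedler_cong l.lcoact_mul hs)
    also have "\<dots> = \<rho> s a' (\<lambda>n c. l.ltwist s (l.lconv (*) (\<lambda>k j. \<sigma>' (mul K k j) n) \<sigma>') (\<lambda>x y. f (x \<diamondop> y) c) a b)"
      by (rule sweedler_cong, rule fun_cong, rule fun_cong, rule l.ltwist_mul) (intro hs)+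
    also have "\<dots> = \<rho> s a (\<lambda>k a0. \<rho> s a' (\<lambda>n c. \<rho> s b (\<lambda>j b0. s (?p k n j) (f (a0 \<diamondop> b0) c))))"
      unfolding l.ltwist_def 1 by (rule sw)
    also have "\<dots> = \<rho> s a (\<lambda>k a0. \<rho> s a' (\<lambda>n c. \<rho> s b (\<lambda>j b0. s (?p k n j) (f a0 (b0 \<diamondop> c)))))"
      by (intro sweedler_cong act_balanced[OF bf l.bilin_lmul _ _ b] hs) (use f in \<open>simp add: balanced_def\<close>)
    also have "\<dots> = \<rho> s a (\<lambda>k a0. l.ltwist s (l.lconv (*) (\<lambda>j n. \<sigma>' k (mul K j n)) \<sigma>') (\<lambda>x y. f a0 (x \<diamondop> y)) b a')"
      unfolding l.ltwist_def 2 by (rule sweedler_cong, rule sw)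
    also have "\<dots> = \<rho> s a (\<lambda>k a0. l.ltwist s (\<lambda>j n. \<sigma>' k (mul K j n)) (\<lambda>x y. f a0 (mul A x y)) b a')"
      by (rule sweedler_cong, rule fun_cong, rule fun_cong, rule l.ltwist_mul[symmetric]) (intro hs)+
    also have "\<dots> = l.ltwist s \<sigma>' f a (mul A b a')"
      unfolding l.ltwist_def by (rule sweedler_cong, rule l.lcoact_mul[symmetric]) (intro hs)
    finally show ?thesis .
  qed
  then show ?thesis
    using l.bilin_ltwist[OF l.form_cinv bf] by (simp add: balanced_def)
qed

abbreviation "to_untwisted \<equiv> l.twist_map (balanced_null A \<B>) \<sigma>"
abbreviation "from_untwisted \<equiv> l.twist_map (balanced_null (left_twist \<sigma> A) \<B>) \<sigma>'"

lemma to_untwisted_balanced: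
  assumes "balanced A \<B> s f"
  shows "sweedler s (to_untwisted X) f = sweedler s X (l.ltwist s \<sigma> f)"
proof -
  have "module s" using assms bilin_modules(3) by (auto simp: balanced_def)
  then show ?thesis
    by (simp add: l.twist_map_def sweedler_balanced[OF assms] l.lin_ext_twist_map)
qed

lemma from_untwisted_balanced:
  assumes "balanced (left_twist \<sigma> A) \<B> s f"
  shows "sweedler s (from_untwisted X) f = sweedler s X (l.ltwist s \<sigma>' f)"
proof -
  have "module s" using assms bilin_modules(3) by (auto simp: balanced_def)
  then show ?thesis
    by (simp add: l.twist_map_def sweedler_balanced[OF assms] l.lin_ext_twist_map)
qed

lemma twist_map_in: "l.twist_map (balanced_null C \<B>) f X \<in> balanced_tensor C \<B>"
  by (simp add: l.twist_map_def balanced_tensor_def)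

lemma to_untwisted_from_untwisted:
  assumes "X \<in> balanced_tensor A \<B>"
  shows "to_untwisted (from_untwisted X) = X"
proof (rule balanced_eqI[OF module_A twist_map_in assms])
  fix f :: "_ \<Rightarrow> _ \<Rightarrow> 'k cog"
  assume f: "balanced A \<B> cog_scale f"
  have "bilin (smul A) (smul A) cog_scale f" using f by (simp add: balanced_def)
  then show "sweedler cog_scale (to_untwisted (from_untwisted X)) f = sweedler cog_scale X f"
    by (simp add: to_untwisted_balanced[OF f] from_untwisted_balanced[OF balanced_ltwist[OF f]] l.ltwist_cocycle_cinv)
qed

lemma from_untwisted_to_untwisted:
  assumes "X \<in> balanced_tensor (left_twist \<sigma> A) \<B>"
  shows "from_untwisted (to_untwisted X) = X"
proof (rule balanced_eqI[OF _ twist_map_in assms])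
  fix f :: "_ \<Rightarrow> _ \<Rightarrow> 'k cog"
  assume f: "balanced (left_twist \<sigma> A) \<B> cog_scale f"
  have "bilin (smul A) (smul A) cog_scale f" using f by (simp add: balanced_def)
  then show "sweedler cog_scale (from_untwisted (to_untwisted X)) f = sweedler cog_scale X f"
    by (simp add: from_untwisted_balanced[OF f] to_untwisted_balanced[OF balanced_ltwist_inverse[OF f]] l.ltwist_cocycle_cinv)
qed (simp add: module_A)

text \<open>The form \<sigma> only reads the left coaction, which commutes with the right coaction
  inside the canonical map; so \<sigma> can be applied before or after it.\<close>

lemma canonical_map_left_twist: "canonical_map H A (to_untwisted X) = canonical_map H (left_twist \<sigma> A) X"
proof (rule tens_eqI[OF module_A module_H canonical_map_in_tens])
  show "canonical_map H (left_twist \<sigma> A) X \<in> tens A H"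
    using canonical_map_in_tens[of H "left_twist \<sigma> A" X] by simp
  let ?s = "cog_scale :: 'k \<Rightarrow> 'k cog \<Rightarrow> 'k cog"
  fix F :: "_ \<Rightarrow> _ \<Rightarrow> 'k cog"
  assume F: "bilin (smul A) (smul H) ?s F"
  then have F': "bilin (smul (left_twist \<sigma> A)) (smul H) ?s F" by simp
  note m = module_cog_scale
  note hs = hom_intros bilin_hom1[OF F] bilin_hom2[OF F]
  note sw = sweedler_swap[OF m]
  have "l.ltwist ?s \<sigma> (\<lambda>a a'. \<delta> ?s a' (\<lambda>a0 h. F (mul A a a0) h)) a a' = \<delta> ?s a' (\<lambda>a0 h. F (a \<diamondop> a0) h)" for a a'
  proof -
    have "l.ltwist ?s \<sigma> (\<lambda>a a'. \<delta> ?s a' (\<lambda>a0 h. F (mul A a a0) h)) a a'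
      = \<rho> ?s a (\<lambda>k a0. \<rho> ?s a' (\<lambda>j x. \<delta> ?s x (\<lambda>b0 h. ?s (\<sigma> k j) (F (mul A a0 b0) h))))"
      unfolding l.ltwist_def sweedler_scale[OF m, symmetric] ..
    also have "\<dots> = \<rho> ?s a (\<lambda>k a0. \<delta> ?s a' (\<lambda>x h. \<rho> ?s x (\<lambda>j b0. ?s (\<sigma> k j) (F (mul A a0 b0) h))))"
      by (intro sweedler_cong compat[symmetric] hs)
    also have "\<dots> = \<delta> ?s a' (\<lambda>x h. \<rho> ?s a (\<lambda>k a0. \<rho> ?s x (\<lambda>j b0. ?s (\<sigma> k j) (F (mul A a0 b0) h))))"
      by (rule sw)
    also have "\<dots> = \<delta> ?s a' (\<lambda>x h. F (a \<diamondop> x) h)"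
      by (rule sweedler_cong, rule l.hom_lmul[symmetric]) (intro hs)
    finally show ?thesis .
  qed
  then have "l.ltwist ?s \<sigma> (\<lambda>a a'. \<delta> ?s a' (\<lambda>a0 h. F (mul A a a0) h)) = (\<lambda>a a'. \<delta> ?s a' (\<lambda>a0 h. F (a \<diamondop> a0) h))"
    by (simp add: fun_eq_iff)
  then show "sweedler ?s (canonical_map H A (to_untwisted X)) F = sweedler ?s (canonical_map H (left_twist \<sigma> A) X) F"
    by (simp add: canonical_map_bilin[OF F] canonical_map_bilin[OF F'] to_untwisted_balanced[OF balanced_canonical[OF F]])
qed

lemma hopf_galois_left_twist: "hopf_galois H (left_twist \<sigma> A) \<longleftrightarrow> hopf_galois H A"
proof -
  let ?T = "balanced_tensor (left_twist \<sigma> A) \<B>"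
  have "bij_betw to_untwisted ?T (balanced_tensor A \<B>)"
    by (rule bij_betw_byWitness[where f' = from_untwisted])
      (auto simp: to_untwisted_from_untwisted from_untwisted_to_untwisted twist_map_in)
  from bij_betw_comp_iff[OF this, of "canonical_map H A" "tens A H"]
  have "bij_betw (canonical_map H A) (balanced_tensor A \<B>) (tens A H)
      \<longleftrightarrow> bij_betw (canonical_map H (left_twist \<sigma> A)) ?T (tens A H)"
    by (simp add: comp_def canonical_map_left_twist)
  then show ?thesis
    using rcomod right_comodule_left_twist by (auto simp: hopf_galois_def)
qed

end

section \<open>Principal comodule algebras\<close>

lemma
  assumes "module s"
  shows swap_out2: "sweedler s X (\<lambda>a b. sweedler s (Y a b) (\<lambda>c d. sweedler s P (\<lambda>x y. F a b c d x y)))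
      = sweedler s P (\<lambda>x y. sweedler s X (\<lambda>a b. sweedler s (Y a b) (\<lambda>c d. F a b c d x y)))"
    and swap_out3: "sweedler s X (\<lambda>a b. sweedler s (Y a b) (\<lambda>c d. sweedler s (Z a b c d) (\<lambda>e f. sweedler s P (\<lambda>x y. G a b c d e f x y))))
      = sweedler s P (\<lambda>x y. sweedler s X (\<lambda>a b. sweedler s (Y a b) (\<lambda>c d. sweedler s (Z a b c d) (\<lambda>e f. G a b c d e f x y))))"
proof -
  note sw = sweedler_swap[OF assms]
  show 2: "sweedler s X (\<lambda>a b. sweedler s (Y a b) (\<lambda>c d. sweedler s P (\<lambda>x y. F a b c d x y)))
      = sweedler s P (\<lambda>x y. sweedler s X (\<lambda>a b. sweedler s (Y a b) (\<lambda>c d. F a b c d x y)))"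
    for X :: "('m \<times> 'n \<Rightarrow>\<^sub>0 'a) set" and Y :: "'m \<Rightarrow> 'n \<Rightarrow> ('o \<times> 'p \<Rightarrow>\<^sub>0 'a) set" and P :: "('q \<times> 'r \<Rightarrow>\<^sub>0 'a) set" and F
    by (rule trans[OF sweedler_cong[OF sw] sw])
  show "sweedler s X (\<lambda>a b. sweedler s (Y a b) (\<lambda>c d. sweedler s (Z a b c d) (\<lambda>e f. sweedler s P (\<lambda>x y. G a b c d e f x y))))
      = sweedler s P (\<lambda>x y. sweedler s X (\<lambda>a b. sweedler s (Y a b) (\<lambda>c d. sweedler s (Z a b c d) (\<lambda>e f. G a b c d e f x y))))"
    by (rule trans[OF sweedler_cong[OF trans[OF sweedler_cong[OF sw] sw]] sw])
qed

section \<open>Scalar identities behind the deformed sections\<close>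

context hopf_cocycle
begin

text \<open>If \<open>s\<close> is a section and \<open>s(a\<^sub>0) = b \<otimes> a'\<close>, then
  \<open>W(a\<^sub>-\<^sub>1, b\<^sub>-\<^sub>1, a'\<^sub>-\<^sub>1) b\<^sub>0 \<otimes> a'\<^sub>0\<close> is a section of the left twist for \<open>W = wf\<close>; for a
  section \<open>s\<close> of the left twist, \<open>W = wg\<close> gives a section of the untwisted algebra.  The factors \<open>lf\<close>
  and \<open>lg\<close> correct for \<open>s\<close> not being \<open>K\<close>-colinear.\<close>

definition wf :: "'h \<Rightarrow> 'h \<Rightarrow> 'h \<Rightarrow> 'k" where "wf y = lconv (*) (\<lambda>p q. lf y (p \<cdot> q)) \<gamma>'"
definition wg :: "'h \<Rightarrow> 'h \<Rightarrow> 'h \<Rightarrow> 'k" where "wg y = lconv (*) \<gamma> (\<lambda>p q. lg y (p \<cdot> q))"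

lemma form3_wf: "form3 wf" and form3_wg: "form3 wg"
  unfolding wf_def[abs_def] wg_def[abs_def] lconv_def[abs_def] by (intro hom_intros)+

lemmas [hom_intros] = trilin_hom1[OF form3_wf] trilin_hom2[OF form3_wf] trilin_hom3[OF form3_wf]
  trilin_hom1[OF form3_wg] trilin_hom2[OF form3_wg] trilin_hom3[OF form3_wg]

text \<open>Ensures that the product of the two legs of the deformed section is the original
  element. It also shows that on a colinear section the correction by lf would be trivial.\<close>

lemma lf_diagonal: "\<Delta> (*) h (\<lambda>a b. lf a b) = \<epsilon> h"
proof -
  have "\<Delta> (*) h (\<lambda>a b. lf a b) = \<Delta> (*) h (\<lambda>a t. \<Delta> (*) t (\<lambda>b c. u a * \<gamma>' (\<S> b) c))"
    unfolding lf_def by (rule coassoc) (intro hom_intros)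
  also have "\<dots> = \<epsilon> h"
    using u_u' unfolding u'_def scalar_pull .
  finally show ?thesis .
qed

lemma lg_diagonal: "\<Delta> (*) h (\<lambda>a b. lg a b) = \<epsilon> h"
proof -
  have "\<Delta> (*) h (\<lambda>a b. lg a b) = \<Delta> (*) h (\<lambda>a t. \<Delta> (*) t (\<lambda>b c. \<gamma> (\<S> a) c * u' b))"
    unfolding lg_def by (rule coassoc) (intro hom_intros)
  then show ?thesis unfolding antipode_cocycle_u' .
qed

text \<open>Linearity over B of the deformed section, reduced to scalars: x is the K-leg of b, j
  that of a, and p and q are those of the two legs of s(a0). The left side comes from the twisted
  product of b and a, the right side from that of b and the B-leg of s(a0).\<close>

lemma wf_mult:
  "\<Delta> (*) x (\<lambda>k v. \<Delta> (*) k (\<lambda>k1 k2. \<Delta> (*) j (\<lambda>j1 j2. \<gamma> k1 j1 * wf (k2 \<cdot> j2) (v \<cdot> p) q)))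
    = \<Delta> (*) p (\<lambda>p1 p2. wf j p1 q * \<gamma> x p2)"
proof -
  note hs = hom_intros
  note sw = scalar_swap and out3 = swap_out3[OF module_mult]
  note sl = sweedler_scale_left[OF module_mult]
  have wf: "wf y (v \<cdot> p) q = \<Delta> (*) v (\<lambda>v1 v2. \<Delta> (*) p (\<lambda>p1 p2. \<Delta> (*) q (\<lambda>q1 q2. lf y (v1 \<cdot> (p1 \<cdot> q1)) * \<gamma>' (v2 \<cdot> p2) q2)))"
    for y v
  proof -
    have "wf y (v \<cdot> p) q = \<Delta> (*) (v \<cdot> p) (\<lambda>z1 z2. \<Delta> (*) q (\<lambda>q1 q2. lf y (z1 \<cdot> q1) * \<gamma>' z2 q2))"
      unfolding wf_def lconv_def ..
    also have "\<dots> = \<Delta> (*) v (\<lambda>v1 v2. \<Delta> (*) p (\<lambda>p1 p2. \<Delta> (*) q (\<lambda>q1 q2. lf y (v1 \<cdot> p1 \<cdot> q1) * \<gamma>' (v2 \<cdot> p2) q2)))"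
      by (rule comul_mul) (intro hs)
    finally show ?thesis by (simp only: mult_assoc)
  qed
  have "\<Delta> (*) x (\<lambda>k v. \<Delta> (*) k (\<lambda>k1 k2. \<Delta> (*) j (\<lambda>j1 j2. \<gamma> k1 j1 * wf (k2 \<cdot> j2) (v \<cdot> p) q)))
    = \<Delta> (*) x (\<lambda>k v. \<Delta> (*) k (\<lambda>k1 k2. \<Delta> (*) v (\<lambda>v1 v2. \<Delta> (*) j (\<lambda>j1 j2. \<Delta> (*) p (\<lambda>p1 p2. \<Delta> (*) q (\<lambda>q1 q2.
        \<gamma> k1 j1 * lf (k2 \<cdot> j2) (v1 \<cdot> (p1 \<cdot> q1)) * \<gamma>' (v2 \<cdot> p2) q2))))))"
    unfolding wf scalar_pull mult.assoc by ((rule sweedler_cong)+, rule sw)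
  also have "\<dots> = \<Delta> (*) x (\<lambda>k1 t. \<Delta> (*) t (\<lambda>s v2. \<Delta> (*) s (\<lambda>k2 v1. \<Delta> (*) j (\<lambda>j1 j2. \<Delta> (*) p (\<lambda>p1 p2. \<Delta> (*) q (\<lambda>q1 q2.
        \<gamma> k1 j1 * lf (k2 \<cdot> j2) (v1 \<cdot> (p1 \<cdot> q1)) * \<gamma>' (v2 \<cdot> p2) q2))))))"
    by (rule coassoc_mid) (intro hs)+
  also have "\<dots> = \<Delta> (*) x (\<lambda>y v2. \<Delta> (*) y (\<lambda>k1 s. \<Delta> (*) s (\<lambda>k2 v1. \<Delta> (*) j (\<lambda>j1 j2. \<Delta> (*) p (\<lambda>p1 p2. \<Delta> (*) q (\<lambda>q1 q2.
        \<gamma> k1 j1 * lf (k2 \<cdot> j2) (v1 \<cdot> (p1 \<cdot> q1)) * \<gamma>' (v2 \<cdot> p2) q2))))))"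
    by (rule coassoc[symmetric]) (intro hs)
  also have "\<dots> = \<Delta> (*) x (\<lambda>y v2. \<Delta> (*) p (\<lambda>p1 p2. \<Delta> (*) q (\<lambda>q1 q2. \<Delta> (*) y (\<lambda>k1 s. \<Delta> (*) s (\<lambda>k2 v1. \<Delta> (*) j (\<lambda>j1 j2.
        \<gamma> k1 j1 * lf (k2 \<cdot> j2) (v1 \<cdot> (p1 \<cdot> q1)) * \<gamma>' (v2 \<cdot> p2) q2))))))"
    by (rule sweedler_cong, rule trans[OF out3], rule sweedler_cong, rule out3)
  \<comment> \<open>The legs of y and j together with n = p1 q1 have the shape of
    \<open>cocycle_lf\<close>, which merges the three legs of y into one.\<close>
  also have "\<dots> = \<Delta> (*) x (\<lambda>y v2. \<Delta> (*) p (\<lambda>p1 p2. \<Delta> (*) q (\<lambda>q1 q2.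
        \<Delta> (*) (p1 \<cdot> q1) (\<lambda>n1 n2. lf j n1 * \<gamma> y n2) * \<gamma>' (v2 \<cdot> p2) q2)))"
    by (simp only: sl cocycle_lf)
  also have "\<dots> = \<Delta> (*) x (\<lambda>y v2. \<Delta> (*) p (\<lambda>p1 p2. \<Delta> (*) q (\<lambda>q1 q2.
        \<Delta> (*) p1 (\<lambda>pa pb. \<Delta> (*) q1 (\<lambda>qa qb. lf j (pa \<cdot> qa) * \<gamma> y (pb \<cdot> qb))) * \<gamma>' (v2 \<cdot> p2) q2)))"
    by (subst comul_mul) (intro hs refl)+
  also have "\<dots> = \<Delta> (*) x (\<lambda>y v2. \<Delta> (*) p (\<lambda>p1 p2. \<Delta> (*) q (\<lambda>q1 q2.
        \<Delta> (*) p1 (\<lambda>pa pb. \<Delta> (*) q1 (\<lambda>qa qb. lf j (pa \<cdot> qa) * (\<gamma> y (pb \<cdot> qb) * \<gamma>' (v2 \<cdot> p2) q2))))))"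
    unfolding scalar_pull mult.assoc ..
  also have "\<dots> = \<Delta> (*) x (\<lambda>y v2. \<Delta> (*) p (\<lambda>pa p'. \<Delta> (*) q (\<lambda>qa q'.
        \<Delta> (*) p' (\<lambda>pb p2. \<Delta> (*) q' (\<lambda>qb q2. lf j (pa \<cdot> qa) * (\<gamma> y (pb \<cdot> qb) * \<gamma>' (v2 \<cdot> p2) q2))))))"
    by (rule sweedler_cong, rule coassoc2) (intro hs)+
  also have "\<dots> = \<Delta> (*) p (\<lambda>pa p'. \<Delta> (*) q (\<lambda>qa q'. \<Delta> (*) x (\<lambda>y v2.
        \<Delta> (*) p' (\<lambda>pb p2. \<Delta> (*) q' (\<lambda>qb q2. lf j (pa \<cdot> qa) * (\<gamma> y (pb \<cdot> qb) * \<gamma>' (v2 \<cdot> p2) q2))))))"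
    by (rule trans[OF sw], rule sweedler_cong, rule sw)
  \<comment> \<open>The two remaining legs of x carry \<gamma> and \<open>\<gamma>'\<close> as on
    the right of \<open>cocycle_mixed1\<close>; reading that identity backwards leaves x in a single
    factor \<gamma>.\<close>
  also have "\<dots> = \<Delta> (*) p (\<lambda>pa p'. \<Delta> (*) q (\<lambda>qa q'. lf j (pa \<cdot> qa) * \<Delta> (*) p' (\<lambda>r1 r2. \<gamma>' r1 q' * \<gamma> x r2)))"
    unfolding cocycle_mixed1 scalar_pull ..
  also have "\<dots> = \<Delta> (*) p (\<lambda>pa p'. \<Delta> (*) p' (\<lambda>r1 r2. \<Delta> (*) q (\<lambda>qa q'. lf j (pa \<cdot> qa) * \<gamma>' r1 q' * \<gamma> x r2)))"
    unfolding scalar_pull mult.assoc by (rule sweedler_cong, rule sw)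
  also have "\<dots> = \<Delta> (*) p (\<lambda>p1 r2. \<Delta> (*) p1 (\<lambda>pa r1. \<Delta> (*) q (\<lambda>qa q'. lf j (pa \<cdot> qa) * \<gamma>' r1 q' * \<gamma> x r2)))"
    by (rule coassoc[symmetric]) (intro hs)
  also have "\<dots> = \<Delta> (*) p (\<lambda>p1 p2. wf j p1 q * \<gamma> x p2)"
    unfolding wf_def lconv_def sl ..
  finally show ?thesis .
qed

text \<open>This is \<open>cocycle_lf\<close> solved for the \<gamma> on its right side: lg undoes
  the lf that stands there, and \<open>\<gamma>'\<close> undoes the \<gamma> on its left
  side.\<close>

lemma cinv_cocycle_lg_lf:
  "\<Delta> (*) w (\<lambda>w1 w2. \<gamma>' w1 j * \<gamma> w2 n)
    = \<Delta> (*) j (\<lambda>j1 j2. \<Delta> (*) n (\<lambda>n1 n2. lg j2 n1 * \<Delta> (*) w (\<lambda>w1 w2. lf (w1 \<cdot> j1) (w2 \<cdot> n2))))"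
proof -
  note hs = hom_intros
  note sw = scalar_swap and out2 = swap_out2[OF module_mult]
  note sl = sweedler_scale_left[OF module_mult] and sr = sweedler_scale[OF module_mult]
  \<comment> \<open>The right side of \<open>cocycle_lf\<close>. Fact A recovers \<gamma> from it by
    means of lg, and fact C is \<open>cocycle_lf\<close> after its leading \<gamma> has been
    cancelled.\<close>
  define R where "R x y n = \<Delta> (*) n (\<lambda>n1 n2. lf y n1 * \<gamma> x n2)" for x y n
  have R1: "module_hom r (*) (\<lambda>x. R (f x) y n)" "module_hom r (*) (\<lambda>x. R y (f x) n)" "module_hom r (*) (\<lambda>x. R y n (f x))"
    if "module_hom r (smul H) f" for r :: "'k \<Rightarrow> 'r::ab_group_add \<Rightarrow> 'r" and f y n
    unfolding R_def by (intro hs that module_hom.axioms(1)[OF that])+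
  note hs = hs R1
  have A: "\<epsilon> y * \<gamma> x n = \<Delta> (*) y (\<lambda>y1 y2. \<Delta> (*) n (\<lambda>n1 n2. lg y2 n1 * R x y1 n2))" for x y n
  proof -
    have "\<Delta> (*) y (\<lambda>y1 y2. \<Delta> (*) n (\<lambda>n1 n2. lg y2 n1 * R x y1 n2))
        = \<Delta> (*) y (\<lambda>y1 y2. \<Delta> (*) n (\<lambda>n1 t. \<Delta> (*) t (\<lambda>na nb. lf y1 na * lg y2 n1 * \<gamma> x nb)))"
      unfolding R_def scalar_pull by (rule sweedler_cong)+ (simp only: mult_ac)
    also have "\<dots> = \<Delta> (*) y (\<lambda>y1 y2. \<Delta> (*) n (\<lambda>m nb. \<Delta> (*) m (\<lambda>n1 na. lf y1 na * lg y2 n1 * \<gamma> x nb)))"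
      by (rule sweedler_cong, rule coassoc[symmetric]) (intro hs)
    also have "\<dots> = \<Delta> (*) n (\<lambda>m nb. \<epsilon> m * (\<epsilon> y * \<gamma> x nb))"
      by (rule trans[OF sw]) (simp only: sl lf_lg, simp only: mult_ac)
    also have "\<dots> = \<epsilon> y * \<gamma> x n"
      by (rule counit_left) (intro hs)
    finally show ?thesis ..
  qed
  have C: "\<Delta> (*) x (\<lambda>x1 x2. \<Delta> (*) y (\<lambda>y1 y2. \<gamma>' x1 y1 * R x2 y2 n)) = \<Delta> (*) x (\<lambda>x1 x2. lf (x1 \<cdot> y) (x2 \<cdot> n))" for x y n
  proof -
    have "\<Delta> (*) x (\<lambda>x1 x2. \<Delta> (*) y (\<lambda>y1 y2. \<gamma>' x1 y1 * R x2 y2 n))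
        = \<Delta> (*) x (\<lambda>x1 x2. \<Delta> (*) y (\<lambda>y1 y2. \<Delta> (*) x2 (\<lambda>xa t. \<Delta> (*) y2 (\<lambda>ya yb. \<Delta> (*) t (\<lambda>xb xc. \<gamma>' x1 y1 * \<gamma> xa ya * lf (xb \<cdot> yb) (xc \<cdot> n))))))"
      unfolding R_def cocycle_lf[symmetric] scalar_pull mult.assoc by ((rule sweedler_cong)+, rule sw)
    also have "\<dots> = \<Delta> (*) x (\<lambda>x' t. \<Delta> (*) y (\<lambda>y' yb. \<Delta> (*) x' (\<lambda>x1 xa. \<Delta> (*) y' (\<lambda>y1 ya. \<Delta> (*) t (\<lambda>xb xc. \<gamma>' x1 y1 * \<gamma> xa ya * lf (xb \<cdot> yb) (xc \<cdot> n))))))"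
      by (rule coassoc2[symmetric]) (intro hs)+
    also have "\<dots> = \<Delta> (*) x (\<lambda>x' t. \<Delta> (*) y (\<lambda>y' yb. e2 x' y' * \<Delta> (*) t (\<lambda>xb xc. lf (xb \<cdot> yb) (xc \<cdot> n))))"
      unfolding conv_cinv(2)[symmetric] lconv_def scalar_pull by ((rule sweedler_cong)+, rule out2)
    also have "\<dots> = \<Delta> (*) x (\<lambda>x' t. \<epsilon> x' * \<Delta> (*) y (\<lambda>y' yb. \<epsilon> y' * \<Delta> (*) t (\<lambda>xb xc. lf (xb \<cdot> yb) (xc \<cdot> n))))"
      unfolding e2_def mult.assoc sr ..
    also have "\<dots> = \<Delta> (*) y (\<lambda>y' yb. \<epsilon> y' * \<Delta> (*) x (\<lambda>xb xc. lf (xb \<cdot> yb) (xc \<cdot> n)))"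
      by (rule counit_left) (intro hs)
    also have "\<dots> = \<Delta> (*) x (\<lambda>x1 x2. lf (x1 \<cdot> y) (x2 \<cdot> n))"
      by (rule counit_left) (intro hs)
    finally show ?thesis .
  qed
  have "\<Delta> (*) w (\<lambda>w1 w2. \<gamma>' w1 j * \<gamma> w2 n) = \<Delta> (*) w (\<lambda>w1 w2. \<Delta> (*) j (\<lambda>j1 j2. \<epsilon> j2 * (\<gamma>' w1 j1 * \<gamma> w2 n)))"
    by (intro sweedler_cong counit_right[symmetric] hs)
  also have "\<dots> = \<Delta> (*) w (\<lambda>w1 w2. \<Delta> (*) j (\<lambda>j1 t. \<Delta> (*) t (\<lambda>ja jb. \<Delta> (*) n (\<lambda>n1 n2. lg jb n1 * (\<gamma>' w1 j1 * R w2 ja n2)))))"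
    unfolding mult.left_commute[of "\<epsilon> _"] A scalar_pull by (simp only: mult_ac)
  also have "\<dots> = \<Delta> (*) w (\<lambda>w1 w2. \<Delta> (*) j (\<lambda>j' jb. \<Delta> (*) j' (\<lambda>j1 ja. \<Delta> (*) n (\<lambda>n1 n2. lg jb n1 * (\<gamma>' w1 j1 * R w2 ja n2)))))"
    by (rule sweedler_cong, rule coassoc[symmetric]) (intro hs)
  also have "\<dots> = \<Delta> (*) j (\<lambda>j' jb. \<Delta> (*) n (\<lambda>n1 n2. \<Delta> (*) w (\<lambda>w1 w2. \<Delta> (*) j' (\<lambda>j1 ja. lg jb n1 * (\<gamma>' w1 j1 * R w2 ja n2)))))"
    by (rule trans[OF sw], rule sweedler_cong, rule out2)
  also have "\<dots> = \<Delta> (*) j (\<lambda>j1 j2. \<Delta> (*) n (\<lambda>n1 n2. lg j2 n1 * \<Delta> (*) w (\<lambda>w1 w2. lf (w1 \<cdot> j1) (w2 \<cdot> n2))))"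
    unfolding sr C ..
  finally show ?thesis .
qed

text \<open>The counterpart of \<open>cocycle_lf\<close> for lg. The factor
  \<open>\<gamma>'\<close>(x2, j2) \<gamma>(x3, n1) is replaced by lg and lf through
  \<open>cinv_cocycle_lg_lf\<close>; the new lf and the lg already present have products in both
  arguments and cancel by \<open>lg_lf\<close>.\<close>

lemma lg_mult:
  "\<Delta> (*) x (\<lambda>x1 t. \<Delta> (*) t (\<lambda>w x4. \<Delta> (*) w (\<lambda>x2 x3. \<Delta> (*) j (\<lambda>j1 j2. \<Delta> (*) n (\<lambda>n1 n2.
      lg (x1 \<cdot> j1) (x4 \<cdot> n2) * (\<gamma>' x2 j2 * \<gamma> x3 n1)))))) = \<epsilon> x * lg j n"
proof -
  note hs = hom_intros
  note sw = scalar_swap and out2 = swap_out2[OF module_mult]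
  note sr = sweedler_scale[OF module_mult]
  have "\<Delta> (*) x (\<lambda>x1 t. \<Delta> (*) t (\<lambda>w x4. \<Delta> (*) w (\<lambda>x2 x3. \<Delta> (*) j (\<lambda>j1 j2. \<Delta> (*) n (\<lambda>n1 n2.
      lg (x1 \<cdot> j1) (x4 \<cdot> n2) * (\<gamma>' x2 j2 * \<gamma> x3 n1))))))
    = \<Delta> (*) x (\<lambda>x1 t. \<Delta> (*) t (\<lambda>w x4. \<Delta> (*) j (\<lambda>j1 j2. \<Delta> (*) n (\<lambda>n1 n2.
      lg (x1 \<cdot> j1) (x4 \<cdot> n2) * \<Delta> (*) w (\<lambda>x2 x3. \<gamma>' x2 j2 * \<gamma> x3 n1)))))"
    unfolding scalar_pull by (rule sweedler_cong, rule sweedler_cong, rule trans[OF sw], rule sweedler_cong, rule sw)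
  also have "\<dots> = \<Delta> (*) x (\<lambda>x1 t. \<Delta> (*) t (\<lambda>w x4. \<Delta> (*) j (\<lambda>j1 j2. \<Delta> (*) n (\<lambda>n1 n2.
      lg (x1 \<cdot> j1) (x4 \<cdot> n2) * \<Delta> (*) j2 (\<lambda>ja jb. \<Delta> (*) n1 (\<lambda>na nb. lg jb na * \<Delta> (*) w (\<lambda>w1 w2. lf (w1 \<cdot> ja) (w2 \<cdot> nb))))))))"
    by (simp only: cinv_cocycle_lg_lf)
  also have "\<dots> = \<Delta> (*) x (\<lambda>x1 t. \<Delta> (*) t (\<lambda>w x4. \<Delta> (*) j (\<lambda>j1 j2. \<Delta> (*) j2 (\<lambda>ja jb. \<Delta> (*) n (\<lambda>n1 n2. \<Delta> (*) n1 (\<lambda>na nb.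
      lg jb na * (lg (x1 \<cdot> j1) (x4 \<cdot> n2) * \<Delta> (*) w (\<lambda>w1 w2. lf (w1 \<cdot> ja) (w2 \<cdot> nb)))))))))"
    by ((rule sweedler_cong)+, rule trans[OF _ sw], rule sweedler_cong) (simp only: scalar_pull mult_ac)
  also have "\<dots> = \<Delta> (*) x (\<lambda>x1 t. \<Delta> (*) t (\<lambda>w x4. \<Delta> (*) j (\<lambda>j' jb. \<Delta> (*) j' (\<lambda>j1 ja. \<Delta> (*) n (\<lambda>n1 n2. \<Delta> (*) n1 (\<lambda>na nb.
      lg jb na * (lg (x1 \<cdot> j1) (x4 \<cdot> n2) * \<Delta> (*) w (\<lambda>w1 w2. lf (w1 \<cdot> ja) (w2 \<cdot> nb)))))))))"
    by (rule sweedler_cong, rule sweedler_cong, rule coassoc[symmetric]) (intro hs)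
  also have "\<dots> = \<Delta> (*) x (\<lambda>x1 t. \<Delta> (*) t (\<lambda>w x4. \<Delta> (*) j (\<lambda>j' jb. \<Delta> (*) j' (\<lambda>j1 ja. \<Delta> (*) n (\<lambda>na n'. \<Delta> (*) n' (\<lambda>nb n2.
      lg jb na * (lg (x1 \<cdot> j1) (x4 \<cdot> n2) * \<Delta> (*) w (\<lambda>w1 w2. lf (w1 \<cdot> ja) (w2 \<cdot> nb)))))))))"
    by (rule sweedler_cong, rule sweedler_cong, rule sweedler_cong, rule sweedler_cong, rule coassoc) (intro hs)
  also have "\<dots> = \<Delta> (*) x (\<lambda>x1 t. \<Delta> (*) t (\<lambda>w x4. \<Delta> (*) w (\<lambda>w1 w2. \<Delta> (*) j (\<lambda>j' jb. \<Delta> (*) n (\<lambda>na n'. \<Delta> (*) j' (\<lambda>j1 ja. \<Delta> (*) n' (\<lambda>nb n2.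
      lg jb na * (lg (x1 \<cdot> j1) (x4 \<cdot> n2) * lf (w1 \<cdot> ja) (w2 \<cdot> nb)))))))))"
  proof ((rule sweedler_cong)+, goal_cases)
    case (1 x1 t w x4)
    have "\<Delta> (*) j (\<lambda>j' jb. \<Delta> (*) j' (\<lambda>j1 ja. \<Delta> (*) n (\<lambda>na n'. \<Delta> (*) n' (\<lambda>nb n2.
        lg jb na * (lg (x1 \<cdot> j1) (x4 \<cdot> n2) * \<Delta> (*) w (\<lambda>w1 w2. lf (w1 \<cdot> ja) (w2 \<cdot> nb)))))))
      = \<Delta> (*) j (\<lambda>j' jb. \<Delta> (*) n (\<lambda>na n'. \<Delta> (*) j' (\<lambda>j1 ja. \<Delta> (*) n' (\<lambda>nb n2. \<Delta> (*) w (\<lambda>w1 w2.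
        lg jb na * (lg (x1 \<cdot> j1) (x4 \<cdot> n2) * lf (w1 \<cdot> ja) (w2 \<cdot> nb)))))))"
      unfolding scalar_pull by (rule sweedler_cong, rule sw)
    also have "\<dots> = \<Delta> (*) j (\<lambda>j' jb. \<Delta> (*) n (\<lambda>na n'. \<Delta> (*) w (\<lambda>w1 w2. \<Delta> (*) j' (\<lambda>j1 ja. \<Delta> (*) n' (\<lambda>nb n2.
        lg jb na * (lg (x1 \<cdot> j1) (x4 \<cdot> n2) * lf (w1 \<cdot> ja) (w2 \<cdot> nb)))))))"
      by ((rule sweedler_cong)+, rule out2)
    also have "\<dots> = \<Delta> (*) w (\<lambda>w1 w2. \<Delta> (*) j (\<lambda>j' jb. \<Delta> (*) n (\<lambda>na n'. \<Delta> (*) j' (\<lambda>j1 ja. \<Delta> (*) n' (\<lambda>nb n2.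
        lg jb na * (lg (x1 \<cdot> j1) (x4 \<cdot> n2) * lf (w1 \<cdot> ja) (w2 \<cdot> nb)))))))"
      by (rule out2)
    finally show ?case .
  qed
  also have "\<dots> = \<Delta> (*) x (\<lambda>y z. \<Delta> (*) y (\<lambda>x1 w1. \<Delta> (*) z (\<lambda>w2 x4. \<Delta> (*) j (\<lambda>j' jb. \<Delta> (*) n (\<lambda>na n'. \<Delta> (*) j' (\<lambda>j1 ja. \<Delta> (*) n' (\<lambda>nb n2.
      lg jb na * (lg (x1 \<cdot> j1) (x4 \<cdot> n2) * lf (w1 \<cdot> ja) (w2 \<cdot> nb)))))))))"
    by (rule coassoc_mid[symmetric]) (intro hs)+
  also have "\<dots> = \<Delta> (*) x (\<lambda>y z. \<Delta> (*) j (\<lambda>j' jb. \<Delta> (*) n (\<lambda>na n'. \<Delta> (*) y (\<lambda>x1 w1. \<Delta> (*) j' (\<lambda>j1 ja. \<Delta> (*) z (\<lambda>w2 x4. \<Delta> (*) n' (\<lambda>nb n2.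
      lg jb na * (lg (x1 \<cdot> j1) (x4 \<cdot> n2) * lf (w1 \<cdot> ja) (w2 \<cdot> nb)))))))))"
    by (rule sweedler_cong, rule trans[OF out2], rule sweedler_cong, rule trans[OF out2],
      (rule sweedler_cong)+, rule sw)
  also have "\<dots> = \<Delta> (*) x (\<lambda>y z. \<Delta> (*) j (\<lambda>j' jb. \<Delta> (*) n (\<lambda>na n'. lg jb na *
      \<Delta> (*) (y \<cdot> j') (\<lambda>a b. \<Delta> (*) (z \<cdot> n') (\<lambda>c d. lg a d * lf b c)))))"
  proof ((rule sweedler_cong)+, goal_cases)
    case (1 y z j' jb na n')
    have "\<Delta> (*) (y \<cdot> j') (\<lambda>a b. \<Delta> (*) (z \<cdot> n') (\<lambda>c d. lg a d * lf b c))
        = \<Delta> (*) y (\<lambda>x1 w1. \<Delta> (*) j' (\<lambda>j1 ja. \<Delta> (*) (z \<cdot> n') (\<lambda>c d. lg (x1 \<cdot> j1) d * lf (w1 \<cdot> ja) c)))"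
      by (rule comul_mul) (intro hs)
    also have "\<dots> = \<Delta> (*) y (\<lambda>x1 w1. \<Delta> (*) j' (\<lambda>j1 ja. \<Delta> (*) z (\<lambda>w2 x4. \<Delta> (*) n' (\<lambda>nb n2.
        lg (x1 \<cdot> j1) (x4 \<cdot> n2) * lf (w1 \<cdot> ja) (w2 \<cdot> nb)))))"
      by (intro sweedler_cong comul_mul hs)
    finally show ?case by (simp only: sr)
  qed
  also have "\<dots> = \<Delta> (*) x (\<lambda>y z. \<epsilon> y * \<Delta> (*) j (\<lambda>j' jb. \<epsilon> j' * \<Delta> (*) n (\<lambda>na n'. \<epsilon> n' * (\<epsilon> z * lg jb na))))"
    unfolding lg_lf counit_mult scalar_pull by (simp only: mult_ac)
  also have "\<dots> = \<Delta> (*) j (\<lambda>j' jb. \<epsilon> j' * \<Delta> (*) n (\<lambda>na n'. \<epsilon> n' * (\<epsilon> x * lg jb na)))"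
    by (rule counit_left) (intro hs)
  also have "\<dots> = \<Delta> (*) n (\<lambda>na n'. \<epsilon> n' * (\<epsilon> x * lg j na))"
    by (rule counit_left) (intro hs)
  also have "\<dots> = \<epsilon> x * lg j n"
    by (rule counit_right) (intro hs)
  finally show ?thesis .
qed

text \<open>Linearity over B for the section of the untwisted algebra, with x, j, p and q as in
  \<open>wf_mult\<close>. Here \<open>\<gamma>'\<close> converts the product of b and a into the
  twisted one, and \<gamma> belongs to the twisted product with the B-leg. The untwisted product
  carries no scalar, hence the counit of x on the right.\<close>

lemma wg_mult:
  "\<Delta> (*) x (\<lambda>k v. \<Delta> (*) k (\<lambda>k1 k2. \<Delta> (*) v (\<lambda>v1 v2. \<Delta> (*) j (\<lambda>j1 j2. \<Delta> (*) p (\<lambda>p1 p2.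
      \<gamma>' k2 j2 * (\<gamma> v1 p1 * wg (k1 \<cdot> j1) (v2 \<cdot> p2) q)))))) = \<epsilon> x * wg j p q"
proof -
  note hs = hom_intros
  note sw = scalar_swap and out2 = swap_out2[OF module_mult] and out3 = swap_out3[OF module_mult]
  note sl = sweedler_scale_left[OF module_mult] and sr = sweedler_scale[OF module_mult]
  \<comment> \<open>The cocycle condition for v, p and q moves \<gamma>(v1, p1) past the \<gamma>
    inside wg. What remains under the sum over v is \<gamma> times lg at p' q', as
    \<open>lg_mult\<close> requires.\<close>
  have inner: "\<Delta> (*) v (\<lambda>v1 v2. \<Delta> (*) p (\<lambda>p1 p2. \<gamma> v1 p1 * wg y (v2 \<cdot> p2) q))
      = \<Delta> (*) p (\<lambda>p1 p'. \<Delta> (*) q (\<lambda>q1 q'. \<gamma> p1 q1 * \<Delta> (*) v (\<lambda>z vb. \<Delta> (*) (p' \<cdot> q') (\<lambda>n1 n2. \<gamma> z n1 * lg y (vb \<cdot> n2)))))" for v y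
  proof -
    have "\<Delta> (*) v (\<lambda>v1 v2. \<Delta> (*) p (\<lambda>p1 p2. \<gamma> v1 p1 * wg y (v2 \<cdot> p2) q))
      = \<Delta> (*) v (\<lambda>v1 v2. \<Delta> (*) p (\<lambda>p1 p2. \<gamma> v1 p1 * \<Delta> (*) v2 (\<lambda>va vb. \<Delta> (*) p2 (\<lambda>pa pb. \<Delta> (*) q (\<lambda>q1 q2.
          \<gamma> (va \<cdot> pa) q1 * lg y (vb \<cdot> pb \<cdot> q2))))))"
      unfolding wg_def lconv_def by (subst comul_mul) (intro hs refl)+
    also have "\<dots> = \<Delta> (*) v (\<lambda>v1 v2. \<Delta> (*) p (\<lambda>p1 p2. \<Delta> (*) v2 (\<lambda>va vb. \<Delta> (*) p2 (\<lambda>pa pb. \<Delta> (*) q (\<lambda>q1 q2.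
          \<gamma> v1 p1 * \<gamma> (va \<cdot> pa) q1 * lg y (vb \<cdot> pb \<cdot> q2))))))"
      unfolding scalar_pull mult.assoc ..
    also have "\<dots> = \<Delta> (*) v (\<lambda>z vb. \<Delta> (*) p (\<lambda>p' pb. \<Delta> (*) z (\<lambda>v1 va. \<Delta> (*) p' (\<lambda>p1 pa. \<Delta> (*) q (\<lambda>q1 q2.
          \<gamma> v1 p1 * \<gamma> (va \<cdot> pa) q1 * lg y (vb \<cdot> pb \<cdot> q2))))))"
      by (rule coassoc2[symmetric]) (intro hs)+
    also have "\<dots> = \<Delta> (*) v (\<lambda>z vb. \<Delta> (*) p (\<lambda>p' pb. \<Delta> (*) q (\<lambda>q1 q2. \<Delta> (*) z (\<lambda>v1 va. \<Delta> (*) p' (\<lambda>p1 pa.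
          \<gamma> v1 p1 * \<gamma> (va \<cdot> pa) q1 * lg y (vb \<cdot> pb \<cdot> q2))))))"
      by ((rule sweedler_cong)+, rule out2)
    also have "\<dots> = \<Delta> (*) v (\<lambda>z vb. \<Delta> (*) p (\<lambda>p' pb. \<Delta> (*) q (\<lambda>q1 q2. \<Delta> (*) p' (\<lambda>p1 pa. \<Delta> (*) q1 (\<lambda>qa qb.
          \<gamma> p1 qa * \<gamma> z (pa \<cdot> qb) * lg y (vb \<cdot> pb \<cdot> q2))))))"
      unfolding sl cocycle ..
    also have "\<dots> = \<Delta> (*) v (\<lambda>z vb. \<Delta> (*) p (\<lambda>p1 p'. \<Delta> (*) q (\<lambda>qa q'. \<Delta> (*) p' (\<lambda>pa pb. \<Delta> (*) q' (\<lambda>qb q2.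
          \<gamma> p1 qa * \<gamma> z (pa \<cdot> qb) * lg y (vb \<cdot> pb \<cdot> q2))))))"
      by (rule sweedler_cong, rule coassoc2) (intro hs)+
    also have "\<dots> = \<Delta> (*) p (\<lambda>p1 p'. \<Delta> (*) q (\<lambda>qa q'. \<Delta> (*) v (\<lambda>z vb. \<Delta> (*) p' (\<lambda>pa pb. \<Delta> (*) q' (\<lambda>qb q2.
          \<gamma> p1 qa * (\<gamma> z (pa \<cdot> qb) * lg y (vb \<cdot> (pb \<cdot> q2))))))))"
      unfolding mult.assoc mult_assoc by (rule trans[OF sw], rule sweedler_cong, rule sw)
    also have "\<dots> = \<Delta> (*) p (\<lambda>p1 p'. \<Delta> (*) q (\<lambda>q1 q'. \<gamma> p1 q1 * \<Delta> (*) v (\<lambda>z vb. \<Delta> (*) (p' \<cdot> q') (\<lambda>n1 n2. \<gamma> z n1 * lg y (vb \<cdot> n2)))))"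
      unfolding sr by (subst comul_mul) (intro hs refl)+
    finally show ?thesis .
  qed
  have "\<Delta> (*) x (\<lambda>k v. \<Delta> (*) k (\<lambda>k1 k2. \<Delta> (*) v (\<lambda>v1 v2. \<Delta> (*) j (\<lambda>j1 j2. \<Delta> (*) p (\<lambda>p1 p2.
      \<gamma>' k2 j2 * (\<gamma> v1 p1 * wg (k1 \<cdot> j1) (v2 \<cdot> p2) q))))))
    = \<Delta> (*) x (\<lambda>k v. \<Delta> (*) k (\<lambda>k1 k2. \<Delta> (*) j (\<lambda>j1 j2. \<gamma>' k2 j2 *
        \<Delta> (*) v (\<lambda>v1 v2. \<Delta> (*) p (\<lambda>p1 p2. \<gamma> v1 p1 * wg (k1 \<cdot> j1) (v2 \<cdot> p2) q)))))"
    unfolding sr[symmetric] by ((rule sweedler_cong)+, rule sw)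
  also have "\<dots> = \<Delta> (*) x (\<lambda>k v. \<Delta> (*) k (\<lambda>k1 k2. \<Delta> (*) j (\<lambda>j1 j2. \<gamma>' k2 j2 *
        \<Delta> (*) p (\<lambda>p1 p'. \<Delta> (*) q (\<lambda>q1 q'. \<gamma> p1 q1 * \<Delta> (*) v (\<lambda>z vb. \<Delta> (*) (p' \<cdot> q') (\<lambda>n1 n2. \<gamma> z n1 * lg (k1 \<cdot> j1) (vb \<cdot> n2))))))))"
    unfolding inner ..
  also have "\<dots> = \<Delta> (*) x (\<lambda>k v. \<Delta> (*) k (\<lambda>k1 k2. \<Delta> (*) j (\<lambda>j1 j2. \<Delta> (*) p (\<lambda>p1 p'. \<Delta> (*) q (\<lambda>q1 q'. \<gamma> p1 q1 *
        \<Delta> (*) v (\<lambda>z vb. \<Delta> (*) (p' \<cdot> q') (\<lambda>n1 n2. lg (k1 \<cdot> j1) (vb \<cdot> n2) * (\<gamma>' k2 j2 * \<gamma> z n1))))))))"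
    unfolding scalar_pull by (simp only: mult_ac)
  also have "\<dots> = \<Delta> (*) p (\<lambda>p1 p'. \<Delta> (*) q (\<lambda>q1 q'. \<gamma> p1 q1 *
        \<Delta> (*) x (\<lambda>k v. \<Delta> (*) k (\<lambda>k1 k2. \<Delta> (*) v (\<lambda>z vb. \<Delta> (*) j (\<lambda>j1 j2. \<Delta> (*) (p' \<cdot> q') (\<lambda>n1 n2.
          lg (k1 \<cdot> j1) (vb \<cdot> n2) * (\<gamma>' k2 j2 * \<gamma> z n1))))))))"
    unfolding sr[symmetric]
    by (rule trans[OF out3], rule sweedler_cong, rule trans[OF out3], (rule sweedler_cong)+, rule sw)
  also have "\<dots> = \<Delta> (*) p (\<lambda>p1 p'. \<Delta> (*) q (\<lambda>q1 q'. \<gamma> p1 q1 *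
        \<Delta> (*) x (\<lambda>k1 t. \<Delta> (*) t (\<lambda>w vb. \<Delta> (*) w (\<lambda>k2 z. \<Delta> (*) j (\<lambda>j1 j2. \<Delta> (*) (p' \<cdot> q') (\<lambda>n1 n2.
          lg (k1 \<cdot> j1) (vb \<cdot> n2) * (\<gamma>' k2 j2 * \<gamma> z n1))))))))"
    by (intro sweedler_cong arg_cong[where f="\<lambda>c. _ * c"] coassoc_mid hs)
  also have "\<dots> = \<Delta> (*) p (\<lambda>p1 p'. \<Delta> (*) q (\<lambda>q1 q'. \<epsilon> x * (\<gamma> p1 q1 * lg j (p' \<cdot> q'))))"
    unfolding lg_mult by (simp only: mult_ac)
  also have "\<dots> = \<epsilon> x * wg j p q"
    unfolding sr wg_def lconv_def ..
  finally show ?thesis .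
qed

end

text \<open>When nonzero scalars are invertible, Baer's criterion is trivial: if a nonzero multiple
  of y lies in the domain, so does y, and otherwise the value 0 is admissible. Confining the values
  to X makes it possible to obtain a projection onto B.\<close>

lemma unit_lin_graph_extend:
  fixes s :: "'k::comm_ring_1 \<Rightarrow> 'm::ab_group_add \<Rightarrow> 'm" and t :: "'k \<Rightarrow> 'n::ab_group_add \<Rightarrow> 'n"
  assumes units: "\<And>c::'k. c \<noteq> 0 \<Longrightarrow> c dvd 1"
    and s: "module s" and t: "module t" and X: "module.subspace t X" and G0: "lin_graph s t X G0"
  shows "\<exists>f. module_hom s t f \<and> (\<forall>a b. (a, b) \<in> G0 \<longrightarrow> f a = b) \<and> (\<forall>a. f a \<in> X)"
proof (rule lin_graph_extend[OF s t X G0])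
  interpret s: module s by fact
  interpret t: module t by fact
  fix G y assume G: "lin_graph s t X G"
  have Gadd: "\<And>a b a' b'. (a, b) \<in> G \<Longrightarrow> (a', b') \<in> G \<Longrightarrow> (a + a', b + b') \<in> G"
    and Gscale: "\<And>c a b. (a, b) \<in> G \<Longrightarrow> (s c a, t c b) \<in> G"
    and Gfun: "\<And>b. (0, b) \<in> G \<Longrightarrow> b = 0" and GX: "\<And>a b. (a, b) \<in> G \<Longrightarrow> b \<in> X"
    using G unfolding lin_graph_def by blast+
  show "\<exists>d\<in>X. \<forall>c x. (s c y, x) \<in> G \<longrightarrow> x = t c d"
  proof (cases "\<exists>i x. i \<noteq> 0 \<and> (s i y, x) \<in> G")
    case True
    then obtain i x j where i: "(s i y, x) \<in> G" "1 = i * j" using units by (metis dvd_def)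
    have y: "(y, t j x) \<in> G" using Gscale[OF i(1), of j] i(2) by (simp add: mult.commute)
    have "z = t c (t j x)" if "(s c y, z) \<in> G" for c z
    proof -
      have "(s c y + s (-1) (s c y), z + t (-1) (t c (t j x))) \<in> G"
        by (intro Gadd Gscale that y)
      then have "(0, z - t c (t j x)) \<in> G" by simp
      then show ?thesis using Gfun by fastforce
    qed
    then show ?thesis using GX[OF y] by blast
  next
    case False
    then have "x = t c 0" if "(s c y, x) \<in> G" for c x
      using that Gfun by (cases "c = 0") auto
    then show ?thesis using t.subspace_0[OF X] by blast
  qed
qed

lemma coset_null2_subspace:
  assumes "X \<in> tensor2 s1 s2 M N"
  shows "X = coset (null2 s1 s2 M N) (rep X)"
  using assms coset_rep[OF subspace_null2] by (fastforce simp: tensor2_def)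

context rcomod
begin

lemma subspace_coinv: "module.subspace (smul A) \<B>"
proof (rule module.subspaceI[OF module_A])
  have hom: "module_hom (smul A) cog_scale (\<lambda>b. \<delta> cog_scale b F)" "module_hom (smul A) cog_scale (\<lambda>b. F b \<one>)"
    if F: "bilin (smul A) (smul H) cog_scale F" for F :: "_ \<Rightarrow> _ \<Rightarrow> 'k cog"
    by (intro hom_intros F bilin_hom1[OF F])+
  show "0 \<in> \<B>"
    by (rule coinvI) (simp add: module_hom.zero[OF hom(1)] module_hom.zero[OF hom(2)])
  show "x + y \<in> \<B>" if "x \<in> \<B>" "y \<in> \<B>" for x y
    by (rule coinvI) (simp add: module_hom.add[OF hom(1)] module_hom.add[OF hom(2)] rcoact_coinv that)
  show "smul A c x \<in> \<B>" if "x \<in> \<B>" for c x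
    by (rule coinvI) (simp add: module_hom.scale[OF hom(1)] module_hom.scale[OF hom(2)] rcoact_coinv that)
qed

lemma mult_coinv:
  assumes "a \<in> \<B>" "b \<in> \<B>"
  shows "a \<odot> b \<in> \<B>"
proof (rule coinvI)
  let ?s = "cog_scale :: 'k \<Rightarrow> 'k cog \<Rightarrow> 'k cog"
  fix F :: "_ \<Rightarrow> _ \<Rightarrow> 'k cog"
  assume F: "bilin (smul A) (smul H) ?s F"
  note hs = hom_intros bilin_hom1[OF F] bilin_hom2[OF F]
  have "\<delta> ?s (a \<odot> b) F = \<delta> ?s a (\<lambda>a0 h. \<delta> ?s b (\<lambda>b0 k. F (a0 \<odot> b0) (h \<cdot> k)))"
    by (rule rcoact_mul[OF F])
  also have "\<dots> = \<delta> ?s b (\<lambda>b0 k. F (a \<odot> b0) (\<one> \<cdot> k))"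
    by (rule rcoact_coinv[OF assms(1)]) (intro hs)
  also have "\<dots> = F (a \<odot> b) (\<one> \<cdot> \<one>)"
    by (rule rcoact_coinv[OF assms(2)]) (intro hs)
  finally show "\<delta> ?s (a \<odot> b) F = F (a \<odot> b) \<one>" by simp
qed

text \<open>Over a field the linear map \<open>a \<mapsto> \<delta>(a) - a \<otimes> 1\<close>, whose kernel is \<open>B\<close>, has a
  generalised inverse \<open>R\<close>.\<close>

lemma coinv_retraction:
  assumes units: "\<And>c::'k. c \<noteq> 0 \<Longrightarrow> c dvd 1"
  shows "\<exists>R. bilin (smul A) (smul H) (smul A) R \<and> (\<forall>a. a - (\<delta> (smul A) a R - R a \<one>) \<in> \<B>)"
proof -
  interpret A: module "smul A" by (rule module_A)
  interpret Fm: module "fscale :: 'k \<Rightarrow> ('a \<times> 'h \<Rightarrow>\<^sub>0 'k) \<Rightarrow> _" by (rule module_fscale)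
  note B = subspace_coinv
  have "lin_graph (smul A) (smul A) \<B> {(b, b) |b. b \<in> \<B>}"
    using A.subspace_0[OF B] A.subspace_add[OF B] A.subspace_scale[OF B] by (auto simp: lin_graph_def)
  from unit_lin_graph_extend[OF units module_A module_A B this]
  obtain \<pi> where \<pi>: "module_hom (smul A) (smul A) \<pi>" "\<And>b. b \<in> \<B> \<Longrightarrow> \<pi> b = b" "\<And>a. \<pi> a \<in> \<B>" by blast
  interpret \<pi>: module_hom "smul A" "smul A" \<pi> by fact
  let ?N = "nul A H :: ('a \<times> 'h \<Rightarrow>\<^sub>0 'k) set"
  note N = subspace_null2[of "smul A" "smul H" UNIV UNIV]
  note Nadd = Fm.subspace_add[OF N] and Nscale = Fm.subspace_scale[OF N] and Ndiff = Fm.subspace_diff[OF N]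
    and N0 = Fm.subspace_0[OF N]
  have gen_N: "gen (a + b, h) - gen (a, h) - gen (b, h) \<in> ?N" "gen (smul A c a, h) - fscale c (gen (a, h)) \<in> ?N" for a b h c
    unfolding null2_def by (rule Fm.span_base, blast)+
  define L where "L a = rep (rcoact A a) - gen (a, \<one>)" for a
  have lin: "linear_mod (smul A) ?N (rcoact A)" and tens: "rcoact A a \<in> tens A H" for a
    using tmap_rcoact by (auto simp: tmap_def)
  have L_add: "L (a + b) - (L a + L b) \<in> ?N" for a b
  proof -
    have "rep (rcoact A (a + b)) - (rep (rcoact A a) + rep (rcoact A b)) \<in> ?N"
      using lin rep_coset[OF N] by (simp add: linear_mod_def)
    from Ndiff[OF this gen_N(1)[of a b \<one>]] show ?thesis by (simp add: L_def algebra_simps)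
  qed
  have L_scale: "L (smul A c a) - fscale c (L a) \<in> ?N" for c a
  proof -
    have "rep (rcoact A (smul A c a)) - fscale c (rep (rcoact A a)) \<in> ?N"
      using lin rep_coset[OF N] by (simp add: linear_mod_def)
    from Ndiff[OF this gen_N(2)[of c a \<one>]] show ?thesis by (simp add: L_def algebra_simps)
  qed
  \<comment> \<open>The partial map from \<delta>(a) - a \<otimes> 1 to a - \<open>\<pi>\<close> a.
    It is single-valued because \<delta>(a) - a \<otimes> 1 vanishes exactly on B, where
    \<open>\<pi>\<close> is the identity. The summand n makes up for L being linear only modulo the
    relations, and forces the extension to vanish on them.\<close>
  let ?G = "{(n + L a, a - \<pi> a) |n a. n \<in> ?N}"
  have G: "lin_graph fscale (smul A) UNIV ?G"
    unfolding lin_graph_def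
  proof (intro conjI allI impI)
    have "0 - L 0 \<in> ?N" using Ndiff[OF N0 L_scale[of 0 0]] by simp
    then show "(0, 0) \<in> ?G" by (intro CollectI exI[of _ "- L 0"] exI[of _ "0 :: 'a"]) (simp add: \<pi>.zero)
  next
    fix x a y b assume "(x, a) \<in> ?G" "(y, b) \<in> ?G"
    then obtain n c m d where "n \<in> ?N" "m \<in> ?N" "x = n + L c" "a = c - \<pi> c" "y = m + L d" "b = d - \<pi> d" by blast
    moreover from this have "n + m - (L (c + d) - (L c + L d)) \<in> ?N" by (intro Ndiff Nadd L_add)
    ultimately show "(x + y, a + b) \<in> ?G"
      by (intro CollectI exI[of _ "n + m - (L (c + d) - (L c + L d))"] exI[of _ "c + d"]) (simp add: \<pi>.add)
  next
    fix r x a assume "(x, a) \<in> ?G"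
    then obtain n c where "n \<in> ?N" "x = n + L c" "a = c - \<pi> c" by blast
    moreover from this have "fscale r n - (L (smul A r c) - fscale r (L c)) \<in> ?N" by (intro Ndiff Nscale L_scale)
    ultimately show "(fscale r x, smul A r a) \<in> ?G"
      by (intro CollectI exI[of _ "fscale r n - (L (smul A r c) - fscale r (L c))"] exI[of _ "smul A r c"])
        (simp add: \<pi>.scale A.scale_right_diff_distrib Fm.scale_right_distrib)
  next
    fix b assume "(0, b) \<in> ?G"
    then obtain n a where n: "n \<in> ?N" "0 = n + L a" "b = a - \<pi> a" by blast
    have "L a = - n" using n(2) by (metis add.commute eq_neg_iff_add_eq_0)
    then have "L a \<in> ?N" using Ndiff[OF N0 n(1)] by simp
    then have "coset ?N (rep (rcoact A a)) = coset ?N (gen (a, \<one>))"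
      by (simp add: coset_eq_iff[OF N] L_def)
    then have "a \<in> \<B>"
      using tensor2_UNIV[OF tens] by (simp add: coinvariants_def)
    then show "b = 0" using n(3) \<pi>(2) by simp
  qed simp
  from unit_lin_graph_extend[OF units module_fscale module_A A.subspace_UNIV G]
  obtain r where r: "module_hom fscale (smul A) r" and rG: "\<And>x a. (x, a) \<in> ?G \<Longrightarrow> r x = a" by blast
  interpret r: module_hom fscale "smul A" r by fact
  have "- L 0 \<in> ?N" using Ndiff[OF N0 L_scale[of 0 0]] by simp
  then have rN: "r n = 0" if "n \<in> ?N" for n
    using Nadd[OF that, of "- L 0"]
    by (intro rG CollectI exI[of _ "n - L 0"] exI[of _ "0 :: 'a"]) (simp add: \<pi>.zero)
  have rL: "r (L a) = a - \<pi> a" for a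
    by (intro rG CollectI exI[of _ "0 :: 'a \<times> 'h \<Rightarrow>\<^sub>0 'k"] exI[of _ a]) (simp add: N0)
  define R where "R a h = r (gen (a, h))" for a h
  have R: "bilin (smul A) (smul H) (smul A) R"
    unfolding R_def[abs_def] by (rule null2_bilin[OF r rN module_A module_H])
  have [simp]: "(\<lambda>(a, h). r (gen (a, h))) = (\<lambda>p. r (gen p))" by (simp add: fun_eq_iff)
  have "\<delta> (smul A) a R - R a \<one> = a - \<pi> a" for a
    unfolding rL[symmetric] L_def r.diff hom_eq_lin_ext[OF r, of "rep _"] by (simp add: sweedler_def R_def)
  then show ?thesis using R \<pi>(3) by (intro exI[of _ R]) simp
qed

end

section \<open>Sections of the multiplication from B \<otimes> A to A\<close>

definition is_section :: "('k::comm_ring_1, 'h::ab_group_add, 'y) hopf_scheme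
    \<Rightarrow> ('k, 'a::ab_group_add, 'h, 'z) right_comod_alg_scheme \<Rightarrow> ('a \<Rightarrow> ('a \<times> 'a \<Rightarrow>\<^sub>0 'k) set) \<Rightarrow> bool" where
  "is_section H A s \<longleftrightarrow>
    (let B = coinvariants H A;
         N = null2 (smul A) (smul A) B UNIV;
         N3 = null3 (smul A) (smul A) (smul H) B UNIV UNIV
     in (\<forall>a. s a \<in> tensor2 (smul A) (smul A) B UNIV) \<and> linear_mod (smul A) N s \<and>
          (\<forall>b\<in>B. \<forall>a. s (mul A b a) = coset N (sweedler fscale (s a) (\<lambda>b' a'. gen (mul A b b', a')))) \<and>
          (\<forall>a. coset N3 (sweedler fscale (s a) (\<lambda>b a'. sweedler fscale (rcoact A a') (\<lambda>a0 h. gen (b, a0, h))))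
             = coset N3 (sweedler fscale (rcoact A a) (\<lambda>a0 h. sweedler fscale (s a0) (\<lambda>b a'. gen (b, a', h))))) \<and>
          (\<forall>a. sweedler (smul A) (s a) (mul A) = a))"

lemma principal_iff_section: "principal_comodule_algebra H A \<longleftrightarrow> hopf_galois H A \<and> (\<exists>s. is_section H A s)"
  by (simp add: principal_comodule_algebra_def is_section_def Let_def)

text \<open>All products in the definition have a left factor in B, where the right twist changes
  nothing. For the product of the two legs of s(a) this holds because \<open>tensor2_keys\<close>
  places the first entries of any representative in B.\<close>

lemma (in rcomod_hopf_cocycle) is_section_right_twist:
  "is_section (twisted_hopf H \<gamma>) (right_twist H \<gamma> A) s \<longleftrightarrow> is_section H A s"
proof -
  have "sweedler (smul A) (s a) (mul (right_twist H \<gamma> A)) = sweedler (smul A) (s a) (mul A)"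
    if "\<forall>a. s a \<in> tensor2 (smul A) (smul A) \<B> UNIV" for a
    using tensor2_keys[OF module_A subspace_coinv] that
    by (intro sweedler_cong_keys) (blast intro: rmul_coinv_left)
  then show ?thesis
    unfolding is_section_def Let_def by (simp add: rmul_coinv_left cong: conj_cong ball_cong)
qed

text \<open>R recovers the part of an element outside B from \<delta>(a) - a \<otimes> 1. The
  projection \<open>proj\<close> made from it splits the inclusion of B and is moreover compatible
  with the left coaction, see \<open>lcoact_proj\<close>.\<close>

locale rcomod_retract = rcomod H A
  for H :: "('k::comm_ring_1, 'h::ab_group_add, 'y) hopf_scheme"
    and A :: "('k, 'a::ab_group_add, 'h, 'z) right_comod_alg_scheme" +
  fixes R :: "'a \<Rightarrow> 'h \<Rightarrow> 'a"
  assumes bilin_R: "bilin (smul A) (smul H) (smul A) R"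
    and R_coinv: "a - (sweedler (smul A) (rcoact A a) R - R a (unit H)) \<in> coinvariants H A"
begin

lemmas [hom_intros] = bilin_hom1[OF bilin_R] bilin_hom2[OF bilin_R]

definition proj :: "'a \<Rightarrow> 'a" where
  "proj a = a - (\<delta> (smul A) a R - R a \<one>)"

lemma hom_proj: "module_hom (smul A) (smul A) proj"
  unfolding proj_def[abs_def] by (intro hom_intros hom_diff bilin_R)

lemmas [hom_intros] = hom_comp[OF hom_proj]

lemma proj_coinv: "proj a \<in> \<B>"
  unfolding proj_def by (rule R_coinv)

lemma proj_id: "b \<in> \<B> \<Longrightarrow> proj b = b"
  by (simp add: proj_def rcoact_coinv bilin_R)

text \<open>Since \<open>proj\<close> splits the inclusion of B, the map from B \<otimes> A to A
  \<otimes> A is injective; so test maps defined on all of A suffice.\<close>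

lemma tensor_coinv_eqI:
  assumes X: "X \<in> tensor2 (smul A) (smul A) \<B> UNIV" and Y: "Y \<in> tensor2 (smul A) (smul A) \<B> UNIV"
    and eq: "\<And>F :: _ \<Rightarrow> _ \<Rightarrow> 'k cog. bilin (smul A) (smul A) cog_scale F \<Longrightarrow> sweedler cog_scale X F = sweedler cog_scale Y F"
  shows "X = Y"
proof -
  let ?N = "null2 (smul A) (smul A) \<B> UNIV"
  have "coset ?N (rep X) = coset ?N (rep Y)"
  proof (rule coset_eqI_cog[OF subspace_null2])
    fix g :: "_ \<Rightarrow> 'k cog"
    assume g: "module_hom fscale cog_scale g" "\<And>n. n \<in> ?N \<Longrightarrow> g n = 0"
    have b: "bilin (smul A) (smul A) cog_scale (\<lambda>a b. g (gen (proj a, b)))"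
      by (rule null2_bilin_on[OF g hom_proj proj_coinv hom_id[OF module_A] UNIV_I])
    have r: "sweedler cog_scale Z (\<lambda>a b. g (gen (proj a, b))) = g (rep Z)" if "Z \<in> tensor2 (smul A) (smul A) \<B> UNIV" for Z
    proof -
      have "sweedler cog_scale Z (\<lambda>a b. g (gen (proj a, b))) = sweedler cog_scale Z (\<lambda>a b. g (gen (a, b)))"
        using tensor2_keys[OF module_A subspace_coinv that] by (intro sweedler_cong_keys) (simp add: proj_id)
      also have "\<dots> = lin_ext cog_scale (\<lambda>p. g (gen p)) (rep Z)"
        by (simp add: sweedler_def case_prod_unfold)
      finally show ?thesis by (simp add: hom_eq_lin_ext[OF g(1), of "rep Z"])
    qed
    show "g (rep X) = g (rep Y)" using eq[OF b] r[OF X] r[OF Y] by simp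
  qed
  with coset_null2_subspace[OF X] coset_null2_subspace[OF Y] show ?thesis by simp
qed

lemma null3_coinv_eqI:
  assumes x: "Poly_Mapping.keys x \<subseteq> \<B> \<times> UNIV" and y: "Poly_Mapping.keys y \<subseteq> \<B> \<times> UNIV"
    and eq: "\<And>F :: _ \<Rightarrow> _ \<Rightarrow> _ \<Rightarrow> 'k cog. trilin (smul A) (smul A) (smul H) cog_scale F
      \<Longrightarrow> lin_ext cog_scale (\<lambda>(a, b, c). F a b c) x = lin_ext cog_scale (\<lambda>(a, b, c). F a b c) y"
  shows "coset (null3 (smul A) (smul A) (smul H) \<B> UNIV UNIV) x = coset (null3 (smul A) (smul A) (smul H) \<B> UNIV UNIV) y"
proof (rule coset_eqI_cog[OF subspace_null3])
  fix g :: "_ \<Rightarrow> 'k cog"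
  assume g: "module_hom fscale cog_scale g" "\<And>n. n \<in> null3 (smul A) (smul A) (smul H) \<B> UNIV UNIV \<Longrightarrow> g n = 0"
  have b: "trilin (smul A) (smul A) (smul H) cog_scale (\<lambda>a b c. g (gen (proj a, b, c)))"
    by (rule null3_trilin_on[OF g hom_proj proj_coinv module_A module_H])
  have r: "lin_ext cog_scale (\<lambda>(a, b, c). g (gen (proj a, b, c))) z = g z" if "Poly_Mapping.keys z \<subseteq> \<B> \<times> UNIV" for z
  proof -
    have "lin_ext cog_scale (\<lambda>(a, b, c). g (gen (proj a, b, c))) z = lin_ext cog_scale (\<lambda>p. g (gen p)) z"
      unfolding lin_ext_def using that by (intro sum.cong) (auto simp: proj_id)
    then show ?thesis by (simp add: hom_eq_lin_ext[OF g(1), of z])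
  qed
  show "g x = g y" using eq[OF b] r[OF x] r[OF y] by simp
qed

text \<open>Replaces the equalities of cosets over B by tests with multilinear maps on the whole of
  A, so that the calculations for a deformed section stay in one module.\<close>

lemma is_sectionI:
  assumes S0: "\<And>a. s a \<in> tensor2 (smul A) (smul A) \<B> UNIV"
    and S1: "\<And>F :: _ \<Rightarrow> _ \<Rightarrow> 'k cog. bilin (smul A) (smul A) cog_scale F \<Longrightarrow> module_hom (smul A) cog_scale (\<lambda>a. sweedler cog_scale (s a) F)"
    and S2: "\<And>(F :: _ \<Rightarrow> _ \<Rightarrow> 'k cog) b a. bilin (smul A) (smul A) cog_scale F \<Longrightarrow> b \<in> \<B> \<Longrightarrow>
      sweedler cog_scale (s (b \<odot> a)) F = sweedler cog_scale (s a) (\<lambda>b' a'. F (b \<odot> b') a')"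
    and S3: "\<And>(F :: _ \<Rightarrow> _ \<Rightarrow> _ \<Rightarrow> 'k cog) a. trilin (smul A) (smul A) (smul H) cog_scale F \<Longrightarrow>
      sweedler cog_scale (s a) (\<lambda>b a'. \<delta> cog_scale a' (\<lambda>a0 h. F b a0 h)) = \<delta> cog_scale a (\<lambda>a0 h. sweedler cog_scale (s a0) (\<lambda>b a'. F b a' h))"
    and S4: "\<And>a. sweedler (smul A) (s a) (mul A) = a"
  shows "is_section H A s"
proof -
  let ?N = "null2 (smul A) (smul A) \<B> UNIV" and ?T = "tensor2 (smul A) (smul A) \<B> UNIV"
  note keys = tensor2_keys[OF module_A subspace_coinv S0]
  note sub = module.subspace_add[OF module_fscale subspace_keys] module.subspace_scale[OF module_fscale subspace_keys]
  have kr: "Poly_Mapping.keys (rep (s a)) \<subseteq> \<B> \<times> UNIV" for a using keys by auto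
  have T: "coset ?N x \<in> ?T" if "Poly_Mapping.keys x \<subseteq> \<B> \<times> UNIV" for x
    using that by (auto simp: tensor2_def)
  have lin: "linear_mod (smul A) ?N s"
    unfolding linear_mod_def
  proof (intro conjI allI)
    fix a b
    show "s (a + b) = coset ?N (rep (s a) + rep (s b))"
    proof (rule tensor_coinv_eqI[OF S0 T])
      show "Poly_Mapping.keys (rep (s a) + rep (s b)) \<subseteq> \<B> \<times> UNIV" using sub(1)[of "rep (s a)" _ "rep (s b)"] kr by simp
      fix F :: "_ \<Rightarrow> _ \<Rightarrow> 'k cog" assume F: "bilin (smul A) (smul A) cog_scale F"
      show "sweedler cog_scale (s (a + b)) F = sweedler cog_scale (coset ?N (rep (s a) + rep (s b))) F"
        by (simp add: sweedler_coset[OF F] lin_ext_add[OF module_cog_scale] module_hom.add[OF S1[OF F]])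
          (simp add: sweedler_def)
    qed
  next
    fix c a
    show "s (smul A c a) = coset ?N (fscale c (rep (s a)))"
    proof (rule tensor_coinv_eqI[OF S0 T])
      show "Poly_Mapping.keys (fscale c (rep (s a))) \<subseteq> \<B> \<times> UNIV" using sub(2)[of "rep (s a)" _ c] kr by simp
      fix F :: "_ \<Rightarrow> _ \<Rightarrow> 'k cog" assume F: "bilin (smul A) (smul A) cog_scale F"
      show "sweedler cog_scale (s (smul A c a)) F = sweedler cog_scale (coset ?N (fscale c (rep (s a)))) F"
        by (simp add: sweedler_coset[OF F] lin_ext_fscale[OF module_cog_scale] module_hom.scale[OF S1[OF F]])
          (simp add: sweedler_def)
    qed
  qed
  have mul: "s (b \<odot> a) = coset ?N (sweedler fscale (s a) (\<lambda>b' a'. gen (b \<odot> b', a')))" if b: "b \<in> \<B>" for a b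
  proof (rule tensor_coinv_eqI[OF S0 T])
    show "Poly_Mapping.keys (sweedler fscale (s a) (\<lambda>b' a'. gen (b \<odot> b', a'))) \<subseteq> \<B> \<times> UNIV"
      by (rule keys_sweedler) (use mult_coinv[OF b] keys in auto)
    fix F :: "_ \<Rightarrow> _ \<Rightarrow> 'k cog" assume F: "bilin (smul A) (smul A) cog_scale F"
    show "sweedler cog_scale (s (b \<odot> a)) F = sweedler cog_scale (coset ?N (sweedler fscale (s a) (\<lambda>b' a'. gen (b \<odot> b', a')))) F"
      by (simp add: sweedler_coset[OF F] lin_ext_sweedler lin_ext_gen module_cog_scale S2[OF F b])
  qed
  have col: "coset (null3 (smul A) (smul A) (smul H) \<B> UNIV UNIV) (sweedler fscale (s a) (\<lambda>b a'. \<delta> fscale a' (\<lambda>a0 h. gen (b, a0, h))))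
      = coset (null3 (smul A) (smul A) (smul H) \<B> UNIV UNIV) (\<delta> fscale a (\<lambda>a0 h. sweedler fscale (s a0) (\<lambda>b a'. gen (b, a', h))))" for a
  proof (rule null3_coinv_eqI)
    show "Poly_Mapping.keys (sweedler fscale (s a) (\<lambda>b a'. \<delta> fscale a' (\<lambda>a0 h. gen (b, a0, h)))) \<subseteq> \<B> \<times> UNIV"
      by (intro keys_sweedler) (use keys in auto)
    show "Poly_Mapping.keys (\<delta> fscale a (\<lambda>a0 h. sweedler fscale (s a0) (\<lambda>b a'. gen (b, a', h)))) \<subseteq> \<B> \<times> UNIV"
      by (intro keys_sweedler) (use keys in auto)
    fix F :: "_ \<Rightarrow> _ \<Rightarrow> _ \<Rightarrow> 'k cog" assume F: "trilin (smul A) (smul A) (smul H) cog_scale F"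
    show "lin_ext cog_scale (\<lambda>(a, b, c). F a b c) (sweedler fscale (s a) (\<lambda>b a'. \<delta> fscale a' (\<lambda>a0 h. gen (b, a0, h))))
        = lin_ext cog_scale (\<lambda>(a, b, c). F a b c) (\<delta> fscale a (\<lambda>a0 h. sweedler fscale (s a0) (\<lambda>b a'. gen (b, a', h))))"
      by (simp add: lin_ext_sweedler lin_ext_gen module_cog_scale S3[OF F])
  qed
  show ?thesis
    unfolding is_section_def Let_def using S0 lin mul col S4 by blast
qed

end

lemma is_section_linear:
  assumes "is_section H A s" "module (smul A)" "bilin (smul A) (smul A) t F" "module_hom r (smul A) f"
  shows "module_hom r t (\<lambda>a. sweedler t (s (f a)) F)"
  by (rule hom_comp[OF linear_mod_hom[OF _ assms(3,2)] assms(4)])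
    (use assms(1) in \<open>auto simp: is_section_def Let_def\<close>)

lemma is_section_mul:
  assumes "is_section H A s" "bilin (smul A) (smul A) t F" "b \<in> coinvariants H A"
  shows "sweedler t (s (mul A b a)) F = sweedler t (s a) (\<lambda>b' a'. F (mul A b b') a')"
  using assms bilin_modules(3)[OF assms(2)]
  by (simp add: is_section_def Let_def sweedler_coset[OF assms(2)] lin_ext_sweedler lin_ext_gen)

text \<open>Right colinearity has the shape of \<open>nest_law\<close>, with s in the place of a
  coaction that commutes with \<delta>.\<close>

lemma is_section_colinear:
  assumes "is_section H A s"
  shows "nest_law (smul A) (smul A) (smul H) t (rcoact A a) s (s a) (rcoact A) T"
  by (rule nest_lawI[where M="coinvariants H A" and N=UNIV and P=UNIV])
    (use assms in \<open>simp add: is_section_def Let_def\<close>)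

section \<open>Deformation of sections along the left twist\<close>

locale section_twist = bicomod_lcocycle K H A \<sigma> + rcomod_retract H A R + k: hopf_cocycle K \<sigma>
  for K :: "('k::comm_ring_1, 'l::ab_group_add, 'x) hopf_scheme"
    and H :: "('k, 'h::ab_group_add, 'y) hopf_scheme"
    and A :: "('k, 'a::ab_group_add, 'h, 'l, 'z) bicomod_alg_scheme" and \<sigma> and R
begin

text \<open>Substitutes for the statement that \<rho> maps B to K \<otimes> B. The projection
  subtracts R applied to \<delta>(b0) - b0 \<otimes> 1, and for coinvariant b these differences
  vanish along \<rho>(b) because the coactions commute. This is the reason to build
  \<open>proj\<close> from R.\<close>

lemma lcoact_proj:
  assumes b: "b \<in> \<B>" and G: "bilin (smul K) (smul A) s G"
  shows "\<rho> s b (\<lambda>k b0. G k (proj b0)) = \<rho> s b (\<lambda>k b0. G k b0)"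
proof -
  note m = bilin_modules(3)[OF G]
  note hs = hom_intros m bilin_hom1[OF G] bilin_hom2[OF G]
  have hG: "module_hom (smul A) s (G k)" for k using G by (simp add: bilin_def)
  have "\<rho> s b (\<lambda>k b0. G k (\<delta> (smul A) b0 R)) = \<rho> s b (\<lambda>k b0. \<delta> s b0 (\<lambda>c h. G k (R c h)))"
    by (simp add: sweedler_hom[OF hG])
  also have "\<dots> = \<delta> s b (\<lambda>b0 h. \<rho> s b0 (\<lambda>k c. G k (R c h)))"
    by (rule compat[symmetric]) (intro hs)
  also have "\<dots> = \<rho> s b (\<lambda>k c. G k (R c \<one>))"
    by (rule rcoact_coinv[OF b]) (intro hs)
  finally have "\<rho> s b (\<lambda>k b0. G k (\<delta> (smul A) b0 R)) = \<rho> s b (\<lambda>k c. G k (R c \<one>))" .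
  moreover have "\<rho> s b (\<lambda>k b0. G k (proj b0)) = \<rho> s b (\<lambda>k b0. G k b0)
      - (\<rho> s b (\<lambda>k b0. G k (\<delta> (smul A) b0 R)) - \<rho> s b (\<lambda>k c. G k (R c \<one>)))"
    by (simp add: proj_def module_hom.diff[OF hG] sweedler_def lin_ext_def case_prod_unfold
        module.scale_right_diff_distrib[OF m] sum_subtractf)
  ultimately show ?thesis by simp
qed

text \<open>The components of the left coaction of an element of B need not lie in B for the chosen
  representative. Inserting \<open>proj\<close> gives a representative with first entries in B, and
  \<open>sec_twist_bilin\<close> shows that it disappears from every evaluation.\<close>

definition sec_twist :: "('l \<Rightarrow> 'l \<Rightarrow> 'l \<Rightarrow> 'k) \<Rightarrow> ('a \<Rightarrow> ('a \<times> 'a \<Rightarrow>\<^sub>0 'k) set) \<Rightarrow> 'a \<Rightarrow> ('a \<times> 'a \<Rightarrow>\<^sub>0 'k) set" where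
  "sec_twist W s a = coset (null2 (smul A) (smul A) \<B> UNIV)
     (\<rho> fscale a (\<lambda>k a0. sweedler fscale (s a0) (l.ltwist fscale (W k) (\<lambda>b c. gen (proj b, c)))))"

lemma sec_twist_in: "sec_twist W s a \<in> tensor2 (smul A) (smul A) \<B> UNIV"
proof -
  have "Poly_Mapping.keys (fscale c (gen (proj b, d))) \<subseteq> \<B> \<times> UNIV" for c b and d :: 'a
    using module.subspace_scale[OF module_fscale subspace_keys[of "\<B> \<times> UNIV"], of "gen (proj b, d)" c] proj_coinv by simp
  then show ?thesis
    unfolding sec_twist_def tensor2_def l.ltwist_def by (intro imageI CollectI keys_sweedler)
qed

lemma sec_twist_bilin:
  assumes s: "\<And>a. s a \<in> tensor2 (smul A) (smul A) \<B> UNIV" and W: "l.form3 W" and F: "bilin (smul A) (smul A) t F"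
  shows "sweedler t (sec_twist W s a) F = \<rho> t a (\<lambda>k a0. sweedler t (s a0) (l.ltwist t (W k) F))"
proof -
  note m = bilin_modules(3)[OF F]
  note hs = hom_intros m bilin_hom1[OF F] bilin_hom2[OF F] trilin_hom1[OF W] trilin_hom2[OF W] trilin_hom3[OF W]
  have "lin_ext t (\<lambda>(a, b). F a b) (l.ltwist fscale (W k) (\<lambda>b c. gen (proj b, c)) b c) = l.ltwist t (W k) (\<lambda>b c. F (proj b) c) b c" for k b c
    using m by (simp add: l.ltwist_def lin_ext_sweedler lin_ext_fscale lin_ext_gen)
  then have "sweedler t (sec_twist W s a) F = \<rho> t a (\<lambda>k a0. sweedler t (s a0) (l.ltwist t (W k) (\<lambda>b c. F (proj b) c)))"
    by (simp add: sec_twist_def sweedler_coset[OF F] lin_ext_sweedler[OF m])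
  also have "\<dots> = \<rho> t a (\<lambda>k a0. sweedler t (s a0) (l.ltwist t (W k) F))"
  proof (rule sweedler_cong, rule sweedler_cong_keys)
    fix k a0 b c assume "(b, c) \<in> Poly_Mapping.keys (rep (s a0))"
    then have b: "b \<in> \<B>" by (rule tensor2_keys[OF module_A subspace_coinv s])
    show "l.ltwist t (W k) (\<lambda>b c. F (proj b) c) b c = l.ltwist t (W k) F b c"
      unfolding l.ltwist_def by (rule lcoact_proj[OF b, of t "\<lambda>l x. \<rho> t c (\<lambda>m c0. t (W k l m) (F x c0))"]) (intro hs)
  qed
  finally show ?thesis .
qed

lemma sec_twist_linear:
  assumes s: "\<And>a. s a \<in> tensor2 (smul A) (smul A) \<B> UNIV" and lin: "linear_mod (smul A) (null2 (smul A) (smul A) \<B> UNIV) s"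
    and W: "l.form3 W" and F: "bilin (smul A) (smul A) t F"
  shows "module_hom (smul A) t (\<lambda>a. sweedler t (sec_twist W s a) F)"
proof -
  note m = bilin_modules(3)[OF F]
  note hs = hom_intros m bilin_hom1[OF F] bilin_hom2[OF F] trilin_hom1[OF W] trilin_hom2[OF W] trilin_hom3[OF W]
    hom_comp[OF linear_mod_hom[OF lin _ module_A]]
  show ?thesis
    unfolding sec_twist_bilin[OF s W F] l.ltwist_def by (intro hs)
qed

text \<open>The deformation reads only the left coaction, on a and on both legs of s(a0). As this
  commutes with \<delta>, the right colinearity of s carries over for any form W.\<close>

lemma sec_twist_colinear:
  fixes t :: "'k \<Rightarrow> 't::ab_group_add \<Rightarrow> 't"
  assumes s: "\<And>a. s a \<in> tensor2 (smul A) (smul A) \<B> UNIV" and lin: "linear_mod (smul A) (null2 (smul A) (smul A) \<B> UNIV) s"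
    and col: "\<And>a. nest_law (smul A) (smul A) (smul H) t (rcoact A a) s (s a) (rcoact A) TYPE('t)"
    and W: "l.form3 W" and F: "trilin (smul A) (smul A) (smul H) t F"
  shows "sweedler t (sec_twist W s a) (\<lambda>b a'. \<delta> t a' (\<lambda>a0 h. F b a0 h))
    = \<delta> t a (\<lambda>a0 h. sweedler t (sec_twist W s a0) (\<lambda>b a'. F b a' h))"
proof -
  note m = trilin_modules[OF F]
  note hs = hom_intros m trilin_hom1[OF F] trilin_hom2[OF F] trilin_hom3[OF F] trilin_hom1[OF W] trilin_hom2[OF W] trilin_hom3[OF W]
    hom_comp[OF linear_mod_hom[OF lin _ module_A]]
  note sw = sweedler_swap[OF m]
  have b1: "bilin (smul A) (smul A) t (\<lambda>b a'. \<delta> t a' (\<lambda>a0 h. F b a0 h))" by (intro hs)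
  have b2: "bilin (smul A) (smul A) t (\<lambda>b a'. F b a' h)" for h by (intro hs)
  have "sweedler t (sec_twist W s a) (\<lambda>b a'. \<delta> t a' (\<lambda>a0 h. F b a0 h))
      = \<rho> t a (\<lambda>k a0. sweedler t (s a0) (\<lambda>b a'. \<rho> t b (\<lambda>l b0. \<rho> t a' (\<lambda>n c. \<delta> t c (\<lambda>c0 h. t (W k l n) (F b0 c0 h))))))"
    unfolding sec_twist_bilin[OF s W b1] l.ltwist_def sweedler_scale[OF m, symmetric] ..
  also have "\<dots> = \<rho> t a (\<lambda>k a0. sweedler t (s a0) (\<lambda>b a'. \<rho> t b (\<lambda>l b0. \<delta> t a' (\<lambda>x h. \<rho> t x (\<lambda>n c0. t (W k l n) (F b0 c0 h))))))"
    by (intro sweedler_cong compat[symmetric] hs)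
  also have "\<dots> = \<rho> t a (\<lambda>k a0. sweedler t (s a0) (\<lambda>b a'. \<delta> t a' (\<lambda>x h. \<rho> t b (\<lambda>l b0. \<rho> t x (\<lambda>n c0. t (W k l n) (F b0 c0 h))))))"
    by (rule sweedler_cong, rule sweedler_cong, rule sw)
  also have "\<dots> = \<rho> t a (\<lambda>k a0. \<delta> t a0 (\<lambda>y h. sweedler t (s y) (\<lambda>b a'. \<rho> t b (\<lambda>l b0. \<rho> t a' (\<lambda>n c0. t (W k l n) (F b0 c0 h))))))"
    by (rule sweedler_cong, rule nest_lawD[OF col, symmetric]) (intro hs)
  also have "\<dots> = \<delta> t a (\<lambda>z h. \<rho> t z (\<lambda>k y. sweedler t (s y) (\<lambda>b a'. \<rho> t b (\<lambda>l b0. \<rho> t a' (\<lambda>n c0. t (W k l n) (F b0 c0 h))))))"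
    by (rule compat[symmetric]) (intro hs)
  also have "\<dots> = \<delta> t a (\<lambda>a0 h. sweedler t (sec_twist W s a0) (\<lambda>b a'. F b a' h))"
    unfolding sec_twist_bilin[OF s W b2] l.ltwist_def ..
  finally show ?thesis .
qed

end

context section_twist
begin

interpretation T: rcomod_retract H "left_twist \<sigma> A" R
  by unfold_locales (use right_comodule_left_twist bilin_R R_coinv in simp_all)

lemma hom_act_form:
  assumes f: "module_hom (smul K) (*) f"
  shows "module_hom (smul A) (smul A) (act f)"
  unfolding act_def[abs_def] by (intro hom_intros hom_comp[OF f])

lemma ltwist_act:
  assumes f: "module_hom (smul K) (*) f"
  shows "l.ltwist (smul A) (\<lambda>p q. f (mul K p q)) (mul A) = (\<lambda>b c. act f (mul A b c))"
proof (intro ext)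
  fix b c
  show "l.ltwist (smul A) (\<lambda>p q. f (mul K p q)) (mul A) b c = act f (mul A b c)"
    unfolding l.ltwist_def act_def
    by (rule l.lcoact_mul[symmetric]) (intro hom_intros hom_comp[OF f])
qed

text \<open>Two successive left coactions merge into one coproduct on K, so only the values of f on
  the diagonal matter.\<close>

lemma act_diagonal:
  assumes f: "l.form2 f" and diag: "\<And>h. sweedler (*) (comul K h) (\<lambda>a b. f a b) = counit K h"
  shows "\<rho> (smul A) a (\<lambda>k a0. act (f k) a0) = a"
proof -
  let ?s = "smul A"
  note hs = hom_intros bilin_hom1[OF f] bilin_hom2[OF f]
  have "\<rho> ?s a (\<lambda>k a0. act (f k) a0) = \<rho> ?s a (\<lambda>x c. sweedler ?s (comul K x) (\<lambda>k j. ?s (f k j) c))"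
    unfolding act_def by (rule l.lcoact_assoc[symmetric]) (intro hs)
  also have "\<dots> = \<rho> ?s a (\<lambda>x c. ?s (counit K x) c)"
    by (simp add: sweedler_scale_left[OF module_A] diag)
  also have "\<dots> = a"
    by (rule l.lcoact_counit) (intro hs)
  finally show ?thesis .
qed

lemma is_section_facts:
  assumes "is_section H C s" "smul C = smul A" "rcoact C = rcoact A" "coinvariants H C = \<B>"
  shows "s a \<in> tensor2 (smul A) (smul A) \<B> UNIV" "linear_mod (smul A) (null2 (smul A) (smul A) \<B> UNIV) s"
    "nest_law (smul A) (smul A) (smul H) t (rcoact A a) s (s a) (rcoact A) T"
    "sweedler (smul A) (s a) (mul C) = a"
  using assms is_section_colinear[OF assms(1), of t a T] by (auto simp: is_section_def Let_def)

lemma is_section_left_twist: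
  assumes sec: "is_section H A s"
  shows "is_section H (left_twist \<sigma> A) (sec_twist k.wf s)"
proof (rule T.is_sectionI, unfold left_twist_simps coinvariants_left_twist)
  let ?s = "smul A"
  note S = is_section_facts[OF sec refl refl refl]
  show "sec_twist k.wf s a \<in> tensor2 ?s ?s \<B> UNIV" for a by (rule sec_twist_in)
  have wf_2: "l.form2 (k.wf x)" for x by (rule l.form2_form3[OF k.form3_wf])
  have lf_1: "module_hom (smul K) (*) (k.lf x)" for x using k.form_lf by (simp add: bilin_def)
  have cf: "l.form2 (\<lambda>p q. k.lf x (mul K p q))" for x by (intro hom_intros)
  show "sweedler ?s (sec_twist k.wf s a) (mul (left_twist \<sigma> A)) = a" for a
  proof -
    \<comment> \<open>The twisted product contributes \<sigma>, which cancels the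
      \<open>\<sigma>'\<close> that ends wf. What is left is lf at the product of the two K-legs,
      that is, a functional acting on the product of A.\<close>
    have "l.ltwist ?s (k.wf x) (mul (left_twist \<sigma> A)) = (\<lambda>b c. act (k.lf x) (mul A b c))" for x
    proof -
      have e: "mul (left_twist \<sigma> A) = l.ltwist ?s \<sigma> (mul A)"
        by (simp add: l.ltwist_def l.lmul_eq fun_eq_iff)
      have "l.ltwist ?s (k.wf x) (mul (left_twist \<sigma> A))
          = l.ltwist ?s (l.lconv (*) (l.lconv (*) (\<lambda>p q. k.lf x (mul K p q)) \<sigma>') \<sigma>) (mul A)"
        unfolding e k.wf_def by (rule l.ltwist_ltwist) (intro l.bilin_lconv cf l.form_cinv l.form_cocycle bilin_mul_A)+
      also have "l.lconv (*) (l.lconv (*) (\<lambda>p q. k.lf x (mul K p q)) \<sigma>') \<sigma> = (\<lambda>p q. k.lf x (mul K p q))"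
        by (simp add: l.lconv_lconv[symmetric] cf l.form_cinv l.form_cocycle l.conv_cinv l.lconv_rconv_mult[of _ l.e2] l.rconv_e2)
      finally show ?thesis by (simp add: ltwist_act[OF lf_1])
    qed
    then have "sweedler ?s (sec_twist k.wf s a) (mul (left_twist \<sigma> A))
        = \<rho> ?s a (\<lambda>k a0. sweedler ?s (s a0) (\<lambda>b c. act (k.lf k) (mul A b c)))"
      by (simp add: sec_twist_bilin[OF S(1) k.form3_wf l.bilin_lmul])
    also have "\<dots> = \<rho> ?s a (\<lambda>k a0. act (k.lf k) a0)"
      by (simp add: sweedler_hom[OF hom_act_form[OF lf_1], symmetric] S(4))
    finally show ?thesis by (simp add: act_diagonal[OF k.form_lf k.lf_diagonal])
  qed
  let ?t = "cog_scale :: 'k \<Rightarrow> 'k cog \<Rightarrow> 'k cog"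
  note m = module_cog_scale
  note hS = is_section_linear[OF sec module_A]
  show "module_hom ?s ?t (\<lambda>a. sweedler ?t (sec_twist k.wf s a) F)" if "bilin ?s ?s ?t F" for F
    by (rule sec_twist_linear[OF S(1,2) k.form3_wf that])
  show "sweedler ?t (sec_twist k.wf s a) (\<lambda>b a'. \<delta> ?t a' (\<lambda>a0 h. F b a0 h))
      = \<delta> ?t a (\<lambda>a0 h. sweedler ?t (sec_twist k.wf s a0) (\<lambda>b a'. F b a' h))" if "trilin ?s ?s (smul H) ?t F" for F a
    by (rule sec_twist_colinear[OF S(1,2,3) k.form3_wf that])
  show "sweedler ?t (sec_twist k.wf s (b \<diamondop> a)) F = sweedler ?t (sec_twist k.wf s a) (\<lambda>b' a'. F (b \<diamondop> b') a')"
    if F: "bilin ?s ?s ?t F" and b: "b \<in> \<B>" for F b a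
  proof -
    note hs = hom_intros bilin_hom1[OF F] bilin_hom2[OF F] hS
    note sw = sweedler_swap[OF m] and out2 = swap_out2[OF m] and out3 = swap_out3[OF m]
    note sc = sweedler_scale[OF m, symmetric] and ss = module.scale_scale[OF m] and sl = sweedler_scale_left[OF m]
    note tw = sec_twist_bilin[OF S(1) k.form3_wf]
    have bF: "bilin ?s ?s ?t (\<lambda>b' a'. F (b \<diamondop> b') a')" by (intro hs bilin_hom2[OF l.bilin_lmul])
    let ?L = "\<lambda>x. l.ltwist ?t (k.wf x) F"
    have bL: "bilin ?s ?s ?t (?L x)" for x by (rule l.bilin_ltwist[OF wf_2 F])
    let ?E = "\<lambda>x j p b0 y q c. ?t (sweedler (*) (comul K x) (\<lambda>k v. sweedler (*) (comul K k) (\<lambda>k1 k2. sweedler (*) (comul K j) (\<lambda>j1 j2.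
        \<sigma> k1 j1 * k.wf (mul K k2 j2) (mul K v p) q)))) (F (mul A b0 y) c)"
    let ?D = "\<lambda>x j p b0 y q c. sweedler ?t (comul K x) (\<lambda>k v. sweedler ?t (comul K k) (\<lambda>k1 k2. sweedler ?t (comul K j) (\<lambda>j1 j2.
        ?t (\<sigma> k1 j1) (?t (k.wf (mul K k2 j2) (mul K v p) q) (F (mul A b0 y) c)))))"
    have "sweedler ?t (sec_twist k.wf s (b \<diamondop> a)) F = \<rho> ?t (b \<diamondop> a) (\<lambda>x x0. sweedler ?t (s x0) (?L x))"
      by (rule tw[OF F])
    also have "\<dots> = \<rho> ?t b (\<lambda>k b0. \<rho> ?t a (\<lambda>j a0. sweedler ?t (comul K k) (\<lambda>k1 k2. sweedler ?t (comul K j) (\<lambda>j1 j2.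
        ?t (\<sigma> k1 j1) (sweedler ?t (s (mul A b0 a0)) (?L (mul K k2 j2)))))))"
      by (rule l.lcoact_lmul) (unfold l.ltwist_def, intro hs)
    \<comment> \<open>\<open>is_section_mul\<close> asks for an element of B, but the components b0
      are arbitrary elements of A. They are projected to B for that one step and released
      afterwards; \<open>lcoact_proj\<close> permits both.\<close>
    also have "\<dots> = \<rho> ?t b (\<lambda>k b0. \<rho> ?t a (\<lambda>j a0. sweedler ?t (comul K k) (\<lambda>k1 k2. sweedler ?t (comul K j) (\<lambda>j1 j2.
        ?t (\<sigma> k1 j1) (sweedler ?t (s (mul A (proj b0) a0)) (?L (mul K k2 j2)))))))"
      by (rule lcoact_proj[OF b, symmetric]) (unfold l.ltwist_def, intro hs)
    also have "\<dots> = \<rho> ?t b (\<lambda>k b0. \<rho> ?t a (\<lambda>j a0. sweedler ?t (comul K k) (\<lambda>k1 k2. sweedler ?t (comul K j) (\<lambda>j1 j2.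
        ?t (\<sigma> k1 j1) (sweedler ?t (s a0) (\<lambda>b' a'. ?L (mul K k2 j2) (mul A (proj b0) b') a'))))))"
      by (simp only: is_section_mul[OF sec bL proj_coinv])
    also have "\<dots> = \<rho> ?t b (\<lambda>k b0. \<rho> ?t a (\<lambda>j a0. sweedler ?t (comul K k) (\<lambda>k1 k2. sweedler ?t (comul K j) (\<lambda>j1 j2.
        ?t (\<sigma> k1 j1) (sweedler ?t (s a0) (\<lambda>b' a'. ?L (mul K k2 j2) (mul A b0 b') a'))))))"
      by (rule lcoact_proj[OF b]) (unfold l.ltwist_def, intro hs)
    also have "\<dots> = \<rho> ?t b (\<lambda>k b0. \<rho> ?t a (\<lambda>j a0. sweedler ?t (comul K k) (\<lambda>k1 k2. sweedler ?t (comul K j) (\<lambda>j1 j2.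
        sweedler ?t (s a0) (\<lambda>b' a'. \<rho> ?t b0 (\<lambda>v b1. \<rho> ?t b' (\<lambda>p y. \<rho> ?t a' (\<lambda>q c.
          ?t (\<sigma> k1 j1) (?t (k.wf (mul K k2 j2) (mul K v p) q) (F (mul A b1 y) c))))))))))"
    proof ((rule sweedler_cong)+, goal_cases)
      case (1 k b0 j a0 k1 k2 j1 j2)
      have "?L (mul K k2 j2) (mul A b0 b') a' = \<rho> ?t b0 (\<lambda>v b1. \<rho> ?t b' (\<lambda>p y. \<rho> ?t a' (\<lambda>q c.
          ?t (k.wf (mul K k2 j2) (mul K v p) q) (F (mul A b1 y) c))))" for b' a'
        unfolding l.ltwist_def by (rule l.lcoact_mul) (intro hs)
      then show ?case by (simp only: sc)
    qed
    also have "\<dots> = \<rho> ?t a (\<lambda>j a0. sweedler ?t (s a0) (\<lambda>b' a'. \<rho> ?t b (\<lambda>k b0. sweedler ?t (comul K k) (\<lambda>k1 k2. sweedler ?t (comul K j) (\<lambda>j1 j2.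
        \<rho> ?t b0 (\<lambda>v b1. \<rho> ?t b' (\<lambda>p y. \<rho> ?t a' (\<lambda>q c.
          ?t (\<sigma> k1 j1) (?t (k.wf (mul K k2 j2) (mul K v p) q) (F (mul A b1 y) c))))))))))"
      by (rule trans[OF sw], rule sweedler_cong, rule out3)
    \<comment> \<open>The sums over b' and a' go outside, so that the two left coactions on b stand
      directly inside each other and can be merged into a coproduct on K.\<close>
    also have "\<dots> = \<rho> ?t a (\<lambda>j a0. sweedler ?t (s a0) (\<lambda>b' a'. \<rho> ?t b' (\<lambda>p y. \<rho> ?t a' (\<lambda>q c. \<rho> ?t b (\<lambda>k b0. \<rho> ?t b0 (\<lambda>v b1.
        sweedler ?t (comul K k) (\<lambda>k1 k2. sweedler ?t (comul K j) (\<lambda>j1 j2.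
          ?t (\<sigma> k1 j1) (?t (k.wf (mul K k2 j2) (mul K v p) q) (F (mul A b1 y) c))))))))))"
    proof (rule sweedler_cong, rule sweedler_cong, goal_cases)
      case (1 j a0 b' a')
      let ?e = "\<lambda>k1 k2 j1 j2 v b1 p y q c. ?t (\<sigma> k1 j1) (?t (k.wf (mul K k2 j2) (mul K v p) q) (F (mul A b1 y) c))"
      have "\<rho> ?t b (\<lambda>k b0. sweedler ?t (comul K k) (\<lambda>k1 k2. sweedler ?t (comul K j) (\<lambda>j1 j2.
          \<rho> ?t b0 (\<lambda>v b1. \<rho> ?t b' (\<lambda>p y. \<rho> ?t a' (\<lambda>q c. ?e k1 k2 j1 j2 v b1 p y q c))))))
        = \<rho> ?t b (\<lambda>k b0. \<rho> ?t b0 (\<lambda>v b1. sweedler ?t (comul K k) (\<lambda>k1 k2. sweedler ?t (comul K j) (\<lambda>j1 j2.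
          \<rho> ?t b' (\<lambda>p y. \<rho> ?t a' (\<lambda>q c. ?e k1 k2 j1 j2 v b1 p y q c))))))"
        by (rule sweedler_cong, rule out2)
      also have "\<dots> = \<rho> ?t b (\<lambda>k b0. \<rho> ?t b0 (\<lambda>v b1. \<rho> ?t b' (\<lambda>p y. \<rho> ?t a' (\<lambda>q c. sweedler ?t (comul K k) (\<lambda>k1 k2. sweedler ?t (comul K j) (\<lambda>j1 j2.
          ?e k1 k2 j1 j2 v b1 p y q c))))))"
        by (rule sweedler_cong, rule sweedler_cong, rule trans[OF out2], rule sweedler_cong, rule out2)
      also have "\<dots> = \<rho> ?t b' (\<lambda>p y. \<rho> ?t a' (\<lambda>q c. \<rho> ?t b (\<lambda>k b0. \<rho> ?t b0 (\<lambda>v b1. sweedler ?t (comul K k) (\<lambda>k1 k2. sweedler ?t (comul K j) (\<lambda>j1 j2.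
          ?e k1 k2 j1 j2 v b1 p y q c))))))"
        by (rule trans[OF out2], rule sweedler_cong, rule out2)
      finally show ?case .
    qed
    also have "\<dots> = \<rho> ?t a (\<lambda>j a0. sweedler ?t (s a0) (\<lambda>b' a'. \<rho> ?t b' (\<lambda>p y. \<rho> ?t a' (\<lambda>q c. \<rho> ?t b (\<lambda>x b0. ?D x j p b0 y q c)))))"
      by (rule sweedler_cong, rule sweedler_cong, rule sweedler_cong, rule sweedler_cong, rule l.lcoact_assoc[symmetric]) (intro hs)
    also have "\<dots> = \<rho> ?t a (\<lambda>j a0. sweedler ?t (s a0) (\<lambda>b' a'. \<rho> ?t b' (\<lambda>p y. \<rho> ?t a' (\<lambda>q c. \<rho> ?t b (\<lambda>x b0. ?E x j p b0 y q c)))))"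
      unfolding ss sl ..
    \<comment> \<open>All factors that involve the K-leg x of b are now collected in one scalar;
      \<open>k.wf_mult\<close> reduces them to \<sigma>(x, p2), which belongs to the twisted product
      of b and b'.\<close>
    also have "\<dots> = \<rho> ?t a (\<lambda>j a0. sweedler ?t (s a0) (\<lambda>b' a'. \<rho> ?t b' (\<lambda>p y. \<rho> ?t a' (\<lambda>q c. \<rho> ?t b (\<lambda>x b0.
        sweedler ?t (comul K p) (\<lambda>p1 p2. ?t (k.wf j p1 q * \<sigma> x p2) (F (mul A b0 y) c)))))))"
      unfolding k.wf_mult sl ..
    also have "\<dots> = \<rho> ?t a (\<lambda>j a0. sweedler ?t (s a0) (\<lambda>b' a'. \<rho> ?t b' (\<lambda>p y. sweedler ?t (comul K p) (\<lambda>p1 p2. \<rho> ?t a' (\<lambda>q c. \<rho> ?t b (\<lambda>x b0.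
        ?t (k.wf j p1 q * \<sigma> x p2) (F (mul A b0 y) c)))))))"
      by (rule sweedler_cong, rule sweedler_cong, rule sweedler_cong, rule out2)
    also have "\<dots> = \<rho> ?t a (\<lambda>j a0. sweedler ?t (s a0) (\<lambda>b' a'. \<rho> ?t b' (\<lambda>p z. \<rho> ?t z (\<lambda>r y. \<rho> ?t a' (\<lambda>q c. \<rho> ?t b (\<lambda>x b0.
        ?t (k.wf j p q * \<sigma> x r) (F (mul A b0 y) c)))))))"
      by (rule sweedler_cong, rule sweedler_cong, rule l.lcoact_assoc) (intro hs)
    also have "\<dots> = \<rho> ?t a (\<lambda>j a0. sweedler ?t (s a0) (l.ltwist ?t (k.wf j) (\<lambda>b' a'. F (b \<diamondop> b') a')))"
    proof (rule sweedler_cong, rule sweedler_cong, goal_cases)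
      case (1 j a0 b' a')
      have "F (b \<diamondop> z) c = \<rho> ?t b (\<lambda>x b0. \<rho> ?t z (\<lambda>r y. ?t (\<sigma> x r) (F (mul A b0 y) c)))" for z c
        by (rule l.hom_lmul) (use F in \<open>simp add: bilin_def\<close>)
      then have "l.ltwist ?t (k.wf j) (\<lambda>b' a'. F (b \<diamondop> b') a') b' a'
          = \<rho> ?t b' (\<lambda>p z. \<rho> ?t a' (\<lambda>q c. \<rho> ?t b (\<lambda>x b0. \<rho> ?t z (\<lambda>r y. ?t (k.wf j p q * \<sigma> x r) (F (mul A b0 y) c)))))"
        by (simp only: l.ltwist_def sc ss)
      also have "\<dots> = \<rho> ?t b' (\<lambda>p z. \<rho> ?t z (\<lambda>r y. \<rho> ?t a' (\<lambda>q c. \<rho> ?t b (\<lambda>x b0. ?t (k.wf j p q * \<sigma> x r) (F (mul A b0 y) c)))))"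
        by (rule sweedler_cong, rule out2)
      finally show ?case by (rule sym)
    qed
    also have "\<dots> = sweedler ?t (sec_twist k.wf s a) (\<lambda>b' a'. F (b \<diamondop> b') a')"
      by (rule tw[OF bF, symmetric])
    finally show ?thesis .
  qed
qed

lemma is_section_untwist:
  assumes sec: "is_section H (left_twist \<sigma> A) s"
  shows "is_section H A (sec_twist k.wg s)"
proof (rule is_sectionI)
  let ?s = "smul A"
  note S = is_section_facts[OF sec left_twist_simps(1) left_twist_simps(3) coinvariants_left_twist]
  show "sec_twist k.wg s a \<in> tensor2 ?s ?s \<B> UNIV" for a by (rule sec_twist_in)
  have wg_2: "l.form2 (k.wg x)" for x by (rule l.form2_form3[OF k.form3_wg])
  have lg_1: "module_hom (smul K) (*) (k.lg x)" for x using k.form_lg by (simp add: bilin_def)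
  have cg: "l.form2 (\<lambda>p q. k.lg x (mul K p q))" for x by (intro hom_intros)
  show "sweedler ?s (sec_twist k.wg s a) (mul A) = a" for a
  proof -
    \<comment> \<open>The leading \<sigma> of wg turns the product of A into the twisted product,
      for which s is a section.\<close>
    have "l.ltwist ?s (k.wg x) (mul A) = (\<lambda>b c. act (k.lg x) (b \<diamondop> c))" for x
    proof -
      have "l.ltwist ?s (k.wg x) (mul A) = l.ltwist ?s \<sigma> (l.ltwist ?s (\<lambda>p q. k.lg x (mul K p q)) (mul A))"
        unfolding k.wg_def by (rule l.ltwist_ltwist[symmetric]) (intro cg l.form_cocycle bilin_mul_A)+
      then show ?thesis
        by (simp add: ltwist_act[OF lg_1] l.lmul_ltwist[OF hom_act_form[OF lg_1]] fun_eq_iff)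
    qed
    then have "sweedler ?s (sec_twist k.wg s a) (mul A)
        = \<rho> ?s a (\<lambda>k a0. sweedler ?s (s a0) (\<lambda>b c. act (k.lg k) (b \<diamondop> c)))"
      by (simp add: sec_twist_bilin[OF S(1) k.form3_wg bilin_mul_A])
    also have "\<dots> = \<rho> ?s a (\<lambda>k a0. act (k.lg k) a0)"
      by (simp add: sweedler_hom[OF hom_act_form[OF lg_1], symmetric] S(4))
    finally show ?thesis by (simp add: act_diagonal[OF k.form_lg k.lg_diagonal])
  qed
  let ?t = "cog_scale :: 'k \<Rightarrow> 'k cog \<Rightarrow> 'k cog"
  note m = module_cog_scale
  note hS = is_section_linear[OF sec, unfolded left_twist_simps, OF module_A]
  note mS = is_section_mul[OF sec, unfolded left_twist_simps coinvariants_left_twist]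
  show "module_hom ?s ?t (\<lambda>a. sweedler ?t (sec_twist k.wg s a) F)" if "bilin ?s ?s ?t F" for F
    by (rule sec_twist_linear[OF S(1,2) k.form3_wg that])
  show "sweedler ?t (sec_twist k.wg s a) (\<lambda>b a'. \<delta> ?t a' (\<lambda>a0 h. F b a0 h))
      = \<delta> ?t a (\<lambda>a0 h. sweedler ?t (sec_twist k.wg s a0) (\<lambda>b a'. F b a' h))" if "trilin ?s ?s (smul H) ?t F" for F a
    by (rule sec_twist_colinear[OF S(1,2,3) k.form3_wg that])
  show "sweedler ?t (sec_twist k.wg s (mul A b a)) F = sweedler ?t (sec_twist k.wg s a) (\<lambda>b' a'. F (mul A b b') a')"
    if F: "bilin ?s ?s ?t F" and b: "b \<in> \<B>" for F b a
  proof -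
    note hs = hom_intros bilin_hom1[OF F] bilin_hom2[OF F] hS bilin_hom1[OF l.bilin_lmul] bilin_hom2[OF l.bilin_lmul]
    note sw = sweedler_swap[OF m] and out2 = swap_out2[OF m] and out3 = swap_out3[OF m]
    note sc = sweedler_scale[OF m, symmetric] and ss = module.scale_scale[OF m] and sl = sweedler_scale_left[OF m]
    note tw = sec_twist_bilin[OF S(1) k.form3_wg]
    have bF: "bilin ?s ?s ?t (\<lambda>b' a'. F (mul A b b') a')" by (intro hs)
    let ?L = "\<lambda>x. l.ltwist ?t (k.wg x) F"
    have bL: "bilin ?s ?s ?t (?L x)" for x by (rule l.bilin_ltwist[OF wg_2 F])
    \<comment> \<open>Since s is linear over B for the twisted product, a product of A under s has
      to be expressed by twisted products, at the price of \<open>\<sigma>'\<close>.\<close>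
    have un: "sweedler ?t (s (mul A x y)) (?L k) = \<rho> ?t x (\<lambda>r x0. \<rho> ?t y (\<lambda>q y0. ?t (\<sigma>' r q) (sweedler ?t (s (x0 \<diamondop> y0)) (?L k))))" for x y k
    proof -
      have g: "module_hom ?s ?t (\<lambda>z. sweedler ?t (s z) (?L k))" by (intro hs bL)
      have "l.ltwist ?t l.e2 (\<lambda>x y. sweedler ?t (s (mul A x y)) (?L k))
          = l.ltwist ?t (l.lconv (*) l.e2 \<sigma>') (\<lambda>x y. sweedler ?t (s (x \<diamondop> y)) (?L k))"
        by (rule l.ltwist_mul[OF l.form2_e2 g])
      moreover have "bilin ?s ?s ?t (\<lambda>x y. sweedler ?t (s (mul A x y)) (?L k))" by (intro hs bL)
      ultimately have "(\<lambda>x y. sweedler ?t (s (mul A x y)) (?L k)) = l.ltwist ?t \<sigma>' (\<lambda>x y. sweedler ?t (s (x \<diamondop> y)) (?L k))"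
        by (simp add: l.ltwist_e2 l.lconv_e2[OF l.form_cinv])
      then show ?thesis by (simp add: l.ltwist_def fun_eq_iff)
    qed
    let ?e = "\<lambda>k1 k2 j1 j2 v1 v2 p1 p2 b1 y q c.
        ?t (\<sigma>' k2 j2) (?t (\<sigma> v1 p1) (?t (k.wg (mul K k1 j1) (mul K v2 p2) q) (F (mul A b1 y) c)))"
    have "sweedler ?t (sec_twist k.wg s (mul A b a)) F = \<rho> ?t (mul A b a) (\<lambda>x x0. sweedler ?t (s x0) (?L x))"
      by (rule tw[OF F])
    also have "\<dots> = \<rho> ?t b (\<lambda>k b0. \<rho> ?t a (\<lambda>j a0. sweedler ?t (s (mul A b0 a0)) (?L (mul K k j))))"
      by (rule l.lcoact_mul) (unfold l.ltwist_def, intro hs)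
    also have "\<dots> = \<rho> ?t b (\<lambda>k b0. \<rho> ?t a (\<lambda>j a0. \<rho> ?t b0 (\<lambda>r x0. \<rho> ?t a0 (\<lambda>q y0.
        ?t (\<sigma>' r q) (sweedler ?t (s (x0 \<diamondop> y0)) (?L (mul K k j)))))))"
      by (simp only: un)
    also have "\<dots> = \<rho> ?t b (\<lambda>k b0. \<rho> ?t a (\<lambda>j a0. sweedler ?t (comul K k) (\<lambda>k1 k2. sweedler ?t (comul K j) (\<lambda>j1 j2.
        ?t (\<sigma>' k2 j2) (sweedler ?t (s (b0 \<diamondop> a0)) (?L (mul K k1 j1)))))))"
      by (rule l.lcoact2) (unfold l.ltwist_def, (intro hs)+)
    also have "\<dots> = \<rho> ?t b (\<lambda>k b0. \<rho> ?t a (\<lambda>j a0. sweedler ?t (comul K k) (\<lambda>k1 k2. sweedler ?t (comul K j) (\<lambda>j1 j2.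
        ?t (\<sigma>' k2 j2) (sweedler ?t (s (proj b0 \<diamondop> a0)) (?L (mul K k1 j1)))))))"
      by (rule lcoact_proj[OF b, symmetric]) (unfold l.ltwist_def, intro hs)
    also have "\<dots> = \<rho> ?t b (\<lambda>k b0. \<rho> ?t a (\<lambda>j a0. sweedler ?t (comul K k) (\<lambda>k1 k2. sweedler ?t (comul K j) (\<lambda>j1 j2.
        ?t (\<sigma>' k2 j2) (sweedler ?t (s a0) (\<lambda>b' a'. ?L (mul K k1 j1) (proj b0 \<diamondop> b') a'))))))"
      by (simp only: mS[OF bL proj_coinv])
    also have "\<dots> = \<rho> ?t b (\<lambda>k b0. \<rho> ?t a (\<lambda>j a0. sweedler ?t (comul K k) (\<lambda>k1 k2. sweedler ?t (comul K j) (\<lambda>j1 j2.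
        ?t (\<sigma>' k2 j2) (sweedler ?t (s a0) (\<lambda>b' a'. ?L (mul K k1 j1) (b0 \<diamondop> b') a'))))))"
      by (rule lcoact_proj[OF b]) (unfold l.ltwist_def, intro hs)
    also have "\<dots> = \<rho> ?t b (\<lambda>k b0. \<rho> ?t a (\<lambda>j a0. sweedler ?t (comul K k) (\<lambda>k1 k2. sweedler ?t (comul K j) (\<lambda>j1 j2.
        sweedler ?t (s a0) (\<lambda>b' a'. \<rho> ?t b0 (\<lambda>v b1. \<rho> ?t b' (\<lambda>p y. sweedler ?t (comul K v) (\<lambda>v1 v2. sweedler ?t (comul K p) (\<lambda>p1 p2. \<rho> ?t a' (\<lambda>q c.
          ?e k1 k2 j1 j2 v1 v2 p1 p2 b1 y q c))))))))))"
    proof ((rule sweedler_cong)+, goal_cases)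
      case (1 k b0 j a0 k1 k2 j1 j2)
      have "?L (mul K k1 j1) (b0 \<diamondop> b') a' = \<rho> ?t b0 (\<lambda>v b1. \<rho> ?t b' (\<lambda>p y. sweedler ?t (comul K v) (\<lambda>v1 v2. sweedler ?t (comul K p) (\<lambda>p1 p2.
          ?t (\<sigma> v1 p1) (\<rho> ?t a' (\<lambda>q c. ?t (k.wg (mul K k1 j1) (mul K v2 p2) q) (F (mul A b1 y) c)))))))" for b' a'
        unfolding l.ltwist_def by (rule l.lcoact_lmul) (intro hs)
      then show ?case by (simp only: sc)
    qed
    also have "\<dots> = \<rho> ?t a (\<lambda>j a0. sweedler ?t (s a0) (\<lambda>b' a'. \<rho> ?t b (\<lambda>k b0. sweedler ?t (comul K k) (\<lambda>k1 k2. sweedler ?t (comul K j) (\<lambda>j1 j2.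
        \<rho> ?t b0 (\<lambda>v b1. \<rho> ?t b' (\<lambda>p y. sweedler ?t (comul K v) (\<lambda>v1 v2. sweedler ?t (comul K p) (\<lambda>p1 p2. \<rho> ?t a' (\<lambda>q c.
          ?e k1 k2 j1 j2 v1 v2 p1 p2 b1 y q c))))))))))"
      by (rule trans[OF sw], rule sweedler_cong, rule out3)
    also have "\<dots> = \<rho> ?t a (\<lambda>j a0. sweedler ?t (s a0) (\<lambda>b' a'. \<rho> ?t b' (\<lambda>p y. \<rho> ?t a' (\<lambda>q c. \<rho> ?t b (\<lambda>k b0. \<rho> ?t b0 (\<lambda>v b1.
        sweedler ?t (comul K k) (\<lambda>k1 k2. sweedler ?t (comul K v) (\<lambda>v1 v2. sweedler ?t (comul K j) (\<lambda>j1 j2. sweedler ?t (comul K p) (\<lambda>p1 p2.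
          ?e k1 k2 j1 j2 v1 v2 p1 p2 b1 y q c))))))))))"
    proof (rule sweedler_cong, rule sweedler_cong, goal_cases)
      case (1 j a0 b' a')
      have "\<rho> ?t b (\<lambda>k b0. sweedler ?t (comul K k) (\<lambda>k1 k2. sweedler ?t (comul K j) (\<lambda>j1 j2.
          \<rho> ?t b0 (\<lambda>v b1. \<rho> ?t b' (\<lambda>p y. sweedler ?t (comul K v) (\<lambda>v1 v2. sweedler ?t (comul K p) (\<lambda>p1 p2. \<rho> ?t a' (\<lambda>q c.
            ?e k1 k2 j1 j2 v1 v2 p1 p2 b1 y q c))))))))
        = \<rho> ?t b (\<lambda>k b0. \<rho> ?t b0 (\<lambda>v b1. sweedler ?t (comul K k) (\<lambda>k1 k2. sweedler ?t (comul K j) (\<lambda>j1 j2.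
          \<rho> ?t b' (\<lambda>p y. \<rho> ?t a' (\<lambda>q c. sweedler ?t (comul K v) (\<lambda>v1 v2. sweedler ?t (comul K p) (\<lambda>p1 p2.
            ?e k1 k2 j1 j2 v1 v2 p1 p2 b1 y q c))))))))"
        by (rule sweedler_cong, rule trans[OF out2], rule sweedler_cong, rule sweedler_cong, rule sweedler_cong, rule sweedler_cong, rule out2)
      also have "\<dots> = \<rho> ?t b (\<lambda>k b0. \<rho> ?t b0 (\<lambda>v b1. \<rho> ?t b' (\<lambda>p y. \<rho> ?t a' (\<lambda>q c. sweedler ?t (comul K k) (\<lambda>k1 k2. sweedler ?t (comul K v) (\<lambda>v1 v2.
          sweedler ?t (comul K j) (\<lambda>j1 j2. sweedler ?t (comul K p) (\<lambda>p1 p2. ?e k1 k2 j1 j2 v1 v2 p1 p2 b1 y q c))))))))"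
        by (rule sweedler_cong, rule sweedler_cong, rule trans[OF out2], rule sweedler_cong, rule trans[OF out2],
          rule sweedler_cong, rule sweedler_cong, rule sw)
      also have "\<dots> = \<rho> ?t b' (\<lambda>p y. \<rho> ?t a' (\<lambda>q c. \<rho> ?t b (\<lambda>k b0. \<rho> ?t b0 (\<lambda>v b1. sweedler ?t (comul K k) (\<lambda>k1 k2. sweedler ?t (comul K v) (\<lambda>v1 v2.
          sweedler ?t (comul K j) (\<lambda>j1 j2. sweedler ?t (comul K p) (\<lambda>p1 p2. ?e k1 k2 j1 j2 v1 v2 p1 p2 b1 y q c))))))))"
        by (rule trans[OF out2], rule sweedler_cong, rule out2)
      finally show ?case .
    qed
    also have "\<dots> = \<rho> ?t a (\<lambda>j a0. sweedler ?t (s a0) (\<lambda>b' a'. \<rho> ?t b' (\<lambda>p y. \<rho> ?t a' (\<lambda>q c. \<rho> ?t b (\<lambda>x b0. sweedler ?t (comul K x) (\<lambda>k v.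
        sweedler ?t (comul K k) (\<lambda>k1 k2. sweedler ?t (comul K v) (\<lambda>v1 v2. sweedler ?t (comul K j) (\<lambda>j1 j2. sweedler ?t (comul K p) (\<lambda>p1 p2.
          ?e k1 k2 j1 j2 v1 v2 p1 p2 b0 y q c))))))))))"
      by (rule sweedler_cong, rule sweedler_cong, rule sweedler_cong, rule sweedler_cong, rule l.lcoact_assoc[symmetric]) (intro hs)
    \<comment> \<open>By \<open>k.wg_mult\<close> the scalars that involve the K-leg x of b collapse
      to a counit, which leaves the untwisted product of b with the B-leg.\<close>
    also have "\<dots> = \<rho> ?t a (\<lambda>j a0. sweedler ?t (s a0) (\<lambda>b' a'. \<rho> ?t b' (\<lambda>p y. \<rho> ?t a' (\<lambda>q c. \<rho> ?t b (\<lambda>x b0.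
        ?t (counit K x) (?t (k.wg j p q) (F (mul A b0 y) c)))))))"
      unfolding ss sl mult.assoc k.wg_mult ..
    also have "\<dots> = \<rho> ?t a (\<lambda>j a0. sweedler ?t (s a0) (l.ltwist ?t (k.wg j) (\<lambda>b' a'. F (mul A b b') a')))"
      unfolding l.ltwist_def by (intro sweedler_cong l.lcoact_counit hs)
    also have "\<dots> = sweedler ?t (sec_twist k.wg s a) (\<lambda>b' a'. F (mul A b b') a')"
      by (rule tw[OF bF, symmetric])
    finally show ?thesis .
  qed
qed

end

theorem theorem4p15:
  fixes K :: "('k::comm_ring_1, 'l::ab_group_add) hopf"
    and H :: "('k, 'h::ab_group_add) hopf"
    and A :: "('k, 'a::ab_group_add, 'h, 'l) bicomod_alg"
    and \<sigma> :: "'l \<Rightarrow> 'l \<Rightarrow> 'k"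
    and \<gamma> :: "'h \<Rightarrow> 'h \<Rightarrow> 'k"
  assumes "hopf_algebra K" and "hopf_algebra H" and "bij (antipode H)"
    and "bicomodule_algebra K H A"
    and "two_cocycle K \<sigma>" and "two_cocycle H \<gamma>"
  shows "(hopf_galois H A \<longleftrightarrow>
            hopf_galois (twisted_hopf H \<gamma>) (two_sided_twist \<sigma> H \<gamma> A)) \<and>
         ((\<forall>c::'k. c \<noteq> 0 \<longrightarrow> c dvd 1) \<longrightarrow>
           (principal_comodule_algebra H A \<longleftrightarrow>
            principal_comodule_algebra (twisted_hopf H \<gamma>) (two_sided_twist \<sigma> H \<gamma> A)))"
proof -
  let ?H = "twisted_hopf H \<gamma>" and ?A = "right_twist H \<gamma> A"
  have bK: "bialgebra K" and bH: "bialgebra H"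
    using assms(1,2) by (simp_all add: hopf_algebra_def)
  interpret r: bicomod K H A
    by (rule bicomodI[OF bK bH assms(4)])
  interpret r: cocycle H \<gamma>
    by unfold_locales (rule assms(6))
  interpret r: hopf_cocycle H \<gamma>
    by unfold_locales (rule assms(2))
  interpret r: bicomod_rcocycle K H A \<gamma>
    by unfold_locales
  interpret r: rcomod_hopf_cocycle H A \<gamma>
    by unfold_locales
  \<comment> \<open>From here on the left twist acts on the right twist, a bicomodule algebra over K
    and the twisted H.\<close>
  interpret l: bicomod K ?H ?A
    by (rule bicomodI[OF bK r.bialgebra_twisted r.bicomodule_right_twist])
  interpret l: cocycle K \<sigma>
    by unfold_locales (rule assms(5))
  interpret l: bicomod_lcocycle K ?H ?A \<sigma>
    by unfold_locales
  have galois: "hopf_galois H A \<longleftrightarrow> hopf_galois ?H (two_sided_twist \<sigma> H \<gamma> A)"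
    using r.hopf_galois_right_twist[OF assms(3)] l.hopf_galois_left_twist by (simp add: two_sided_twist_def)
  have "(\<exists>s. is_section ?H ?A s) \<longleftrightarrow> (\<exists>s. is_section ?H (left_twist \<sigma> ?A) s)" if "\<forall>c::'k. c \<noteq> 0 \<longrightarrow> c dvd 1"
  proof -
    \<comment> \<open>The invertibility of nonzero scalars enters here: it provides the generalised
      inverse R, and with it the projection onto B used to compare sections.\<close>
    obtain R where R: "bilin (smul ?A) (smul ?H) (smul ?A) R"
      "\<And>a. a - (sweedler (smul ?A) (rcoact ?A a) R - R a (unit ?H)) \<in> coinvariants ?H ?A"
      using l.coinv_retraction \<open>\<forall>c::'k. c \<noteq> 0 \<longrightarrow> c dvd 1\<close> by blast
    interpret l: section_twist K ?H ?A \<sigma> R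
      by unfold_locales (use assms(1) R in simp_all)
    show ?thesis using l.is_section_left_twist l.is_section_untwist by blast
  qed
  then show ?thesis
    using galois by (simp add: principal_iff_section r.is_section_right_twist two_sided_twist_def)
qed

end
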